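(* (Reconstruction Theorem.) Let $\Lambda$ be a finite abelian group and $P$ a manifold. Then the following assertions hold: (a) If $P$ is compact and $(C^{\infty}(P),\Lambda,\alpha)$ is a noncommutative principal $\Lambda$-bundle, then we obtain a principal $\Lambda$-bundle $(P,P/\Lambda,\Lambda,\mathrm{pr},\sigma)$, where $\mathrm{pr}:P\to P/\Lambda$ is the orbit map of the action $\sigma:P\times\Lambda\to P$ determined by $\delta_{\sigma(p,\lambda)}=\delta_p\circ\alpha(\lambda)$. (b) Conversely, if $(P,M,\Lambda,q,\sigma)$ is a principal $\Lambda$-bundle (total space $P$, base manifold $M$, projection $q$, right action $\sigma$), then the corresponding dynamical system $(C^{\infty}(P),\Lambda,\alpha)$, $\alpha(\lambda,f)(p):=f(\sigma(p,\lambda))$, is a noncommutative principal $\Lambda$-bundle.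
   Context: Manifolds are finite-dimensional, paracompact, second countable and smooth; algebras are associative and complex; $C^\infty(P)$ carries its usual locally convex topology. For $p\in P$, $\delta_p$ is the point evaluation $f\mapsto f(p)$; $p\mapsto\delta_p$ is a bijection of $P$ onto the set of nonzero algebra homomorphisms $C^{\infty}(P)\to\mathbb{C}$. For an algebra $A$, $\Gamma_A$ denotes the set of nonzero algebra homomorphisms $A\to\mathbb{C}$. A dynamical system $(A,\Lambda,\alpha)$ consists of a unital locally convex algebra $A$ and a group homomorphism $\alpha:\Lambda\to\mathrm{Aut}(A)$ inducing a continuous action. For $\chi\in\widehat{\Lambda}=\mathrm{Hom}(\Lambda,\mathbb{T})$, $A_\chi=\{a\in A:\alpha(\lambda)a=\chi(\lambda)a\ \forall\lambda\in\Lambda\}$. Trivial bundles: let $\{\lambda_1,\ldots,\lambda_k\}$ be a set of generators of $\Lambda$ of minimal cardinality, of orders $n_1,\ldots,n_k$, such that $\Lambda$ is the internal direct product of the cyclic subgroups $\langle\lambda_i\rangle$. Define $\widehat{\lambda}_i\in\widehat{\Lambda}$ by $\widehat{\lambda}_i(\lambda_i)=\exp(2\pi i/n_i)$ (imaginary unit in the exponent) and $\widehat{\lambda}_i(\lambda_j)=1$ for $j\neq i$. $(A,\Lambda,\alpha)$ is a trivial noncommutative principal $\Lambda$-bundle if there exists such a set of generators for which each $A_{\widehat{\lambda}_i}$ contains an invertible element $a_i$ with $a_i^{n_i}=1_A$. Smooth localization: for a unital locally convex algebra $A$ and $a\in A$, let $f_a\in C^\infty(\mathbb{R},A)$, $f_a(t)=1_A-ta$,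 where $C^\infty(\mathbb{R},A)$ carries the smooth compact-open topology, let $I_a$ be the closure of the two-sided ideal generated by $f_a$, and set $A_{\{a\}}:=C^\infty(\mathbb{R},A)/I_a$. Let $C_A$ be the center of $A$ and $C_A^\Lambda$ the fixed point algebra of the induced $\Lambda$-action on $C_A$. For $z\in C_A^\Lambda$, $\alpha_{\{z\}}(\lambda,[f]):=[\alpha(\lambda)\circ f]$ defines an action of $\Lambda$ on $A_{\{z\}}$, giving a dynamical system $(A_{\{z\}},\Lambda,\alpha_{\{z\}})$. A dynamical system $(A,\Lambda,\alpha)$ is a noncommutative principal $\Lambda$-bundle if for each $\chi\in\Gamma_{C_A^\Lambda}$ there exists $z\in C_A^\Lambda$ with $\chi(z)\neq0$ such that $(A_{\{z\}},\Lambda,\alpha_{\{z\}})$ is a trivial noncommutative principal $\Lambda$-bundle.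
   Formalization: In the definition of a noncommutative principal bundle, z must satisfy that χ(z) is nonzero and real, not just nonzero; otherwise (a) fails, e.g. z = i·1 makes the localization zero, so every dynamical system, even one with trivial action, would qualify. *)

theory Defs
  imports "HOL-Analysis.Analysis" "HOL-Algebra.QuotRing" "HOL-Algebra.Module" "HOL-Algebra.Bij"
    "HOL-Algebra.Product_Groups" "HOL-Algebra.Multiplicative_Group"
begin

section \<open>Smooth manifolds\<close>

text \<open>
  Model spaces are the spaces \<^term>\<open>Euclidean_space n\<close> of sequences supported in \<open>{..<n}\<close>, so that
  the dimension is a natural number and may be \<open>0\<close>. A function on an open subset \<open>V\<close> of such a space
  is smooth if all its iterated partial derivatives exist and are continuous on \<open>V\<close>.
\<close>

definition partial_deriv ::
    "nat \<Rightarrow> ((nat \<Rightarrow> real) \<Rightarrow> 'b::real_normed_vector) \<Rightarrow> (nat \<Rightarrow> real) \<Rightarrow> 'b" where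
  "partial_deriv i f x = vector_derivative (\<lambda>s. f (x(i := s))) (at (x i))"

definition iter_partial ::
    "nat list \<Rightarrow> ((nat \<Rightarrow> real) \<Rightarrow> 'b::real_normed_vector) \<Rightarrow> (nat \<Rightarrow> real) \<Rightarrow> 'b" where
  "iter_partial is f = foldr partial_deriv is f"

definition smooth_fun ::
    "nat \<Rightarrow> (nat \<Rightarrow> real) set \<Rightarrow> ((nat \<Rightarrow> real) \<Rightarrow> 'b::real_normed_vector) \<Rightarrow> bool" where
  "smooth_fun n V f \<longleftrightarrow>
     (\<forall>is \<in> lists {..<n}.
        continuous_map (subtopology (Euclidean_space n) V) euclidean (iter_partial is f) \<and>
        (\<forall>i<n. \<forall>x\<in>V. (\<lambda>s. iter_partial is f (x(i := s))) differentiable (at (x i))))"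

text \<open>A chart is a pair of its domain and its coordinate map; atlases need not be maximal.\<close>

record 'a mfd =
  mtop :: "'a topology"
  mdim :: nat
  atlas :: "('a set \<times> ('a \<Rightarrow> nat \<Rightarrow> real)) set"

abbreviation points :: "('a, 'm) mfd_scheme \<Rightarrow> 'a set" where
  "points M \<equiv> topspace (mtop M)"

definition paracompact_space :: "'a topology \<Rightarrow> bool" where
  "paracompact_space X \<longleftrightarrow>
     (\<forall>C. (\<forall>U\<in>C. openin X U) \<and> \<Union> C = topspace X \<longrightarrow>
        (\<exists>D. (\<forall>V\<in>D. openin X V) \<and> \<Union> D = topspace X \<and>
             (\<forall>V\<in>D. \<exists>U\<in>C. V \<subseteq> U) \<and> locally_finite_in X D))"

definition manifold :: "'a mfd \<Rightarrow> bool" where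
  "manifold M \<longleftrightarrow>
     Hausdorff_space (mtop M) \<and> second_countable (mtop M) \<and> paracompact_space (mtop M) \<and>
     (\<Union>(U, \<phi>) \<in> atlas M. U) = points M \<and>
     (\<forall>(U, \<phi>) \<in> atlas M.
        openin (mtop M) U \<and> openin (Euclidean_space (mdim M)) (\<phi> ` U) \<and>
        homeomorphic_map (subtopology (mtop M) U)
          (subtopology (Euclidean_space (mdim M)) (\<phi> ` U)) \<phi>) \<and>
     (\<forall>(U, \<phi>) \<in> atlas M. \<forall>(V, \<psi>) \<in> atlas M. \<forall>j < mdim M.
        smooth_fun (mdim M) (\<phi> ` (U \<inter> V)) (\<lambda>x. \<psi> (inv_into U \<phi> x) j))"

definition smooth_map :: "'a mfd \<Rightarrow> 'b mfd \<Rightarrow> ('a \<Rightarrow> 'b) \<Rightarrow> bool" where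
  "smooth_map M N f \<longleftrightarrow>
     continuous_map (mtop M) (mtop N) f \<and>
     (\<forall>(U, \<phi>) \<in> atlas M. \<forall>(V, \<psi>) \<in> atlas N. \<forall>j < mdim N.
        smooth_fun (mdim M) (\<phi> ` (U \<inter> f -` V)) (\<lambda>x. \<psi> (f (inv_into U \<phi> x)) j))"

definition diffeomorphism :: "'a mfd \<Rightarrow> 'b mfd \<Rightarrow> ('a \<Rightarrow> 'b) \<Rightarrow> bool" where
  "diffeomorphism M N f \<longleftrightarrow>
     bij_betw f (points M) (points N) \<and>
     smooth_map M N f \<and> smooth_map N M (inv_into (points M) f)"

definition open_submanifold :: "'a mfd \<Rightarrow> 'a set \<Rightarrow> 'a mfd" where
  "open_submanifold M W =
     \<lparr>mtop = subtopology (mtop M) W, mdim = mdim M, atlas = (\<lambda>(U, \<phi>). (U \<inter> W, \<phi>)) ` atlas M\<rparr>"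

text \<open>The product of \<open>M\<close> with the discrete (zero-dimensional) manifold \<open>D\<close>.\<close>

definition times_discrete :: "'a mfd \<Rightarrow> 'g set \<Rightarrow> ('a \<times> 'g) mfd" where
  "times_discrete M D =
     \<lparr>mtop = prod_topology (mtop M) (discrete_topology D), mdim = mdim M,
      atlas = {(U \<times> {g}, \<phi> \<circ> fst) | U \<phi> g. (U, \<phi>) \<in> atlas M \<and> g \<in> D}\<rparr>"

section \<open>Principal bundles with discrete structure group\<close>

definition right_action :: "'p set \<Rightarrow> ('g, 'c) monoid_scheme \<Rightarrow> ('p \<times> 'g \<Rightarrow> 'p) \<Rightarrow> bool" where
  "right_action X G \<sigma> \<longleftrightarrow>
     \<sigma> \<in> X \<times> carrier G \<rightarrow> X \<and>
     (\<forall>p\<in>X. \<sigma> (p, \<one>\<^bsub>G\<^esub>) = p) \<and>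
     (\<forall>p\<in>X. \<forall>g\<in>carrier G. \<forall>h\<in>carrier G. \<sigma> (\<sigma> (p, g), h) = \<sigma> (p, g \<otimes>\<^bsub>G\<^esub> h))"

definition principal_bundle ::
    "'p mfd \<Rightarrow> 'm mfd \<Rightarrow> ('g, 'c) monoid_scheme \<Rightarrow> ('p \<Rightarrow> 'm) \<Rightarrow> ('p \<times> 'g \<Rightarrow> 'p) \<Rightarrow> bool" where
  "principal_bundle P M G q \<sigma> \<longleftrightarrow>
     manifold P \<and> manifold M \<and>
     smooth_map P M q \<and> q ` points P = points M \<and>
     right_action (points P) G \<sigma> \<and> smooth_map (times_discrete P (carrier G)) P \<sigma> \<and>
     (\<forall>m \<in> points M. \<exists>U \<Phi>. openin (mtop M) U \<and> m \<in> U \<and>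
        diffeomorphism (times_discrete (open_submanifold M U) (carrier G))
          (open_submanifold P {p \<in> points P. q p \<in> U}) \<Phi> \<and>
        (\<forall>u\<in>U. \<forall>g\<in>carrier G. q (\<Phi> (u, g)) = u) \<and>
        (\<forall>u\<in>U. \<forall>g\<in>carrier G. \<forall>h\<in>carrier G. \<Phi> (u, g \<otimes>\<^bsub>G\<^esub> h) = \<sigma> (\<Phi> (u, g), h)))"

section \<open>Unital locally convex algebras\<close>

record 'a lc_algebra = "(complex, 'a) Module.module" +
  lctop :: "'a topology"

definition complex_ring :: "complex ring" where
  "complex_ring = \<lparr>carrier = UNIV, monoid.mult = (*), one = 1, zero = 0, add = (+)\<rparr>"

definition unital_algebra :: "(complex, 'a, 'm) module_scheme \<Rightarrow> bool" where
  "unital_algebra A \<longleftrightarrow>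
     ring A \<and> Module.module complex_ring A \<and>
     (\<forall>c. \<forall>a\<in>carrier A. \<forall>b\<in>carrier A.
        c \<odot>\<^bsub>A\<^esub> (a \<otimes>\<^bsub>A\<^esub> b) = (c \<odot>\<^bsub>A\<^esub> a) \<otimes>\<^bsub>A\<^esub> b \<and>
        c \<odot>\<^bsub>A\<^esub> (a \<otimes>\<^bsub>A\<^esub> b) = a \<otimes>\<^bsub>A\<^esub> (c \<odot>\<^bsub>A\<^esub> b))"

definition convex_in :: "(complex, 'a, 'm) module_scheme \<Rightarrow> 'a set \<Rightarrow> bool" where
  "convex_in A V \<longleftrightarrow>
     (\<forall>a\<in>V. \<forall>b\<in>V. \<forall>t\<in>{0..1::real}.
        (complex_of_real t \<odot>\<^bsub>A\<^esub> a) \<oplus>\<^bsub>A\<^esub> (complex_of_real (1 - t) \<odot>\<^bsub>A\<^esub> b) \<in> V)"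

definition locally_convex_algebra :: "'a lc_algebra \<Rightarrow> bool" where
  "locally_convex_algebra A \<longleftrightarrow>
     unital_algebra A \<and> topspace (lctop A) = carrier A \<and> Hausdorff_space (lctop A) \<and>
     continuous_map (prod_topology (lctop A) (lctop A)) (lctop A) (\<lambda>(a, b). a \<oplus>\<^bsub>A\<^esub> b) \<and>
     continuous_map (prod_topology euclidean (lctop A)) (lctop A) (\<lambda>(c, a). c \<odot>\<^bsub>A\<^esub> a) \<and>
     continuous_map (prod_topology (lctop A) (lctop A)) (lctop A) (\<lambda>(a, b). a \<otimes>\<^bsub>A\<^esub> b) \<and>
     (\<forall>U. openin (lctop A) U \<and> \<zero>\<^bsub>A\<^esub> \<in> U \<longrightarrow>
        (\<exists>V. openin (lctop A) V \<and> \<zero>\<^bsub>A\<^esub> \<in> V \<and> V \<subseteq> U \<and> convex_in A V))"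

definition algebra_characters :: "(complex, 'a, 'm) module_scheme \<Rightarrow> ('a \<Rightarrow> complex) set" where
  "algebra_characters A =
     {\<xi> \<in> extensional (carrier A).
        (\<forall>a\<in>carrier A. \<forall>b\<in>carrier A.
           \<xi> (a \<oplus>\<^bsub>A\<^esub> b) = \<xi> a + \<xi> b \<and> \<xi> (a \<otimes>\<^bsub>A\<^esub> b) = \<xi> a * \<xi> b) \<and>
        (\<forall>c. \<forall>a\<in>carrier A. \<xi> (c \<odot>\<^bsub>A\<^esub> a) = c * \<xi> a) \<and>
        (\<exists>a\<in>carrier A. \<xi> a \<noteq> 0)}"

definition algebra_auto_group :: "(complex, 'a, 'm) module_scheme \<Rightarrow> ('a \<Rightarrow> 'a) monoid" where
  "algebra_auto_group A =
     BijGroup (carrier A)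
       \<lparr>carrier := {h \<in> Bij (carrier A). h \<in> ring_hom A A \<and>
                     (\<forall>c. \<forall>a\<in>carrier A. h (c \<odot>\<^bsub>A\<^esub> a) = c \<odot>\<^bsub>A\<^esub> h a)}\<rparr>"

text \<open>The groups considered are finite, hence carry the discrete topology.\<close>

definition dynamical_system ::
    "'a lc_algebra \<Rightarrow> ('g, 'c) monoid_scheme \<Rightarrow> ('g \<Rightarrow> 'a \<Rightarrow> 'a) \<Rightarrow> bool" where
  "dynamical_system A G \<alpha> \<longleftrightarrow>
     locally_convex_algebra A \<and> group G \<and> \<alpha> \<in> hom G (algebra_auto_group A) \<and>
     continuous_map (prod_topology (discrete_topology (carrier G)) (lctop A)) (lctop A)
       (\<lambda>(g, a). \<alpha> g a)"

definition fixed_center ::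
    "'a lc_algebra \<Rightarrow> ('g, 'c) monoid_scheme \<Rightarrow> ('g \<Rightarrow> 'a \<Rightarrow> 'a) \<Rightarrow> 'a set" where
  "fixed_center A G \<alpha> =
     {z \<in> carrier A. (\<forall>a\<in>carrier A. z \<otimes>\<^bsub>A\<^esub> a = a \<otimes>\<^bsub>A\<^esub> z) \<and> (\<forall>g\<in>carrier G. \<alpha> g z = z)}"

definition subalgebra_on :: "'a lc_algebra \<Rightarrow> 'a set \<Rightarrow> 'a lc_algebra" where
  "subalgebra_on A B = A\<lparr>carrier := B, lctop := subtopology (lctop A) B\<rparr>"

section \<open>Trivial noncommutative principal bundles\<close>

definition circle_group :: "complex monoid" where
  "circle_group = \<lparr>carrier = sphere 0 1, monoid.mult = (*), one = 1\<rparr>"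

definition dual_group_set :: "('g, 'c) monoid_scheme \<Rightarrow> ('g \<Rightarrow> complex) set" where
  "dual_group_set G = hom G circle_group \<inter> extensional (carrier G)"

definition isotypic_component ::
    "'a lc_algebra \<Rightarrow> ('g, 'c) monoid_scheme \<Rightarrow> ('g \<Rightarrow> 'a \<Rightarrow> 'a) \<Rightarrow> ('g \<Rightarrow> complex) \<Rightarrow> 'a set" where
  "isotypic_component A G \<alpha> \<xi> = {a \<in> carrier A. \<forall>g\<in>carrier G. \<alpha> g a = \<xi> g \<odot>\<^bsub>A\<^esub> a}"

definition minimal_cyclic_basis :: "('g, 'c) monoid_scheme \<Rightarrow> 'g set \<Rightarrow> bool" where
  "minimal_cyclic_basis G S \<longleftrightarrow>
     finite S \<and> S \<subseteq> carrier G \<and> generate G S = carrier G \<and>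
     (\<forall>T. finite T \<and> T \<subseteq> carrier G \<and> generate G T = carrier G \<longrightarrow> card S \<le> card T) \<and>
     (\<lambda>x. finprod G x S) \<in> iso (product_group S (\<lambda>s. subgroup_generated G {s})) G"

definition dual_generator :: "('g, 'c) monoid_scheme \<Rightarrow> 'g set \<Rightarrow> 'g \<Rightarrow> 'g \<Rightarrow> complex" where
  "dual_generator G S s =
     (THE \<xi>. \<xi> \<in> dual_group_set G \<and>
        \<xi> s = exp (2 * complex_of_real pi * \<i> / of_nat (group.ord G s)) \<and>
        (\<forall>t \<in> S - {s}. \<xi> t = 1))"

definition trivial_nc_principal_bundle ::
    "'a lc_algebra \<Rightarrow> ('g, 'c) monoid_scheme \<Rightarrow> ('g \<Rightarrow> 'a \<Rightarrow> 'a) \<Rightarrow> bool" where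
  "trivial_nc_principal_bundle A G \<alpha> \<longleftrightarrow>
     dynamical_system A G \<alpha> \<and>
     (\<exists>S. minimal_cyclic_basis G S \<and>
        (\<forall>s\<in>S. \<exists>a \<in> isotypic_component A G \<alpha> (dual_generator G S s).
           a \<in> Units A \<and> a [^]\<^bsub>A\<^esub> group.ord G s = \<one>\<^bsub>A\<^esub>))"

section \<open>Smooth localization\<close>

definition has_curve_deriv :: "'a lc_algebra \<Rightarrow> (real \<Rightarrow> 'a) \<Rightarrow> 'a \<Rightarrow> real \<Rightarrow> bool" where
  "has_curve_deriv A f d t \<longleftrightarrow>
     limitin (lctop A) (\<lambda>h. complex_of_real (inverse h) \<odot>\<^bsub>A\<^esub> (f (t + h) \<ominus>\<^bsub>A\<^esub> f t)) d (at 0)"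

definition curve_deriv :: "'a lc_algebra \<Rightarrow> (real \<Rightarrow> 'a) \<Rightarrow> real \<Rightarrow> 'a" where
  "curve_deriv A f t = (THE d. has_curve_deriv A f d t)"

definition smooth_curve :: "'a lc_algebra \<Rightarrow> (real \<Rightarrow> 'a) \<Rightarrow> bool" where
  "smooth_curve A f \<longleftrightarrow>
     range f \<subseteq> carrier A \<and> (\<forall>k t. \<exists>d. has_curve_deriv A ((curve_deriv A ^^ k) f) d t)"

text \<open>The smooth compact-open topology is the initial topology for the maps \<open>f \<mapsto> f\<^sup>(\<^sup>k\<^sup>)\<close> into the
  continuous curves with the compact-open topology.\<close>

definition smooth_curve_algebra :: "'a lc_algebra \<Rightarrow> (real \<Rightarrow> 'a) lc_algebra" where
  "smooth_curve_algebra A =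
     \<lparr>carrier = {f. smooth_curve A f},
      monoid.mult = (\<lambda>f g t. f t \<otimes>\<^bsub>A\<^esub> g t),
      one = (\<lambda>t. \<one>\<^bsub>A\<^esub>),
      zero = (\<lambda>t. \<zero>\<^bsub>A\<^esub>),
      add = (\<lambda>f g t. f t \<oplus>\<^bsub>A\<^esub> g t),
      smult = (\<lambda>c f t. c \<odot>\<^bsub>A\<^esub> f t),
      lctop = topology_generated_by
        {{f. smooth_curve A f \<and> (curve_deriv A ^^ k) f ` K \<subseteq> V} | k K V.
           compact K \<and> openin (lctop A) V}\<rparr>"

definition quotient_lc_algebra :: "'a lc_algebra \<Rightarrow> 'a set \<Rightarrow> 'a set lc_algebra" where
  "quotient_lc_algebra A I =
     \<lparr>carrier = carrier (A Quot I),
      monoid.mult = monoid.mult (A Quot I),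
      one = one (A Quot I),
      zero = zero (A Quot I),
      add = add (A Quot I),
      smult = (\<lambda>c X. \<Union>a\<in>X. I +>\<^bsub>A\<^esub> (c \<odot>\<^bsub>A\<^esub> a)),
      lctop = topology (\<lambda>W. W \<subseteq> carrier (A Quot I) \<and>
        openin (lctop A) {a \<in> carrier A. I +>\<^bsub>A\<^esub> a \<in> W})\<rparr>"

definition localization_ideal :: "'a lc_algebra \<Rightarrow> 'a \<Rightarrow> (real \<Rightarrow> 'a) set" where
  "localization_ideal A a =
     lctop (smooth_curve_algebra A) closure_of
       (genideal (smooth_curve_algebra A) {\<lambda>t. \<one>\<^bsub>A\<^esub> \<ominus>\<^bsub>A\<^esub> (complex_of_real t \<odot>\<^bsub>A\<^esub> a)})"

definition smooth_localization :: "'a lc_algebra \<Rightarrow> 'a \<Rightarrow> (real \<Rightarrow> 'a) set lc_algebra" where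
  "smooth_localization A a =
     quotient_lc_algebra (smooth_curve_algebra A) (localization_ideal A a)"

definition localized_action ::
    "'a lc_algebra \<Rightarrow> 'a \<Rightarrow> ('g \<Rightarrow> 'a \<Rightarrow> 'a) \<Rightarrow> 'g \<Rightarrow> (real \<Rightarrow> 'a) set \<Rightarrow> (real \<Rightarrow> 'a) set" where
  "localized_action A z \<alpha> g =
     (\<lambda>X \<in> carrier (smooth_localization A z).
        \<Union>f\<in>X. localization_ideal A z +>\<^bsub>smooth_curve_algebra A\<^esub> (\<alpha> g \<circ> f))"

section \<open>Noncommutative principal bundles\<close>

text \<open>
  The localization at \<open>z\<close> uses the \<^emph>\<open>real\<close> parameter \<open>t\<close> in \<open>1 - t z\<close>, so a character \<open>\<xi>\<close> can survive
  in it only if \<open>1 - t \<xi>(z) = 0\<close> has a real solution, that is, if \<open>\<xi>(z)\<close> is real and nonzero. For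
  complex algebras the condition \<open>\<xi>(z) \<noteq> 0\<close> alone is void: for \<open>z = \<i> 1\<close> the curve \<open>1 - t z\<close> is
  invertible, the localization is the zero algebra, and every dynamical system, for instance one with
  trivial action, would be a noncommutative principal bundle. (Excluding the zero algebra does not
  help: let \<open>z\<close> be \<open>\<i>\<close> on a component on which the action is trivial and \<open>1\<close> on the remaining ones.)
  Hence the conjunct \<open>\<xi> z \<in> \<real>\<close>.
\<close>

definition nc_principal_bundle ::
    "'a lc_algebra \<Rightarrow> ('g, 'c) monoid_scheme \<Rightarrow> ('g \<Rightarrow> 'a \<Rightarrow> 'a) \<Rightarrow> bool" where
  "nc_principal_bundle A G \<alpha> \<longleftrightarrow>
     dynamical_system A G \<alpha> \<and>
     (\<forall>\<xi> \<in> algebra_characters (subalgebra_on A (fixed_center A G \<alpha>)).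
        \<exists>z \<in> fixed_center A G \<alpha>. \<xi> z \<noteq> 0 \<and> \<xi> z \<in> \<real> \<and>
          trivial_nc_principal_bundle (smooth_localization A z) G (localized_action A z \<alpha>))"

section \<open>The algebra of smooth functions on a manifold\<close>

definition smooth_functions :: "'p mfd \<Rightarrow> ('p \<Rightarrow> complex) set" where
  "smooth_functions P =
     {f \<in> extensional (points P).
        \<forall>(U, \<phi>) \<in> atlas P. smooth_fun (mdim P) (\<phi> ` U) (\<lambda>x. f (inv_into U \<phi> x))}"

text \<open>
  The topology is that of uniform convergence on compact sets of all partial derivatives in charts.
  The whole space is added to the subbasis only to cover an empty atlas.
\<close>

definition smooth_function_algebra :: "'p mfd \<Rightarrow> ('p \<Rightarrow> complex) lc_algebra" where
  "smooth_function_algebra P =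
     \<lparr>carrier = smooth_functions P,
      monoid.mult = (\<lambda>f g. \<lambda>p\<in>points P. f p * g p),
      one = (\<lambda>p\<in>points P. 1),
      zero = (\<lambda>p\<in>points P. 0),
      add = (\<lambda>f g. \<lambda>p\<in>points P. f p + g p),
      smult = (\<lambda>c f. \<lambda>p\<in>points P. c * f p),
      lctop = topology_generated_by (insert (smooth_functions P)
        {{f \<in> smooth_functions P. iter_partial is (\<lambda>x. f (inv_into U \<phi> x)) ` K \<subseteq> V} | U \<phi> is K V.
           (U, \<phi>) \<in> atlas P \<and> is \<in> lists {..<mdim P} \<and>
           compactin (Euclidean_space (mdim P)) K \<and> K \<subseteq> \<phi> ` U \<and> open V})\<rparr>"

definition point_evaluation :: "'p mfd \<Rightarrow> 'p \<Rightarrow> ('p \<Rightarrow> complex) \<Rightarrow> complex" where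
  "point_evaluation P p = (\<lambda>f \<in> smooth_functions P. f p)"

definition determined_action ::
    "'p mfd \<Rightarrow> ('g, 'c) monoid_scheme \<Rightarrow> ('g \<Rightarrow> ('p \<Rightarrow> complex) \<Rightarrow> 'p \<Rightarrow> complex) \<Rightarrow>
     ('p \<times> 'g \<Rightarrow> 'p) \<Rightarrow> bool" where
  "determined_action P G \<alpha> \<sigma> \<longleftrightarrow>
     \<sigma> \<in> points P \<times> carrier G \<rightarrow>\<^sub>E points P \<and>
     (\<forall>p\<in>points P. \<forall>g\<in>carrier G.
        point_evaluation P (\<sigma> (p, g)) = compose (smooth_functions P) (point_evaluation P p) (\<alpha> g))"

definition pullback_action ::
    "'p mfd \<Rightarrow> ('p \<times> 'g \<Rightarrow> 'p) \<Rightarrow> 'g \<Rightarrow> ('p \<Rightarrow> complex) \<Rightarrow> 'p \<Rightarrow> complex" where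
  "pullback_action P \<sigma> g = (\<lambda>f \<in> smooth_functions P. \<lambda>p \<in> points P. f (\<sigma> (p, g)))"

definition orbit_map :: "('g, 'c) monoid_scheme \<Rightarrow> ('p \<times> 'g \<Rightarrow> 'p) \<Rightarrow> 'p \<Rightarrow> 'p set" where
  "orbit_map G \<sigma> p = {\<sigma> (p, g) | g. g \<in> carrier G}"

end

theory Submission
  imports Defs
begin

text \<open>
  Characters of \<open>C\<^sup>\<infinity>(P)\<close> are point evaluations, so the automorphisms \<open>\<alpha>(\<lambda>)\<close> come from diffeomorphisms
  of \<open>P\<close>. If \<open>\<lambda>\<close> fixes a point \<open>p\<close>, choose \<open>z\<close> with \<open>z(p)\<close> real and nonzero and a trivial localization at \<open>z\<close>.
  Evaluation of curves at \<open>t = 1 / z(p)\<close> followed by evaluation at \<open>p\<close> is a \<open>\<lambda>\<close>-invariant character of this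
  localization. It does not vanish on the invertible isotypic elements, so all dual generators are
  \<open>1\<close> at \<open>\<lambda>\<close>, whence \<open>\<lambda> = 1\<close>. A free smooth action of a finite group has a quotient manifold.

  Conversely, over a trivializing open set of the base take an invariant bump function \<open>z\<close>. Multiplying it
  with the dual generators, read as locally constant functions of the fibre coordinate, gives isotypic
  functions \<open>w\<close> with \<open>w\<^sup>n = z\<^sup>n\<close>. The class of \<open>t \<mapsto> t z\<close> in the localization at \<open>z\<close> is \<open>1\<close>, so the class of
  \<open>t \<mapsto> t w\<close> is an \<open>n\<close>-th root of unity.
\<close>

section \<open>Families of smooth functions on Euclidean spaces\<close>

text \<open>Characters are identified with points in both directions: on \<open>P\<close>, and for
  the converse on the base, where a character of the fixed algebra is composed with the pullback
  along \<open>q\<close> and becomes a point of \<open>M\<close>. The localization divides by a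
  closure, so nothing can be read off from generators of the ideal alone. Evaluation still descends
  because its kernel is a closed ideal containing \<open>1 - t z\<close>; the same minimality makes
  the ideal invariant under the group. Another obstacle is the cyclic basis of a trivial bundle,
  which must be as small as any generating set. Splitting into cyclic groups of prime power order
  fails here (Z/6 has one generator, Z/2 x Z/3 uses two), hence the exchange argument on generating
  sets of minimal cardinality. On the quotient, every smoothness claim is lifted to
  \<open>P\<close>, where a local section after the projection is locally the action of a single
  group element; there the smoothness of the action applies.\<close>

text \<open>
  \<open>F x\<close> is a function on the open set \<open>V\<close> for every point \<open>x\<close> of the parameter space \<open>X\<close>, and the
  partial derivatives of order at most \<open>k\<close> are required to be continuous jointly in both arguments.
  By the exponential law this is the same as continuity of \<open>F\<close> from \<open>X\<close> into a space of functions,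
  so closure properties of families give smoothness and continuity of the algebraic operations at once.
\<close>

primrec Ck_family ::
    "nat \<Rightarrow> 'x topology \<Rightarrow> nat \<Rightarrow> (nat \<Rightarrow> real) set \<Rightarrow>
     ('x \<Rightarrow> (nat \<Rightarrow> real) \<Rightarrow> 'b::real_normed_vector) \<Rightarrow> bool" where
  "Ck_family 0 X n V F \<longleftrightarrow>
     continuous_map (prod_topology X (subtopology (Euclidean_space n) V)) euclidean (\<lambda>(x, y). F x y)"
| "Ck_family (Suc k) X n V F \<longleftrightarrow>
     continuous_map (prod_topology X (subtopology (Euclidean_space n) V)) euclidean (\<lambda>(x, y). F x y) \<and>
     (\<forall>i<n. (\<forall>x\<in>topspace X. \<forall>y\<in>V. (\<lambda>s. F x (y(i := s))) differentiable (at (y i))) \<and>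
        Ck_family k X n V (\<lambda>x. partial_deriv i (F x)))"

definition smooth_family ::
    "'x topology \<Rightarrow> nat \<Rightarrow> (nat \<Rightarrow> real) set \<Rightarrow>
     ('x \<Rightarrow> (nat \<Rightarrow> real) \<Rightarrow> 'b::real_normed_vector) \<Rightarrow> bool" where
  "smooth_family X n V F \<longleftrightarrow> (\<forall>k. Ck_family k X n V F)"

lemma continuous_map_euclidean_iff_tendsto:
  "continuous_map X euclidean f \<longleftrightarrow> (\<forall>x\<in>topspace X. (f \<longlongrightarrow> f x) (atin X x))"
  by (simp add: continuous_map_atin)

lemma Ck_family_continuous:
  "Ck_family k X n V F \<Longrightarrow>
     continuous_map (prod_topology X (subtopology (Euclidean_space n) V)) euclidean (\<lambda>(x, y). F x y)"
  by (cases k) auto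

lemma openin_Euclidean_space_subset: "openin (Euclidean_space n) V \<Longrightarrow> y \<in> V \<Longrightarrow> n \<le> i \<Longrightarrow> y i = 0"
  using openin_subset[of "Euclidean_space n" V] by (auto simp: topspace_Euclidean_space)

text \<open>Points of \<open>W\<close> vanish beyond \<open>m\<close>, so cutting \<open>g\<close>
  off above \<open>m\<close> changes nothing and the coordinates below \<open>m\<close> decide
  continuity.\<close>

lemma continuous_map_into_Euclidean_subspace:
  assumes "W \<subseteq> topspace (Euclidean_space m)" "\<And>j. j < m \<Longrightarrow> continuous_map T euclideanreal (\<lambda>x. g x j)"
    and "\<And>x. x \<in> topspace T \<Longrightarrow> g x \<in> W"
  shows "continuous_map T (subtopology (Euclidean_space m) W) g"
proof -
  have "continuous_map T (Euclidean_space m) (\<lambda>x i. if i < m then g x i else 0)"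
    using assms(2) by (simp add: continuous_map_componentwise_Euclidean_space)
  moreover have "(\<lambda>i. if i < m then g x i else 0) = g x" if "x \<in> topspace T" for x
    using assms(1) assms(3)[OF that] by (fastforce simp: topspace_Euclidean_space fun_eq_iff not_less)
  ultimately have "continuous_map T (Euclidean_space m) g"
    by (metis (mono_tags, lifting) continuous_map_eq)
  then show ?thesis
    using assms(3) by (auto simp: continuous_map_in_subtopology)
qed

lemma continuous_map_Euclidean_coordinate:
  "continuous_map (subtopology (Euclidean_space n) V) euclideanreal (\<lambda>y. y j)"
  unfolding Euclidean_space_def
  by (intro continuous_map_from_subtopology) (metis UNIV_I continuous_map_product_coordinates)

text \<open>Partial derivatives at a point of \<open>V\<close> only probe \<open>V\<close>, because
  the coordinate line through the point stays in \<open>V\<close> for a while. The congruence lemmas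
  rest on this: they replace a function by another one that agrees with it on \<open>V\<close>
  only.\<close>

lemma eventually_slice_in_open:
  assumes "openin (Euclidean_space n) V" "y \<in> V" "i < n"
  shows "\<forall>\<^sub>F s in nhds (y i). y(i := s) \<in> V"
proof -
  have y0: "y j = 0" if "j \<ge> n" for j
    using openin_Euclidean_space_subset[OF assms(1,2) that] .
  have "continuous_map euclideanreal (subtopology (Euclidean_space n) (topspace (Euclidean_space n)))
      (\<lambda>s. y(i := s))"
  proof (rule continuous_map_into_Euclidean_subspace)
    show "continuous_map euclideanreal euclideanreal (\<lambda>s. (y(i := s)) j)" for j
      by (cases "j = i") auto
  qed (use y0 assms(3) in \<open>auto simp: topspace_Euclidean_space\<close>)
  then have "openin euclideanreal {s \<in> topspace euclideanreal. y(i := s) \<in> V}"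
    using assms(1) by (intro openin_continuous_map_preimage) auto
  then have "open {s. y(i := s) \<in> V}"
    by simp
  then show ?thesis
    using assms(2) by (auto simp: eventually_nhds)
qed

lemma partial_cong:
  assumes "openin (Euclidean_space n) V" "y \<in> V" "i < n" "\<And>y. y \<in> V \<Longrightarrow> f y = g y"
  shows "((\<lambda>s. f (y(i := s))) has_vector_derivative d) (at (y i)) \<longleftrightarrow>
         ((\<lambda>s. g (y(i := s))) has_vector_derivative d) (at (y i))"
proof -
  have ev: "\<forall>\<^sub>F s in nhds (y i). f (y(i := s)) = g (y(i := s))"
    using eventually_slice_in_open[OF assms(1-3)] by eventually_elim (use assms(4) in auto)
  have "f y = g y" using assms by auto
  with ev show ?thesis
    unfolding has_vector_derivative_def
    by (intro iffI; elim has_derivative_transform_eventually)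
       (auto simp: eventually_nhds_conv_at elim: eventually_mono)
qed

lemma partial_deriv_cong:
  assumes "openin (Euclidean_space n) V" "y \<in> V" "i < n" "\<And>y. y \<in> V \<Longrightarrow> f y = g y"
  shows "partial_deriv i f y = partial_deriv i g y"
  unfolding partial_deriv_def vector_derivative_def
  by (rule arg_cong[where f = Eps]) (rule ext, rule partial_cong[OF assms])

lemma partial_differentiable_cong:
  assumes "openin (Euclidean_space n) V" "y \<in> V" "i < n" "\<And>y. y \<in> V \<Longrightarrow> f y = g y"
  shows "(\<lambda>s. f (y(i := s))) differentiable (at (y i)) \<longleftrightarrow> (\<lambda>s. g (y(i := s))) differentiable (at (y i))"
proof
  assume "(\<lambda>s. f (y(i := s))) differentiable (at (y i))"
  then have "((\<lambda>s. f (y(i := s))) has_vector_derivative partial_deriv i f y) (at (y i))"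
    by (simp add: vector_derivative_works partial_deriv_def)
  then have "((\<lambda>s. g (y(i := s))) has_vector_derivative partial_deriv i f y) (at (y i))"
    using partial_cong[OF assms(1-3), of f g] assms(4) by blast
  then show "(\<lambda>s. g (y(i := s))) differentiable (at (y i))"
    by (rule differentiableI_vector)
next
  assume "(\<lambda>s. g (y(i := s))) differentiable (at (y i))"
  then have "((\<lambda>s. g (y(i := s))) has_vector_derivative partial_deriv i g y) (at (y i))"
    by (simp add: vector_derivative_works partial_deriv_def)
  then have "((\<lambda>s. f (y(i := s))) has_vector_derivative partial_deriv i g y) (at (y i))"
    using partial_cong[OF assms(1-3), of f g] assms(4) by blast
  then show "(\<lambda>s. f (y(i := s))) differentiable (at (y i))"
    by (rule differentiableI_vector)
qed

lemma Ck_family_cong: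
  assumes "openin (Euclidean_space n) V" "\<And>x y. x \<in> topspace X \<Longrightarrow> y \<in> V \<Longrightarrow> F x y = G x y"
    and "Ck_family k X n V F"
  shows "Ck_family k X n V G"
  using assms(2,3)
proof (induction k arbitrary: F G)
  case 0
  then show ?case
    by (auto elim!: continuous_map_eq)
next
  case (Suc k)
  have "Ck_family k X n V (\<lambda>x. partial_deriv i (G x))" if "i < n" for i
    by (rule Suc.IH[where F = "\<lambda>x. partial_deriv i (F x)"])
      (use Suc.prems that in \<open>auto intro: partial_deriv_cong[OF assms(1)]\<close>)
  moreover have "(\<lambda>s. G x (y(i := s))) differentiable (at (y i))"
    if "i < n" "x \<in> topspace X" "y \<in> V" for i x y
    using partial_differentiable_cong[OF assms(1) that(3,1), of "F x" "G x"] Suc.prems that by auto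
  ultimately show ?case
    using Suc.prems by (auto elim!: continuous_map_eq)
qed

text \<open>Lets the partial derivatives be supplied as explicit formulas \<open>F'\<close>. A
  closure property then splits into a differentiation rule and the induction hypothesis applied to
  the ingredients of the formula.\<close>

lemma Ck_family_SucI:
  assumes "openin (Euclidean_space n) V"
    and "continuous_map (prod_topology X (subtopology (Euclidean_space n) V)) euclidean (\<lambda>(x, y). F x y)"
    and "\<And>i. i < n \<Longrightarrow> Ck_family k X n V (F' i)"
    and der: "\<And>i x y. i < n \<Longrightarrow> x \<in> topspace X \<Longrightarrow> y \<in> V \<Longrightarrow>
          ((\<lambda>s. F x (y(i := s))) has_vector_derivative F' i x y) (at (y i))"
  shows "Ck_family (Suc k) X n V F"
proof -
  have "Ck_family k X n V (\<lambda>x. partial_deriv i (F x))" if "i < n" for i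
    by (rule Ck_family_cong[OF assms(1) _ assms(3)[OF that]])
      (use der[OF that, THEN vector_derivative_at] in \<open>auto simp: partial_deriv_def\<close>)
  moreover have "(\<lambda>s. F x (y(i := s))) differentiable (at (y i))"
    if "i < n" "x \<in> topspace X" "y \<in> V" for i x y
    using der[OF that] by (rule differentiableI_vector)
  ultimately show ?thesis
    using assms(2) by simp
qed

lemma Ck_family_SucD:
  assumes "Ck_family (Suc k) X n V F" "i < n"
  shows "Ck_family k X n V (\<lambda>x. partial_deriv i (F x))"
    and "x \<in> topspace X \<Longrightarrow> y \<in> V \<Longrightarrow>
      ((\<lambda>s. F x (y(i := s))) has_vector_derivative partial_deriv i (F x) y) (at (y i))"
  using assms by (auto simp: partial_deriv_def vector_derivative_works)

lemma Ck_family_mono: "Ck_family (Suc k) X n V F \<Longrightarrow> Ck_family k X n V F"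
  by (induction k arbitrary: F) auto

lemma Ck_family_reparam:
  assumes "continuous_map X' X r" "V' \<subseteq> V" "Ck_family k X n V F"
  shows "Ck_family k X' n V' (\<lambda>x. F (r x))"
  using assms(3)
proof (induction k arbitrary: F)
  have c: "continuous_map (prod_topology X' (subtopology (Euclidean_space n) V')) euclidean (\<lambda>(x, y). F (r x) y)"
    if "continuous_map (prod_topology X (subtopology (Euclidean_space n) V)) euclidean (\<lambda>(x, y). F x y)"
    for F :: "'b \<Rightarrow> (nat \<Rightarrow> real) \<Rightarrow> 'c"
  proof -
    have "continuous_map (prod_topology X' (subtopology (Euclidean_space n) V'))
        (prod_topology X (subtopology (Euclidean_space n) V)) (\<lambda>z. (r (fst z), snd z))"
    proof (rule continuous_map_pairedI)
      show "continuous_map (prod_topology X' (subtopology (Euclidean_space n) V')) X (\<lambda>z. r (fst z))"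
        using continuous_map_compose[OF continuous_map_fst assms(1)] by (simp add: o_def)
      have "continuous_map (subtopology (Euclidean_space n) V') (subtopology (Euclidean_space n) V) id"
        using assms(2) by (auto simp: continuous_map_in_subtopology intro: continuous_map_from_subtopology)
      from continuous_map_compose[OF continuous_map_snd this]
      show "continuous_map (prod_topology X' (subtopology (Euclidean_space n) V'))
          (subtopology (Euclidean_space n) V) snd"
        by (simp add: o_def)
    qed
    from continuous_map_compose[OF this that] show ?thesis
      by (simp add: o_def case_prod_unfold)
  qed
  {
    case 0
    then show ?case using c by simp
  next
    case (Suc k)
    then show ?case
      using c[of F] assms(2) continuous_map_image_subset_topspace[OF assms(1)] by fastforce
  }
qed

lemma Ck_family_local:
  assumes "\<And>y. y \<in> V \<Longrightarrow> \<exists>V0. openin (Euclidean_space n) V0 \<and> y \<in> V0 \<and> Ck_family k X n V0 F"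
  shows "Ck_family k X n V F"
  using assms
proof (induction k arbitrary: F)
  have c: "continuous_map (prod_topology X (subtopology (Euclidean_space n) V)) euclidean (\<lambda>(x, y). F x y)"
    if ex: "\<And>y. y \<in> V \<Longrightarrow> \<exists>V0. openin (Euclidean_space n) V0 \<and> y \<in> V0 \<and>
        continuous_map (prod_topology X (subtopology (Euclidean_space n) V0)) euclidean (\<lambda>(x, y). F x y)"
    for F :: "'a \<Rightarrow> (nat \<Rightarrow> real) \<Rightarrow> 'b"
  proof -
    obtain N where N: "\<And>y. y \<in> V \<Longrightarrow> openin (Euclidean_space n) (N y) \<and> y \<in> N y \<and>
        continuous_map (prod_topology X (subtopology (Euclidean_space n) (N y))) euclidean (\<lambda>(x, y). F x y)"
      using ex by metis
    let ?T = "prod_topology X (subtopology (Euclidean_space n) V)"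
    show ?thesis
    proof (rule pasting_lemma[where I = V and T = "\<lambda>y. topspace X \<times> (N y \<inter> V)" and f = "\<lambda>_ (x, y). F x y"])
      fix y assume y: "y \<in> V"
      show "openin ?T (topspace X \<times> (N y \<inter> V))"
        using N[OF y] by (auto simp: openin_prod_Times_iff openin_subtopology)
      \<comment> \<open>The neighbourhoods \<open>N y\<close> may reach outside \<open>V\<close>, so
        the pieces are cut down to \<open>N y \<inter> V\<close> and the known continuity is
        restricted to them.\<close>
      have "subtopology ?T (topspace X \<times> (N y \<inter> V)) =
          subtopology (prod_topology X (subtopology (Euclidean_space n) (N y))) (topspace X \<times> V)"
        by (simp add: subtopology_Times[symmetric] subtopology_subtopology prod_topology_subtopology)
          (rule arg_cong[where f = "subtopology _"], blast)
      then show "continuous_map (subtopology ?T (topspace X \<times> (N y \<inter> V))) euclidean (\<lambda>(x, y). F x y)"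
        using N[OF y] by (simp add: continuous_map_from_subtopology)
    next
      fix z assume "z \<in> topspace ?T"
      then show "\<exists>j. j \<in> V \<and> z \<in> topspace X \<times> (N j \<inter> V) \<and> (case z of (x, y) \<Rightarrow> F x y) = (case z of (x, y) \<Rightarrow> F x y)"
        using N by auto
    qed auto
  qed
  {
    case 0
    then show ?case using c by simp
  next
    case (Suc k)
    have "Ck_family k X n V (\<lambda>x. partial_deriv i (F x))" if "i < n" for i
      by (rule Suc.IH) (use Suc.prems that in fastforce)
    moreover have "(\<lambda>s. F x (y(i := s))) differentiable (at (y i))"
      if "i < n" "x \<in> topspace X" "y \<in> V" for i x y
      using Suc.prems[OF that(3)] that by auto
    moreover have "continuous_map (prod_topology X (subtopology (Euclidean_space n) V)) euclidean (\<lambda>(x, y). F x y)"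
      by (rule c) (use Suc.prems in fastforce)
    ultimately show ?case
      by simp
  }
qed

lemma Ck_family_parameter:
  assumes "openin (Euclidean_space n) V" "continuous_map X euclidean c"
  shows "Ck_family k X n V (\<lambda>x y. c x)"
  using assms(2)
proof (induction k arbitrary: c)
  have *: "continuous_map (prod_topology X (subtopology (Euclidean_space n) V)) euclidean (\<lambda>(x, y). c x)"
    if "continuous_map X euclidean c" for c :: "'a \<Rightarrow> 'b"
    using continuous_map_compose[OF continuous_map_fst that] by (simp add: o_def case_prod_unfold)
  {
    case 0
    then show ?case using * by simp
  next
    case (Suc k)
    then show ?case
      by (intro Ck_family_SucI[OF assms(1), where F' = "\<lambda>i x y. 0"] * Suc.IH) auto
  }
qed

lemma Ck_family_coordinate:
  assumes "openin (Euclidean_space n) V"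
  shows "Ck_family k X n V (\<lambda>x y. y j)"
proof -
  have c: "continuous_map (prod_topology X (subtopology (Euclidean_space n) V)) euclidean (\<lambda>(x, y). y j)"
    using continuous_map_compose[OF continuous_map_snd continuous_map_Euclidean_coordinate]
    by (simp add: o_def case_prod_unfold)
  show ?thesis
  proof (cases k)
    case (Suc l)
    show ?thesis
      unfolding Suc
    proof (rule Ck_family_SucI[OF assms c, where F' = "\<lambda>i x y. if i = j then 1 else 0"])
      show "((\<lambda>s. (y(i := s)) j) has_vector_derivative (if i = j then 1 else 0)) (at (y i))" for i and y :: "nat \<Rightarrow> real"
        by (cases "i = j") auto
    qed (use Ck_family_parameter[OF assms, of X "\<lambda>_. 0 :: real" l] Ck_family_parameter[OF assms, of X "\<lambda>_. 1 :: real" l] in auto)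
  qed (use c in simp)
qed

lemma Ck_family_add:
  assumes V: "openin (Euclidean_space n) V" and "Ck_family k X n V F" "Ck_family k X n V G"
  shows "Ck_family k X n V (\<lambda>x y. F x y + G x y)"
  using assms(2,3)
proof (induction k arbitrary: F G)
  case 0
  then show ?case
    using continuous_map_add[of _ "\<lambda>(x, y). F x y" "\<lambda>(x, y). G x y"] by (simp add: case_prod_unfold)
next
  case (Suc k)
  show ?case
  proof (rule Ck_family_SucI[OF V])
    show "continuous_map (prod_topology X (subtopology (Euclidean_space n) V)) euclidean (\<lambda>(x, y). F x y + G x y)"
      using Suc.prems continuous_map_add[of _ "\<lambda>(x, y). F x y" "\<lambda>(x, y). G x y"] by (simp add: case_prod_unfold)
    fix i assume i: "i < n"
    show "Ck_family k X n V (\<lambda>x y. partial_deriv i (F x) y + partial_deriv i (G x) y)"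
      using Suc.IH Suc.prems i by simp
    show "((\<lambda>s. F x (y(i := s)) + G x (y(i := s))) has_vector_derivative partial_deriv i (F x) y + partial_deriv i (G x) y) (at (y i))"
      if "x \<in> topspace X" "y \<in> V" for x y
      by (rule has_vector_derivative_add[OF Ck_family_SucD(2)[OF Suc.prems(1) i that] Ck_family_SucD(2)[OF Suc.prems(2) i that]])
  qed
qed

lemma Ck_family_sum:
  assumes "openin (Euclidean_space n) V" "finite I" "\<And>i. i \<in> I \<Longrightarrow> Ck_family k X n V (F i)"
  shows "Ck_family k X n V (\<lambda>x y. \<Sum>i\<in>I. F i x y)"
  using assms(2,3)
  by (induction I) (auto intro: Ck_family_add[OF assms(1)] Ck_family_parameter[OF assms(1)])

lemma Ck_family_bounded_linear:
  fixes F :: "'x \<Rightarrow> (nat \<Rightarrow> real) \<Rightarrow> 'b::real_normed_vector"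
  assumes V: "openin (Euclidean_space n) V" and L: "bounded_linear L" and "Ck_family k X n V F"
  shows "Ck_family k X n V (\<lambda>x y. L (F x y))"
  using assms(3)
proof (induction k arbitrary: F)
  have *: "continuous_map T euclidean (\<lambda>(x, y). L (F x y))"
    if "continuous_map T euclidean (\<lambda>(x, y). F x y)" for T and F :: "'x \<Rightarrow> (nat \<Rightarrow> real) \<Rightarrow> 'b"
    using that bounded_linear.tendsto[OF L]
    unfolding continuous_map_euclidean_iff_tendsto by (auto simp: case_prod_unfold)
  {
    case 0
    then show ?case using * by simp
  next
    case (Suc k)
    show ?case
      by (rule Ck_family_SucI[OF V *[OF Ck_family_continuous[OF Suc.prems]] Suc.IH[OF Ck_family_SucD(1)[OF Suc.prems]]
            bounded_linear.has_vector_derivative[OF L Ck_family_SucD(2)[OF Suc.prems]]])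
  }
qed

lemma Ck_family_bounded_bilinear:
  fixes F :: "'x \<Rightarrow> (nat \<Rightarrow> real) \<Rightarrow> 'b::real_normed_vector"
    and G :: "'x \<Rightarrow> (nat \<Rightarrow> real) \<Rightarrow> 'c::real_normed_vector"
  assumes V: "openin (Euclidean_space n) V" and B: "bounded_bilinear B"
    and "Ck_family k X n V F" "Ck_family k X n V G"
  shows "Ck_family k X n V (\<lambda>x y. B (F x y) (G x y))"
  using assms(3,4)
proof (induction k arbitrary: F G)
  have *: "continuous_map T euclidean (\<lambda>(x, y). B (F x y) (G x y))"
    if "continuous_map T euclidean (\<lambda>(x, y). F x y)" "continuous_map T euclidean (\<lambda>(x, y). G x y)"
    for T and F :: "'x \<Rightarrow> (nat \<Rightarrow> real) \<Rightarrow> 'b" and G :: "'x \<Rightarrow> (nat \<Rightarrow> real) \<Rightarrow> 'c"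
    using that
    unfolding continuous_map_euclidean_iff_tendsto
    by (auto simp: case_prod_unfold intro!: bounded_bilinear.tendsto[OF B])
  {
    case 0
    then show ?case using * by simp
  next
    case (Suc k)
    show ?case
    proof (rule Ck_family_SucI[OF V])
      show "continuous_map (prod_topology X (subtopology (Euclidean_space n) V)) euclidean (\<lambda>(x, y). B (F x y) (G x y))"
        using Suc.prems by (intro *) auto
      fix i assume i: "i < n"
      show "Ck_family k X n V (\<lambda>x y. B (F x y) (partial_deriv i (G x) y) + B (partial_deriv i (F x) y) (G x y))"
        by (intro Ck_family_add[OF V] Suc.IH Suc.prems[THEN Ck_family_mono] Suc.prems[THEN Ck_family_SucD(1)] i)
      show "((\<lambda>s. B (F x (y(i := s))) (G x (y(i := s)))) has_vector_derivative
          B (F x y) (partial_deriv i (G x) y) + B (partial_deriv i (F x) y) (G x y)) (at (y i))"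
        if "x \<in> topspace X" "y \<in> V" for x y
        using bounded_bilinear.has_vector_derivative[OF B Ck_family_SucD(2)[OF Suc.prems(1) i that] Ck_family_SucD(2)[OF Suc.prems(2) i that]]
        unfolding fun_upd_triv .
    qed
  }
qed

lemma Ck_family_inverse:
  fixes F :: "'x \<Rightarrow> (nat \<Rightarrow> real) \<Rightarrow> 'b::real_normed_field"
  assumes V: "openin (Euclidean_space n) V" and F: "Ck_family k X n V F"
    and nz: "\<And>x y. x \<in> topspace X \<Longrightarrow> y \<in> V \<Longrightarrow> F x y \<noteq> 0"
  shows "Ck_family k X n V (\<lambda>x y. inverse (F x y))"
  using F
proof (induction k)
  have *: "continuous_map (prod_topology X (subtopology (Euclidean_space n) V)) euclidean (\<lambda>(x, y). inverse (F x y))"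
    using Ck_family_continuous[OF F] nz
    unfolding continuous_map_euclidean_iff_tendsto by (auto simp: case_prod_unfold intro!: tendsto_inverse)
  {
    case 0
    then show ?case using * by simp
  next
    case (Suc k)
    show ?case
    proof (rule Ck_family_SucI[OF V *])
      fix i assume i: "i < n"
      \<comment> \<open>The derivative of the inverse contains the inverse itself, so the induction
        keeps \<open>F\<close> fixed and feeds the result of lower order back into the
        formula.\<close>
      have IH: "Ck_family k X n V (\<lambda>x y. inverse (F x y))"
        using Suc Ck_family_mono by blast
      have D: "Ck_family k X n V (\<lambda>x. partial_deriv i (F x))"
        using Suc.prems i by simp
      show "Ck_family k X n V (\<lambda>x y. - (inverse (F x y) * partial_deriv i (F x) y * inverse (F x y)))"
        by (rule Ck_family_bounded_linear[OF V bounded_linear_minus[OF bounded_linear_ident]],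
            rule Ck_family_bounded_bilinear[OF V bounded_bilinear_mult],
            rule Ck_family_bounded_bilinear[OF V bounded_bilinear_mult]) (rule IH D)+
      show "((\<lambda>s. inverse (F x (y(i := s)))) has_vector_derivative
          - (inverse (F x y) * partial_deriv i (F x) y * inverse (F x y))) (at (y i))"
        if "x \<in> topspace X" "y \<in> V" for x y
        using Ck_family_SucD(2)[OF Suc.prems i that] nz[OF that]
        unfolding has_vector_derivative_def
        by (auto intro!: derivative_eq_intros)
    qed
  }
qed

text \<open>\<open>H\<close> lists a function together with all its derivatives. The chain rule
  turns \<open>H j\<close> into \<open>H (Suc j)\<close>, so the induction runs for all
  \<open>j\<close> at once.\<close>

lemma Ck_family_real_compose:
  fixes F :: "'x \<Rightarrow> (nat \<Rightarrow> real) \<Rightarrow> real"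
  assumes V: "openin (Euclidean_space n) V" and F: "Ck_family k X n V F"
    and H: "\<And>j u. (H j has_real_derivative H (Suc j) u) (at u)"
  shows "Ck_family k X n V (\<lambda>x y. H j (F x y))"
  using F
proof (induction k arbitrary: j)
  have *: "continuous_map (prod_topology X (subtopology (Euclidean_space n) V)) euclidean (\<lambda>(x, y). H j (F x y))" for j
  proof -
    have "isCont (H j) u" for u
      using H DERIV_isCont by blast
    then have "continuous_map euclideanreal euclideanreal (H j)"
      by (simp add: continuous_on_eq_continuous_at)
    from continuous_map_compose[OF Ck_family_continuous[OF F] this] show ?thesis
      by (simp add: o_def case_prod_unfold)
  qed
  {
    case 0
    then show ?case using * by simp
  next
    case (Suc k)
    show ?case
    proof (rule Ck_family_SucI[OF V *])
      fix i assume i: "i < n"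
      show "Ck_family k X n V (\<lambda>x y. partial_deriv i (F x) y * H (Suc j) (F x y))"
        by (intro Ck_family_bounded_bilinear[OF V bounded_bilinear_mult] Suc.IH Ck_family_SucD(1)[OF Suc.prems i]
              Ck_family_mono[OF Suc.prems])
      show "((\<lambda>s. H j (F x (y(i := s)))) has_vector_derivative
          partial_deriv i (F x) y * H (Suc j) (F x y)) (at (y i))"
        if "x \<in> topspace X" "y \<in> V" for x y
        using field_vector_diff_chain_at[OF Ck_family_SucD(2)[OF Suc.prems i that], of "H j" "H (Suc j) (F x y)"] H[of j "F x y"]
        unfolding o_def by simp
    qed
  }
qed

section \<open>First-order approximation and the chain rule\<close>

lemma Euclidean_open_contains_cube:
  assumes "openin (Euclidean_space m) W" "w \<in> W"
  obtains d where "d > 0"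
    "\<And>w'. w' \<in> topspace (Euclidean_space m) \<Longrightarrow> (\<And>j. j < m \<Longrightarrow> \<bar>w' j - w j\<bar> < d) \<Longrightarrow> w' \<in> W"
proof -
  obtain T where T: "openin (powertop_real UNIV) T" "W = T \<inter> {x. \<forall>i\<ge>m. x i = 0}"
    using assms(1) unfolding Euclidean_space_def openin_subtopology by auto
  then have "w \<in> T" using assms by auto
  then obtain U where U: "finite {i. U i \<noteq> UNIV}" "\<And>i. open (U i)" "w \<in> Pi\<^sub>E UNIV U" "Pi\<^sub>E UNIV U \<subseteq> T"
    using T(1) unfolding openin_product_topology_alt by force
  have "\<exists>e>0. \<forall>u. \<bar>u - w i\<bar> < e \<longrightarrow> u \<in> U i" for i
    using U(2)[of i] U(3) unfolding open_dist by (auto simp: PiE_iff dist_real_def)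
  then obtain e where e: "\<And>i. e i > 0" "\<And>i u. \<bar>u - w i\<bar> < e i \<Longrightarrow> u \<in> U i"
    by metis
  \<comment> \<open>Only finitely many coordinates are constrained by a basic open set; the extra 1
    keeps the set under \<open>Min\<close> nonempty if none is.\<close>
  define d where "d = Min (insert 1 (e ` {i. U i \<noteq> UNIV}))"
  have d: "d > 0" "\<And>i. U i \<noteq> UNIV \<Longrightarrow> d \<le> e i"
    unfolding d_def using U(1) e(1) by auto
  show thesis
  proof (rule that[OF d(1)])
    fix w' assume w': "w' \<in> topspace (Euclidean_space m)" "\<And>j. j < m \<Longrightarrow> \<bar>w' j - w j\<bar> < d"
    have "w' i \<in> U i" for i
    proof (cases "U i = UNIV")
      case False
      have "\<bar>w' i - w i\<bar> < d"
        using w' d(1) openin_Euclidean_space_subset[OF assms] by (cases "i < m") (auto simp: topspace_Euclidean_space)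
      then show ?thesis using d(2)[OF False] e(2) by force
    qed auto
    then have "w' \<in> T" using U(4) by auto
    then show "w' \<in> W" using T(2) w'(1) by (auto simp: topspace_Euclidean_space)
  qed
qed

text \<open>The point \<open>w\<close> is moved to \<open>w'\<close> one coordinate at a time. On
  each edge the mean value inequality applies, and near \<open>w\<close> the partial derivatives
  differ from their values at \<open>w\<close> by at most \<open>e\<close>.\<close>

lemma C1_linear_approximation:
  fixes f :: "(nat \<Rightarrow> real) \<Rightarrow> 'b::real_normed_vector"
  assumes W: "openin (Euclidean_space m) W" "w \<in> W"
    and D: "\<And>j y. j < m \<Longrightarrow> y \<in> W \<Longrightarrow> ((\<lambda>s. f (y(j := s))) has_vector_derivative D j y) (at (y j))"
    and cont: "\<And>j. j < m \<Longrightarrow> continuous_map (subtopology (Euclidean_space m) W) euclidean (D j)"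
    and e: "e > 0"
  obtains d where "d > 0"
    "\<And>w'. w' \<in> topspace (Euclidean_space m) \<Longrightarrow> (\<And>j. j < m \<Longrightarrow> \<bar>w' j - w j\<bar> < d) \<Longrightarrow>
       norm (f w' - f w - (\<Sum>j<m. (w' j - w j) *\<^sub>R D j w)) \<le> e * (\<Sum>j<m. \<bar>w' j - w j\<bar>)"
proof -
  have Wsub: "W \<subseteq> topspace (Euclidean_space m)"
    using W(1) by (rule openin_subset)
  define N where "N = W \<inter> \<Inter>((\<lambda>j. {y \<in> W. D j y \<in> ball (D j w) e}) ` {..<m})"
  have "openin (Euclidean_space m) {y \<in> W. D j y \<in> ball (D j w) e}" if "j < m" for j
  proof -
    have "openin (subtopology (Euclidean_space m) W) {y \<in> topspace (subtopology (Euclidean_space m) W). D j y \<in> ball (D j w) e}"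
      by (rule openin_continuous_map_preimage[OF cont[OF that]]) simp
    moreover have "topspace (subtopology (Euclidean_space m) W) = W"
      using Wsub by auto
    ultimately show ?thesis
      using W(1) openin_trans_full by metis
  qed
  then have "openin (Euclidean_space m) N"
    unfolding N_def by (cases "m = 0") (use W(1) in \<open>auto intro!: openin_Int openin_Inter\<close>)
  moreover have "w \<in> N"
    using W(2) e by (auto simp: N_def)
  ultimately obtain d where d: "d > 0"
    "\<And>w'. w' \<in> topspace (Euclidean_space m) \<Longrightarrow> (\<And>j. j < m \<Longrightarrow> \<bar>w' j - w j\<bar> < d) \<Longrightarrow> w' \<in> N"
    using Euclidean_open_contains_cube by blast
  show thesis
  proof (rule that[OF d(1)])
    fix w' assume w': "w' \<in> topspace (Euclidean_space m)" "\<And>j. j < m \<Longrightarrow> \<bar>w' j - w j\<bar> < d"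
    \<comment> \<open>The corners of the polygonal path: \<open>h l\<close> has already taken over
      the first \<open>l\<close> coordinates of \<open>w'\<close>.\<close>
    define h where "h l = (\<lambda>j. if j < l then w' j else w j)" for l
    have z: "w j = 0" "w' j = 0" if "j \<ge> m" for j
      using openin_Euclidean_space_subset[OF W that] w'(1) that by (auto simp: topspace_Euclidean_space)
    have h0: "h 0 = w" by (simp add: h_def)
    have hm: "h m = w'" using z by (auto simp: h_def fun_eq_iff)
    have step: "norm (f (h (Suc l)) - f (h l) - (w' l - w l) *\<^sub>R D l w) \<le> e * \<bar>w' l - w l\<bar>" if l: "l < m" for l
    proof -
      have mem: "(h l)(l := s) \<in> N" if "s \<in> closed_segment (w l) (w' l)" for s
      proof (rule d(2))
        show "(h l)(l := s) \<in> topspace (Euclidean_space m)"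
          using z l by (auto simp: h_def topspace_Euclidean_space)
        have "\<bar>s - w l\<bar> \<le> \<bar>w' l - w l\<bar>"
          using that by (auto simp: closed_segment_eq_real_ivl split: if_splits)
        then show "\<bar>((h l)(l := s)) j - w j\<bar> < d" if "j < m" for j
          using w'(2)[OF that] w'(2)[OF l] d(1) by (auto simp: h_def)
      qed
      \<comment> \<open>Subtracting the linear part makes the derivative the difference of two
        partial derivatives, which is at most \<open>e\<close> in norm on the edge.\<close>
      define g where "g s = f ((h l)(l := s)) - s *\<^sub>R D l w" for s
      have "norm (g (w' l) - g (w l)) \<le> e * norm (w' l - w l)"
      proof (rule differentiable_bound[of "closed_segment (w l) (w' l)" g "\<lambda>s u. u *\<^sub>R (D l ((h l)(l := s)) - D l w)"])
        fix s assume s: "s \<in> closed_segment (w l) (w' l)"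
        have "((\<lambda>s'. f (((h l)(l := s))(l := s'))) has_vector_derivative D l ((h l)(l := s))) (at (((h l)(l := s)) l))"
          using mem[OF s] by (intro D[OF l]) (auto simp: N_def)
        then have "((\<lambda>s'. f ((h l)(l := s'))) has_vector_derivative D l ((h l)(l := s))) (at s)"
          by simp
        then have "(g has_vector_derivative D l ((h l)(l := s)) - D l w) (at s)"
          unfolding g_def by (auto intro!: derivative_eq_intros)
        then show "(g has_derivative (\<lambda>u. u *\<^sub>R (D l ((h l)(l := s)) - D l w))) (at s within closed_segment (w l) (w' l))"
          unfolding has_vector_derivative_def by (rule has_derivative_at_withinI)
        have "norm (D l ((h l)(l := s)) - D l w) \<le> e"
          using mem[OF s] l by (auto simp: N_def dist_norm norm_minus_commute less_imp_le)
        then show "onorm (\<lambda>u. u *\<^sub>R (D l ((h l)(l := s)) - D l w)) \<le> e"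
          by (intro onorm_le) (simp, subst mult.commute, simp add: mult_right_mono)
      qed auto
      moreover have "h (Suc l) = (h l)(l := w' l)" "h l = (h l)(l := w l)"
        by (auto simp: h_def fun_eq_iff less_Suc_eq)
      ultimately show ?thesis
        by (simp add: g_def algebra_simps)
    qed
    have "f w' - f w = (\<Sum>l<m. f (h (Suc l)) - f (h l))"
      using sum_lessThan_telescope[of "\<lambda>l. f (h l)" m] h0 hm by simp
    then have "f w' - f w - (\<Sum>j<m. (w' j - w j) *\<^sub>R D j w) =
        (\<Sum>l<m. f (h (Suc l)) - f (h l) - (w' l - w l) *\<^sub>R D l w)"
      by (simp add: sum_subtractf)
    also have "norm \<dots> \<le> (\<Sum>l<m. e * \<bar>w' l - w l\<bar>)"
      by (rule sum_norm_le) (use step in auto)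
    finally show "norm (f w' - f w - (\<Sum>j<m. (w' j - w j) *\<^sub>R D j w)) \<le> e * (\<Sum>j<m. \<bar>w' j - w j\<bar>)"
      by (simp add: sum_distrib_left)
  qed
qed

text \<open>Continuous partial derivatives give total differentiability, with an error of order
  \<open>e\<close> times the displacement. A differentiable curve has displacement at most a
  constant times \<open>s - s0\<close>, so the remainder \<open>R\<close> is of smaller order than
  \<open>s - s0\<close>.\<close>

lemma has_vector_derivative_along_curve:
  fixes f :: "(nat \<Rightarrow> real) \<Rightarrow> 'b::real_normed_vector"
  assumes W: "openin (Euclidean_space m) W" "c s0 \<in> W"
    and D: "\<And>j y. j < m \<Longrightarrow> y \<in> W \<Longrightarrow> ((\<lambda>s. f (y(j := s))) has_vector_derivative D j y) (at (y j))"
    and cont: "\<And>j. j < m \<Longrightarrow> continuous_map (subtopology (Euclidean_space m) W) euclidean (D j)"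
    and c: "\<forall>\<^sub>F s in nhds s0. c s \<in> topspace (Euclidean_space m)"
    and c': "\<And>j. j < m \<Longrightarrow> ((\<lambda>s. c s j) has_vector_derivative c' j) (at s0)"
  shows "((\<lambda>s. f (c s)) has_vector_derivative (\<Sum>j<m. c' j *\<^sub>R D j (c s0))) (at s0)"
proof -
  define R where "R s = f (c s) - f (c s0) - (\<Sum>j<m. (c s j - c s0 j) *\<^sub>R D j (c s0))" for s
  define K where "K = (\<Sum>j<m. \<bar>c' j\<bar> + 1)"
  have K: "K \<ge> 0" unfolding K_def by (intro sum_nonneg) auto
  \<comment> \<open>The difference quotient is eventually within 1 of its limit; this is the origin
    of the constant \<open>\<bar>c' j\<bar> + 1\<close>.\<close>
  have lip: "\<forall>\<^sub>F s in at s0. \<bar>c s j - c s0 j\<bar> \<le> (\<bar>c' j\<bar> + 1) * \<bar>s - s0\<bar>" if "j < m" for j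
  proof -
    have "((\<lambda>s. (c s j - c s0 j) / (s - s0)) \<longlongrightarrow> c' j) (at s0)"
      using c'[OF that] by (simp add: has_real_derivative_iff_has_vector_derivative[symmetric] has_field_derivative_iff)
    then have "\<forall>\<^sub>F s in at s0. dist ((c s j - c s0 j) / (s - s0)) (c' j) < 1"
      by (rule tendstoD) simp
    moreover have "\<forall>\<^sub>F s in at s0. s \<noteq> s0"
      by (simp add: eventually_at_filter)
    ultimately show ?thesis
    proof eventually_elim
      case (elim s)
      then have "\<bar>(c s j - c s0 j) / (s - s0)\<bar> \<le> \<bar>c' j\<bar> + 1"
        unfolding dist_real_def by linarith
      with elim show ?case
        by (simp add: abs_divide divide_le_eq)
    qed
  qed
  then have lipall: "\<forall>\<^sub>F s in at s0. \<forall>j\<in>{..<m}. \<bar>c s j - c s0 j\<bar> \<le> (\<bar>c' j\<bar> + 1) * \<bar>s - s0\<bar>"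
    by (intro eventually_ball_finite) auto
  have cc: "\<forall>\<^sub>F s in at s0. \<forall>j\<in>{..<m}. \<bar>c s j - c s0 j\<bar> < d" if "d > 0" for d
  proof (intro eventually_ball_finite ballI)
    fix j assume "j \<in> {..<m}"
    then have "isCont (\<lambda>s. c s j) s0"
      using c' has_vector_derivative_continuous by fastforce
    then show "\<forall>\<^sub>F s in at s0. \<bar>c s j - c s0 j\<bar> < d"
      using that by (auto simp: isCont_def dest!: tendstoD simp: dist_real_def)
  qed auto
  have "((\<lambda>s. (1 / norm (s - s0)) *\<^sub>R R s) \<longlongrightarrow> 0) (at s0)"
  proof (rule tendstoI)
    fix e :: real assume "e > 0"
    \<comment> \<open>Dividing by \<open>K + 1\<close> covers \<open>m = 0\<close>, where
      \<open>K = 0\<close>, and makes the final bound strict.\<close>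
    define e1 where "e1 = e / (K + 1)"
    have e1: "e1 > 0" using \<open>e > 0\<close> K by (simp add: e1_def)
    obtain d where d: "d > 0"
      "\<And>w'. w' \<in> topspace (Euclidean_space m) \<Longrightarrow> (\<And>j. j < m \<Longrightarrow> \<bar>w' j - c s0 j\<bar> < d) \<Longrightarrow>
       norm (f w' - f (c s0) - (\<Sum>j<m. (w' j - c s0 j) *\<^sub>R D j (c s0))) \<le> e1 * (\<Sum>j<m. \<bar>w' j - c s0 j\<bar>)"
      using C1_linear_approximation[OF W D cont e1] by blast
    have "\<forall>\<^sub>F s in at s0. c s \<in> topspace (Euclidean_space m)"
      using c by (auto simp: eventually_nhds_conv_at)
    moreover have "\<forall>\<^sub>F s in at s0. s \<noteq> s0"
      by (simp add: eventually_at_filter)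
    ultimately show "\<forall>\<^sub>F s in at s0. dist ((1 / norm (s - s0)) *\<^sub>R R s) 0 < e"
      using cc[OF d(1)] lipall
    proof eventually_elim
      case (elim s)
      have "norm (R s) \<le> e1 * (\<Sum>j<m. \<bar>c s j - c s0 j\<bar>)"
        unfolding R_def using elim by (intro d(2)) auto
      also have "\<dots> \<le> e1 * (\<Sum>j<m. (\<bar>c' j\<bar> + 1) * \<bar>s - s0\<bar>)"
        using elim e1 by (intro mult_left_mono sum_mono) auto
      also have "\<dots> = (e1 * K) * \<bar>s - s0\<bar>"
        by (simp only: K_def sum_distrib_right mult.assoc)
      finally have "norm (R s) / \<bar>s - s0\<bar> \<le> e1 * K"
        using elim by (simp add: divide_le_eq)
      also have "\<dots> < e"
        using \<open>e > 0\<close> K by (simp add: e1_def field_simps)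
      finally show ?case by simp
    qed
  qed
  moreover have "R s0 = 0" by (simp add: R_def)
  ultimately have "(R has_vector_derivative 0) (at s0)"
    unfolding has_vector_derivative_def has_derivative_iff_norm
    by (auto simp: bounded_linear_zero dest: tendsto_norm_zero)
  moreover have "((\<lambda>s. f (c s0) + (\<Sum>j<m. (c s j - c s0 j) *\<^sub>R D j (c s0))) has_vector_derivative (\<Sum>j<m. c' j *\<^sub>R D j (c s0))) (at s0)"
  proof -
    have "((\<lambda>s. (c s j - c s0 j) *\<^sub>R D j (c s0)) has_vector_derivative c' j *\<^sub>R D j (c s0)) (at s0)" if "j < m" for j
    proof -
      have "((\<lambda>s. c s j - c s0 j) has_vector_derivative c' j) (at s0)"
        using c'[OF that] by (auto intro!: derivative_eq_intros)
      from bounded_linear.has_vector_derivative[OF bounded_linear_scaleR_left this] show ?thesis .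
    qed
    then have "((\<lambda>s. (\<Sum>j<m. (c s j - c s0 j) *\<^sub>R D j (c s0))) has_vector_derivative (\<Sum>j<m. c' j *\<^sub>R D j (c s0))) (at s0)"
      by (intro has_vector_derivative_sum) auto
    from has_vector_derivative_add[OF has_vector_derivative_const[of "f (c s0)"] this] show ?thesis
      by simp
  qed
  ultimately have "((\<lambda>s. R s + (f (c s0) + (\<Sum>j<m. (c s j - c s0 j) *\<^sub>R D j (c s0)))) has_vector_derivative (0 + (\<Sum>j<m. c' j *\<^sub>R D j (c s0)))) (at s0)"
    by (rule has_vector_derivative_add)
  then show ?thesis
    by (simp add: R_def)
qed

text \<open>The chain rule yields products of derivatives of \<open>G\<close> with derivatives of
  \<open>F\<close> taken along \<open>G\<close>, and the latter have the original form at one order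
  less. The outer function depends on the parameter too, since functions that vary with
  \<open>x\<close> have to be read in other charts.\<close>

lemma Ck_family_compose:
  assumes V: "openin (Euclidean_space n) V" and W: "openin (Euclidean_space m) W"
    and "Ck_family k X m W F" and "\<And>j. j < m \<Longrightarrow> Ck_family k X n V (\<lambda>x y. G x y j)"
    and GW: "\<And>x y. x \<in> topspace X \<Longrightarrow> y \<in> V \<Longrightarrow> G x y \<in> W"
  shows "Ck_family k X n V (\<lambda>x y. F x (G x y))"
  using assms(3,4)
proof (induction k arbitrary: F)
  have *: "continuous_map (prod_topology X (subtopology (Euclidean_space n) V)) euclidean (\<lambda>(x, y). F x (G x y))"
    if F: "Ck_family k X m W F" and G: "\<And>j. j < m \<Longrightarrow> Ck_family k X n V (\<lambda>x y. G x y j)" for k F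
  proof -
    have "continuous_map (prod_topology X (subtopology (Euclidean_space n) V))
        (prod_topology X (subtopology (Euclidean_space m) W)) (\<lambda>z. (fst z, G (fst z) (snd z)))"
      using G[THEN Ck_family_continuous] GW openin_subset[OF W]
      by (intro continuous_map_pairedI continuous_map_into_Euclidean_subspace continuous_map_fst)
         (auto simp: case_prod_unfold)
    from continuous_map_compose[OF this Ck_family_continuous[OF F]] show ?thesis
      by (simp add: o_def case_prod_unfold)
  qed
  {
    case 0
    then show ?case using *[of 0] by simp
  next
    case (Suc k)
    show ?case
    proof (rule Ck_family_SucI[OF V *[OF Suc.prems]])
      fix i assume i: "i < n"
      show "Ck_family k X n V (\<lambda>x y. \<Sum>j<m. partial_deriv i (\<lambda>y. G x y j) y *\<^sub>R partial_deriv j (F x) (G x y))"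
      proof (intro Ck_family_sum[OF V] Ck_family_bounded_bilinear[OF V bounded_bilinear_scaleR])
        fix j assume "j \<in> {..<m}"
        then have j: "j < m" by simp
        show "Ck_family k X n V (\<lambda>x. partial_deriv i (\<lambda>y. G x y j))"
          by (rule Ck_family_SucD(1)[OF Suc.prems(2)[OF j] i])
        show "Ck_family k X n V (\<lambda>x y. partial_deriv j (F x) (G x y))"
          by (rule Suc.IH[OF Ck_family_SucD(1)[OF Suc.prems(1) j] Ck_family_mono[OF Suc.prems(2)]])
      qed auto
      fix x y assume x: "x \<in> topspace X" and y: "y \<in> V"
      have pt: "continuous_map (discrete_topology {()}) X (\<lambda>_. x)"
        using x by simp
      show "((\<lambda>s. F x (G x (y(i := s)))) has_vector_derivative
          (\<Sum>j<m. partial_deriv i (\<lambda>y. G x y j) y *\<^sub>R partial_deriv j (F x) (G x y))) (at (y i))"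
      proof (rule has_vector_derivative_along_curve[OF W, where c = "\<lambda>s. G x (y(i := s))" and ?s0.0 = "y i", simplified])
        show "G x y \<in> W" using GW x y by auto
        show "((\<lambda>s. F x (w(j := s))) has_vector_derivative partial_deriv j (F x) w) (at (w j))"
          if "j < m" "w \<in> W" for j w
          using Ck_family_SucD(2)[OF Suc.prems(1) that(1) x that(2)] .
        show "continuous_map (subtopology (Euclidean_space m) W) euclidean (partial_deriv j (F x))" if "j < m" for j
        proof -
          have "continuous_map (subtopology (Euclidean_space m) W)
              (prod_topology X (subtopology (Euclidean_space m) W)) (\<lambda>w. (x, w))"
            using x by (intro continuous_map_pairedI) auto
          from continuous_map_compose[OF this Ck_family_continuous[OF Ck_family_SucD(1)[OF Suc.prems(1) that]]]
          show ?thesis by (simp add: o_def)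
        qed
        show "\<forall>\<^sub>F s in nhds (y i). G x (y(i := s)) \<in> topspace (Euclidean_space m)"
          using eventually_slice_in_open[OF V y i]
          by eventually_elim (use GW[OF x] openin_subset[OF W] in blast)
        show "((\<lambda>s. G x (y(i := s)) j) has_vector_derivative partial_deriv i (\<lambda>y. G x y j) y) (at (y i))" if "j < m" for j
          using Ck_family_SucD(2)[OF Suc.prems(2)[OF that] i x y] .
      qed
    qed
  }
qed

section \<open>Comparison with iterated partial derivatives\<close>

lemma iter_partial_Nil: "iter_partial [] f = f"
  by (simp add: iter_partial_def)

lemma iter_partial_snoc: "iter_partial (is @ [i]) f = iter_partial is (partial_deriv i f)"
  by (simp add: iter_partial_def)

lemma smooth_family_partial:
  assumes "smooth_family X n V F" "i < n"
  shows "smooth_family X n V (\<lambda>x. partial_deriv i (F x))"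
  using assms Ck_family_SucD(1)[of _ X n V F i] by (auto simp: smooth_family_def)

text \<open>\<open>iter_partial\<close> applies the last entry of the list before the others, and
  \<open>Ck_family\<close> also strips off the derivative taken first. Hence the lists are taken
  apart at their end.\<close>

lemma smooth_family_iff:
  "smooth_family X n V F \<longleftrightarrow>
     (\<forall>is\<in>lists {..<n}.
        continuous_map (prod_topology X (subtopology (Euclidean_space n) V)) euclidean
          (\<lambda>(x, y). iter_partial is (F x) y) \<and>
        (\<forall>i<n. \<forall>x\<in>topspace X. \<forall>y\<in>V. (\<lambda>s. iter_partial is (F x) (y(i := s))) differentiable (at (y i))))"
  (is "_ \<longleftrightarrow> (\<forall>is\<in>lists {..<n}. ?P is F)")
proof
  have "?P is F" if "is \<in> lists {..<n}" "smooth_family X n V F" for "is" F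
    using that
  proof (induction "is" arbitrary: F rule: rev_induct)
    case Nil
    then have "Ck_family (Suc 0) X n V F"
      by (simp add: smooth_family_def del: Ck_family.simps)
    then show ?case
      unfolding iter_partial_Nil Ck_family.simps by blast
  next
    case (snoc i "is")
    then have "is \<in> lists {..<n}" "i < n" by auto
    then show ?case
      unfolding iter_partial_snoc using snoc.prems(2) by (intro snoc.IH smooth_family_partial)
  qed
  then show "smooth_family X n V F \<Longrightarrow> \<forall>is\<in>lists {..<n}. ?P is F"
    by blast
next
  assume "\<forall>is\<in>lists {..<n}. ?P is F"
  then have "Ck_family k X n V F" for k
  proof (induction k arbitrary: F)
    case 0
    from this[rule_format, of "[]"] show ?case by (simp add: iter_partial_Nil)
  next
    case (Suc k)
    have "Ck_family k X n V (\<lambda>x. partial_deriv i (F x))" if "i < n" for i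
    proof (rule Suc.IH, rule)
      fix "is" assume "is \<in> lists {..<n}"
      then have "is @ [i] \<in> lists {..<n}" using that by simp
      from Suc.prems[rule_format, OF this] show "?P is (\<lambda>x. partial_deriv i (F x))"
        unfolding iter_partial_snoc by blast
    qed
    moreover have "?P [] F"
      by (rule Suc.prems[rule_format]) simp
    ultimately show ?case
      unfolding iter_partial_Nil Ck_family.simps by blast
  qed
  then show "smooth_family X n V F"
    by (simp add: smooth_family_def)
qed

text \<open>A one-point parameter space makes single functions a special case, so all closure
  properties of families apply to them.\<close>

lemma smooth_fun_iff_family: "smooth_fun n V f \<longleftrightarrow> smooth_family (discrete_topology {()}) n V (\<lambda>_. f)"
proof -
  have "continuous_map (prod_topology (discrete_topology {()}) Y) euclidean (\<lambda>(x, y). g y) \<longleftrightarrow> continuous_map Y euclidean g"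
    (is "?L \<longleftrightarrow> ?R") for Y :: "(nat \<Rightarrow> real) topology" and g :: "(nat \<Rightarrow> real) \<Rightarrow> 'a"
  proof
    assume ?L
    moreover have "continuous_map Y (prod_topology (discrete_topology {()}) Y) (\<lambda>y. ((), y))"
      by (intro continuous_map_pairedI) auto
    ultimately have "continuous_map Y euclidean ((\<lambda>(x, y). g y) \<circ> (\<lambda>y. ((), y)))"
      by (rule continuous_map_compose[rotated])
    then show ?R
      by (simp add: o_def)
  next
    assume ?R
    from continuous_map_compose[OF continuous_map_snd this] show ?L
      by (simp add: o_def case_prod_unfold)
  qed
  then show ?thesis
    by (simp add: smooth_family_iff smooth_fun_def)
qed

lemma smooth_fun_imp_family: "smooth_fun n V f \<Longrightarrow> smooth_family X n V (\<lambda>_. f)"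
  unfolding smooth_fun_iff_family smooth_family_def
  using Ck_family_reparam[where r = "\<lambda>_. ()" and F = "\<lambda>_. f" and X = "discrete_topology {()}" and X' = X and n = n and V = V and V' = V]
  by simp

lemma smooth_family_reparam:
  "smooth_family X n V F \<Longrightarrow> continuous_map X' X r \<Longrightarrow> V' \<subseteq> V \<Longrightarrow> smooth_family X' n V' (\<lambda>x. F (r x))"
  by (simp add: smooth_family_def Ck_family_reparam)

lemma smooth_family_subset: "smooth_family X n V F \<Longrightarrow> V' \<subseteq> V \<Longrightarrow> smooth_family X n V' F"
  using smooth_family_reparam[of X n V F X id] by (simp add: o_def)

lemma smooth_family_cong:
  assumes "openin (Euclidean_space n) V" "\<And>x y. x \<in> topspace X \<Longrightarrow> y \<in> V \<Longrightarrow> F x y = G x y"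
    and "smooth_family X n V F"
  shows "smooth_family X n V G"
  using Ck_family_cong[OF assms(1), of X F G] assms(2,3) by (simp add: smooth_family_def)

lemma smooth_family_local:
  assumes "\<And>y. y \<in> V \<Longrightarrow> \<exists>V0. openin (Euclidean_space n) V0 \<and> y \<in> V0 \<and> smooth_family X n V0 F"
  shows "smooth_family X n V F"
  unfolding smooth_family_def
proof
  fix k
  show "Ck_family k X n V F"
    by (rule Ck_family_local) (use assms in \<open>auto simp: smooth_family_def\<close>)
qed

lemma smooth_family_parameter:
  "openin (Euclidean_space n) V \<Longrightarrow> continuous_map X euclidean c \<Longrightarrow> smooth_family X n V (\<lambda>x y. c x)"
  by (simp add: smooth_family_def Ck_family_parameter)

lemma smooth_family_coordinate: "openin (Euclidean_space n) V \<Longrightarrow> smooth_family X n V (\<lambda>x y. y j)"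
  by (simp add: smooth_family_def Ck_family_coordinate)

lemma smooth_family_add:
  "openin (Euclidean_space n) V \<Longrightarrow> smooth_family X n V F \<Longrightarrow> smooth_family X n V G \<Longrightarrow>
     smooth_family X n V (\<lambda>x y. F x y + G x y)"
  by (simp add: smooth_family_def Ck_family_add)

lemma smooth_family_mult:
  fixes F G :: "'x \<Rightarrow> (nat \<Rightarrow> real) \<Rightarrow> 'b::real_normed_algebra"
  shows "openin (Euclidean_space n) V \<Longrightarrow> smooth_family X n V F \<Longrightarrow> smooth_family X n V G \<Longrightarrow>
     smooth_family X n V (\<lambda>x y. F x y * G x y)"
  by (simp add: smooth_family_def Ck_family_bounded_bilinear bounded_bilinear_mult)

lemma smooth_family_bounded_linear:
  "openin (Euclidean_space n) V \<Longrightarrow> bounded_linear L \<Longrightarrow> smooth_family X n V F \<Longrightarrow>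
     smooth_family X n V (\<lambda>x y. L (F x y))"
  by (simp add: smooth_family_def Ck_family_bounded_linear)

lemma smooth_family_inverse:
  fixes F :: "'x \<Rightarrow> (nat \<Rightarrow> real) \<Rightarrow> 'b::real_normed_field"
  assumes "openin (Euclidean_space n) V" "smooth_family X n V F"
    and "\<And>x y. x \<in> topspace X \<Longrightarrow> y \<in> V \<Longrightarrow> F x y \<noteq> 0"
  shows "smooth_family X n V (\<lambda>x y. inverse (F x y))"
  using assms by (simp add: smooth_family_def Ck_family_inverse)

lemma smooth_family_compose:
  assumes "openin (Euclidean_space n) V" "openin (Euclidean_space m) W"
    and "smooth_family X m W F" and "\<And>j. j < m \<Longrightarrow> smooth_family X n V (\<lambda>x y. G x y j)"
    and "\<And>x y. x \<in> topspace X \<Longrightarrow> y \<in> V \<Longrightarrow> G x y \<in> W"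
  shows "smooth_family X n V (\<lambda>x y. F x (G x y))"
  unfolding smooth_family_def
  by (rule allI, rule Ck_family_compose[OF assms(1,2)]) (use assms in \<open>auto simp: smooth_family_def\<close>)

section \<open>A smooth function that vanishes exactly on the negative reals\<close>

definition flat_exp :: "real \<Rightarrow> real" where
  "flat_exp x = (if 0 < x then exp (- inverse x) else 0)"

lemma flat_exp_pos_iff [simp]: "0 < flat_exp x \<longleftrightarrow> 0 < x"
  and flat_exp_nonneg [simp]: "0 \<le> flat_exp x"
  and flat_exp_eq_0_iff [simp]: "flat_exp x = 0 \<longleftrightarrow> x \<le> 0"
  by (auto simp: flat_exp_def)

text \<open>All derivatives of \<^const>\<open>flat_exp\<close> have this form.\<close>

definition flat_poly :: "real poly \<Rightarrow> real \<Rightarrow> real" where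
  "flat_poly p x = (if 0 < x then poly p (inverse x) * exp (- inverse x) else 0)"

lemma poly_mult_exp_tendsto_0: "((\<lambda>u::real. u ^ k * poly p u * exp (- u)) \<longlongrightarrow> 0) at_top"
proof (induction p arbitrary: k)
  case 0
  then show ?case by simp
next
  case (pCons a p)
  have "((\<lambda>u. a * (u ^ k / exp u) + u ^ Suc k * poly p u * exp (- u)) \<longlongrightarrow> a * 0 + 0) at_top"
    by (intro tendsto_intros tendsto_power_div_exp_0 pCons.IH)
  moreover have "(\<lambda>u. a * (u ^ k / exp u) + u ^ Suc k * poly p u * exp (- u)) =
      (\<lambda>u. u ^ k * poly (pCons a p) u * exp (- u))"
    by (auto simp: fun_eq_iff exp_minus field_simps)
  ultimately show ?case by simp
qed

text \<open>With \<open>u = 1 / x\<close> the derivative of \<open>u\<close> is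
  \<open>- u^2\<close>, so that of \<open>p(u) exp(- u)\<close> is
  \<open>u^2 (p(u) - p'(u)) exp(- u)\<close>; this is the polynomial shown. At 0 the right
  difference quotient is \<open>u p(u) exp(- u)\<close> for \<open>u\<close> tending to
  infinity.\<close>

lemma flat_poly_deriv:
  "(flat_poly p has_real_derivative flat_poly ([:0, 0, 1:] * (p - pderiv p)) x) (at x)"
proof -
  consider "x > 0" | "x < 0" | "x = 0" by linarith
  then show ?thesis
  proof cases
    case 1
    have "((\<lambda>x. poly p (inverse x) * exp (- inverse x)) has_real_derivative
        flat_poly ([:0, 0, 1:] * (p - pderiv p)) x) (at x)"
      using 1 by (auto intro!: derivative_eq_intros simp: flat_poly_def power2_eq_square algebra_simps)
    then show ?thesis
      by (rule has_field_derivative_transform_within_open[where S = "{0<..}"]) (use 1 in \<open>auto simp: flat_poly_def\<close>)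
  next
    case 2
    have "((\<lambda>x. 0) has_real_derivative flat_poly ([:0, 0, 1:] * (p - pderiv p)) x) (at x)"
      using 2 by (auto simp: flat_poly_def)
    then show ?thesis
      by (rule has_field_derivative_transform_within_open[where S = "{..<0}"]) (use 2 in \<open>auto simp: flat_poly_def\<close>)
  next
    case 3
    have "((\<lambda>h. inverse h ^ 1 * poly p (inverse h) * exp (- inverse h)) \<longlongrightarrow> 0) (at_right (0::real))"
      using filterlim_compose[OF poly_mult_exp_tendsto_0 filterlim_inverse_at_top_right] .
    moreover have "\<forall>\<^sub>F h in at_right (0::real). inverse h ^ 1 * poly p (inverse h) * exp (- inverse h) = flat_poly p h / h"
      by (auto simp: eventually_at_filter flat_poly_def field_simps)
    ultimately have "((\<lambda>h. flat_poly p h / h) \<longlongrightarrow> 0) (at_right 0)"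
      using tendsto_cong by force
    moreover have "((\<lambda>h. flat_poly p h / h) \<longlongrightarrow> 0) (at_left 0)"
      by (rule tendsto_eventually) (auto simp: eventually_at_filter flat_poly_def)
    ultimately have "((\<lambda>h. flat_poly p h / h) \<longlongrightarrow> 0) (at 0)"
      by (simp add: filterlim_split_at)
    then show ?thesis
      using 3 by (simp add: has_field_derivative_iff flat_poly_def)
  qed
qed

lemma smooth_family_flat_exp:
  assumes "openin (Euclidean_space n) V" "smooth_family X n V F"
  shows "smooth_family X n V (\<lambda>x y. flat_exp (F x y))"
proof -
  \<comment> \<open>\<open>H j\<close> is the j-th derivative of \<open>flat_exp\<close>, obtained
    from the polynomial 1 by iterating the step of \<open>flat_poly_deriv\<close>.\<close>
  define H where "H j = flat_poly (((\<lambda>p. [:0, 0, 1:] * (p - pderiv p)) ^^ j) 1)" for j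
  have H: "(H j has_real_derivative H (Suc j) u) (at u)" for j u
    using flat_poly_deriv by (simp add: H_def)
  have "flat_exp = H 0"
    by (auto simp: H_def flat_exp_def flat_poly_def fun_eq_iff)
  then show ?thesis
    using assms Ck_family_real_compose[where H = H, OF assms(1) _ H, of _ X F 0] by (simp add: smooth_family_def)
qed

section \<open>Function spaces and the exponential law\<close>

text \<open>By the tube lemma. This half of the exponential law turns a jointly continuous map into
  a continuous map to a function space with a compact-open topology.\<close>

lemma openin_compact_tube:
  assumes F: "continuous_map (prod_topology X Y) Z (\<lambda>(x, y). F x y)"
    and K: "compactin Y K" and V: "openin Z V"
  shows "openin X {x \<in> topspace X. \<forall>y\<in>K. F x y \<in> V}"
proof (subst openin_subopen, intro ballI)
  fix x assume x: "x \<in> {x \<in> topspace X. \<forall>y\<in>K. F x y \<in> V}"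
  let ?W = "{z \<in> topspace (prod_topology X Y). (case z of (x, y) \<Rightarrow> F x y) \<in> V}"
  have W: "openin (prod_topology X Y) ?W"
    by (rule openin_continuous_map_preimage[OF F V])
  have sub: "{x} \<times> K \<subseteq> ?W" and xX: "x \<in> topspace X"
    using x compactin_subset_topspace[OF K] by auto
  obtain U V' where U: "openin X U" "x \<in> U" "K \<subseteq> V'" "U \<times> V' \<subseteq> ?W"
    using tube_lemma_right[OF W K xX sub] by auto
  have "F a y \<in> V" if "a \<in> U" "y \<in> K" for a y
    using subsetD[OF U(4), of "(a, y)"] that U(3) by auto
  then show "\<exists>T. openin X T \<and> x \<in> T \<and> T \<subseteq> {x \<in> topspace X. \<forall>y\<in>K. F x y \<in> V}"
    using U openin_subset[OF U(1)] by (intro exI[of _ U]) auto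
qed

text \<open>The other half of the exponential law, where the points of \<open>Y\<close> must have
  compact neighbourhoods. \<open>D\<close> stands for a derivative of \<open>f\<close>, so the lemma
  serves every order of differentiation.\<close>

lemma continuous_map_evaluation:
  assumes D: "\<And>f. f \<in> topspace T \<Longrightarrow> continuous_map Y Z (D f)"
    and Y: "neighbourhood_base_of (compactin Y) Y"
    and T: "\<And>K V. compactin Y K \<Longrightarrow> openin Z V \<Longrightarrow> openin T {f \<in> topspace T. D f ` K \<subseteq> V}"
  shows "continuous_map (prod_topology T Y) Z (\<lambda>(f, y). D f y)"
  unfolding continuous_map_def
proof (intro conjI allI impI)
  show "(\<lambda>(f, y). D f y) \<in> topspace (prod_topology T Y) \<rightarrow> topspace Z"
    using D continuous_map_image_subset_topspace by fastforce
  fix V assume V: "openin Z V"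
  let ?P = "{z \<in> topspace (prod_topology T Y). (case z of (f, y) \<Rightarrow> D f y) \<in> V}"
  show "openin (prod_topology T Y) ?P"
  proof (subst openin_subopen, intro ballI)
    fix z assume z: "z \<in> ?P"
    then obtain f y where fy: "z = (f, y)" "f \<in> topspace T" "y \<in> topspace Y" "D f y \<in> V"
      by auto
    have "openin Y {y \<in> topspace Y. D f y \<in> V}"
      by (rule openin_continuous_map_preimage[OF D[OF fy(2)] V])
    then obtain U K where UK: "openin Y U" "compactin Y K" "y \<in> U" "U \<subseteq> K" "K \<subseteq> {y \<in> topspace Y. D f y \<in> V}"
      using Y fy unfolding neighbourhood_base_of by (metis (mono_tags, lifting) mem_Collect_eq)
    let ?N = "{f \<in> topspace T. D f ` K \<subseteq> V} \<times> U"
    have "openin (prod_topology T Y) ?N"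
      using T[OF UK(2) V] UK(1) by (simp add: openin_prod_Times_iff)
    moreover have "z \<in> ?N" "?N \<subseteq> ?P"
      using fy UK openin_subset[OF UK(1)] by (auto simp: image_subset_iff subset_iff)
    ultimately show "\<exists>N. openin (prod_topology T Y) N \<and> z \<in> N \<and> N \<subseteq> ?P"
      by blast
  qed
qed

text \<open>A product of quotient maps can fail to be a quotient map; open maps avoid this. Binary
  operations can then be pushed down to quotient algebras.\<close>

lemma quotient_map_prod_open:
  assumes f: "continuous_map X X' f" "open_map X X' f" "f ` topspace X = topspace X'"
    and g: "continuous_map Y Y' g" "open_map Y Y' g" "g ` topspace Y = topspace Y'"
  shows "quotient_map (prod_topology X Y) (prod_topology X' Y') (\<lambda>(x, y). (f x, g y))"
proof (rule continuous_open_imp_quotient_map)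
  show "continuous_map (prod_topology X Y) (prod_topology X' Y') (\<lambda>(x, y). (f x, g y))"
    using f(1) g(1) by (simp add: continuous_map_prod_top)
  show "open_map (prod_topology X Y) (prod_topology X' Y') (\<lambda>(x, y). (f x, g y))"
    unfolding open_map_def
  proof (intro allI impI)
    fix W assume W: "openin (prod_topology X Y) W"
    show "openin (prod_topology X' Y') ((\<lambda>(x, y). (f x, g y)) ` W)"
    proof (subst openin_subopen, intro ballI)
      fix z assume "z \<in> (\<lambda>(x, y). (f x, g y)) ` W"
      then obtain x y where xy: "(x, y) \<in> W" "z = (f x, g y)" by auto
      obtain U V where UV: "openin X U" "openin Y V" "x \<in> U" "y \<in> V" "U \<times> V \<subseteq> W"
        using W[unfolded openin_prod_topology_alt, rule_format, OF xy(1)] by auto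
      have "openin (prod_topology X' Y') ((f ` U) \<times> (g ` V))"
        using f(2) g(2) UV(1,2) by (simp add: openin_prod_Times_iff open_map_def)
      moreover have "z \<in> (f ` U) \<times> (g ` V)"
        using UV xy by simp
      moreover have "(f ` U) \<times> (g ` V) \<subseteq> (\<lambda>(x, y). (f x, g y)) ` W"
      proof clarify
        fix a b assume "a \<in> U" "b \<in> V"
        then have "(a, b) \<in> W" using UV(5) by blast
        then show "(f a, g b) \<in> (\<lambda>(x, y). (f x, g y)) ` W" by (rule rev_image_eqI) simp
      qed
      ultimately show "\<exists>T. openin (prod_topology X' Y') T \<and> z \<in> T \<and> T \<subseteq> (\<lambda>(x, y). (f x, g y)) ` W"
        by blast
    qed
  qed
  show "(\<lambda>(x, y). (f x, g y)) ` topspace (prod_topology X Y) = topspace (prod_topology X' Y')"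
    by (simp add: image_paired_Times f(3) g(3))
qed

section \<open>Locally convex algebras\<close>

lemma cring_complex_ring: "cring complex_ring"
proof -
  have "\<exists>y. y + x = 0" for x :: complex
    by (rule exI[of _ "- x"]) simp
  then show ?thesis
    by (intro cringI abelian_groupI comm_monoidI) (auto simp: complex_ring_def algebra_simps)
qed

lemma a_inv_complex_ring: "\<ominus>\<^bsub>complex_ring\<^esub> c = - c"
proof -
  interpret cring complex_ring by (rule cring_complex_ring)
  show ?thesis
    by (rule sum_zero_eq_neg[symmetric]) (auto simp: complex_ring_def)
qed

text \<open>Finite intersections of convex sets are convex, so the subbasis decides.\<close>

lemma locally_convex_generated:
  assumes "\<And>s. s \<in> S \<Longrightarrow> z \<in> s \<Longrightarrow> \<exists>V. openin (topology_generated_by S) V \<and> z \<in> V \<and> V \<subseteq> s \<and> convex_in A V"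
    and "openin (topology_generated_by S) U" "z \<in> U"
  shows "\<exists>V. openin (topology_generated_by S) V \<and> z \<in> V \<and> V \<subseteq> U \<and> convex_in A V"
  using openin_topology_generated_by[OF assms(2)] assms(3)
proof (induction)
  case (Int a b)
  then obtain V W where "openin (topology_generated_by S) V" "z \<in> V" "V \<subseteq> a" "convex_in A V"
    "openin (topology_generated_by S) W" "z \<in> W" "W \<subseteq> b" "convex_in A W"
    by blast
  then show ?case
    by (intro exI[of _ "V \<inter> W"]) (auto simp: convex_in_def)
next
  case (UN K)
  then show ?case by (meson Union_iff Union_upper order_trans)
qed (use assms(1) in auto)

locale lc_alg = ring A for A :: "'a lc_algebra" (structure) +
  assumes lc: "locally_convex_algebra A"
begin

lemma module: "Module.module complex_ring A"
  and topspace_eq [simp]: "topspace (lctop A) = carrier A"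
  and Hausdorff: "Hausdorff_space (lctop A)"
  using lc by (auto simp: locally_convex_algebra_def unital_algebra_def)

sublocale M: Module.module complex_ring A
  by (rule module)

lemma smult_in [simp]: "a \<in> carrier A \<Longrightarrow> c \<odot> a \<in> carrier A"
  using M.smult_closed[of c a] by (simp add: complex_ring_def)

lemma smult_add_left: "a \<in> carrier A \<Longrightarrow> (b + c) \<odot> a = b \<odot> a \<oplus> c \<odot> a"
  using M.smult_l_distr[of b c a] by (simp add: complex_ring_def)

lemma smult_add_right: "a \<in> carrier A \<Longrightarrow> b \<in> carrier A \<Longrightarrow> c \<odot> (a \<oplus> b) = c \<odot> a \<oplus> c \<odot> b"
  using M.smult_r_distr[of c a b] by (simp add: complex_ring_def)

lemma smult_smult: "a \<in> carrier A \<Longrightarrow> b \<odot> (c \<odot> a) = (b * c) \<odot> a"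
  using M.smult_assoc1[of b c a] by (simp add: complex_ring_def)

lemma smult_1 [simp]: "a \<in> carrier A \<Longrightarrow> 1 \<odot> a = a"
  using M.smult_one[of a] by (simp add: complex_ring_def)

lemma smult_0_left [simp]: "a \<in> carrier A \<Longrightarrow> 0 \<odot> a = \<zero>"
  using M.smult_l_null[of a] by (simp add: complex_ring_def)

lemma smult_0_right [simp]: "c \<odot> \<zero> = \<zero>"
  using M.smult_r_null[of c] by (simp add: complex_ring_def)

lemma smult_minus_left: "a \<in> carrier A \<Longrightarrow> (- c) \<odot> a = \<ominus> (c \<odot> a)"
  using M.smult_l_minus[of c a] by (simp add: a_inv_complex_ring) (simp add: complex_ring_def)

lemma smult_minus_1: "a \<in> carrier A \<Longrightarrow> (- 1) \<odot> a = \<ominus> a"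
  by (simp add: smult_minus_left)

lemma smult_diff_right: "a \<in> carrier A \<Longrightarrow> b \<in> carrier A \<Longrightarrow> c \<odot> (a \<ominus> b) = c \<odot> a \<ominus> c \<odot> b"
  by (simp add: minus_eq smult_add_right smult_minus_1[symmetric] smult_smult)

lemma smult_mult_left: "a \<in> carrier A \<Longrightarrow> b \<in> carrier A \<Longrightarrow> (c \<odot> a) \<otimes> b = c \<odot> (a \<otimes> b)"
  and smult_mult_right: "a \<in> carrier A \<Longrightarrow> b \<in> carrier A \<Longrightarrow> a \<otimes> (c \<odot> b) = c \<odot> (a \<otimes> b)"
  using lc unfolding locally_convex_algebra_def unital_algebra_def by metis+

lemma continuous_map_in_carrier: "continuous_map X (lctop A) f \<Longrightarrow> x \<in> topspace X \<Longrightarrow> f x \<in> carrier A"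
  using continuous_map_image_subset_topspace by fastforce

lemma add_cont: "continuous_map (prod_topology (lctop A) (lctop A)) (lctop A) (\<lambda>(a, b). a \<oplus> b)"
  and smult_cont: "continuous_map (prod_topology euclidean (lctop A)) (lctop A) (\<lambda>(c, a). c \<odot> a)"
  and mult_cont: "continuous_map (prod_topology (lctop A) (lctop A)) (lctop A) (\<lambda>(a, b). a \<otimes> b)"
  using lc by (auto simp: locally_convex_algebra_def)

lemma continuous_map_lc_add:
  "continuous_map X (lctop A) f \<Longrightarrow> continuous_map X (lctop A) g \<Longrightarrow> continuous_map X (lctop A) (\<lambda>x. f x \<oplus> g x)"
  using continuous_map_compose[OF continuous_map_pairedI add_cont] by (simp add: o_def)

lemma continuous_map_lc_mult:
  "continuous_map X (lctop A) f \<Longrightarrow> continuous_map X (lctop A) g \<Longrightarrow> continuous_map X (lctop A) (\<lambda>x. f x \<otimes> g x)"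
  using continuous_map_compose[OF continuous_map_pairedI mult_cont] by (simp add: o_def)

lemma continuous_map_lc_smult:
  "continuous_map X euclidean c \<Longrightarrow> continuous_map X (lctop A) g \<Longrightarrow> continuous_map X (lctop A) (\<lambda>x. c x \<odot> g x)"
  using continuous_map_compose[OF continuous_map_pairedI smult_cont] by (simp add: o_def)

lemma continuous_map_lc_diff:
  assumes f: "continuous_map X (lctop A) f" and g: "continuous_map X (lctop A) g"
  shows "continuous_map X (lctop A) (\<lambda>x. f x \<ominus> g x)"
proof (rule continuous_map_eq)
  show "continuous_map X (lctop A) (\<lambda>x. f x \<oplus> (-1) \<odot> g x)"
    by (intro continuous_map_lc_add continuous_map_lc_smult f g) auto
qed (auto simp: smult_minus_1 minus_eq continuous_map_in_carrier[OF g])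

lemma limitin_lc_add:
  "limitin (lctop A) f a F \<Longrightarrow> limitin (lctop A) g b F \<Longrightarrow> limitin (lctop A) (\<lambda>x. f x \<oplus> g x) (a \<oplus> b) F"
  using continuous_map_limit[OF add_cont, of "\<lambda>x. (f x, g x)" "(a, b)" F]
  by (simp add: limitin_pairwise o_def)

lemma limitin_lc_mult:
  "limitin (lctop A) f a F \<Longrightarrow> limitin (lctop A) g b F \<Longrightarrow> limitin (lctop A) (\<lambda>x. f x \<otimes> g x) (a \<otimes> b) F"
  using continuous_map_limit[OF mult_cont, of "\<lambda>x. (f x, g x)" "(a, b)" F]
  by (simp add: limitin_pairwise o_def)

lemma limitin_lc_smult:
  "(c \<longlongrightarrow> d) F \<Longrightarrow> limitin (lctop A) g b F \<Longrightarrow> limitin (lctop A) (\<lambda>x. c x \<odot> g x) (d \<odot> b) F"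
  using continuous_map_limit[OF smult_cont, of "\<lambda>x. (c x, g x)" "(d, b)" F]
  by (simp add: limitin_pairwise o_def)

section \<open>Smooth curves\<close>

lemma has_curve_deriv_unique: "has_curve_deriv A f d t \<Longrightarrow> has_curve_deriv A f d' t \<Longrightarrow> d = d'"
  unfolding has_curve_deriv_def using limitin_Hausdorff_unique[OF _ _ _ Hausdorff] by force

lemma curve_deriv_eq: "has_curve_deriv A f d t \<Longrightarrow> curve_deriv A f t = d"
  unfolding curve_deriv_def using has_curve_deriv_unique by blast

lemma has_curve_deriv_in_carrier: "has_curve_deriv A f d t \<Longrightarrow> d \<in> carrier A"
  unfolding has_curve_deriv_def using limitin_topspace by fastforce

lemma has_curve_deriv_const: "a \<in> carrier A \<Longrightarrow> has_curve_deriv A (\<lambda>_. a) \<zero> t"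
  by (simp add: has_curve_deriv_def minus_eq r_neg)

lemma has_curve_deriv_linear:
  assumes a: "a \<in> carrier A"
  shows "has_curve_deriv A (\<lambda>t. complex_of_real t \<odot> a) a t"
  unfolding has_curve_deriv_def
proof (rule limitin_eventually)
  have "complex_of_real (inverse h) \<odot> (complex_of_real (t + h) \<odot> a \<ominus> complex_of_real t \<odot> a) = a" if "h \<noteq> 0" for h
  proof -
    have "complex_of_real (t + h) \<odot> a \<ominus> complex_of_real t \<odot> a = complex_of_real h \<odot> a"
      using a by (simp add: minus_eq smult_minus_left[symmetric] smult_add_left[symmetric])
    then show ?thesis
      using a that by (simp add: smult_smult flip: of_real_mult)
  qed
  then show "\<forall>\<^sub>F h in at 0. complex_of_real (inverse h) \<odot> (complex_of_real (t + h) \<odot> a \<ominus> complex_of_real t \<odot> a) = a"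
    by (auto simp: eventually_at_filter)
qed (use a in simp)

lemma has_curve_deriv_add:
  assumes "range f \<subseteq> carrier A" "range g \<subseteq> carrier A" "has_curve_deriv A f d t" "has_curve_deriv A g e t"
  shows "has_curve_deriv A (\<lambda>t. f t \<oplus> g t) (d \<oplus> e) t"
proof -
  have c: "f s \<in> carrier A" "g s \<in> carrier A" for s using assms by auto
  have "(f s \<oplus> g s) \<ominus> (f t \<oplus> g t) = (f s \<ominus> f t) \<oplus> (g s \<ominus> g t)" for s
    using c by (simp add: minus_eq minus_add a_ac)
  then show ?thesis
    using limitin_lc_add[OF assms(3,4)[unfolded has_curve_deriv_def]] c
    unfolding has_curve_deriv_def by (simp add: smult_add_right)
qed

lemma has_curve_deriv_smult:
  assumes "range f \<subseteq> carrier A" "has_curve_deriv A f d t"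
  shows "has_curve_deriv A (\<lambda>t. c \<odot> f t) (c \<odot> d) t"
proof -
  have c: "f s \<in> carrier A" for s using assms by auto
  have "complex_of_real (inverse h) \<odot> (c \<odot> f s \<ominus> c \<odot> f t) = c \<odot> (complex_of_real (inverse h) \<odot> (f s \<ominus> f t))" for h s
    using c by (simp add: smult_diff_right[symmetric] smult_smult mult.commute)
  then show ?thesis
    using limitin_lc_smult[OF tendsto_const assms(2)[unfolded has_curve_deriv_def]]
    unfolding has_curve_deriv_def by simp
qed

text \<open>\<open>f (t + h)\<close> is \<open>h\<close> times the difference quotient plus
  \<open>f t\<close>, and the first summand tends to 0 by continuity of scalar multiplication. The
  product rule needs this limit.\<close>

lemma has_curve_deriv_imp_limit:
  assumes "range f \<subseteq> carrier A" "has_curve_deriv A f d t"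
  shows "limitin (lctop A) (\<lambda>h. f (t + h)) (f t) (at 0)"
proof -
  have c: "f s \<in> carrier A" for s using assms by auto
  have "((\<lambda>h. complex_of_real h) \<longlongrightarrow> of_real 0) (at 0)"
    by (intro tendsto_intros)
  then have "limitin (lctop A) (\<lambda>h. complex_of_real h \<odot> (complex_of_real (inverse h) \<odot> (f (t + h) \<ominus> f t)) \<oplus> f t) (0 \<odot> d \<oplus> f t) (at 0)"
    using assms(2) c by (intro limitin_lc_add limitin_lc_smult) (auto simp: has_curve_deriv_def)
  moreover have "0 \<odot> d \<oplus> f t = f t"
    using has_curve_deriv_in_carrier[OF assms(2)] c by simp
  moreover have "complex_of_real h \<odot> (complex_of_real (inverse h) \<odot> (f (t + h) \<ominus> f t)) \<oplus> f t = f (t + h)" if "h \<noteq> 0" for h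
    using c that by (simp add: smult_smult minus_eq a_assoc l_neg flip: of_real_mult)
  then have "\<forall>\<^sub>F h in at 0. complex_of_real h \<odot> (complex_of_real (inverse h) \<odot> (f (t + h) \<ominus> f t)) \<oplus> f t = f (t + h)"
    by (simp add: eventually_at_filter)
  ultimately show ?thesis
    using limitin_transform_eventually by fastforce
qed

lemma has_curve_deriv_imp_continuous:
  assumes "range f \<subseteq> carrier A" "\<And>t. \<exists>d. has_curve_deriv A f d t"
  shows "continuous_map euclideanreal (lctop A) f"
  unfolding continuous_map_atin
proof
  fix t :: real
  have "limitin (lctop A) (\<lambda>h. f (t + h)) (f t) (at 0)"
    using assms has_curve_deriv_imp_limit by blast
  then have "limitin (lctop A) f (f t) (at t)"
    unfolding limitin_def by (subst at_to_0) (simp add: eventually_filtermap add.commute)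
  moreover have "atin euclideanreal t = at t"
    by (simp add: filter_eq_iff eventually_atin eventually_at_topological) blast
  ultimately show "limitin (lctop A) f (f t) (atin euclideanreal t)"
    by simp
qed

text \<open>The difference of products is split without exchanging factors, because the algebra is
  noncommutative. One summand contains \<open>g (t + h)\<close>, whose limit is supplied by
  differentiability.\<close>

lemma has_curve_deriv_mult:
  assumes "range f \<subseteq> carrier A" "range g \<subseteq> carrier A" "has_curve_deriv A f d t" "has_curve_deriv A g e t"
  shows "has_curve_deriv A (\<lambda>t. f t \<otimes> g t) (d \<otimes> g t \<oplus> f t \<otimes> e) t"
proof -
  have c: "f s \<in> carrier A" "g s \<in> carrier A" for s using assms by auto
  have split: "(a' \<otimes> b') \<ominus> (a \<otimes> b) = (a' \<ominus> a) \<otimes> b' \<oplus> a \<otimes> (b' \<ominus> b)"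
    if "a \<in> carrier A" "a' \<in> carrier A" "b \<in> carrier A" "b' \<in> carrier A" for a a' b b'
  proof -
    have "(a' \<ominus> a) \<otimes> b' \<oplus> a \<otimes> (b' \<ominus> b) = a' \<otimes> b' \<oplus> (\<ominus> (a \<otimes> b') \<oplus> (a \<otimes> b' \<oplus> \<ominus> (a \<otimes> b)))"
      using that by (simp add: minus_eq l_distr r_distr l_minus r_minus a_assoc)
    also have "\<dots> = a' \<otimes> b' \<oplus> \<ominus> (a \<otimes> b)"
      using that by (simp add: r_neg1 r_neg2)
    finally show ?thesis by (simp add: minus_eq)
  qed
  have "limitin (lctop A) (\<lambda>h. (complex_of_real (inverse h) \<odot> (f (t + h) \<ominus> f t)) \<otimes> g (t + h) \<oplus>
      f t \<otimes> (complex_of_real (inverse h) \<odot> (g (t + h) \<ominus> g t))) (d \<otimes> g t \<oplus> f t \<otimes> e) (at 0)"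
    using assms(3,4) c has_curve_deriv_imp_limit[OF assms(2,4)]
    by (intro limitin_lc_add limitin_lc_mult) (auto simp: has_curve_deriv_def)
  moreover have "(complex_of_real (inverse h) \<odot> (f (t + h) \<ominus> f t)) \<otimes> g (t + h) \<oplus>
      f t \<otimes> (complex_of_real (inverse h) \<odot> (g (t + h) \<ominus> g t)) =
      complex_of_real (inverse h) \<odot> (f (t + h) \<otimes> g (t + h) \<ominus> f t \<otimes> g t)" for h
    using c by (simp add: split smult_add_right smult_mult_left smult_mult_right)
  ultimately show ?thesis
    unfolding has_curve_deriv_def by simp
qed

end

text \<open>Counterpart of \<open>Ck_family\<close> for curves in a locally convex algebra, where
  the derivative is a limit in \<open>lctop\<close> and no norm is available.\<close>

primrec curve_Ck_family :: "nat \<Rightarrow> 'a lc_algebra \<Rightarrow> 'x topology \<Rightarrow> ('x \<Rightarrow> real \<Rightarrow> 'a) \<Rightarrow> bool" where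
  "curve_Ck_family 0 A X F \<longleftrightarrow>
     continuous_map (prod_topology X euclideanreal) (lctop A) (\<lambda>(x, t). F x t)"
| "curve_Ck_family (Suc k) A X F \<longleftrightarrow>
     continuous_map (prod_topology X euclideanreal) (lctop A) (\<lambda>(x, t). F x t) \<and>
     (\<forall>x\<in>topspace X. \<forall>t. \<exists>d. has_curve_deriv A (F x) d t) \<and>
     curve_Ck_family k A X (\<lambda>x. curve_deriv A (F x))"

definition smooth_curve_family :: "'a lc_algebra \<Rightarrow> 'x topology \<Rightarrow> ('x \<Rightarrow> real \<Rightarrow> 'a) \<Rightarrow> bool" where
  "smooth_curve_family A X F \<longleftrightarrow> (\<forall>k. curve_Ck_family k A X F)"

lemma curve_Ck_family_continuous:
  "curve_Ck_family k A X F \<Longrightarrow> continuous_map (prod_topology X euclideanreal) (lctop A) (\<lambda>(x, t). F x t)"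
  by (cases k) auto

lemma curve_Ck_family_mono: "curve_Ck_family (Suc k) A X F \<Longrightarrow> curve_Ck_family k A X F"
  by (induction k arbitrary: F) auto

lemma curve_Ck_family_cong:
  assumes "curve_Ck_family k A X F" "\<And>x. x \<in> topspace X \<Longrightarrow> F x = G x"
  shows "curve_Ck_family k A X G"
  using assms
proof (induction k arbitrary: F G)
  case 0
  then show ?case by (auto elim!: continuous_map_eq)
next
  case (Suc k)
  have "curve_Ck_family k A X (\<lambda>x. curve_deriv A (G x))"
    by (rule Suc.IH[of "\<lambda>x. curve_deriv A (F x)"]) (use Suc.prems in auto)
  then show ?case using Suc.prems by (auto elim!: continuous_map_eq)
qed

lemma curve_Ck_family_reparam:
  assumes r: "continuous_map X' X r" and "curve_Ck_family k A X F"
  shows "curve_Ck_family k A X' (\<lambda>x. F (r x))"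
  using assms(2)
proof (induction k arbitrary: F)
  have c: "continuous_map (prod_topology X' euclideanreal) (lctop A) (\<lambda>(x, t). F (r x) t)"
    if "continuous_map (prod_topology X euclideanreal) (lctop A) (\<lambda>(x, t). F x t)" for F
  proof -
    have "continuous_map (prod_topology X' euclideanreal) (prod_topology X euclideanreal) (\<lambda>z. (r (fst z), snd z))"
      using continuous_map_compose[OF continuous_map_fst r]
      by (intro continuous_map_pairedI continuous_map_snd) (simp add: o_def)
    from continuous_map_compose[OF this that] show ?thesis
      by (simp add: o_def case_prod_unfold)
  qed
  {
    case 0
    then show ?case using c by simp
  next
    case (Suc k)
    then show ?case
      using c[of F] continuous_map_image_subset_topspace[OF r] by fastforce
  }
qed

context lc_alg
begin

lemma curve_Ck_family_in_carrier:
  "curve_Ck_family k A X F \<Longrightarrow> x \<in> topspace X \<Longrightarrow> F x t \<in> carrier A"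
  using continuous_map_in_carrier[OF curve_Ck_family_continuous, of k X F "(x, t)"] by simp

lemma curve_Ck_family_SucI:
  assumes "continuous_map (prod_topology X euclideanreal) (lctop A) (\<lambda>(x, t). F x t)"
    and "\<And>x t. x \<in> topspace X \<Longrightarrow> has_curve_deriv A (F x) (F' x t) t" and "curve_Ck_family k A X F'"
  shows "curve_Ck_family (Suc k) A X F"
proof -
  have "curve_deriv A (F x) = F' x" if "x \<in> topspace X" for x
    using curve_deriv_eq[OF assms(2)[OF that]] by auto
  then show ?thesis
    using assms curve_Ck_family_cong[OF assms(3)] by auto
qed

lemma curve_Ck_family_SucD:
  assumes "curve_Ck_family (Suc k) A X F"
  shows "curve_Ck_family k A X (\<lambda>x. curve_deriv A (F x))"
    and "x \<in> topspace X \<Longrightarrow> has_curve_deriv A (F x) (curve_deriv A (F x) t) t"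
    and "x \<in> topspace X \<Longrightarrow> range (F x) \<subseteq> carrier A"
  using assms curve_deriv_eq curve_Ck_family_in_carrier[OF assms] by fastforce+

lemma curve_Ck_family_parameter:
  assumes "continuous_map X (lctop A) c"
  shows "curve_Ck_family k A X (\<lambda>x t. c x)"
  using assms
proof (induction k arbitrary: c)
  have *: "continuous_map (prod_topology X euclideanreal) (lctop A) (\<lambda>(x, t). c x)"
    if "continuous_map X (lctop A) c" for c
    using continuous_map_compose[OF continuous_map_fst that] by (simp add: o_def case_prod_unfold)
  {
    case 0
    then show ?case using * by simp
  next
    case (Suc k)
    show ?case
      by (rule curve_Ck_family_SucI[where F' = "\<lambda>x t. \<zero>"])
        (use Suc * in \<open>auto intro!: has_curve_deriv_const continuous_map_in_carrier[OF Suc.prems]\<close>)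
  }
qed

lemma curve_Ck_family_linear:
  assumes "continuous_map X (lctop A) c"
  shows "curve_Ck_family k A X (\<lambda>x t. complex_of_real t \<odot> c x)"
proof -
  have fst: "continuous_map (prod_topology X euclideanreal) (lctop A) (\<lambda>z. c (fst z))"
    using continuous_map_compose[OF continuous_map_fst assms] by (simp add: o_def)
  have "continuous_map euclideanreal euclidean complex_of_real"
    by (auto intro: continuous_intros)
  then have "continuous_map (prod_topology X euclideanreal) euclidean (\<lambda>z. complex_of_real (snd z))"
    using continuous_map_compose[OF continuous_map_snd, of euclideanreal euclidean complex_of_real X] by (simp add: o_def)
  from continuous_map_lc_smult[OF this fst]
  have *: "continuous_map (prod_topology X euclideanreal) (lctop A) (\<lambda>(x, t). complex_of_real t \<odot> c x)"
    by (simp add: case_prod_unfold)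
  show ?thesis
  proof (cases k)
    case (Suc l)
    show ?thesis
      unfolding Suc
      by (rule curve_Ck_family_SucI[OF * _ curve_Ck_family_parameter[OF assms]])
        (use continuous_map_in_carrier[OF assms] has_curve_deriv_linear in auto)
  qed (use * in simp)
qed

lemma curve_Ck_family_add:
  assumes "curve_Ck_family k A X F" "curve_Ck_family k A X G"
  shows "curve_Ck_family k A X (\<lambda>x t. F x t \<oplus> G x t)"
  using assms
proof (induction k arbitrary: F G)
  have *: "continuous_map (prod_topology X euclideanreal) (lctop A) (\<lambda>(x, t). F x t \<oplus> G x t)"
    if "curve_Ck_family k A X F" "curve_Ck_family k A X G" for k F G
    using continuous_map_lc_add[OF that[THEN curve_Ck_family_continuous]] by (simp add: case_prod_unfold)
  {
    case 0
    then show ?case using *[of 0 F G] by simp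
  next
    case (Suc k)
    show ?case
      by (rule curve_Ck_family_SucI[OF *[OF Suc.prems] has_curve_deriv_add
            Suc.IH[OF curve_Ck_family_SucD(1)[OF Suc.prems(1)] curve_Ck_family_SucD(1)[OF Suc.prems(2)]]])
        (use curve_Ck_family_SucD(2,3)[OF Suc.prems(1)] curve_Ck_family_SucD(2,3)[OF Suc.prems(2)] in auto)
  }
qed

lemma curve_Ck_family_mult:
  assumes "curve_Ck_family k A X F" "curve_Ck_family k A X G"
  shows "curve_Ck_family k A X (\<lambda>x t. F x t \<otimes> G x t)"
  using assms
proof (induction k arbitrary: F G)
  have *: "continuous_map (prod_topology X euclideanreal) (lctop A) (\<lambda>(x, t). F x t \<otimes> G x t)"
    if "curve_Ck_family k A X F" "curve_Ck_family k A X G" for k F G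
    using continuous_map_lc_mult[OF that[THEN curve_Ck_family_continuous]] by (simp add: case_prod_unfold)
  {
    case 0
    then show ?case using *[of 0 F G] by simp
  next
    case (Suc k)
    have "curve_Ck_family k A X (\<lambda>x t. curve_deriv A (F x) t \<otimes> G x t \<oplus> F x t \<otimes> curve_deriv A (G x) t)"
      by (intro curve_Ck_family_add Suc.IH Suc.prems[THEN curve_Ck_family_SucD(1)] Suc.prems[THEN curve_Ck_family_mono])
    then show ?case
      by (rule curve_Ck_family_SucI[OF *[OF Suc.prems] has_curve_deriv_mult, rotated -1])
        (use curve_Ck_family_SucD(2,3)[OF Suc.prems(1)] curve_Ck_family_SucD(2,3)[OF Suc.prems(2)] in auto)
  }
qed

lemma curve_Ck_family_smult:
  assumes c: "continuous_map X euclidean c" and "curve_Ck_family k A X F"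
  shows "curve_Ck_family k A X (\<lambda>x t. c x \<odot> F x t)"
  using assms(2)
proof (induction k arbitrary: F)
  have c': "continuous_map (prod_topology X euclideanreal) euclidean (\<lambda>z. c (fst z))"
    using continuous_map_compose[OF continuous_map_fst c] by (simp add: o_def)
  have *: "continuous_map (prod_topology X euclideanreal) (lctop A) (\<lambda>(x, t). c x \<odot> F x t)"
    if "curve_Ck_family k A X F" for k F
    using continuous_map_lc_smult[OF c' that[THEN curve_Ck_family_continuous]] by (simp add: case_prod_unfold)
  {
    case 0
    then show ?case using *[of 0 F] by simp
  next
    case (Suc k)
    show ?case
      by (rule curve_Ck_family_SucI[OF *[OF Suc.prems] has_curve_deriv_smult
            Suc.IH[OF curve_Ck_family_SucD(1)[OF Suc.prems(1)]]])
        (use curve_Ck_family_SucD(2,3)[OF Suc.prems(1)] in auto)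
  }
qed

lemma has_curve_deriv_hom:
  assumes h: "continuous_map (lctop A) (lctop A) h"
    and add: "\<And>a b. a \<in> carrier A \<Longrightarrow> b \<in> carrier A \<Longrightarrow> h (a \<oplus> b) = h a \<oplus> h b"
    and smult: "\<And>c a. a \<in> carrier A \<Longrightarrow> h (c \<odot> a) = c \<odot> h a"
    and f: "range f \<subseteq> carrier A" "has_curve_deriv A f d t"
  shows "has_curve_deriv A (\<lambda>t. h (f t)) (h d) t"
proof -
  have c: "f s \<in> carrier A" for s using f by auto
  have hc: "h a \<in> carrier A" if "a \<in> carrier A" for a
    using continuous_map_in_carrier[OF h] that by simp
  have "h (complex_of_real (inverse u) \<odot> (f s \<ominus> f t)) = complex_of_real (inverse u) \<odot> (h (f s) \<ominus> h (f t))" for u s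
    using c hc by (simp add: smult minus_eq add smult_minus_1[symmetric])
  then show ?thesis
    using continuous_map_limit[OF h f(2)[unfolded has_curve_deriv_def]]
    unfolding has_curve_deriv_def by (simp add: o_def)
qed

lemma curve_Ck_family_hom:
  assumes h: "continuous_map (lctop A) (lctop A) h"
    and add: "\<And>a b. a \<in> carrier A \<Longrightarrow> b \<in> carrier A \<Longrightarrow> h (a \<oplus> b) = h a \<oplus> h b"
    and smult: "\<And>c a. a \<in> carrier A \<Longrightarrow> h (c \<odot> a) = c \<odot> h a"
    and "curve_Ck_family k A X F"
  shows "curve_Ck_family k A X (\<lambda>x t. h (F x t))"
  using assms(4)
proof (induction k arbitrary: F)
  have *: "continuous_map (prod_topology X euclideanreal) (lctop A) (\<lambda>(x, t). h (F x t))"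
    if "curve_Ck_family k A X F" for k F
    using continuous_map_compose[OF curve_Ck_family_continuous[OF that] h] by (simp add: o_def case_prod_unfold)
  {
    case 0
    then show ?case using *[of 0 F] by simp
  next
    case (Suc k)
    show ?case
      by (rule curve_Ck_family_SucI[OF *[OF Suc.prems] has_curve_deriv_hom[OF h add smult]
            Suc.IH[OF curve_Ck_family_SucD(1)[OF Suc.prems(1)]]])
        (use curve_Ck_family_SucD(2,3)[OF Suc.prems(1)] in auto)
  }
qed

lemma smooth_curve_iterate:
  assumes "smooth_curve A f"
  shows "range ((curve_deriv A ^^ k) f) \<subseteq> carrier A"
    and "has_curve_deriv A ((curve_deriv A ^^ k) f) ((curve_deriv A ^^ Suc k) f t) t"
    and "continuous_map euclideanreal (lctop A) ((curve_deriv A ^^ k) f)"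
proof -
  have D: "has_curve_deriv A ((curve_deriv A ^^ k) f) ((curve_deriv A ^^ Suc k) f t) t" for k t
  proof -
    obtain d where "has_curve_deriv A ((curve_deriv A ^^ k) f) d t"
      using assms unfolding smooth_curve_def by blast
    then show ?thesis
      using curve_deriv_eq by simp
  qed
  then show "has_curve_deriv A ((curve_deriv A ^^ k) f) ((curve_deriv A ^^ Suc k) f t) t" .
  show R: "range ((curve_deriv A ^^ k) f) \<subseteq> carrier A"
  proof (cases k)
    case 0
    then show ?thesis using assms by (simp add: smooth_curve_def)
  next
    case (Suc l)
    then show ?thesis using has_curve_deriv_in_carrier[OF D[of l]] by auto
  qed
  show "continuous_map euclideanreal (lctop A) ((curve_deriv A ^^ k) f)"
    using has_curve_deriv_imp_continuous[OF R] D by blast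
qed

lemma smooth_curve_family_iff:
  "smooth_curve_family A X F \<longleftrightarrow> (\<forall>x\<in>topspace X. smooth_curve A (F x)) \<and>
     (\<forall>k. continuous_map (prod_topology X euclideanreal) (lctop A) (\<lambda>(x, t). (curve_deriv A ^^ k) (F x) t))"
  (is "_ \<longleftrightarrow> ?R F")
proof
  assume F: "smooth_curve_family A X F"
  have fam: "smooth_curve_family A X (\<lambda>x. (curve_deriv A ^^ k) (F x))" for k
  proof (induction k)
    case (Suc k)
    then have "curve_Ck_family (Suc j) A X (\<lambda>x. (curve_deriv A ^^ k) (F x))" for j
      by (simp add: smooth_curve_family_def del: curve_Ck_family.simps)
    from curve_Ck_family_SucD(1)[OF this] show ?case
      by (simp add: smooth_curve_family_def)
  qed (use F in simp)
  then have "curve_Ck_family (Suc 0) A X (\<lambda>x. (curve_deriv A ^^ k) (F x))" for k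
    by (simp add: smooth_curve_family_def del: curve_Ck_family.simps)
  moreover have "range (F x) \<subseteq> carrier A" if "x \<in> topspace X" for x
    using F curve_Ck_family_in_carrier[of 0 X F x] that by (auto simp: smooth_curve_family_def simp del: curve_Ck_family.simps)
  ultimately show "?R F"
    by (auto simp: smooth_curve_def)
next
  assume "?R F"
  then have "curve_Ck_family k A X F" for k
  proof (induction k arbitrary: F)
    case 0
    then show ?case by (auto dest: spec[of _ 0])
  next
    case (Suc k)
    have "curve_Ck_family k A X (\<lambda>x. curve_deriv A (F x))"
    proof (rule Suc.IH, intro conjI ballI allI)
      fix x assume "x \<in> topspace X"
      then have s: "smooth_curve A (F x)" using Suc.prems by blast
      then have "\<exists>d. has_curve_deriv A ((curve_deriv A ^^ Suc j) (F x)) d t" for j t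
        unfolding smooth_curve_def by blast
      then show "smooth_curve A (curve_deriv A (F x))"
        using smooth_curve_iterate(1)[OF s, of 1] by (simp add: smooth_curve_def funpow_swap1)
    next
      fix j
      have "continuous_map (prod_topology X euclideanreal) (lctop A) (\<lambda>(x, t). (curve_deriv A ^^ Suc j) (F x) t)"
        using Suc.prems by blast
      then show "continuous_map (prod_topology X euclideanreal) (lctop A) (\<lambda>(x, t). (curve_deriv A ^^ j) (curve_deriv A (F x)) t)"
        by (simp add: funpow_swap1)
    qed
    moreover have "\<exists>d. has_curve_deriv A (F x) d t" if "x \<in> topspace X" for x t
      using Suc.prems that smooth_curve_iterate(2)[of "F x" 0 t] by auto
    ultimately show ?case
      using Suc.prems by (auto dest: spec[of _ 0])
  qed
  then show "smooth_curve_family A X F"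
    by (simp add: smooth_curve_family_def)
qed

lemma smooth_curve_imp_family:
  assumes "smooth_curve A f"
  shows "smooth_curve_family A X (\<lambda>_. f)"
  unfolding smooth_curve_family_iff
  using assms continuous_map_compose[OF continuous_map_snd[of X] smooth_curve_iterate(3)[OF assms]]
  by (simp add: o_def case_prod_unfold)

lemma smooth_curve_if_family: "smooth_curve_family A (discrete_topology {()}) (\<lambda>_. f) \<Longrightarrow> smooth_curve A f"
  by (simp add: smooth_curve_family_iff)

section \<open>The locally convex algebra of smooth curves\<close>

abbreviation "SC \<equiv> smooth_curve_algebra A"

lemma SC_simps:
  "carrier SC = {f. smooth_curve A f}" "monoid.mult SC = (\<lambda>f g t. f t \<otimes> g t)" "one SC = (\<lambda>t. \<one>)"
  "zero SC = (\<lambda>t. \<zero>)" "add SC = (\<lambda>f g t. f t \<oplus> g t)" "smult SC = (\<lambda>c f t. c \<odot> f t)"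
  by (simp_all add: smooth_curve_algebra_def)

lemma topspace_SC: "topspace (lctop SC) = {f. smooth_curve A f}"
proof -
  let ?S = "{{f. smooth_curve A f \<and> (curve_deriv A ^^ k) f ` K \<subseteq> V} |k K V. compact K \<and> openin (lctop A) V}"
  have mem: "{f. smooth_curve A f} \<in> ?S"
    \<comment> \<open>The empty compact set imposes no condition, so the carrier itself is a
      subbasic set.\<close>
    by (rule CollectI, intro exI[of _ 0] exI[of _ "{}"]) simp
  have "\<Union>?S = {f. smooth_curve A f}"
    by (rule antisym[OF _ Union_upper[OF mem]]) auto
  then show ?thesis
    by (simp add: smooth_curve_algebra_def)
qed

lemma smooth_curve_family_evaluation: "smooth_curve_family A (lctop SC) (\<lambda>f. f)"
  unfolding smooth_curve_family_iff
proof (intro conjI ballI allI)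
  fix k
  show "continuous_map (prod_topology (lctop SC) euclideanreal) (lctop A) (\<lambda>(f, t). (curve_deriv A ^^ k) f t)"
  proof (rule continuous_map_evaluation)
    show "neighbourhood_base_of (compactin euclideanreal) euclideanreal"
      using locally_compact_space_neighbourhood_base[of euclideanreal] locally_compact_space_euclidean
        Hausdorff_space_euclidean by blast
    fix K V assume KV: "compactin euclideanreal K" "openin (lctop A) V"
    have "{f \<in> topspace (lctop SC). (curve_deriv A ^^ k) f ` K \<subseteq> V} = {f. smooth_curve A f \<and> (curve_deriv A ^^ k) f ` K \<subseteq> V}"
      by (auto simp: topspace_SC)
    also have "openin (lctop SC) \<dots>"
      unfolding smooth_curve_algebra_def using KV by (auto intro!: topology_generated_by_Basis)
    finally show "openin (lctop SC) {f \<in> topspace (lctop SC). (curve_deriv A ^^ k) f ` K \<subseteq> V}" .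
  qed (use topspace_SC smooth_curve_iterate(3) in auto)
qed (auto simp: topspace_SC)

text \<open>Exponential law for curves: one direction reparametrizes the universal family of
  evaluations, the other is the tube lemma at every order. Continuity of an operation on curves
  thereby becomes a closure property of families.\<close>

lemma continuous_map_SC_iff: "continuous_map X (lctop SC) \<Phi> \<longleftrightarrow> smooth_curve_family A X \<Phi>"
proof
  assume "continuous_map X (lctop SC) \<Phi>"
  then show "smooth_curve_family A X \<Phi>"
    using smooth_curve_family_evaluation curve_Ck_family_reparam[of X "lctop SC" \<Phi> _ A "\<lambda>f. f"]
    by (auto simp: smooth_curve_family_def)
next
  assume F: "smooth_curve_family A X \<Phi>"
  then have smooth: "smooth_curve A (\<Phi> x)" if "x \<in> topspace X" for x
    using that by (simp add: smooth_curve_family_iff)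
  have "openin X (\<Phi> -` {f. smooth_curve A f \<and> (curve_deriv A ^^ k) f ` K \<subseteq> V} \<inter> topspace X)"
    if "compact K" "openin (lctop A) V" for k K V
  proof -
    have "openin X {x \<in> topspace X. \<forall>t\<in>K. (curve_deriv A ^^ k) (\<Phi> x) t \<in> V}"
      by (rule openin_compact_tube[where Y = euclideanreal and Z = "lctop A"])
        (use F that in \<open>auto simp: smooth_curve_family_iff\<close>)
    moreover have "{x \<in> topspace X. \<forall>t\<in>K. (curve_deriv A ^^ k) (\<Phi> x) t \<in> V} =
        \<Phi> -` {f. smooth_curve A f \<and> (curve_deriv A ^^ k) f ` K \<subseteq> V} \<inter> topspace X"
      using smooth by auto
    ultimately show ?thesis by simp
  qed
  moreover have "\<Phi> ` topspace X \<subseteq> \<Union> {{f. smooth_curve A f \<and> (curve_deriv A ^^ k) f ` K \<subseteq> V} |k K V. compact K \<and> openin (lctop A) V}"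
    using smooth topspace_SC by (simp add: smooth_curve_algebra_def image_subset_iff)
  ultimately show "continuous_map X (lctop SC) \<Phi>"
    unfolding smooth_curve_algebra_def by (auto simp: continuous_on_generated_topo_iff)
qed

lemma smooth_curve_add: "smooth_curve A f \<Longrightarrow> smooth_curve A g \<Longrightarrow> smooth_curve A (\<lambda>t. f t \<oplus> g t)"
  and smooth_curve_mult: "smooth_curve A f \<Longrightarrow> smooth_curve A g \<Longrightarrow> smooth_curve A (\<lambda>t. f t \<otimes> g t)"
  and smooth_curve_smult: "smooth_curve A f \<Longrightarrow> smooth_curve A (\<lambda>t. c \<odot> f t)"
  using smooth_curve_imp_family[of f "discrete_topology {()}"] smooth_curve_imp_family[of g "discrete_topology {()}"]
  by (auto intro!: smooth_curve_if_family curve_Ck_family_add curve_Ck_family_mult curve_Ck_family_smult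
       simp: smooth_curve_family_def)

lemma smooth_curve_const: "a \<in> carrier A \<Longrightarrow> smooth_curve A (\<lambda>t. a)"
  and smooth_curve_linear: "a \<in> carrier A \<Longrightarrow> smooth_curve A (\<lambda>t. complex_of_real t \<odot> a)"
  by (auto intro!: smooth_curve_if_family curve_Ck_family_parameter curve_Ck_family_linear
       simp: smooth_curve_family_def)

lemma smooth_curve_carrier [simp]: "smooth_curve A f \<Longrightarrow> f t \<in> carrier A"
  by (auto simp: smooth_curve_def)

lemma ring_SC: "ring SC"
proof (intro ringI abelian_groupI monoidI)
  show "\<exists>y\<in>carrier SC. y \<oplus>\<^bsub>SC\<^esub> x = \<zero>\<^bsub>SC\<^esub>" if "x \<in> carrier SC" for x
  proof (rule bexI[of _ "\<lambda>t. (-1) \<odot> x t"])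
    show "(\<lambda>t. (-1) \<odot> x t) \<in> carrier SC"
      using that smooth_curve_smult[of x "-1"] by (simp only: SC_simps mem_Collect_eq)
  qed (use that in \<open>auto simp: SC_simps smult_minus_1 l_neg\<close>)
qed (auto simp: SC_simps smooth_curve_add smooth_curve_mult smooth_curve_const a_ac m_assoc l_distr r_distr fun_eq_iff)

lemma module_SC: "Module.module complex_ring SC"
  by (rule moduleI[OF cring_complex_ring ring.is_abelian_group[OF ring_SC]])
    (auto simp: SC_simps smooth_curve_smult complex_ring_def smult_add_left smult_add_right smult_smult)

text \<open>Makes the subbasic sets convex whenever their target is convex.\<close>

lemma curve_deriv_funpow_linear:
  assumes "smooth_curve A f" "smooth_curve A g"
  shows "(curve_deriv A ^^ k) (\<lambda>t. c \<odot> f t \<oplus> d \<odot> g t) = (\<lambda>t. c \<odot> (curve_deriv A ^^ k) f t \<oplus> d \<odot> (curve_deriv A ^^ k) g t)"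
proof (induction k)
  case (Suc k)
  note f = smooth_curve_iterate[OF assms(1), of k] and g = smooth_curve_iterate[OF assms(2), of k]
  have "has_curve_deriv A (\<lambda>t. c \<odot> (curve_deriv A ^^ k) f t \<oplus> d \<odot> (curve_deriv A ^^ k) g t)
      (c \<odot> (curve_deriv A ^^ Suc k) f t \<oplus> d \<odot> (curve_deriv A ^^ Suc k) g t) t" for t
    using f(1) g(1) by (intro has_curve_deriv_add has_curve_deriv_smult f(2) g(2)) auto
  from curve_deriv_eq[OF this] show ?case
    by (simp add: Suc.IH fun_eq_iff)
qed simp

text \<open>Curves are separated by evaluation at a time where they differ. The operations are
  continuous because, applied to the projections of the product, they give smooth families. Convex
  neighbourhoods come from shrinking the target of a subbasic set.\<close>

lemma lc_SC: "locally_convex_algebra SC"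
  unfolding locally_convex_algebra_def
proof (intro conjI allI impI)
  show "unital_algebra SC"
    unfolding unital_algebra_def using ring_SC module_SC by (auto simp: SC_simps smult_mult_left smult_mult_right)
  show "topspace (lctop SC) = carrier SC"
    by (simp add: topspace_SC SC_simps)
  have ev: "continuous_map (lctop SC) (lctop A) (\<lambda>f. f t)" for t
  proof -
    have "continuous_map (prod_topology (lctop SC) euclideanreal) (lctop A) (\<lambda>(f, t). f t)"
      using smooth_curve_family_evaluation curve_Ck_family_continuous[of 0 A "lctop SC" "\<lambda>f. f"] by (simp add: smooth_curve_family_def)
    moreover have "continuous_map (lctop SC) (prod_topology (lctop SC) euclideanreal) (\<lambda>f. (f, t))"
      by (intro continuous_map_pairedI) auto
    ultimately have "continuous_map (lctop SC) (lctop A) ((\<lambda>(f, t). f t) \<circ> (\<lambda>f. (f, t)))"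
      by (rule continuous_map_compose[rotated])
    then show ?thesis
      by (simp add: o_def)
  qed
  show "Hausdorff_space (lctop SC)"
    unfolding Hausdorff_space_def
  proof (intro allI impI)
    fix f g assume fg: "f \<in> topspace (lctop SC) \<and> g \<in> topspace (lctop SC) \<and> f \<noteq> g"
    then obtain t where "f t \<noteq> g t" by blast
    then obtain U V where UV: "openin (lctop A) U" "openin (lctop A) V" "f t \<in> U" "g t \<in> V" "disjnt U V"
      using Hausdorff fg unfolding Hausdorff_space_def topspace_SC
      by (metis mem_Collect_eq smooth_curve_carrier topspace_eq)
    show "\<exists>U V. openin (lctop SC) U \<and> openin (lctop SC) V \<and> f \<in> U \<and> g \<in> V \<and> disjnt U V"
      by (intro exI[of _ "{f \<in> topspace (lctop SC). f t \<in> U}"] exI[of _ "{f \<in> topspace (lctop SC). f t \<in> V}"])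
        (use UV fg in \<open>auto simp: disjnt_iff intro: openin_continuous_map_preimage[OF ev]\<close>)
  qed
  have E: "curve_Ck_family k A X r" if "continuous_map X (lctop SC) r" for k X and r :: "'x \<Rightarrow> real \<Rightarrow> 'a"
    using that continuous_map_SC_iff smooth_curve_family_def by blast
  have fst: "curve_Ck_family k A (prod_topology (lctop SC) (lctop SC)) (\<lambda>z. fst z)" for k
    by (rule E) (rule continuous_map_fst)
  have snd: "curve_Ck_family k A (prod_topology X (lctop SC)) (\<lambda>z. snd z)" for k and X :: "'x topology"
    by (rule E) (rule continuous_map_snd)
  show "continuous_map (prod_topology (lctop SC) (lctop SC)) (lctop SC) (\<lambda>(a, b). a \<oplus>\<^bsub>SC\<^esub> b)"
    unfolding continuous_map_SC_iff smooth_curve_family_def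
    using curve_Ck_family_add[OF fst snd] by (simp add: SC_simps case_prod_unfold)
  show "continuous_map (prod_topology (lctop SC) (lctop SC)) (lctop SC) (\<lambda>(a, b). a \<otimes>\<^bsub>SC\<^esub> b)"
    unfolding continuous_map_SC_iff smooth_curve_family_def
    using curve_Ck_family_mult[OF fst snd] by (simp add: SC_simps case_prod_unfold)
  show "continuous_map (prod_topology euclidean (lctop SC)) (lctop SC) (\<lambda>(c, a). c \<odot>\<^bsub>SC\<^esub> a)"
    unfolding continuous_map_SC_iff smooth_curve_family_def
    using curve_Ck_family_smult[OF continuous_map_fst snd] by (simp add: SC_simps case_prod_unfold)
  let ?S = "{{f. smooth_curve A f \<and> (curve_deriv A ^^ k) f ` K \<subseteq> V} |k K V. compact K \<and> openin (lctop A) V}"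
  have T: "lctop SC = topology_generated_by ?S"
    by (simp add: smooth_curve_algebra_def)
  fix U assume U: "openin (lctop SC) U \<and> \<zero>\<^bsub>SC\<^esub> \<in> U"
  show "\<exists>V. openin (lctop SC) V \<and> \<zero>\<^bsub>SC\<^esub> \<in> V \<and> V \<subseteq> U \<and> convex_in SC V"
    unfolding T
  proof (rule locally_convex_generated)
    fix s assume s: "s \<in> ?S" "\<zero>\<^bsub>SC\<^esub> \<in> s"
    then obtain k K V where kKV: "s = {f. smooth_curve A f \<and> (curve_deriv A ^^ k) f ` K \<subseteq> V}" "compact K" "openin (lctop A) V"
      by blast
    have "curve_deriv A (\<lambda>t. \<zero>) = (\<lambda>t. \<zero>)"
      using curve_deriv_eq[OF has_curve_deriv_const] by blast
    then have zero: "(curve_deriv A ^^ k) (\<lambda>t. \<zero>) = (\<lambda>t. \<zero>)"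
      by (induction k) simp_all
    \<comment> \<open>For empty \<open>K\<close> the target need not contain 0; the empty set then
      serves as a convex target.\<close>
    obtain V' where V': "openin (lctop A) V'" "K \<noteq> {} \<longrightarrow> \<zero> \<in> V'" "V' \<subseteq> V" "convex_in A V'"
    proof (cases "K = {}")
      case True
      show thesis by (rule that[of "{}"]) (auto simp: True convex_in_def)
    next
      case False
      then have "\<zero> \<in> V" using s kKV zero by (auto simp: SC_simps)
      then show thesis using that lc kKV(3) unfolding locally_convex_algebra_def by meson
    qed
    let ?V = "{f. smooth_curve A f \<and> (curve_deriv A ^^ k) f ` K \<subseteq> V'}"
    have "openin (topology_generated_by ?S) ?V"
      using kKV V' by (intro topology_generated_by_Basis) auto
    moreover have "\<zero>\<^bsub>SC\<^esub> \<in> ?V"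
      using V' zero by (auto simp: SC_simps smooth_curve_const)
    moreover have "?V \<subseteq> s" using kKV V' by auto
    moreover have "convex_in SC ?V"
      using V'(4) unfolding convex_in_def
      by (auto simp: SC_simps smooth_curve_add smooth_curve_smult curve_deriv_funpow_linear image_subset_iff)
    ultimately show "\<exists>V. openin (topology_generated_by ?S) V \<and> \<zero>\<^bsub>SC\<^esub> \<in> V \<and> V \<subseteq> s \<and> convex_in SC V"
      by blast
  qed (use U T in auto)
qed

lemma lc_alg_SC: "lc_alg SC"
  by (intro lc_alg.intro ring_SC lc_alg_axioms.intro lc_SC)

end

section \<open>Quotients by closed ideals\<close>

lemma continuous_map_discrete_times:
  assumes "\<And>g. g \<in> D \<Longrightarrow> continuous_map Y Z (\<lambda>y. f (g, y))"
  shows "continuous_map (prod_topology (discrete_topology D) Y) Z f"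
  unfolding continuous_map_def
proof (intro conjI allI impI)
  show "f \<in> topspace (prod_topology (discrete_topology D) Y) \<rightarrow> topspace Z"
    using assms continuous_map_image_subset_topspace by fastforce
  fix V assume V: "openin Z V"
  have "{z \<in> topspace (prod_topology (discrete_topology D) Y). f z \<in> V} =
      (\<Union>g\<in>D. {g} \<times> {y \<in> topspace Y. f (g, y) \<in> V})"
    by auto
  also have "openin (prod_topology (discrete_topology D) Y) \<dots>"
    using openin_continuous_map_preimage[OF assms V]
    by (intro openin_Union) (auto simp: openin_prod_Times_iff)
  finally show "openin (prod_topology (discrete_topology D) Y) {z \<in> topspace (prod_topology (discrete_topology D) Y). f z \<in> V}" .
qed

text \<open>Addition, negation and multiplication by a fixed element are continuous and preserve
  \<open>J\<close>, so they preserve its closure. For addition the closure of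
  \<open>J \<times> J\<close> is the product of the closures.\<close>

lemma (in lc_alg) closure_of_ideal:
  assumes "ideal J A"
  shows "ideal (lctop A closure_of J) A"
proof -
  interpret J: ideal J A by fact
  have JA: "J \<subseteq> carrier A" by (rule J.a_subset)
  let ?C = "lctop A closure_of J"
  have CA: "?C \<subseteq> carrier A"
    using closure_of_subset_topspace[of "lctop A" J] by simp
  have sub: "J \<subseteq> ?C"
    using JA by (simp add: closure_of_subset)
  have map1: "h a \<in> ?C" if "continuous_map (lctop A) (lctop A) h" "h ` J \<subseteq> J" "a \<in> ?C" for h a
    using continuous_map_image_closure_subset[OF that(1), of J] closure_of_mono[OF that(2), of "lctop A"] that(3) by blast
  have add: "a \<oplus> b \<in> ?C" if "a \<in> ?C" "b \<in> ?C" for a b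
  proof -
    have "(a, b) \<in> prod_topology (lctop A) (lctop A) closure_of (J \<times> J)"
      using that by (simp add: closure_of_Times)
    then have "(\<lambda>(a, b). a \<oplus> b) (a, b) \<in> lctop A closure_of ((\<lambda>(a, b). a \<oplus> b) ` (J \<times> J))"
      using continuous_map_image_closure_subset[OF add_cont, of "J \<times> J"] by blast
    moreover have "(\<lambda>(a, b). a \<oplus> b) ` (J \<times> J) \<subseteq> J"
      using J.a_closed by auto
    ultimately show ?thesis
      using closure_of_mono[of _ J "lctop A"] by auto
  qed
  have cont_mult: "continuous_map (lctop A) (lctop A) (\<lambda>a. x \<otimes> a)" "continuous_map (lctop A) (lctop A) (\<lambda>a. a \<otimes> x)"
    if "x \<in> carrier A" for x
    using that by (intro continuous_map_lc_mult; simp)+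
  have inv: "\<ominus> a \<in> ?C" if "a \<in> ?C" for a
  proof -
    have "continuous_map (lctop A) (lctop A) (\<lambda>a. \<zero> \<ominus> a)"
      by (intro continuous_map_lc_diff) auto
    moreover have "(\<lambda>a. \<zero> \<ominus> a) ` J \<subseteq> J"
      using JA by (auto simp: minus_eq)
    ultimately have "\<zero> \<ominus> a \<in> ?C"
      by (rule map1[OF _ _ that])
    then show ?thesis
      using that CA by (simp add: minus_eq subset_iff)
  qed
  show ?thesis
  proof (rule idealI[OF ring_axioms])
    show "subgroup ?C (add_monoid A)"
    proof (rule add.subgroupI)
      show "?C \<noteq> {}" using sub additive_subgroup.zero_closed[OF J.additive_subgroup_axioms] by blast
    qed (use CA inv add in \<open>auto simp: a_inv_def\<close>)
    show "x \<otimes> a \<in> ?C" "a \<otimes> x \<in> ?C" if "a \<in> ?C" "x \<in> carrier A" for a x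
      using map1[OF cont_mult(1)[OF that(2)] _ that(1)] map1[OF cont_mult(2)[OF that(2)] _ that(1)]
        J.I_l_closed J.I_r_closed that(2) by auto
  qed
qed

text \<open>Closedness of the ideal makes the quotient Hausdorff.\<close>

locale lc_quotient = lc_alg A + ideal I A for A :: "'a lc_algebra" (structure) and I +
  assumes closed: "closedin (lctop A) I"
begin

abbreviation "Q \<equiv> quotient_lc_algebra A I"

lemma carrier_Q: "carrier Q = (\<lambda>a. I +> a) ` carrier A"
  by (auto simp: quotient_lc_algebra_def FactRing_def A_RCOSETS_def' image_def)

lemma add_Q: "a \<in> carrier A \<Longrightarrow> b \<in> carrier A \<Longrightarrow> (I +> a) \<oplus>\<^bsub>Q\<^esub> (I +> b) = I +> (a \<oplus> b)"
  by (simp add: quotient_lc_algebra_def FactRing_def a_rcos_sum)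

lemma mult_Q: "a \<in> carrier A \<Longrightarrow> b \<in> carrier A \<Longrightarrow> (I +> a) \<otimes>\<^bsub>Q\<^esub> (I +> b) = I +> (a \<otimes> b)"
  by (simp add: quotient_lc_algebra_def FactRing_def rcoset_mult_add)

lemma one_Q: "\<one>\<^bsub>Q\<^esub> = I +> \<one>"
  by (simp add: quotient_lc_algebra_def FactRing_def)

lemma zero_Q: "\<zero>\<^bsub>Q\<^esub> = I +> \<zero>"
  using a_coset_add_zero[OF a_subset] by (simp add: quotient_lc_algebra_def FactRing_def)

lemma coset_eq_iff: "a \<in> carrier A \<Longrightarrow> b \<in> carrier A \<Longrightarrow> I +> a = I +> b \<longleftrightarrow> a \<ominus> b \<in> I"
  using quotient_eq_iff_same_a_r_cos[OF ideal_axioms] by simp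

lemma mem_coset_iff: "a \<in> carrier A \<Longrightarrow> b \<in> I +> a \<longleftrightarrow> b \<in> carrier A \<and> I +> b = I +> a"
proof -
  assume a: "a \<in> carrier A"
  have "b \<in> I +> b" if "b \<in> carrier A" for b
    using a_rcos_self[OF that] by simp
  then show ?thesis
    using a_repr_independence'[of b a] a a_r_coset_subset_G[OF a_subset a] by auto
qed

text \<open>\<open>c \<odot> i\<close> is the product of \<open>c \<odot> \<one>\<close> with
  \<open>i\<close>, so a ring ideal in a unital algebra is automatically a subspace. The generated
  ideal is only a ring ideal by definition.\<close>

lemma smult_I: "i \<in> I \<Longrightarrow> c \<odot> i \<in> I"
proof -
  assume i: "i \<in> I"
  then have "c \<odot> i = (c \<odot> \<one>) \<otimes> i"
    using a_subset by (simp add: smult_mult_left subset_iff)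
  then show ?thesis using i I_l_closed by simp
qed

text \<open>Scalar multiplication on the quotient and the localized action are defined as unions
  over all representatives. If \<open>h\<close> respects congruence, all cosets in such a union
  coincide.\<close>

lemma union_cosets:
  assumes "a \<in> carrier A" and "\<And>b. b \<in> carrier A \<Longrightarrow> b \<ominus> a \<in> I \<Longrightarrow> h b \<in> carrier A \<and> h b \<ominus> h a \<in> I"
  shows "(\<Union>b\<in>I +> a. I +> h b) = I +> h a"
proof -
  have "a \<ominus> a \<in> I" using assms(1) by (simp add: minus_eq r_neg)
  then have ha: "h a \<in> carrier A" using assms by blast
  have eq: "I +> h b = I +> h a" if "b \<in> I +> a" for b
  proof -
    have "b \<in> carrier A" "b \<ominus> a \<in> I"
      using that assms(1) mem_coset_iff[of a b] coset_eq_iff[of b a] by auto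
    then show ?thesis
      using assms(2)[of b] ha coset_eq_iff[of "h b" "h a"] by blast
  qed
  have "(\<Union>b\<in>I +> a. I +> h b) = (\<Union>b\<in>I +> a. I +> h a)"
    by (rule SUP_cong[OF refl eq])
  moreover have "a \<in> I +> a" using assms by (simp add: mem_coset_iff)
  ultimately show ?thesis by blast
qed

lemma smult_Q: "a \<in> carrier A \<Longrightarrow> c \<odot>\<^bsub>Q\<^esub> (I +> a) = I +> (c \<odot> a)"
  using union_cosets[of a "\<lambda>a. c \<odot> a"] smult_I
  by (simp add: quotient_lc_algebra_def smult_diff_right[symmetric])

lemmas Q_simps = add_Q mult_Q smult_Q

lemma ring_Q: "ring Q"
proof (intro ringI abelian_groupI monoidI)
  show "\<exists>y\<in>carrier Q. y \<oplus>\<^bsub>Q\<^esub> x = \<zero>\<^bsub>Q\<^esub>" if "x \<in> carrier Q" for x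
    using that by (auto simp: carrier_Q zero_Q intro!: bexI[of _ "\<ominus> _"] simp: add_Q l_neg)
qed (auto simp: carrier_Q Q_simps one_Q zero_Q a_ac m_assoc l_distr r_distr)

lemma module_Q: "Module.module complex_ring Q"
  by (rule moduleI[OF cring_complex_ring ring.is_abelian_group[OF ring_Q]])
    (auto simp: carrier_Q Q_simps complex_ring_def smult_add_left smult_add_right smult_smult)

lemma openin_Q: "openin (lctop Q) W \<longleftrightarrow> W \<subseteq> carrier Q \<and> openin (lctop A) {a \<in> carrier A. I +> a \<in> W}"
proof -
  let ?P = "\<lambda>W. W \<subseteq> carrier (A Quot I) \<and> openin (lctop A) {a \<in> carrier A. I +> a \<in> W}"
  have "istopology ?P"
    unfolding istopology_def
  proof (intro conjI allI impI)
    fix S T assume "?P S" "?P T"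
    moreover have "{a \<in> carrier A. I +> a \<in> S \<inter> T} = {a \<in> carrier A. I +> a \<in> S} \<inter> {a \<in> carrier A. I +> a \<in> T}"
      by auto
    ultimately show "openin (lctop A) {a \<in> carrier A. I +> a \<in> S \<inter> T}" by auto
    show "S \<inter> T \<subseteq> carrier (A Quot I)" using \<open>?P S\<close> by auto
  next
    fix K assume K: "\<forall>S\<in>K. ?P S"
    moreover have "{a \<in> carrier A. I +> a \<in> \<Union>K} = (\<Union>S\<in>K. {a \<in> carrier A. I +> a \<in> S})"
      by auto
    ultimately show "openin (lctop A) {a \<in> carrier A. I +> a \<in> \<Union>K}" by auto
    show "\<Union>K \<subseteq> carrier (A Quot I)" using K by auto
  qed
  then show ?thesis
    by (simp add: quotient_lc_algebra_def)
qed

lemma topspace_Q: "topspace (lctop Q) = carrier Q"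
proof (rule antisym)
  have "{a \<in> carrier A. I +> a \<in> carrier Q} = topspace (lctop A)"
    by (auto simp: carrier_Q)
  then have "openin (lctop Q) (carrier Q)"
    unfolding openin_Q by (metis openin_topspace order_refl)
  then show "carrier Q \<subseteq> topspace (lctop Q)"
    by (rule openin_subset)
qed (use openin_Q openin_topspace in blast)

lemma continuous_coset: "continuous_map (lctop A) (lctop Q) (\<lambda>a. I +> a)"
  unfolding continuous_map_def by (auto simp: topspace_Q carrier_Q openin_Q)

text \<open>The preimage of the image of \<open>U\<close> is the union of the translates of
  \<open>U\<close> by elements of \<open>I\<close>.\<close>

lemma open_coset: "open_map (lctop A) (lctop Q) (\<lambda>a. I +> a)"
  unfolding open_map_def
proof (intro allI impI)
  fix U assume U: "openin (lctop A) U"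
  then have UA: "U \<subseteq> carrier A" using openin_subset by fastforce
  have "{a \<in> carrier A. I +> a \<in> (\<lambda>a. I +> a) ` U} = (\<Union>i\<in>I. {a \<in> topspace (lctop A). i \<oplus> a \<in> U})"
  proof (intro equalityI subsetI)
    fix a assume "a \<in> {a \<in> carrier A. I +> a \<in> (\<lambda>a. I +> a) ` U}"
    then obtain u where u: "a \<in> carrier A" "u \<in> U" "I +> u = I +> a" by auto
    then have "u \<ominus> a \<in> I"
      using UA coset_eq_iff[of u a] by blast
    moreover have "u \<ominus> a \<oplus> a = u"
      using u UA by (auto simp: minus_eq a_assoc l_neg)
    ultimately show "a \<in> (\<Union>i\<in>I. {a \<in> topspace (lctop A). i \<oplus> a \<in> U})"
      using u by (auto intro!: bexI[of _ "u \<ominus> a"])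
  next
    fix a assume "a \<in> (\<Union>i\<in>I. {a \<in> topspace (lctop A). i \<oplus> a \<in> U})"
    then obtain i where i: "i \<in> I" "a \<in> carrier A" "i \<oplus> a \<in> U" by auto
    have ic: "i \<in> carrier A" using i a_subset by auto
    then have "(i \<oplus> a) \<ominus> a = i"
      using i(2) by (simp add: minus_eq a_assoc r_neg)
    then have "I +> (i \<oplus> a) = I +> a"
      using i ic by (simp add: coset_eq_iff)
    then show "a \<in> {a \<in> carrier A. I +> a \<in> (\<lambda>a. I +> a) ` U}"
      using i by (auto intro!: image_eqI[of _ _ "i \<oplus> a"])
  qed
  moreover have "openin (lctop A) {a \<in> topspace (lctop A). i \<oplus> a \<in> U}" if "i \<in> I" for i
    by (rule openin_continuous_map_preimage[OF _ U], rule continuous_map_lc_add)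
      (use that a_subset in auto)
  ultimately show "openin (lctop Q) ((\<lambda>a. I +> a) ` U)"
    using UA unfolding openin_Q by (auto simp: carrier_Q)
qed

lemma coset_onto: "(\<lambda>a. I +> a) ` topspace (lctop A) = topspace (lctop Q)"
  by (simp add: topspace_Q carrier_Q)

lemma quotient_coset: "quotient_map (lctop A) (lctop Q) (\<lambda>a. I +> a)"
  by (rule continuous_open_imp_quotient_map[OF continuous_coset open_coset coset_onto])

text \<open>The operations descend along products of the open coset map. Two distinct cosets are
  separated by pulling the complement of \<open>I\<close> back along subtraction, and images of
  convex neighbourhoods are convex.\<close>

lemma lc_Q: "locally_convex_algebra Q"
  unfolding locally_convex_algebra_def
proof (intro conjI allI impI)
  show "unital_algebra Q"
    unfolding unital_algebra_def using ring_Q module_Q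
    by (auto simp: carrier_Q Q_simps smult_mult_left smult_mult_right)
  show "topspace (lctop Q) = carrier Q" by (rule topspace_Q)
  note qq = quotient_map_prod_open[OF continuous_coset open_coset coset_onto continuous_coset open_coset coset_onto]
  have lift: "continuous_map (prod_topology (lctop Q) (lctop Q)) (lctop Q) (\<lambda>(a, b). op' a b)"
    if cont: "continuous_map (prod_topology (lctop A) (lctop A)) (lctop A) (\<lambda>(a, b). op a b)"
      and hom: "\<And>a b. a \<in> carrier A \<Longrightarrow> b \<in> carrier A \<Longrightarrow> op' (I +> a) (I +> b) = I +> op a b" for op op'
  proof (rule continuous_compose_quotient_map[OF qq])
    have "continuous_map (prod_topology (lctop A) (lctop A)) (lctop Q) ((\<lambda>a. I +> a) \<circ> (\<lambda>(a, b). op a b))"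
      by (rule continuous_map_compose[OF cont continuous_coset])
    then show "continuous_map (prod_topology (lctop A) (lctop A)) (lctop Q) ((\<lambda>(a, b). op' a b) \<circ> (\<lambda>(x, y). (I +> x, I +> y)))"
      by (rule continuous_map_eq) (auto simp: hom)
  qed
  show "continuous_map (prod_topology (lctop Q) (lctop Q)) (lctop Q) (\<lambda>(a, b). a \<oplus>\<^bsub>Q\<^esub> b)"
    by (rule lift[OF add_cont add_Q])
  show "continuous_map (prod_topology (lctop Q) (lctop Q)) (lctop Q) (\<lambda>(a, b). a \<otimes>\<^bsub>Q\<^esub> b)"
    by (rule lift[OF mult_cont mult_Q])
  show "continuous_map (prod_topology euclidean (lctop Q)) (lctop Q) (\<lambda>(c, a). c \<odot>\<^bsub>Q\<^esub> a)"
  proof (rule continuous_compose_quotient_map)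
    show "quotient_map (prod_topology euclidean (lctop A)) (prod_topology euclidean (lctop Q)) (\<lambda>(c, a). (c, I +> a))"
      by (rule quotient_map_prod_open[OF _ _ _ continuous_coset open_coset coset_onto]) (auto simp: open_map_def)
    have "continuous_map (prod_topology euclidean (lctop A)) (lctop Q) ((\<lambda>a. I +> a) \<circ> (\<lambda>(c, a). c \<odot> a))"
      by (rule continuous_map_compose[OF smult_cont continuous_coset])
    then show "continuous_map (prod_topology euclidean (lctop A)) (lctop Q) ((\<lambda>(c, a). c \<odot>\<^bsub>Q\<^esub> a) \<circ> (\<lambda>(c, a). (c, I +> a)))"
      by (rule continuous_map_eq) (auto simp: smult_Q)
  qed
  show "Hausdorff_space (lctop Q)"
    unfolding Hausdorff_space_def
  proof (intro allI impI)
    fix X Y assume XY: "X \<in> topspace (lctop Q) \<and> Y \<in> topspace (lctop Q) \<and> X \<noteq> Y"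
    then obtain a b where ab: "a \<in> carrier A" "b \<in> carrier A" "X = I +> a" "Y = I +> b"
      by (auto simp: topspace_Q carrier_Q)
    have nI: "a \<ominus> b \<notin> I" using ab XY coset_eq_iff by auto
    have diff: "continuous_map (prod_topology (lctop A) (lctop A)) (lctop A) (\<lambda>z. fst z \<ominus> snd z)"
      by (intro continuous_map_lc_diff continuous_map_fst continuous_map_snd)
    have "openin (lctop A) (topspace (lctop A) - I)"
      using closed by blast
    then have op: "openin (prod_topology (lctop A) (lctop A))
        {z \<in> topspace (prod_topology (lctop A) (lctop A)). fst z \<ominus> snd z \<in> topspace (lctop A) - I}"
      by (rule openin_continuous_map_preimage[OF diff])
    have "(a, b) \<in> {z \<in> topspace (prod_topology (lctop A) (lctop A)). fst z \<ominus> snd z \<in> topspace (lctop A) - I}"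
      using ab nI by simp
    from op[unfolded openin_prod_topology_alt, rule_format, OF this]
    obtain U V where UV: "openin (lctop A) U" "openin (lctop A) V" "a \<in> U" "b \<in> V"
        and sub: "U \<times> V \<subseteq> {z \<in> topspace (prod_topology (lctop A) (lctop A)). fst z \<ominus> snd z \<in> topspace (lctop A) - I}"
      by auto
    have "I +> u \<noteq> I +> v" if "u \<in> U" "v \<in> V" for u v
    proof -
      have "(u, v) \<in> {z \<in> topspace (prod_topology (lctop A) (lctop A)). fst z \<ominus> snd z \<in> topspace (lctop A) - I}"
        using sub that by blast
      then show ?thesis by (simp add: coset_eq_iff)
    qed
    then have "disjnt ((\<lambda>a. I +> a) ` U) ((\<lambda>a. I +> a) ` V)"
      by (auto simp: disjnt_iff)
    then show "\<exists>U V. openin (lctop Q) U \<and> openin (lctop Q) V \<and> X \<in> U \<and> Y \<in> V \<and> disjnt U V"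
      using UV ab open_coset unfolding open_map_def by blast
  qed
  fix U assume U: "openin (lctop Q) U \<and> \<zero>\<^bsub>Q\<^esub> \<in> U"
  then have "openin (lctop A) {a \<in> carrier A. I +> a \<in> U}" "\<zero> \<in> {a \<in> carrier A. I +> a \<in> U}"
    by (auto simp: openin_Q zero_Q)
  then obtain V where V: "openin (lctop A) V" "\<zero> \<in> V" "V \<subseteq> {a \<in> carrier A. I +> a \<in> U}" "convex_in A V"
    using lc unfolding locally_convex_algebra_def by meson
  have "convex_in Q ((\<lambda>a. I +> a) ` V)"
    unfolding convex_in_def
  proof (intro ballI)
    fix X Y and t :: real assume "X \<in> (\<lambda>a. I +> a) ` V" "Y \<in> (\<lambda>a. I +> a) ` V" and t: "t \<in> {0..1}"
    then obtain a b where ab: "a \<in> V" "b \<in> V" "X = I +> a" "Y = I +> b" by auto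
    then have "a \<in> carrier A" "b \<in> carrier A" using V(3) by auto
    then have "complex_of_real t \<odot>\<^bsub>Q\<^esub> X \<oplus>\<^bsub>Q\<^esub> complex_of_real (1 - t) \<odot>\<^bsub>Q\<^esub> Y =
        I +> (complex_of_real t \<odot> a \<oplus> complex_of_real (1 - t) \<odot> b)"
      using ab by (simp add: Q_simps)
    then show "complex_of_real t \<odot>\<^bsub>Q\<^esub> X \<oplus>\<^bsub>Q\<^esub> complex_of_real (1 - t) \<odot>\<^bsub>Q\<^esub> Y \<in> (\<lambda>a. I +> a) ` V"
      using V(4) ab t unfolding convex_in_def by blast
  qed
  then show "\<exists>V. openin (lctop Q) V \<and> \<zero>\<^bsub>Q\<^esub> \<in> V \<and> V \<subseteq> U \<and> convex_in Q V"
    using V open_coset by (intro exI[of _ "(\<lambda>a. I +> a) ` V"]) (auto simp: open_map_def zero_Q)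
qed

lemma pow_Q: "a \<in> carrier A \<Longrightarrow> (I +> a) [^]\<^bsub>Q\<^esub> (n::nat) = I +> (a [^] n)"
  by (induction n) (auto simp: one_Q mult_Q)

end

section \<open>Localization of dynamical systems\<close>

locale lc_dynamics = lc_alg A + G: group G for A :: "'a lc_algebra" (structure) and G :: "('g, 'c) monoid_scheme" and \<alpha> +
  assumes dyn: "dynamical_system A G \<alpha>"
begin

lemma auto_Bij: "g \<in> carrier G \<Longrightarrow> \<alpha> g \<in> Bij (carrier A)"
  and auto_ring_hom: "g \<in> carrier G \<Longrightarrow> \<alpha> g \<in> ring_hom A A"
  and auto_smult: "g \<in> carrier G \<Longrightarrow> a \<in> carrier A \<Longrightarrow> \<alpha> g (c \<odot> a) = c \<odot> \<alpha> g a"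
  using dyn by (auto simp: dynamical_system_def hom_def algebra_auto_group_def)

lemma auto_closed [simp]: "g \<in> carrier G \<Longrightarrow> a \<in> carrier A \<Longrightarrow> \<alpha> g a \<in> carrier A"
  and auto_add: "g \<in> carrier G \<Longrightarrow> a \<in> carrier A \<Longrightarrow> b \<in> carrier A \<Longrightarrow> \<alpha> g (a \<oplus> b) = \<alpha> g a \<oplus> \<alpha> g b"
  and auto_mult: "g \<in> carrier G \<Longrightarrow> a \<in> carrier A \<Longrightarrow> b \<in> carrier A \<Longrightarrow> \<alpha> g (a \<otimes> b) = \<alpha> g a \<otimes> \<alpha> g b"
  and auto_one [simp]: "g \<in> carrier G \<Longrightarrow> \<alpha> g \<one> = \<one>"
  using auto_ring_hom[of g] by (auto simp: ring_hom_closed ring_hom_add ring_hom_mult ring_hom_one)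

lemma auto_a_inv: "g \<in> carrier G \<Longrightarrow> a \<in> carrier A \<Longrightarrow> \<alpha> g (\<ominus> a) = \<ominus> \<alpha> g a"
  using auto_smult[of g a "-1"] by (simp add: smult_minus_1)

lemma auto_comp: "g \<in> carrier G \<Longrightarrow> h \<in> carrier G \<Longrightarrow> a \<in> carrier A \<Longrightarrow> \<alpha> (g \<otimes>\<^bsub>G\<^esub> h) a = \<alpha> g (\<alpha> h a)"
  using dyn auto_Bij[of g] auto_Bij[of h]
  by (auto simp: dynamical_system_def hom_def algebra_auto_group_def BijGroup_def compose_def)

text \<open>The image of the identity is idempotent by the homomorphism law and injective as a
  bijection of the carrier, hence the identity.\<close>

lemma auto_id: "a \<in> carrier A \<Longrightarrow> \<alpha> \<one>\<^bsub>G\<^esub> a = a"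
proof -
  assume a: "a \<in> carrier A"
  have "\<alpha> \<one>\<^bsub>G\<^esub> (\<alpha> \<one>\<^bsub>G\<^esub> a) = \<alpha> \<one>\<^bsub>G\<^esub> a"
    using auto_comp[of "\<one>\<^bsub>G\<^esub>" "\<one>\<^bsub>G\<^esub>" a] a by simp
  moreover have "inj_on (\<alpha> \<one>\<^bsub>G\<^esub>) (carrier A)"
    using auto_Bij[of "\<one>\<^bsub>G\<^esub>"] by (auto simp: Bij_def bij_betw_def)
  ultimately show ?thesis
    using a by (simp add: inj_on_eq_iff)
qed

lemma auto_cont: "g \<in> carrier G \<Longrightarrow> continuous_map (lctop A) (lctop A) (\<alpha> g)"
proof -
  assume g: "g \<in> carrier G"
  have "continuous_map (lctop A) (prod_topology (discrete_topology (carrier G)) (lctop A)) (\<lambda>a. (g, a))"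
    using g by (intro continuous_map_pairedI) auto
  moreover have "continuous_map (prod_topology (discrete_topology (carrier G)) (lctop A)) (lctop A) (\<lambda>(g, a). \<alpha> g a)"
    using dyn by (simp add: dynamical_system_def)
  ultimately have "continuous_map (lctop A) (lctop A) ((\<lambda>(g, a). \<alpha> g a) \<circ> (\<lambda>a. (g, a)))"
    by (rule continuous_map_compose)
  then show ?thesis by (simp add: o_def)
qed

text \<open>A continuous linear map commutes with differentiation of curves. Applied to the
  universal family this gives continuity of the induced map on curves.\<close>

lemma auto_curve_family:
  assumes "g \<in> carrier G" "smooth_curve_family A X F"
  shows "smooth_curve_family A X (\<lambda>x. \<alpha> g \<circ> F x)"
  unfolding smooth_curve_family_def o_def
  by (rule allI, rule curve_Ck_family_hom[OF auto_cont])
    (use assms auto_add auto_smult in \<open>auto simp: smooth_curve_family_def\<close>)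

lemma auto_smooth_curve: "g \<in> carrier G \<Longrightarrow> smooth_curve A f \<Longrightarrow> smooth_curve A (\<alpha> g \<circ> f)"
  using auto_curve_family[OF _ smooth_curve_imp_family] smooth_curve_if_family by blast

end

locale lc_localization = lc_dynamics A G \<alpha> for A :: "'a lc_algebra" (structure) and G :: "('g, 'c) monoid_scheme" and \<alpha> +
  fixes z
  assumes z: "z \<in> fixed_center A G \<alpha>"
begin

abbreviation "I \<equiv> localization_ideal A z"
abbreviation "L \<equiv> smooth_localization A z"
abbreviation "fz \<equiv> (\<lambda>t. \<one> \<ominus> complex_of_real t \<odot> z)"

lemma z_carrier [simp]: "z \<in> carrier A"
  and z_fixed [simp]: "g \<in> carrier G \<Longrightarrow> \<alpha> g z = z"
  using z by (auto simp: fixed_center_def)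

sublocale S: lc_alg SC
  by (rule lc_alg_SC)

lemma fz_smooth: "smooth_curve A fz"
proof -
  have "smooth_curve A (\<lambda>t. \<one> \<oplus> (-1) \<odot> (complex_of_real t \<odot> z))"
    by (intro smooth_curve_add smooth_curve_smult smooth_curve_const smooth_curve_linear) auto
  then show ?thesis
    by (simp add: minus_eq smult_minus_1)
qed

lemma ideal_generated: "ideal (genideal SC {fz}) SC"
  by (rule S.genideal_ideal) (use fz_smooth in \<open>auto simp: SC_simps\<close>)

lemma fz_in_ideal: "fz \<in> I"
proof -
  have "fz \<in> genideal SC {fz}"
    by (rule S.genideal_self') (use fz_smooth in \<open>auto simp: SC_simps\<close>)
  moreover have "genideal SC {fz} \<subseteq> topspace (lctop SC)"
    using ideal.Icarr[OF ideal_generated] by auto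
  ultimately show ?thesis
    unfolding localization_ideal_def using closure_of_subset[of "genideal SC {fz}" "lctop SC"] by (rule_tac subsetD)
qed

sublocale L: lc_quotient SC I
proof (intro lc_quotient.intro lc_quotient_axioms.intro S.lc_alg_axioms)
  show "ideal I SC"
    unfolding localization_ideal_def by (rule S.closure_of_ideal[OF ideal_generated])
  show "closedin (lctop SC) I"
    unfolding localization_ideal_def by simp
qed

lemma L_eq: "L = L.Q"
  by (simp add: smooth_localization_def)

text \<open>The closed ideal has no explicit description of its elements; it is controlled from
  above, by exhibiting closed ideals that contain the one curve \<open>1 - t z\<close>.\<close>

lemma ideal_I_minimal:
  assumes "ideal K SC" "closedin (lctop SC) K" "fz \<in> K"
  shows "I \<subseteq> K"
  unfolding localization_ideal_def
  by (rule closure_of_minimal[OF S.genideal_minimal[OF assms(1)] assms(2)]) (use assms(3) in auto)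

lemma SC_a_inv: "f \<in> carrier SC \<Longrightarrow> \<ominus>\<^bsub>SC\<^esub> f = (\<lambda>t. \<ominus> f t)"
  using S.smult_minus_1[of f] by (auto simp: SC_simps smult_minus_1 fun_eq_iff)

lemma SC_minus: "f \<in> carrier SC \<Longrightarrow> g \<in> carrier SC \<Longrightarrow> f \<ominus>\<^bsub>SC\<^esub> g = (\<lambda>t. f t \<ominus> g t)"
  by (simp add: S.minus_eq minus_eq SC_a_inv) (simp add: SC_simps)

lemma auto_SC_closed: "g \<in> carrier G \<Longrightarrow> f \<in> carrier SC \<Longrightarrow> \<alpha> g \<circ> f \<in> carrier SC"
  using auto_smooth_curve by (simp add: SC_simps)

lemma auto_SC_cont: "g \<in> carrier G \<Longrightarrow> continuous_map (lctop SC) (lctop SC) (\<lambda>f. \<alpha> g \<circ> f)"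
  using auto_curve_family[OF _ smooth_curve_family_evaluation] by (simp add: continuous_map_SC_iff)

text \<open>The curves that \<open>\<alpha> g\<close> carries into \<open>I\<close> form a closed
  ideal. It contains \<open>1 - t z\<close> because \<open>z\<close> is fixed, so it contains
  \<open>I\<close>.\<close>

lemma auto_ideal:
  assumes g: "g \<in> carrier G" and f: "f \<in> I"
  shows "\<alpha> g \<circ> f \<in> I"
proof -
  let ?J = "{f \<in> topspace (lctop SC). \<alpha> g \<circ> f \<in> I}"
  have top: "topspace (lctop SC) = carrier SC" by simp
  have "I \<subseteq> ?J"
  proof (rule ideal_I_minimal)
    show "closedin (lctop SC) ?J"
      by (rule closedin_continuous_map_preimage[OF auto_SC_cont[OF g] L.closed])
    have fz: "\<alpha> g \<circ> fz = fz"
      using g by (simp add: fun_eq_iff minus_eq auto_add auto_a_inv auto_smult)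
    show "fz \<in> ?J"
      unfolding top mem_Collect_eq fz using fz_in_ideal fz_smooth by (simp add: SC_simps)
    have add: "\<alpha> g \<circ> (x \<oplus>\<^bsub>SC\<^esub> y) = (\<alpha> g \<circ> x) \<oplus>\<^bsub>SC\<^esub> (\<alpha> g \<circ> y)"
      and mult: "\<alpha> g \<circ> (x \<otimes>\<^bsub>SC\<^esub> y) = (\<alpha> g \<circ> x) \<otimes>\<^bsub>SC\<^esub> (\<alpha> g \<circ> y)"
      if "x \<in> carrier SC" "y \<in> carrier SC" for x y
      using that g by (auto simp: SC_simps fun_eq_iff auto_add auto_mult)
    have zero: "\<alpha> g \<circ> \<zero>\<^bsub>SC\<^esub> = \<zero>\<^bsub>SC\<^esub>"
      using auto_smult[OF g, of \<zero> 0] g by (auto simp: SC_simps fun_eq_iff)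
    have inv: "\<alpha> g \<circ> (\<ominus>\<^bsub>SC\<^esub> x) = \<ominus>\<^bsub>SC\<^esub> (\<alpha> g \<circ> x)" if "x \<in> carrier SC" for x
      using that g by (simp add: SC_a_inv auto_SC_closed) (auto simp: SC_simps fun_eq_iff auto_a_inv)
    show "ideal ?J SC"
      unfolding top
    proof (rule idealI[OF S.ring_axioms])
      show "subgroup {f \<in> carrier SC. \<alpha> g \<circ> f \<in> I} (add_monoid SC)"
      proof (rule S.add.subgroupI)
        show "{f \<in> carrier SC. \<alpha> g \<circ> f \<in> I} \<noteq> {}"
          using zero additive_subgroup.zero_closed[OF L.additive_subgroup_axioms] S.zero_closed by fastforce
      qed (use add inv in \<open>auto simp: a_inv_def[symmetric]\<close>)
    qed (use mult L.I_l_closed L.I_r_closed auto_SC_closed[OF g] in auto)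
  qed
  then show ?thesis using f by auto
qed

lemma localized_action_coset:
  assumes g: "g \<in> carrier G" and f: "f \<in> carrier SC"
  shows "localized_action A z \<alpha> g (I +>\<^bsub>SC\<^esub> f) = I +>\<^bsub>SC\<^esub> (\<alpha> g \<circ> f)"
proof -
  have "I +>\<^bsub>SC\<^esub> f \<in> carrier L"
    using f by (simp add: L_eq L.carrier_Q)
  moreover have "(\<alpha> g \<circ> b) \<ominus>\<^bsub>SC\<^esub> (\<alpha> g \<circ> f) \<in> I" if "b \<in> carrier SC" "b \<ominus>\<^bsub>SC\<^esub> f \<in> I" for b
  proof -
    have "(\<alpha> g \<circ> b) \<ominus>\<^bsub>SC\<^esub> (\<alpha> g \<circ> f) = \<alpha> g \<circ> (b \<ominus>\<^bsub>SC\<^esub> f)"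
      using that(1) f g auto_SC_closed[OF g]
      by (simp add: SC_minus) (auto simp: SC_simps fun_eq_iff minus_eq auto_add auto_a_inv)
    then show ?thesis using auto_ideal[OF g that(2)] by simp
  qed
  ultimately show ?thesis
    using L.union_cosets[OF f, of "\<lambda>f. \<alpha> g \<circ> f"] auto_SC_closed[OF g] by (simp add: localized_action_def)
qed

lemma dynamical_system_localization: "dynamical_system L G (localized_action A z \<alpha>)"
  unfolding dynamical_system_def
proof (intro conjI)
  let ?\<beta> = "localized_action A z \<alpha>"
  show "locally_convex_algebra L"
    unfolding L_eq by (rule L.lc_Q)
  show "group G" by (rule G.group_axioms)
  have cosE: "\<exists>f\<in>carrier SC. X = I +>\<^bsub>SC\<^esub> f" if "X \<in> carrier L" for X
    using that by (auto simp: L_eq L.carrier_Q)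
  have cos: "I +>\<^bsub>SC\<^esub> f \<in> carrier L" if "f \<in> carrier SC" for f
    using that by (auto simp: L_eq L.carrier_Q)
  have comp: "?\<beta> (g \<otimes>\<^bsub>G\<^esub> h) X = ?\<beta> g (?\<beta> h X)" if gh: "g \<in> carrier G" "h \<in> carrier G" and X: "X \<in> carrier L" for g h X
  proof -
    obtain f where f: "f \<in> carrier SC" "X = I +>\<^bsub>SC\<^esub> f" using cosE[OF X] by blast
    have "\<alpha> (g \<otimes>\<^bsub>G\<^esub> h) \<circ> f = \<alpha> g \<circ> (\<alpha> h \<circ> f)"
      using gh f by (auto simp: fun_eq_iff SC_simps auto_comp)
    then show ?thesis
      using gh f auto_SC_closed[of h f] by (simp add: localized_action_coset)
  qed
  have one: "?\<beta> \<one>\<^bsub>G\<^esub> X = X" if X: "X \<in> carrier L" for X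
  proof -
    obtain f where f: "f \<in> carrier SC" "X = I +>\<^bsub>SC\<^esub> f" using cosE[OF X] by blast
    have "\<alpha> \<one>\<^bsub>G\<^esub> \<circ> f = f"
      using f by (auto simp: fun_eq_iff SC_simps auto_id)
    then show ?thesis
      using f by (simp add: localized_action_coset)
  qed
  have closed: "?\<beta> g X \<in> carrier L" if "g \<in> carrier G" "X \<in> carrier L" for g X
    using cosE[OF that(2)] that(1) cos auto_SC_closed by (auto simp: localized_action_coset)
  have bij: "?\<beta> g \<in> Bij (carrier L)" if g: "g \<in> carrier G" for g
  proof -
    have "bij_betw (?\<beta> g) (carrier L) (carrier L)"
      by (rule bij_betwI[where g = "?\<beta> (inv\<^bsub>G\<^esub> g)"])
        (use g closed comp[symmetric] one in auto)
    then show ?thesis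
      by (simp add: Bij_def localized_action_def)
  qed
  show "?\<beta> \<in> hom G (algebra_auto_group L)"
  proof (rule homI)
    fix g assume g: "g \<in> carrier G"
    have "?\<beta> g \<in> ring_hom L L"
    proof (rule ring_hom_memI)
      show "?\<beta> g x \<in> carrier L" if "x \<in> carrier L" for x using closed g that by blast
      show "?\<beta> g (x \<otimes>\<^bsub>L\<^esub> y) = ?\<beta> g x \<otimes>\<^bsub>L\<^esub> ?\<beta> g y" "?\<beta> g (x \<oplus>\<^bsub>L\<^esub> y) = ?\<beta> g x \<oplus>\<^bsub>L\<^esub> ?\<beta> g y"
        if xy: "x \<in> carrier L" "y \<in> carrier L" for x y
      proof -
        obtain a b where ab: "a \<in> carrier SC" "x = I +>\<^bsub>SC\<^esub> a" "b \<in> carrier SC" "y = I +>\<^bsub>SC\<^esub> b"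
          using cosE[OF xy(1)] cosE[OF xy(2)] by blast
        have "\<alpha> g \<circ> (a \<otimes>\<^bsub>SC\<^esub> b) = (\<alpha> g \<circ> a) \<otimes>\<^bsub>SC\<^esub> (\<alpha> g \<circ> b)" "\<alpha> g \<circ> (a \<oplus>\<^bsub>SC\<^esub> b) = (\<alpha> g \<circ> a) \<oplus>\<^bsub>SC\<^esub> (\<alpha> g \<circ> b)"
          using ab g by (auto simp: SC_simps fun_eq_iff auto_add auto_mult)
        then show "?\<beta> g (x \<otimes>\<^bsub>L\<^esub> y) = ?\<beta> g x \<otimes>\<^bsub>L\<^esub> ?\<beta> g y" "?\<beta> g (x \<oplus>\<^bsub>L\<^esub> y) = ?\<beta> g x \<oplus>\<^bsub>L\<^esub> ?\<beta> g y"
          using ab g auto_SC_closed[OF g] by (simp_all add: L_eq L.Q_simps localized_action_coset)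
      qed
      have "\<alpha> g \<circ> \<one>\<^bsub>SC\<^esub> = \<one>\<^bsub>SC\<^esub>"
        using g by (auto simp: SC_simps fun_eq_iff)
      then show "?\<beta> g \<one>\<^bsub>L\<^esub> = \<one>\<^bsub>L\<^esub>"
        using g by (simp add: L_eq L.one_Q localized_action_coset)
    qed
    moreover have "?\<beta> g (c \<odot>\<^bsub>L\<^esub> x) = c \<odot>\<^bsub>L\<^esub> ?\<beta> g x" if x: "x \<in> carrier L" for c x
    proof -
      obtain a where a: "a \<in> carrier SC" "x = I +>\<^bsub>SC\<^esub> a"
        using cosE[OF x] by blast
      have "\<alpha> g \<circ> (c \<odot>\<^bsub>SC\<^esub> a) = c \<odot>\<^bsub>SC\<^esub> (\<alpha> g \<circ> a)"
        using a g by (auto simp: SC_simps fun_eq_iff auto_smult)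
      then show ?thesis
        using a g auto_SC_closed[OF g] by (simp add: L_eq L.Q_simps localized_action_coset)
    qed
    ultimately show "?\<beta> g \<in> carrier (algebra_auto_group L)"
      using bij[OF g] by (simp add: algebra_auto_group_def)
    fix h assume h: "h \<in> carrier G"
    have "?\<beta> (g \<otimes>\<^bsub>G\<^esub> h) = compose (carrier L) (?\<beta> g) (?\<beta> h)"
    proof (rule extensionalityI[where A = "carrier L"])
      show "?\<beta> (g \<otimes>\<^bsub>G\<^esub> h) \<in> extensional (carrier L)"
        by (simp add: localized_action_def)
    qed (use comp g h in \<open>auto simp: compose_def\<close>)
    then show "?\<beta> (g \<otimes>\<^bsub>G\<^esub> h) = ?\<beta> g \<otimes>\<^bsub>algebra_auto_group L\<^esub> ?\<beta> h"
      using bij g h by (simp add: algebra_auto_group_def BijGroup_def)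
  qed
  show "continuous_map (prod_topology (discrete_topology (carrier G)) (lctop L)) (lctop L) (\<lambda>(g, a). ?\<beta> g a)"
  proof (rule continuous_map_discrete_times)
    fix g assume g: "g \<in> carrier G"
    have "continuous_map (lctop SC) (lctop L) ((\<lambda>f. I +>\<^bsub>SC\<^esub> f) \<circ> (\<lambda>f. \<alpha> g \<circ> f))"
      unfolding L_eq by (rule continuous_map_compose[OF auto_SC_cont[OF g] L.continuous_coset])
    then have "continuous_map (lctop SC) (lctop L) (?\<beta> g \<circ> (\<lambda>f. I +>\<^bsub>SC\<^esub> f))"
      by (rule continuous_map_eq) (use g in \<open>auto simp: localized_action_coset\<close>)
    then have "continuous_map (lctop L) (lctop L) (?\<beta> g)"
      using continuous_compose_quotient_map[OF L.quotient_coset] L_eq by metis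
    then show "continuous_map (lctop L) (lctop L) (\<lambda>a. case (g, a) of (g, a) \<Rightarrow> ?\<beta> g a)"
      by simp
  qed
qed

text \<open>In the localization the class of \<open>t \<mapsto> t z\<close> is \<open>1\<close>, so that of \<open>t \<mapsto> t w\<close> is an \<open>n\<close>-th root of unity
  as soon as \<open>w\<^sup>n = z\<^sup>n\<close>.\<close>

lemma localization_root_of_unity:
  assumes w: "w \<in> isotypic_component A G \<alpha> \<xi>" and n: "n > 0" and pow: "w [^] n = z [^] (n::nat)"
  shows "\<exists>a \<in> isotypic_component L G (localized_action A z \<alpha>) \<xi>. a \<in> Units L \<and> a [^]\<^bsub>L\<^esub> n = \<one>\<^bsub>L\<^esub>"
proof -
  have wc [simp]: "w \<in> carrier A" and wg: "\<And>g. g \<in> carrier G \<Longrightarrow> \<alpha> g w = \<xi> g \<odot> w"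
    using w by (auto simp: isotypic_component_def)
  define F where "F v = (\<lambda>t. complex_of_real t \<odot> v)" for v
  have F: "F v \<in> carrier SC" if "v \<in> carrier A" for v
    using smooth_curve_linear[OF that] by (simp add: F_def SC_simps)
  have powF: "F v [^]\<^bsub>SC\<^esub> k = (\<lambda>t. complex_of_real t ^ k \<odot> (v [^] k))" if v: "v \<in> carrier A" for v and k :: nat
  proof (induction k)
    case (Suc k)
    then show ?case
      using v by (simp add: S.nat_pow_Suc) (auto simp: SC_simps F_def fun_eq_iff smult_mult_left smult_mult_right smult_smult mult.commute)
  qed (simp add: SC_simps)
  interpret L': ring L unfolding L_eq by (rule L.ring_Q)
  let ?a = "I +>\<^bsub>SC\<^esub> F w"
  have a: "?a \<in> carrier L"
    using F[OF wc] by (simp add: L_eq L.carrier_Q)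
  have "\<one>\<^bsub>SC\<^esub> \<ominus>\<^bsub>SC\<^esub> F z = fz"
    using F[of z] by (simp add: SC_minus) (simp add: SC_simps F_def)
  then have "I +>\<^bsub>SC\<^esub> F z = \<one>\<^bsub>L\<^esub>"
    using fz_in_ideal L.coset_eq_iff[of "\<one>\<^bsub>SC\<^esub>" "F z"] F[of z] by (simp add: L_eq L.one_Q)
  moreover have "?a [^]\<^bsub>L\<^esub> n = (I +>\<^bsub>SC\<^esub> F z) [^]\<^bsub>L\<^esub> n"
    using F by (simp add: L_eq L.pow_Q powF pow)
  ultimately have pow1: "?a [^]\<^bsub>L\<^esub> n = \<one>\<^bsub>L\<^esub>"
    by simp
  obtain m where m: "n = Suc m" using n gr0_implies_Suc by blast
  \<comment> \<open>Since \<open>n = m + 1\<close>, the power with exponent \<open>m\<close> is a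
    two-sided inverse.\<close>
  have "?a [^]\<^bsub>L\<^esub> m \<otimes>\<^bsub>L\<^esub> ?a = \<one>\<^bsub>L\<^esub>" "?a \<otimes>\<^bsub>L\<^esub> ?a [^]\<^bsub>L\<^esub> m = \<one>\<^bsub>L\<^esub>"
    using pow1 a m L'.nat_pow_Suc2[OF a, of m] by auto
  then have "?a \<in> Units L"
    using a unfolding Units_def by (auto intro!: bexI[of _ "?a [^]\<^bsub>L\<^esub> m"])
  moreover have "localized_action A z \<alpha> g ?a = \<xi> g \<odot>\<^bsub>L\<^esub> ?a" if g: "g \<in> carrier G" for g
  proof -
    have "\<alpha> g \<circ> F w = \<xi> g \<odot>\<^bsub>SC\<^esub> F w"
      using g wg[OF g] by (auto simp: F_def SC_simps fun_eq_iff auto_smult smult_smult mult.commute)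
    then show ?thesis
      using F[OF wc] g by (simp add: localized_action_coset) (simp add: L_eq L.smult_Q)
  qed
  ultimately show ?thesis
    using a pow1 by (auto simp: isotypic_component_def)
qed

text \<open>A continuous character of \<open>A\<close> whose value at \<open>z\<close> has the real inverse \<open>t\<close> extends to the
  localization, by evaluation of curves at \<open>t\<close>.\<close>

lemma localization_character:
  fixes ev :: "'a \<Rightarrow> complex"
  assumes cont: "continuous_map (lctop A) euclidean ev"
    and add: "\<And>a b. a \<in> carrier A \<Longrightarrow> b \<in> carrier A \<Longrightarrow> ev (a \<oplus> b) = ev a + ev b"
    and mult: "\<And>a b. a \<in> carrier A \<Longrightarrow> b \<in> carrier A \<Longrightarrow> ev (a \<otimes> b) = ev a * ev b"
    and smult: "\<And>c a. a \<in> carrier A \<Longrightarrow> ev (c \<odot> a) = c * ev a"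
    and one: "ev \<one> = 1" and t: "complex_of_real t * ev z = 1"
    and x: "x \<in> isotypic_component L G (localized_action A z \<alpha>) \<xi>" "x \<in> Units L"
  shows "\<exists>a\<in>carrier A. ev a \<noteq> 0 \<and> (\<forall>g\<in>carrier G. ev (\<alpha> g a) = \<xi> g * ev a)"
proof -
  have evm: "ev (\<ominus> a) = - ev a" if "a \<in> carrier A" for a
    using smult[OF that, of "-1"] that by (simp add: smult_minus_1)
  have evd: "ev (a \<ominus> b) = ev a - ev b" if "a \<in> carrier A" "b \<in> carrier A" for a b
    using that by (simp add: minus_eq add evm)
  have ev0: "ev \<zero> = 0"
    using smult[of \<zero> 0] by simp
  \<comment> \<open>The kernel of evaluation at time \<open>t\<close> followed by \<open>ev\<close>.
    It is a closed ideal and contains \<open>1 - t z\<close> because \<open>t * ev z = 1\<close>; so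
    evaluation factors through the localization.\<close>
  let ?K = "{f \<in> topspace (lctop SC). ev (f t) \<in> {0}}"
  have top: "topspace (lctop SC) = carrier SC" by simp
  have "I \<subseteq> ?K"
  proof (rule ideal_I_minimal)
    have "continuous_map (prod_topology (lctop SC) euclideanreal) (lctop A) (\<lambda>(f, t). f t)"
      using smooth_curve_family_evaluation curve_Ck_family_continuous[of 0 A "lctop SC" "\<lambda>f. f"] by (simp add: smooth_curve_family_def)
    moreover have "continuous_map (lctop SC) (prod_topology (lctop SC) euclideanreal) (\<lambda>f. (f, t))"
      by (intro continuous_map_pairedI) auto
    ultimately have "continuous_map (lctop SC) (lctop A) ((\<lambda>(f, t). f t) \<circ> (\<lambda>f. (f, t)))"
      by (rule continuous_map_compose[rotated])
    from continuous_map_compose[OF this cont]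
    have "continuous_map (lctop SC) euclidean (\<lambda>f. ev (f t))"
      by (simp add: o_def)
    then show "closedin (lctop SC) ?K"
      by (rule closedin_continuous_map_preimage) simp
    show "fz \<in> ?K"
      using fz_smooth t one by (auto simp: SC_simps evd smult)
    have inv: "ev ((\<ominus>\<^bsub>SC\<^esub> f) t) = - ev (f t)" if "f \<in> carrier SC" for f
      using that evm by (simp add: SC_a_inv) (simp add: SC_simps)
    show "ideal ?K SC"
      unfolding top
    proof (rule idealI[OF S.ring_axioms])
      show "subgroup {f \<in> carrier SC. ev (f t) \<in> {0}} (add_monoid SC)"
      proof (rule S.add.subgroupI)
        show "{f \<in> carrier SC. ev (f t) \<in> {0}} \<noteq> {}"
          using S.zero_closed ev0 by (auto simp: SC_simps intro!: exI[of _ "\<lambda>t. \<zero>"])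
        show "a \<oplus>\<^bsub>SC\<^esub> b \<in> {f \<in> carrier SC. ev (f t) \<in> {0}}"
          if "a \<in> {f \<in> carrier SC. ev (f t) \<in> {0}}" "b \<in> {f \<in> carrier SC. ev (f t) \<in> {0}}" for a b
          using that S.a_closed[of a b] by (auto simp: SC_simps add)
      qed (use inv in \<open>auto simp: a_inv_def[symmetric]\<close>)
      fix a x assume "a \<in> {f \<in> carrier SC. ev (f t) \<in> {0}}" "x \<in> carrier SC"
      then show "x \<otimes>\<^bsub>SC\<^esub> a \<in> {f \<in> carrier SC. ev (f t) \<in> {0}}" "a \<otimes>\<^bsub>SC\<^esub> x \<in> {f \<in> carrier SC. ev (f t) \<in> {0}}"
        using S.m_closed[of a x] S.m_closed[of x a] by (auto simp: SC_simps mult)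
    qed
  qed
  then have cong: "ev (f t) = ev (h t)" if "f \<in> carrier SC" "h \<in> carrier SC" "I +>\<^bsub>SC\<^esub> f = I +>\<^bsub>SC\<^esub> h" for f h
    using that L.coset_eq_iff[of f h] by (auto simp: SC_minus) (auto simp: SC_simps evd subset_iff)
  have xL: "x \<in> carrier L" using x(2) by (auto simp: Units_def)
  then obtain f where f: "f \<in> carrier SC" "x = I +>\<^bsub>SC\<^esub> f"
    by (auto simp: L_eq L.carrier_Q)
  obtain y where y: "y \<in> carrier L" "x \<otimes>\<^bsub>L\<^esub> y = \<one>\<^bsub>L\<^esub>"
    using x(2) by (auto simp: Units_def)
  then obtain h where h: "h \<in> carrier SC" "y = I +>\<^bsub>SC\<^esub> h"
    by (auto simp: L_eq L.carrier_Q)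
  \<comment> \<open>Representatives of a unit and its inverse multiply to 1 modulo the ideal.
    Evaluation turns this into an equation between numbers, which excludes
    \<open>ev (f t) = 0\<close>.\<close>
  have "ev ((f \<otimes>\<^bsub>SC\<^esub> h) t) = ev (\<one>\<^bsub>SC\<^esub> t)"
    using y f h by (intro cong) (auto simp: L_eq L.mult_Q L.one_Q)
  then have "ev (f t) * ev (h t) = 1"
    using f h by (simp add: SC_simps mult one)
  then have "ev (f t) \<noteq> 0" by auto
  moreover have "ev (\<alpha> g (f t)) = \<xi> g * ev (f t)" if g: "g \<in> carrier G" for g
  proof -
    have "localized_action A z \<alpha> g x = \<xi> g \<odot>\<^bsub>L\<^esub> x"
      using x(1) g by (auto simp: isotypic_component_def)
    then have "I +>\<^bsub>SC\<^esub> (\<alpha> g \<circ> f) = I +>\<^bsub>SC\<^esub> (\<xi> g \<odot>\<^bsub>SC\<^esub> f)"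
      using f g by (simp add: localized_action_coset) (simp add: L_eq L.smult_Q)
    from cong[OF auto_SC_closed[OF g f(1)] S.smult_in[OF f(1)] this]
    show ?thesis
      using f by (simp add: SC_simps smult)
  qed
  moreover have "f t \<in> carrier A" using f by (simp add: SC_simps)
  ultimately show ?thesis by blast
qed

end

section \<open>Bases and characters of finite abelian groups\<close>

text \<open>An integer linear combination of the elements of \<open>T\<close>, in multiplicative
  notation.\<close>

definition int_span_elt :: "('g, 'c) monoid_scheme \<Rightarrow> 'g set \<Rightarrow> ('g \<Rightarrow> int) \<Rightarrow> 'g" where
  "int_span_elt G T m = finprod G (\<lambda>t. t [^]\<^bsub>G\<^esub> m t) T"

context comm_group
begin

lemma ord_pos: "finite (carrier G) \<Longrightarrow> x \<in> carrier G \<Longrightarrow> 0 < ord x"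
  using ord_ge_1[of x] by linarith

lemma int_span_elt_closed [simp]: "T \<subseteq> carrier G \<Longrightarrow> int_span_elt G T m \<in> carrier G"
  unfolding int_span_elt_def by (intro finprod_closed) auto

lemma int_span_elt_insert:
  "finite T \<Longrightarrow> T \<subseteq> carrier G \<Longrightarrow> t \<in> carrier G \<Longrightarrow> t \<notin> T \<Longrightarrow>
     int_span_elt G (insert t T) m = t [^] m t \<otimes> int_span_elt G T m"
  unfolding int_span_elt_def by (intro finprod_insert) auto

lemma int_span_elt_remove:
  assumes "finite T" "T \<subseteq> carrier G" "t \<in> T"
  shows "int_span_elt G T m = t [^] m t \<otimes> int_span_elt G (T - {t}) m"
  using int_span_elt_insert[of "T - {t}" t m] assms by (auto simp: insert_absorb)

lemma int_span_elt_cong: "T \<subseteq> carrier G \<Longrightarrow> (\<And>t. t \<in> T \<Longrightarrow> m t = m' t) \<Longrightarrow> int_span_elt G T m = int_span_elt G T m'"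
  unfolding int_span_elt_def by (intro finprod_cong') auto

lemma int_span_elt_add: "T \<subseteq> carrier G \<Longrightarrow> int_span_elt G T (\<lambda>t. m t + m' t) = int_span_elt G T m \<otimes> int_span_elt G T m'"
proof -
  assume T: "T \<subseteq> carrier G"
  have "int_span_elt G T (\<lambda>t. m t + m' t) = finprod G (\<lambda>t. t [^] m t \<otimes> t [^] m' t) T"
    unfolding int_span_elt_def using T by (intro finprod_cong') (auto simp: int_pow_mult)
  also have "\<dots> = int_span_elt G T m \<otimes> int_span_elt G T m'"
    unfolding int_span_elt_def using T by (intro finprod_multf) auto
  finally show ?thesis .
qed

lemma int_span_elt_zero: "int_span_elt G T (\<lambda>t. 0) = \<one>"
  unfolding int_span_elt_def by (intro finprod_one_eqI) simp

lemma int_span_elt_pow: "finite T \<Longrightarrow> T \<subseteq> carrier G \<Longrightarrow> int_span_elt G T m [^] (k::int) = int_span_elt G T (\<lambda>t. m t * k)"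
  by (induction T rule: finite_induct)
    (auto simp: int_span_elt_insert int_pow_distrib int_pow_pow, simp_all add: int_span_elt_def)

lemma int_span_elt_minus:
  assumes "finite T" "T \<subseteq> carrier G"
  shows "int_span_elt G T (\<lambda>t. - m t) = inv (int_span_elt G T m)"
  using int_span_elt_pow[OF assms, of m "-1"] assms by (simp add: int_pow_neg)

lemma int_span_elt_single:
  assumes "finite T" "T \<subseteq> carrier G" "t \<in> T"
  shows "int_span_elt G T (\<lambda>s. if s = t then k else 0) = t [^] k"
proof -
  have "int_span_elt G (T - {t}) (\<lambda>s. if s = t then k else 0) = int_span_elt G (T - {t}) (\<lambda>s. 0)"
    using assms by (intro int_span_elt_cong) auto
  then show ?thesis
    using assms by (simp add: int_span_elt_remove[OF assms] int_span_elt_zero subset_iff)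
qed

text \<open>Integer combinations are closed under products and inverses by commutativity. From here
  on a relation between generators is a coefficient function.\<close>

lemma generate_eq_int_span:
  assumes T: "finite T" "T \<subseteq> carrier G"
  shows "generate G T = range (int_span_elt G T)"
proof
  show "generate G T \<subseteq> range (int_span_elt G T)"
  proof
    fix x assume "x \<in> generate G T"
    then show "x \<in> range (int_span_elt G T)"
    proof induction
      case one
      show ?case using int_span_elt_zero[of T] by (metis rangeI)
    next
      case (incl h)
      then show ?case
        using int_span_elt_single[OF T, of h 1] T(2) by (intro range_eqI[of _ _ "\<lambda>s. if s = h then 1 else 0"]) (auto simp: subset_iff)
    next
      case (inv h)
      then show ?case
        using int_span_elt_single[OF T, of h "-1"] T(2)
        by (intro range_eqI[of _ _ "\<lambda>s. if s = h then -1 else 0"]) (auto simp: subset_iff int_pow_neg)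
    next
      case (eng h1 h2)
      then obtain m m' where "h1 = int_span_elt G T m" "h2 = int_span_elt G T m'" by auto
      then show ?case
        using int_span_elt_add[OF T(2), of m m'] by (metis rangeI)
    qed
  qed
  have fin: "finprod G f U \<in> generate G T" if "finite U" "f \<in> U \<rightarrow> generate G T" for f U
    using that
  proof (induction U rule: finite_induct)
    case (insert u U)
    then have "f \<in> insert u U \<rightarrow> carrier G"
      using generate_incl[OF T(2)] by blast
    with insert show ?case
      by (simp add: generate.eng)
  qed (simp add: generate.one)
  have "(\<lambda>t. t [^] m t) \<in> T \<rightarrow> generate G T" for m :: "'a \<Rightarrow> int"
    using subgroup_int_pow_closed[OF generate_is_subgroup[OF T(2)] generate.incl] by blast
  from fin[OF T(1) this] show "range (int_span_elt G T) \<subseteq> generate G T"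
    by (auto simp: int_span_elt_def)
qed

lemma generate_insert_eqI:
  assumes "R \<subseteq> carrier G" "R' \<subseteq> carrier G" "a \<in> carrier G" "b \<in> carrier G" "generate G R = generate G R'"
    and "a \<in> generate G (insert b R')" "b \<in> generate G (insert a R)"
  shows "generate G (insert a R) = generate G (insert b R')"
proof -
  have R: "R \<subseteq> generate G (insert b R')" "R' \<subseteq> generate G (insert a R)"
    using assms(5) generate.incl[of _ R G] generate.incl[of _ R' G] mono_generate[of R' "insert b R'"]
      mono_generate[of R "insert a R"] by blast+
  show ?thesis
    using assms R by (intro equalityI generate_subgroup_incl generate_is_subgroup) auto
qed

text \<open>In a finite group coefficients cannot be unique; only the powers
  \<open>s [^] m s\<close> can be required to be trivial. This says that the cyclic subgroups form
  an internal direct product.\<close>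

definition independent_set :: "'a set \<Rightarrow> bool" where
  "independent_set S \<longleftrightarrow> (\<forall>m. int_span_elt G S m = \<one> \<longrightarrow> (\<forall>s\<in>S. s [^] m s = \<one>))"

text \<open>Minimality refers to the subgroup generated by \<open>T\<close> instead of the whole
  group, so that an induction can pass to the span of fewer generators.\<close>

definition minimal_generators :: "'a set \<Rightarrow> bool" where
  "minimal_generators T \<longleftrightarrow> finite T \<and> T \<subseteq> carrier G \<and>
     (\<forall>T'. finite T' \<and> T' \<subseteq> carrier G \<and> generate G T' = generate G T \<longrightarrow> card T \<le> card T')"

text \<open>
  Among all generating sets of minimal cardinality and all relations between their elements we take a
  relation with the least positive coefficient \<open>a\<close>, attached to the generator \<open>s\<close>. Minimality makes
  \<open>a\<close> divide the other coefficients, so \<open>s\<close> can be replaced by an element \<open>y\<close> of order \<open>a\<close> whose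
  cyclic group meets the span of the other generators trivially.
\<close>

lemma independent_generators_exist:
  assumes fin: "finite (carrier G)" and "minimal_generators T"
  shows "\<exists>S. finite S \<and> S \<subseteq> carrier G \<and> generate G S = generate G T \<and> card S = card T \<and> independent_set S"
  using assms(2)
proof (induction "card T" arbitrary: T)
  case 0
  then have "T = {}" by (auto simp: minimal_generators_def)
  then show ?case by (intro exI[of _ "{}"]) (auto simp: independent_set_def)
next
  case (Suc n)
  define H where "H = generate G T"
  define gens where "gens T' \<longleftrightarrow> finite T' \<and> T' \<subseteq> carrier G \<and> generate G T' = H \<and> card T' = Suc n" for T'
  have min: "Suc n \<le> card T'" if "finite T'" "T' \<subseteq> carrier G" "generate G T' = H" for T'
    using Suc that by (auto simp: minimal_generators_def H_def)
  have gensI: "gens (insert x R) \<and> x \<notin> R"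
    if "finite R" "R \<subseteq> carrier G" "x \<in> carrier G" "generate G (insert x R) = H" "card R \<le> n" for x R
    using min[of "insert x R"] that by (auto simp: gens_def card_insert_if split: if_splits)
  \<comment> \<open>Coefficients of relations over every generating set of the minimal size, not
    only over \<open>T\<close>: the contradictions below change the generating set. The order of a
    generator shows that such a number exists.\<close>
  define coeff where "coeff a \<longleftrightarrow> a > 0 \<and> (\<exists>T' s m. gens T' \<and> s \<in> T' \<and> int_span_elt G T' m = \<one> \<and> m s = int a)" for a
  have gensT: "gens T"
    using Suc by (auto simp: gens_def minimal_generators_def H_def)
  then obtain s0 where s0: "s0 \<in> T" by (auto simp: gens_def dest: card_eq_SucD)
  have T: "finite T" "T \<subseteq> carrier G" using gensT by (auto simp: gens_def)
  have "ord s0 > 0" using s0 T fin ord_pos by blast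
  moreover have "int_span_elt G T (\<lambda>s. if s = s0 then int (ord s0) else 0) = \<one>"
    using int_span_elt_single[OF T s0] s0 T by (auto simp: int_pow_int subset_iff)
  ultimately have "coeff (ord s0)"
    unfolding coeff_def using gensT s0 by force
  define a where "a = (LEAST a. coeff a)"
  have "coeff a" unfolding a_def by (rule LeastI) fact
  have least: "\<not> coeff b" if "b < a" for b using that not_less_Least unfolding a_def by blast
  obtain T' s m where T': "gens T'" "s \<in> T'" "int_span_elt G T' m = \<one>" "m s = int a" and a: "a > 0"
    using \<open>coeff a\<close> unfolding coeff_def by blast
  have T'f: "finite T'" "T' \<subseteq> carrier G" "generate G T' = H" "card T' = Suc n"
    using T'(1) by (auto simp: gens_def)
  define R where "R = T' - {s}"
  have R: "finite R" "R \<subseteq> carrier G" "card R = n" "s \<notin> R" "s \<in> carrier G" "insert s R = T'"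
    using T'f T'(2) by (auto simp: R_def)
  have rel: "s [^] int a \<otimes> int_span_elt G R m = \<one>"
    using int_span_elt_insert[OF R(1,2,5,4), of m] T' R by simp
  \<comment> \<open>Multiplying \<open>s\<close> by an element of the span of the others can be
    undone, so it preserves the generated group; minimality prevents the new element from lying in
    \<open>R\<close>.\<close>
  have replace: "gens (insert (s \<otimes> r) R) \<and> s \<otimes> r \<notin> R" if r: "r \<in> generate G R" for r
  proof (rule gensI[OF R(1,2)])
    have rc: "r \<in> carrier G" using r generate_incl[OF R(2)] by blast
    then show c: "s \<otimes> r \<in> carrier G" using R by simp
    have mono: "generate G R \<subseteq> generate G (insert x R)" for x by (rule mono_generate) auto
    have "s = (s \<otimes> r) \<otimes> inv r" using rc R by (simp add: m_assoc)
    moreover have "inv r \<in> generate G (insert (s \<otimes> r) R)"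
      using r mono[of "s \<otimes> r"] c R(2) by (intro generate_m_inv_closed) auto
    ultimately have "s \<in> generate G (insert (s \<otimes> r) R)"
      by (metis generate.eng generate.incl insertI1)
    moreover have "s \<otimes> r \<in> generate G (insert s R)"
      using r mono[of s] by (intro generate.eng[OF generate.incl]) auto
    ultimately have "generate G (insert (s \<otimes> r) R) = generate G (insert s R)"
      using R c by (intro generate_insert_eqI) auto
    then show "generate G (insert (s \<otimes> r) R) = H" using R T'f by simp
  qed (use R in simp)
  have dvd: "int a dvd m t" if t: "t \<in> R" for t
  proof (rule ccontr)
    assume nd: "\<not> int a dvd m t"
    define q where "q = m t div int a"
    define r where "r = m t mod int a"
    have "r \<ge> 0" "r < int a" "r \<noteq> 0" using nd a by (simp_all add: r_def dvd_eq_mod_eq_0)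
    then have r: "r > 0" "r < int a" by linarith+
    have tc: "t \<in> carrier G" using t R by auto
    \<comment> \<open>Absorbing \<open>t [^] q\<close> into \<open>s\<close> leaves the relation
      true with coefficient \<open>a\<close> at \<open>s'\<close> and the remainder \<open>r\<close>
      at \<open>t\<close>. A remainder strictly between 0 and \<open>a\<close> contradicts the
      choice of \<open>a\<close>.\<close>
    define s' where "s' = s \<otimes> t [^] q"
    have "t [^] q \<in> generate G R"
      using subgroup_int_pow_closed[OF generate_is_subgroup[OF R(2)] generate.incl[OF t]] .
    then have g: "gens (insert s' R)" "s' \<notin> R"
      using replace by (auto simp: s'_def)
    have s'c: "s' \<in> carrier G" using R tc by (simp add: s'_def)
    define m' where "m' = m(s' := int a, t := r)"
    have "s' \<noteq> t" using g t by auto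
    have R': "finite (R - {t})" "R - {t} \<subseteq> carrier G" using R by auto
    have "int_span_elt G (insert s' R) m' = s' [^] int a \<otimes> (t [^] r \<otimes> int_span_elt G (R - {t}) m')"
      using int_span_elt_insert[OF R(1,2) s'c g(2), of m'] int_span_elt_remove[OF R(1,2) t, of m'] \<open>s' \<noteq> t\<close>
      by (simp add: m'_def)
    also have "int_span_elt G (R - {t}) m' = int_span_elt G (R - {t}) m"
      using R' g(2) by (intro int_span_elt_cong) (auto simp: m'_def)
    also have "s' [^] int a \<otimes> (t [^] r \<otimes> int_span_elt G (R - {t}) m) =
        s [^] int a \<otimes> (t [^] (q * int a + r) \<otimes> int_span_elt G (R - {t}) m)"
      using R R' tc by (simp add: s'_def int_pow_distrib int_pow_pow int_pow_mult m_assoc)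
    also have "q * int a + r = m t" by (simp add: q_def r_def)
    also have "t [^] m t \<otimes> int_span_elt G (R - {t}) m = int_span_elt G R m"
      using int_span_elt_remove[OF R(1,2) t] by simp
    finally have "int_span_elt G (insert s' R) m' = \<one>" using rel by simp
    moreover have "m' t = int (nat r)" using r by (simp add: m'_def)
    ultimately have "coeff (nat r)"
      unfolding coeff_def using g(1) t r by (metis insertI2 zero_less_nat_eq)
    then show False using least[of "nat r"] r by auto
  qed
  \<comment> \<open>All coefficients on \<open>R\<close> are multiples of \<open>a\<close>, so the
    relation says that the product of \<open>s\<close> with this \<open>u\<close> has a-th power
    1.\<close>
  define u where "u = int_span_elt G R (\<lambda>t. m t div int a)"
  have u: "u \<in> generate G R" "u \<in> carrier G"
    using generate_eq_int_span[OF R(1,2)] R by (auto simp: u_def)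
  define y where "y = s \<otimes> u"
  have y: "gens (insert y R)" "y \<notin> R" "y \<in> carrier G"
    using replace[OF u(1)] u R by (auto simp: y_def)
  have "int_span_elt G R (\<lambda>t. m t div int a * int a) = int_span_elt G R m"
    using dvd R by (intro int_span_elt_cong) auto
  then have ya: "y [^] int a = \<one>"
    using R u rel by (simp add: y_def int_pow_distrib) (simp add: u_def int_span_elt_pow)
  \<comment> \<open>Modulo \<open>a\<close> the coefficient of \<open>y\<close> may be replaced by
    its remainder, since \<open>y [^] int a = \<one>\<close>. A positive remainder would be a
    smaller element of \<open>coeff\<close>, so \<open>y\<close> contributes nothing to any
    relation.\<close>
  have yrel: "y [^] k y = \<one>" if k: "int_span_elt G (insert y R) k = \<one>" for k
  proof -
    define r where "r = k y mod int a"
    have r: "r \<ge> 0" "r < int a" using a by (simp_all add: r_def)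
    have "y [^] k y = y [^] (int a * (k y div int a) + r)" by (simp add: r_def)
    also have "\<dots> = (y [^] int a) [^] (k y div int a) \<otimes> y [^] r"
      using y by (simp add: int_pow_mult int_pow_pow)
    finally have yr: "y [^] k y = y [^] r" using ya y by simp
    have "int_span_elt G R (k(y := r)) = int_span_elt G R k"
      using R y by (intro int_span_elt_cong) auto
    then have "int_span_elt G (insert y R) (k(y := r)) = \<one>"
      using k int_span_elt_insert[OF R(1,2) y(3,2)] yr by simp
    then have "coeff (nat r)" if "r > 0"
      unfolding coeff_def using y(1) that by (intro conjI exI[of _ "insert y R"] exI[of _ y] exI[of _ "k(y := r)"]) auto
    then have "r = 0" using least[of "nat r"] r by linarith
    then show ?thesis using yr by simp
  qed
  have H_y: "generate G (insert y R) = H" using y by (simp add: gens_def)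
  have yR': "generate G (insert y R') = H" if "R' \<subseteq> carrier G" "generate G R' = generate G R" for R'
    unfolding H_y[symmetric] using that R y
    by (intro generate_insert_eqI) (auto intro: generate.incl)
  \<comment> \<open>A smaller generating set for the span of \<open>R\<close> would, together with
    \<open>y\<close>, generate \<open>H\<close> with fewer than \<open>Suc n\<close>
    elements.\<close>
  have "minimal_generators R"
    unfolding minimal_generators_def
  proof (intro conjI allI impI)
    fix R' assume R': "finite R' \<and> R' \<subseteq> carrier G \<and> generate G R' = generate G R"
    then have "Suc n \<le> card (insert y R')"
      using yR'[of R'] y by (intro min) auto
    then show "card R \<le> card R'"
      using R R' by (auto simp: card_insert_if split: if_splits)
  qed (use R in auto)
  then obtain S where S: "finite S" "S \<subseteq> carrier G" "generate G S = generate G R" "card S = n" "independent_set S"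
    using Suc.hyps(1)[of R] R by auto
  have yS: "gens (insert y S)" "y \<notin> S"
    using gensI[OF S(1,2) y(3) yR'[OF S(2,3)]] S by auto
  have "independent_set (insert y S)"
    unfolding independent_set_def
  proof (intro allI impI)
    fix k assume k: "int_span_elt G (insert y S) k = \<one>"
    have eq: "y [^] k y \<otimes> int_span_elt G S k = \<one>"
      using k int_span_elt_insert[OF S(1,2) y(3) yS(2)] by simp
    \<comment> \<open>\<open>yrel\<close> concerns relations over \<open>insert y R\<close>. The
      part of the relation over \<open>S\<close> is therefore rewritten over \<open>R\<close>, which
      has the same span; since \<open>y \<notin> R\<close> the coefficient of \<open>y\<close> can
      be set freely.\<close>
    have "int_span_elt G S k \<in> range (int_span_elt G R)"
      using generate_eq_int_span[OF R(1,2)] generate_eq_int_span[OF S(1,2)] S(3) by auto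
    then obtain k2 where k2: "int_span_elt G S k = int_span_elt G R k2" by auto
    have "int_span_elt G R (k2(y := k y)) = int_span_elt G R k2"
      using R y by (intro int_span_elt_cong) auto
    then have "int_span_elt G (insert y R) (k2(y := k y)) = \<one>"
      using int_span_elt_insert[OF R(1,2) y(3,2)] eq k2 by simp
    from yrel[OF this] have yk: "y [^] k y = \<one>" by simp
    then have "int_span_elt G S k = \<one>" using eq S by simp
    then show "\<forall>s\<in>insert y S. s [^] k s = \<one>"
      using S(5) yk by (auto simp: independent_set_def)
  qed
  then show ?case
    using yS Suc.hyps(2) by (intro exI[of _ "insert y S"]) (auto simp: gens_def H_def)
qed

section \<open>Cyclic bases as independent generating sets\<close>

lemma finprod_eq_int_span:
  assumes "finite S" "S \<subseteq> carrier G" "x \<in> (\<Pi>\<^sub>E s\<in>S. carrier (subgroup_generated G {s}))"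
  obtains m where "finprod G x S = int_span_elt G S m" "\<And>s. s \<in> S \<Longrightarrow> x s = s [^] m s"
proof -
  have "\<exists>k::int. x s = s [^] k" if "s \<in> S" for s
    using assms that carrier_subgroup_generated_by_singleton[of s] by (fastforce simp: PiE_iff)
  then obtain m :: "'a \<Rightarrow> int" where m: "\<And>s. s \<in> S \<Longrightarrow> x s = s [^] m s" by metis
  moreover have "finprod G x S = int_span_elt G S m"
    unfolding int_span_elt_def using assms m by (intro finprod_cong') auto
  ultimately show thesis using that by blast
qed

text \<open>A generating set of least cardinality is replaced by an independent one of the same
  size. Generation makes the product map onto, independence makes it injective.\<close>

lemma minimal_cyclic_basis_exists:
  assumes fin: "finite (carrier G)"
  shows "\<exists>S. minimal_cyclic_basis G S"
proof -
  define P where "P k \<longleftrightarrow> (\<exists>T. finite T \<and> T \<subseteq> carrier G \<and> generate G T = carrier G \<and> card T = k)" for k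
  have "generate G (carrier G) = carrier G"
    by (intro equalityI generate_incl subsetI) (auto intro: generate.incl)
  then have "P (card (carrier G))" unfolding P_def using fin by blast
  then have "P (LEAST k. P k)" by (rule LeastI)
  then obtain T where T: "finite T" "T \<subseteq> carrier G" "generate G T = carrier G" "card T = (LEAST k. P k)"
    unfolding P_def by blast
  have least: "card T \<le> card T'" if "finite T'" "T' \<subseteq> carrier G" "generate G T' = carrier G" for T'
    unfolding T(4) by (rule Least_le) (use that in \<open>auto simp: P_def\<close>)
  have minT: "minimal_generators T"
    using T least by (auto simp: minimal_generators_def)
  obtain S where S: "finite S" "S \<subseteq> carrier G" "generate G S = carrier G" "card S = card T" "independent_set S"
    using independent_generators_exist[OF fin minT] T(3) by auto
  let ?P = "product_group S (\<lambda>s. subgroup_generated G {s})"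
  have sub: "carrier (subgroup_generated G {s}) \<subseteq> carrier G" for s
    by (rule carrier_subgroup_generated_subset)
  have "(\<lambda>x. finprod G x S) \<in> iso ?P G"
  proof (rule isoI)
    show "(\<lambda>x. finprod G x S) \<in> hom ?P G"
    proof (rule homI)
      fix x assume "x \<in> carrier ?P"
      then have x: "x \<in> S \<rightarrow> carrier G" using sub by (fastforce simp: PiE_iff)
      then show "finprod G x S \<in> carrier G" by simp
      fix y assume "y \<in> carrier ?P"
      then have y: "y \<in> S \<rightarrow> carrier G" using sub by (fastforce simp: PiE_iff)
      have "finprod G (x \<otimes>\<^bsub>?P\<^esub> y) S = finprod G (\<lambda>s. x s \<otimes> y s) S"
        using x y by (intro finprod_cong') auto
      then show "finprod G (x \<otimes>\<^bsub>?P\<^esub> y) S = finprod G x S \<otimes> finprod G y S"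
        using x y by simp
    qed
    show "bij_betw (\<lambda>x. finprod G x S) (carrier ?P) (carrier G)"
      unfolding bij_betw_def
    proof
      show "inj_on (\<lambda>x. finprod G x S) (carrier ?P)"
      proof (rule inj_onI)
        fix x y assume xy: "x \<in> carrier ?P" "y \<in> carrier ?P" "finprod G x S = finprod G y S"
        obtain m where m: "finprod G x S = int_span_elt G S m" "\<And>s. s \<in> S \<Longrightarrow> x s = s [^] m s"
          using finprod_eq_int_span[OF S(1,2)] xy(1) by auto
        obtain k where k: "finprod G y S = int_span_elt G S k" "\<And>s. s \<in> S \<Longrightarrow> y s = s [^] k s"
          using finprod_eq_int_span[OF S(1,2)] xy(2) by auto
        have "int_span_elt G S (\<lambda>s. m s + - k s) = \<one>"
          using S m(1) k(1) xy(3) by (simp only: int_span_elt_add int_span_elt_minus) simp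
        then have "s [^] (m s + - k s) = \<one>" if "s \<in> S" for s
          using S(5) that by (auto simp: independent_set_def)
        then have "x s = y s" if "s \<in> S" for s
          using m(2)[OF that] k(2)[OF that] that S(2) int_pow_eq[of s "k s" "m s"] int_pow_eq_id[of s "m s - k s"]
          by auto
        then show "x = y" using xy by (auto intro: PiE_ext)
      qed
      show "(\<lambda>x. finprod G x S) ` carrier ?P = carrier G"
      proof
        show "carrier G \<subseteq> (\<lambda>x. finprod G x S) ` carrier ?P"
        proof
          fix g assume "g \<in> carrier G"
          then obtain m where m: "g = int_span_elt G S m"
            using generate_eq_int_span[OF S(1,2)] S(3) by auto
          let ?x = "\<lambda>s\<in>S. s [^] m s"
          have "?x \<in> carrier ?P"
            using S carrier_subgroup_generated_by_singleton by auto
          moreover have "finprod G ?x S = g"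
            unfolding m int_span_elt_def using S by (intro finprod_cong') auto
          ultimately show "g \<in> (\<lambda>x. finprod G x S) ` carrier ?P" by blast
        qed
      qed (use sub in \<open>fastforce intro!: finprod_closed simp: PiE_iff\<close>)
    qed
  qed
  then show ?thesis
    using S least unfolding minimal_cyclic_basis_def by auto
qed

text \<open>A relation exhibits a tuple of powers with product 1, as has the trivial tuple;
  injectivity of the product map identifies them.\<close>

lemma minimal_cyclic_basis_independent:
  assumes "minimal_cyclic_basis G S"
  shows "finite S" "S \<subseteq> carrier G" "generate G S = carrier G" "independent_set S"
proof -
  show S: "finite S" "S \<subseteq> carrier G" "generate G S = carrier G"
    using assms by (auto simp: minimal_cyclic_basis_def)
  let ?P = "product_group S (\<lambda>s. subgroup_generated G {s})"
  have inj: "inj_on (\<lambda>x. finprod G x S) (carrier ?P)"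
    using assms by (auto simp: minimal_cyclic_basis_def iso_def bij_betw_def)
  show "independent_set S"
    unfolding independent_set_def
  proof (intro allI impI ballI)
    fix m s assume m: "int_span_elt G S m = \<one>" and s: "s \<in> S"
    let ?x = "\<lambda>s\<in>S. s [^] m s" and ?e = "\<lambda>s\<in>S. \<one>"
    have "?x \<in> carrier ?P"
      using S carrier_subgroup_generated_by_singleton by auto
    moreover have "?e \<in> carrier ?P"
      by (auto simp: carrier_subgroup_generated intro: generate.one)
    moreover have "finprod G ?x S = finprod G ?e S"
    proof -
      have "finprod G ?x S = int_span_elt G S m"
        unfolding int_span_elt_def using S by (intro finprod_cong') auto
      moreover have "finprod G ?e S = \<one>" by (rule finprod_one_eqI) auto
      ultimately show ?thesis using m by simp
    qed
    ultimately have "?x = ?e" using inj by (rule_tac inj_onD)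
    from fun_cong[OF this, of s] show "s [^] m s = \<one>" using s by simp
  qed
qed

section \<open>Characters of a group with a cyclic basis\<close>

lemma dual_generator_eq:
  assumes fin: "finite (carrier G)" and S: "minimal_cyclic_basis G S" and s: "s \<in> S"
  shows "dual_generator G S s \<in> dual_group_set G"
    and "dual_generator G S s (int_span_elt G S m) = exp (2 * complex_of_real pi * \<i> * of_int (m s) / of_nat (ord s))"
proof -
  note SS = minimal_cyclic_basis_independent[OF S]
  have sc: "s \<in> carrier G" using SS s by auto
  have ord: "ord s > 0" using fin sc ord_pos by blast
  define e where "e k = exp (2 * complex_of_real pi * \<i> * of_int k / of_nat (ord s))" for k :: int
  have e_add: "e (k + l) = e k * e l" for k l
    by (simp add: e_def add_divide_distrib ring_distribs exp_add)
  have norm_e: "norm (e k) = 1" for k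
  proof -
    have "e k = exp (\<i> * of_real (2 * pi * of_int k / of_nat (ord s)))"
      by (simp add: e_def mult_ac)
    then show ?thesis by (simp add: norm_exp_i_times)
  qed
  have e0: "e k = 1" if "int (ord s) dvd k" for k
  proof -
    obtain l where "k = int (ord s) * l" using \<open>int (ord s) dvd k\<close> by blast
    then have "e k = exp (2 * of_int l * pi * \<i>)" using ord by (simp add: e_def mult_ac)
    also have "\<dots> = 1" by (metis exp_integer_2pi Ints_of_int mult.assoc mult.commute)
    finally show ?thesis .
  qed
  have ex: "\<exists>m. g = int_span_elt G S m" if "g \<in> carrier G" for g
    using generate_eq_int_span[OF SS(1,2)] SS(3) that by auto
  \<comment> \<open>Coefficients of \<open>g\<close> are chosen arbitrarily. The character does not
    notice the choice, because by independence two possible coefficients of \<open>s\<close> differ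
    by a multiple of the order of \<open>s\<close>.\<close>
  define co where "co g = (SOME m. g = int_span_elt G S m)" for g
  have co: "g = int_span_elt G S (co g)" if "g \<in> carrier G" for g
    unfolding co_def by (rule someI_ex[OF ex[OF that]])
  define \<xi> where "\<xi> = (\<lambda>g\<in>carrier G. e (co g s))"
  have wd: "e (m s) = e (k s)" if "int_span_elt G S m = int_span_elt G S k" for m k
  proof -
    have "int_span_elt G S (\<lambda>s. m s + - k s) = \<one>"
      using SS that by (simp only: int_span_elt_add int_span_elt_minus) simp
    then have "s [^] (m s + - k s) = \<one>" using SS(4) s by (auto simp: independent_set_def)
    then have "e (m s + - k s) = 1" using int_pow_eq_id[OF sc] e0 by blast
    then have "e (m s + - k s) * e (k s) = e (k s)" by simp
    then show ?thesis by (simp add: e_add[symmetric])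
  qed
  have xi: "\<xi> (int_span_elt G S m) = e (m s)" for m
    using SS co[of "int_span_elt G S m"] by (simp add: \<xi>_def) (metis wd)
  have xi_dual: "\<xi> \<in> dual_group_set G"
    unfolding dual_group_set_def
  proof (intro IntI homI)
    fix g h assume gh: "g \<in> carrier G" "h \<in> carrier G"
    have "g \<otimes> h = int_span_elt G S (\<lambda>t. co g t + co h t)"
      using co[OF gh(1)] co[OF gh(2)] int_span_elt_add[OF SS(2)] by metis
    then show "\<xi> (g \<otimes> h) = \<xi> g \<otimes>\<^bsub>circle_group\<^esub> \<xi> h"
      using gh by (simp only: xi) (simp add: e_add \<xi>_def circle_group_def)
  qed (auto simp: \<xi>_def circle_group_def norm_e)
  have xi_s: "\<xi> t = (if t = s then e 1 else 1)" if "t \<in> S" for t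
  proof -
    have "t = int_span_elt G S (\<lambda>r. if r = t then 1 else 0)"
      using int_span_elt_single[OF SS(1,2) that, of 1] that SS by auto
    then have "\<xi> t = e (if s = t then 1 else 0)" by (metis xi)
    then show ?thesis using e0[of 0] by auto
  qed
  have "dual_generator G S s = \<xi>"
    unfolding dual_generator_def
  proof (rule the_equality)
    show "\<xi> \<in> dual_group_set G \<and> \<xi> s = exp (2 * complex_of_real pi * \<i> / of_nat (ord s)) \<and> (\<forall>t\<in>S - {s}. \<xi> t = 1)"
      using xi_dual xi_s s by (auto simp: e_def)
    \<comment> \<open>The definite description also demands uniqueness: two characters that agree on
      \<open>S\<close> agree on the group generated by \<open>S\<close>.\<close>
    fix \<eta> assume eta: "\<eta> \<in> dual_group_set G \<and> \<eta> s = exp (2 * complex_of_real pi * \<i> / of_nat (ord s)) \<and> (\<forall>t\<in>S - {s}. \<eta> t = 1)"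
    have eq_S: "\<eta> t = \<xi> t" if "t \<in> S" for t
      using eta xi_s[OF that] that by (auto simp: e_def)
    have hom: "\<zeta> (g \<otimes> h) = \<zeta> g * \<zeta> h" "\<zeta> g \<noteq> 0"
      if "\<zeta> \<in> dual_group_set G" "g \<in> carrier G" "h \<in> carrier G" for \<zeta> g h
      using that by (auto simp: dual_group_set_def hom_def circle_group_def) (metis funcset_mem mem_sphere_0 norm_zero zero_neq_one)
    have hom1: "\<zeta> \<one> = 1" if "\<zeta> \<in> dual_group_set G" for \<zeta>
      using hom[OF that, of \<one> \<one>] by simp
    have "\<eta> g = \<xi> g" if "g \<in> generate G S" for g
      using that
    proof induction
      case (inv h)
      then have h: "h \<in> carrier G" using SS by auto
      have invs: "\<zeta> (inv h) = inverse (\<zeta> h)" if "\<zeta> \<in> dual_group_set G" for \<zeta>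
        using hom[OF that, of "inv h" h] hom1[OF that] h by (simp add: inverse_unique[symmetric] mult.commute)
      show ?case using invs[of \<eta>] invs[OF xi_dual] eta eq_S[OF inv] by simp
    next
      case (eng g h)
      then have "g \<in> carrier G" "h \<in> carrier G" using generate_in_carrier[OF SS(2)] by auto
      then show ?case using hom(1)[of \<eta> g h] hom(1)[OF xi_dual, of g h] eta eng by simp
    next
      case one
      show ?case using hom1[of \<eta>] hom1[OF xi_dual] eta by simp
    qed (rule eq_S)
    then show "\<eta> = \<xi>"
      using eta xi_dual SS(3) by (intro extensionalityI[of \<eta> "carrier G"]) (auto simp: dual_group_set_def)
  qed
  then show "dual_generator G S s \<in> dual_group_set G"
    and "dual_generator G S s (int_span_elt G S m) = exp (2 * complex_of_real pi * \<i> * of_int (m s) / of_nat (ord s))"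
    using xi_dual xi by (auto simp: e_def)
qed

text \<open>\<open>exp (2 \<pi> i m / ord s) = 1\<close> forces the order of \<open>s\<close> to
  divide its coefficient, so every factor of \<open>g\<close> is trivial.\<close>

lemma dual_generators_separate:
  assumes fin: "finite (carrier G)" and S: "minimal_cyclic_basis G S" and g: "g \<in> carrier G"
    and 1: "\<And>s. s \<in> S \<Longrightarrow> dual_generator G S s g = 1"
  shows "g = \<one>"
proof -
  note SS = minimal_cyclic_basis_independent[OF S]
  obtain m where m: "g = int_span_elt G S m"
    using generate_eq_int_span[OF SS(1,2)] SS(3) g by auto
  have "s [^] m s = \<one>" if s: "s \<in> S" for s
  proof -
    have sc: "s \<in> carrier G" using SS s by auto
    have ord: "ord s > 0" using fin sc ord_pos by blast
    have "exp (2 * complex_of_real pi * \<i> * of_int (m s) / of_nat (ord s)) = 1"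
      using 1[OF s] dual_generator_eq(2)[OF fin S s] m by simp
    then obtain l :: int where "2 * pi * of_int (m s) / of_nat (ord s) = of_int (2 * l) * pi"
      unfolding exp_eq_1 by (auto simp: mult_ac)
    then have "of_int (m s) = (of_int (l * int (ord s)) :: real)"
      using ord by (simp add: field_simps)
    then have "m s = l * int (ord s)" by linarith
    then show ?thesis using int_pow_eq_id[OF sc] by simp
  qed
  then show ?thesis
    unfolding m int_span_elt_def by (intro finprod_one_eqI) auto
qed

lemma dual_generator_power:
  assumes fin: "finite (carrier G)" and S: "minimal_cyclic_basis G S" and s: "s \<in> S" and g: "g \<in> carrier G"
  shows "dual_generator G S s g ^ ord s = 1"
proof -
  note SS = minimal_cyclic_basis_independent[OF S]
  obtain m where m: "g = int_span_elt G S m"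
    using generate_eq_int_span[OF SS(1,2)] SS(3) g by auto
  have "ord s > 0" using fin s SS ord_pos by blast
  then have "dual_generator G S s g ^ ord s = exp (2 * of_int (m s) * pi * \<i>)"
    unfolding m dual_generator_eq(2)[OF fin S s] exp_of_nat_mult[symmetric] by (simp add: mult_ac)
  also have "\<dots> = 1" by (metis exp_integer_2pi Ints_of_int mult.assoc mult.commute)
  finally show ?thesis .
qed

end

section \<open>Smooth functions on manifolds\<close>

definition smooth_mfd_family ::
    "'p mfd \<Rightarrow> 'x topology \<Rightarrow> ('x \<Rightarrow> 'p \<Rightarrow> 'b::real_normed_vector) \<Rightarrow> bool" where
  "smooth_mfd_family P X F \<longleftrightarrow>
     (\<forall>(U, \<phi>)\<in>atlas P. smooth_family X (mdim P) (\<phi> ` U) (\<lambda>x y. F x (inv_into U \<phi> y)))"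

abbreviation smooth_on_mfd :: "'p mfd \<Rightarrow> ('p \<Rightarrow> 'b::real_normed_vector) \<Rightarrow> bool" where
  "smooth_on_mfd P f \<equiv> smooth_mfd_family P (discrete_topology {()}) (\<lambda>_. f)"

lemma smooth_functions_iff: "f \<in> smooth_functions P \<longleftrightarrow> f \<in> extensional (points P) \<and> smooth_on_mfd P f"
  by (auto simp: smooth_functions_def smooth_mfd_family_def smooth_fun_iff_family)

lemma smooth_mfd_familyD:
  "smooth_mfd_family P X F \<Longrightarrow> (U, \<phi>) \<in> atlas P \<Longrightarrow>
     smooth_family X (mdim P) (\<phi> ` U) (\<lambda>x y. F x (inv_into U \<phi> y))"
  by (auto simp: smooth_mfd_family_def)

lemma smooth_mfd_family_reparam:
  "smooth_mfd_family P X F \<Longrightarrow> continuous_map X' X r \<Longrightarrow> smooth_mfd_family P X' (\<lambda>x. F (r x))"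
  unfolding smooth_mfd_family_def by (auto intro: smooth_family_reparam)

lemma smooth_mfd_family_imp_on_mfd: "smooth_mfd_family P X F \<Longrightarrow> x \<in> topspace X \<Longrightarrow> smooth_on_mfd P (F x)"
  using smooth_mfd_family_reparam[of P X F "discrete_topology {()}" "\<lambda>_. x"] by simp

locale smooth_manifold =
  fixes P :: "'p mfd"
  assumes mfd: "manifold P"
begin

abbreviation "n \<equiv> mdim P"

lemma chart:
  assumes "(U, \<phi>) \<in> atlas P"
  shows chart_open: "openin (mtop P) U" and chart_image_open: "openin (Euclidean_space n) (\<phi> ` U)"
    and chart_homeo: "homeomorphic_map (subtopology (mtop P) U) (subtopology (Euclidean_space n) (\<phi> ` U)) \<phi>"
    and chart_transition: "(V, \<psi>) \<in> atlas P \<Longrightarrow> j < n \<Longrightarrow> smooth_fun n (\<phi> ` (U \<inter> V)) (\<lambda>x. \<psi> (inv_into U \<phi> x) j)"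
  using mfd assms unfolding manifold_def by blast+

lemma chart_subset: "(U, \<phi>) \<in> atlas P \<Longrightarrow> U \<subseteq> points P"
  using chart_open openin_subset by blast

lemma chart_at:
  assumes "p \<in> points P"
  obtains U \<phi> where "(U, \<phi>) \<in> atlas P" "p \<in> U"
proof -
  have "p \<in> (\<Union>(U, \<phi>) \<in> atlas P. U)"
    using assms mfd unfolding manifold_def by blast
  then show thesis using that by auto
qed

lemma chart_inj: "(U, \<phi>) \<in> atlas P \<Longrightarrow> inj_on \<phi> U"
  using homeomorphic_imp_injective_map[OF chart_homeo] chart_subset by (fastforce simp: Int_absorb1)

lemma chart_inv_in: "(U, \<phi>) \<in> atlas P \<Longrightarrow> y \<in> \<phi> ` U \<Longrightarrow> inv_into U \<phi> y \<in> U"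
  by (rule inv_into_into)

lemma chart_inv_points: "(U, \<phi>) \<in> atlas P \<Longrightarrow> y \<in> \<phi> ` U \<Longrightarrow> inv_into U \<phi> y \<in> points P"
  using chart_inv_in chart_subset by blast

lemma chart_inv_left [simp]: "(U, \<phi>) \<in> atlas P \<Longrightarrow> p \<in> U \<Longrightarrow> inv_into U \<phi> (\<phi> p) = p"
  by (simp add: chart_inj)

lemma chart_image_openin:
  assumes c: "(U, \<phi>) \<in> atlas P" and W: "openin (mtop P) W"
  shows "openin (Euclidean_space n) (\<phi> ` (U \<inter> W))"
proof -
  have "openin (subtopology (mtop P) U) (U \<inter> W)"
    using W by (metis Int_commute openin_subtopology_Int)
  then have "openin (subtopology (Euclidean_space n) (\<phi> ` U)) (\<phi> ` (U \<inter> W))"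
    using homeomorphic_imp_open_map[OF chart_homeo[OF c]] by (simp add: open_map_def)
  then show ?thesis
    using chart_image_open[OF c] openin_trans_full by blast
qed

lemma chart_inv_continuous:
  assumes c: "(U, \<phi>) \<in> atlas P"
  shows "continuous_map (subtopology (Euclidean_space n) (\<phi> ` U)) (mtop P) (inv_into U \<phi>)"
  unfolding continuous_map_def
proof (intro conjI allI impI)
  show "inv_into U \<phi> \<in> topspace (subtopology (Euclidean_space n) (\<phi> ` U)) \<rightarrow> points P"
    using chart_inv_points[OF c] by auto
  fix W assume W: "openin (mtop P) W"
  have "{y \<in> topspace (subtopology (Euclidean_space n) (\<phi> ` U)). inv_into U \<phi> y \<in> W} = \<phi> ` (U \<inter> W)"
    using c openin_subset[OF chart_image_open[OF c]] by auto
  then show "openin (subtopology (Euclidean_space n) (\<phi> ` U))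
      {y \<in> topspace (subtopology (Euclidean_space n) (\<phi> ` U)). inv_into U \<phi> y \<in> W}"
    using chart_image_openin[OF c W] by (auto simp: openin_open_subtopology chart_image_open[OF c])
qed

text \<open>For functions given by cases and for locally finite sums: near each point they are
  compared with a family already known to be smooth.\<close>

lemma smooth_mfd_family_local:
  assumes "\<And>p. p \<in> points P \<Longrightarrow> \<exists>W G. openin (mtop P) W \<and> p \<in> W \<and> smooth_mfd_family P X G \<and>
      (\<forall>x\<in>topspace X. \<forall>q\<in>W. F x q = G x q)"
  shows "smooth_mfd_family P X F"
  unfolding smooth_mfd_family_def
proof clarify
  fix U \<phi> assume c: "(U, \<phi>) \<in> atlas P"
  show "smooth_family X n (\<phi> ` U) (\<lambda>x y. F x (inv_into U \<phi> y))"
  proof (rule smooth_family_local)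
    fix y assume y: "y \<in> \<phi> ` U"
    obtain W G where W: "openin (mtop P) W" "inv_into U \<phi> y \<in> W" "smooth_mfd_family P X G"
      "\<forall>x\<in>topspace X. \<forall>q\<in>W. F x q = G x q"
      using assms[OF chart_inv_points[OF c y]] by auto
    have "smooth_family X n (\<phi> ` (U \<inter> W)) (\<lambda>x y. G x (inv_into U \<phi> y))"
      by (rule smooth_family_subset[OF smooth_mfd_familyD[OF W(3) c]]) auto
    then have "smooth_family X n (\<phi> ` (U \<inter> W)) (\<lambda>x y. F x (inv_into U \<phi> y))"
      by (rule smooth_family_cong[OF chart_image_openin[OF c W(1)], rotated]) (use c W(4) in auto)
    moreover have "y \<in> \<phi> ` (U \<inter> W)"
      using y W(2) c by auto
    ultimately show "\<exists>V0. openin (Euclidean_space n) V0 \<and> y \<in> V0 \<and> smooth_family X n V0 (\<lambda>x y. F x (inv_into U \<phi> y))"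
      using chart_image_openin[OF c W(1)] by blast
  qed
qed

lemma smooth_mfd_family_cong:
  assumes "smooth_mfd_family P X F" "\<And>x p. x \<in> topspace X \<Longrightarrow> p \<in> points P \<Longrightarrow> F x p = G x p"
  shows "smooth_mfd_family P X G"
  by (rule smooth_mfd_family_local) (use assms in \<open>auto intro!: exI[of _ "points P"] exI[of _ F]\<close>)

lemma smooth_mfd_family_parameter: "continuous_map X euclidean c \<Longrightarrow> smooth_mfd_family P X (\<lambda>x p. c x)"
  unfolding smooth_mfd_family_def by (auto intro: smooth_family_parameter chart_image_open)

lemma smooth_mfd_family_add:
  "smooth_mfd_family P X F \<Longrightarrow> smooth_mfd_family P X G \<Longrightarrow> smooth_mfd_family P X (\<lambda>x p. F x p + G x p)"
  unfolding smooth_mfd_family_def by (auto intro!: smooth_family_add chart_image_open)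

lemma smooth_mfd_family_mult:
  fixes F G :: "'x \<Rightarrow> 'p \<Rightarrow> 'b::real_normed_algebra"
  shows "smooth_mfd_family P X F \<Longrightarrow> smooth_mfd_family P X G \<Longrightarrow> smooth_mfd_family P X (\<lambda>x p. F x p * G x p)"
  unfolding smooth_mfd_family_def by (auto intro!: smooth_family_mult chart_image_open)

lemma smooth_mfd_family_bounded_linear:
  assumes "bounded_linear L" "smooth_mfd_family P X F"
  shows "smooth_mfd_family P X (\<lambda>x p. L (F x p))"
  unfolding smooth_mfd_family_def
proof clarify
  fix U \<phi> assume c: "(U, \<phi>) \<in> atlas P"
  show "smooth_family X n (\<phi> ` U) (\<lambda>x y. L (F x (inv_into U \<phi> y)))"
    by (rule smooth_family_bounded_linear[OF chart_image_open[OF c] assms(1) smooth_mfd_familyD[OF assms(2) c]])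
qed

lemma smooth_mfd_family_inverse:
  fixes F :: "'x \<Rightarrow> 'p \<Rightarrow> 'b::real_normed_field"
  assumes "smooth_mfd_family P X F" "\<And>x p. x \<in> topspace X \<Longrightarrow> p \<in> points P \<Longrightarrow> F x p \<noteq> 0"
  shows "smooth_mfd_family P X (\<lambda>x p. inverse (F x p))"
  unfolding smooth_mfd_family_def
proof clarify
  fix U \<phi> assume c: "(U, \<phi>) \<in> atlas P"
  show "smooth_family X n (\<phi> ` U) (\<lambda>x y. inverse (F x (inv_into U \<phi> y)))"
    by (rule smooth_family_inverse[OF chart_image_open[OF c] smooth_mfd_familyD[OF assms(1) c]])
      (use assms(2) chart_inv_points[OF c] in auto)
qed

lemma smooth_mfd_family_flat_exp:
  "smooth_mfd_family P X F \<Longrightarrow> smooth_mfd_family P X (\<lambda>x p. flat_exp (F x p))"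
  unfolding smooth_mfd_family_def by (auto intro: smooth_family_flat_exp chart_image_open)

lemma smooth_mfd_family_diff:
  "smooth_mfd_family P X F \<Longrightarrow> smooth_mfd_family P X G \<Longrightarrow> smooth_mfd_family P X (\<lambda>x p. F x p - G x p)"
  using smooth_mfd_family_add[of X F "\<lambda>x p. - G x p"]
    smooth_mfd_family_bounded_linear[OF bounded_linear_minus[OF bounded_linear_ident], of X G] by simp

lemma smooth_mfd_family_sum:
  "finite I \<Longrightarrow> (\<And>i. i \<in> I \<Longrightarrow> smooth_mfd_family P X (F i)) \<Longrightarrow> smooth_mfd_family P X (\<lambda>x p. \<Sum>i\<in>I. F i x p)"
  by (induction I rule: finite_induct) (auto intro: smooth_mfd_family_add smooth_mfd_family_parameter)

lemma smooth_mfd_family_prod: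
  fixes F :: "'i \<Rightarrow> 'x \<Rightarrow> 'p \<Rightarrow> 'b::{real_normed_algebra_1, comm_monoid_mult}"
  shows "finite I \<Longrightarrow> (\<And>i. i \<in> I \<Longrightarrow> smooth_mfd_family P X (F i)) \<Longrightarrow> smooth_mfd_family P X (\<lambda>x p. \<Prod>i\<in>I. F i x p)"
  by (induction I rule: finite_induct) (auto intro: smooth_mfd_family_mult smooth_mfd_family_parameter)

lemma smooth_on_mfd_continuous:
  assumes f: "smooth_on_mfd P f"
  shows "continuous_map (mtop P) euclidean f"
proof (rule pasting_lemma[where I = "atlas P" and T = fst and f = "\<lambda>_. f"])
  fix c assume "c \<in> atlas P"
  then obtain U \<phi> where c: "c = (U, \<phi>)" "(U, \<phi>) \<in> atlas P" by (cases c) auto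
  then show "openin (mtop P) (fst c)" using chart_open by auto
  have "Ck_family 0 (discrete_topology {()}) n (\<phi> ` U) (\<lambda>x y. f (inv_into U \<phi> y))"
    using smooth_mfd_familyD[OF f c(2)] unfolding smooth_family_def by blast
  then have "continuous_map (prod_topology (discrete_topology {()}) (subtopology (Euclidean_space n) (\<phi> ` U))) euclidean (\<lambda>(x, y). f (inv_into U \<phi> y))"
    by simp
  moreover have "continuous_map (subtopology (mtop P) U) (prod_topology (discrete_topology {()}) (subtopology (Euclidean_space n) (\<phi> ` U))) (\<lambda>p. ((), \<phi> p))"
    using homeomorphic_imp_continuous_map[OF chart_homeo[OF c(2)]] by (intro continuous_map_pairedI) auto
  ultimately have "continuous_map (subtopology (mtop P) U) euclidean ((\<lambda>(x, y). f (inv_into U \<phi> y)) \<circ> (\<lambda>p. ((), \<phi> p)))"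
    by (rule continuous_map_compose[rotated])
  then have "continuous_map (subtopology (mtop P) U) euclidean f"
    by (rule continuous_map_eq) (use c(2) in auto)
  then show "continuous_map (subtopology (mtop P) (fst c)) euclidean f"
    by (simp add: c(1))
next
  fix p assume "p \<in> points P"
  then obtain U \<phi> where "(U, \<phi>) \<in> atlas P" "p \<in> U" by (rule chart_at)
  then show "\<exists>j. j \<in> atlas P \<and> p \<in> fst j \<and> f p = f p" by force
qed auto

end

text \<open>Near each point both manifolds are read in charts. There the composite is a chart
  expression of \<open>F\<close> after one of \<open>s\<close>, and the chain rule applies on the
  part of the chart that \<open>s\<close> maps into the second one.\<close>

lemma smooth_mfd_family_pullback:
  assumes N: "manifold N" and P: "manifold P" and s: "smooth_map N P s" and F: "smooth_mfd_family P X F"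
  shows "smooth_mfd_family N X (\<lambda>x q. F x (s q))"
  unfolding smooth_mfd_family_def
proof clarify
  interpret N: smooth_manifold N by standard (rule N)
  interpret P: smooth_manifold P by standard (rule P)
  have cont: "continuous_map (mtop N) (mtop P) s" using s by (simp add: smooth_map_def)
  fix U \<phi> assume c: "(U, \<phi>) \<in> atlas N"
  show "smooth_family X (mdim N) (\<phi> ` U) (\<lambda>x y. F x (s (inv_into U \<phi> y)))"
  proof (rule smooth_family_local)
    fix y assume y: "y \<in> \<phi> ` U"
    then have q: "inv_into U \<phi> y \<in> points N" by (rule N.chart_inv_points[OF c])
    then have "s (inv_into U \<phi> y) \<in> points P"
      using continuous_map_image_subset_topspace[OF cont] by auto
    then obtain V \<psi> where V: "(V, \<psi>) \<in> atlas P" "s (inv_into U \<phi> y) \<in> V"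
      by (rule P.chart_at)
    let ?W = "{q \<in> points N. s q \<in> V}"
    have W: "openin (mtop N) ?W"
      by (rule openin_continuous_map_preimage[OF cont P.chart_open[OF V(1)]])
    have eq: "U \<inter> ?W = U \<inter> s -` V" using N.chart_subset[OF c] by auto
    let ?V0 = "\<phi> ` (U \<inter> ?W)"
    have op: "openin (Euclidean_space (mdim N)) ?V0"
      by (rule N.chart_image_openin[OF c W])
    have "smooth_family X (mdim N) ?V0 (\<lambda>x y. F x (inv_into V \<psi> (\<psi> (s (inv_into U \<phi> y)))))"
    proof (rule smooth_family_compose[OF op P.chart_image_open[OF V(1)] smooth_mfd_familyD[OF F V(1)]])
      fix j assume "j < mdim P"
      then show "smooth_family X (mdim N) ?V0 (\<lambda>x y. \<psi> (s (inv_into U \<phi> y)) j)"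
        using s c V(1) unfolding smooth_map_def eq by (intro smooth_fun_imp_family) blast
    next
      fix x y assume "y \<in> ?V0"
      then show "\<psi> (s (inv_into U \<phi> y)) \<in> \<psi> ` V" using c by auto
    qed
    then have "smooth_family X (mdim N) ?V0 (\<lambda>x y. F x (s (inv_into U \<phi> y)))"
      by (rule smooth_family_cong[OF op, rotated]) (use c V(1) in auto)
    moreover have "y \<in> ?V0" using y q V(2) c by auto
    ultimately show "\<exists>V0. openin (Euclidean_space (mdim N)) V0 \<and> y \<in> V0 \<and>
        smooth_family X (mdim N) V0 (\<lambda>x y. F x (s (inv_into U \<phi> y)))"
      using op by blast
  qed
qed

subsection \<open>The locally convex algebra of smooth functions\<close>

lemma iter_partial_cong:
  assumes V: "openin (Euclidean_space n) V" and "is \<in> lists {..<n}" "y \<in> V" and eq: "\<And>y. y \<in> V \<Longrightarrow> f y = g y"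
  shows "iter_partial is f y = iter_partial is g y"
  using assms(2,3)
proof (induction "is" arbitrary: y rule: list.induct)
  case (Cons i "is")
  then have i: "i < n" and "is": "is \<in> lists {..<n}" by auto
  have "partial_deriv i (iter_partial is f) y = partial_deriv i (iter_partial is g) y"
    by (rule partial_deriv_cong[OF V Cons.prems(2) i]) (rule Cons.IH[OF "is"])
  then show ?case by (simp add: iter_partial_def)
qed (simp add: iter_partial_Nil eq)

lemma iter_partial_linear:
  fixes f g :: "(nat \<Rightarrow> real) \<Rightarrow> complex"
  assumes V: "openin (Euclidean_space n) V" and f: "smooth_fun n V f" and g: "smooth_fun n V g"
    and "is \<in> lists {..<n}" "y \<in> V"
  shows "iter_partial is (\<lambda>y. c * f y + d * g y) y = c * iter_partial is f y + d * iter_partial is g y"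
  using assms(4,5)
proof (induction "is" arbitrary: y rule: list.induct)
  case (Cons i "is")
  then have i: "i < n" and "is": "is \<in> lists {..<n}" by auto
  have D: "((\<lambda>s. iter_partial is h (y(i := s))) has_vector_derivative partial_deriv i (iter_partial is h) y) (at (y i))"
    if "smooth_fun n V h" for h
  proof -
    have "(\<lambda>s. iter_partial is h (y(i := s))) differentiable (at (y i))"
      using that "is" i Cons.prems(2) unfolding smooth_fun_def by blast
    then show ?thesis unfolding vector_derivative_works partial_deriv_def .
  qed
  have "((\<lambda>s. c * iter_partial is f (y(i := s)) + d * iter_partial is g (y(i := s))) has_vector_derivative
      c * partial_deriv i (iter_partial is f) y + d * partial_deriv i (iter_partial is g) y) (at (y i))"
    by (intro has_vector_derivative_add has_vector_derivative_mult_right D f g)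
  then have "partial_deriv i (\<lambda>y. c * iter_partial is f y + d * iter_partial is g y) y =
      c * partial_deriv i (iter_partial is f) y + d * partial_deriv i (iter_partial is g) y"
    unfolding partial_deriv_def by (rule vector_derivative_at)
  moreover have "partial_deriv i (iter_partial is (\<lambda>y. c * f y + d * g y)) y =
      partial_deriv i (\<lambda>y. c * iter_partial is f y + d * iter_partial is g y) y"
    by (rule partial_deriv_cong[OF V Cons.prems(2) i]) (rule Cons.IH[OF "is"])
  ultimately show ?case by (simp add: iter_partial_def)
qed (simp add: iter_partial_Nil)

context smooth_manifold
begin

abbreviation "A \<equiv> smooth_function_algebra P"

lemma A_simps:
  "carrier A = smooth_functions P" "monoid.mult A = (\<lambda>f g. \<lambda>p\<in>points P. f p * g p)" "one A = (\<lambda>p\<in>points P. 1)"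
  "zero A = (\<lambda>p\<in>points P. 0)" "add A = (\<lambda>f g. \<lambda>p\<in>points P. f p + g p)" "smult A = (\<lambda>c f. \<lambda>p\<in>points P. c * f p)"
  by (simp_all add: smooth_function_algebra_def)

lemma topspace_A: "topspace (lctop A) = smooth_functions P"
  unfolding smooth_function_algebra_def by auto

lemma restrict_smooth_mfd_family:
  "smooth_mfd_family P X (\<lambda>x. restrict (F x) (points P)) \<longleftrightarrow> smooth_mfd_family P X F"
  by (auto elim!: smooth_mfd_family_cong)

lemma restrict_smooth: "restrict f (points P) \<in> smooth_functions P \<longleftrightarrow> smooth_on_mfd P f"
  by (simp add: smooth_functions_iff restrict_smooth_mfd_family)

text \<open>Chart images are open in a Euclidean space and hence locally compact, which the
  evaluation half of the exponential law requires. Every continuous family of functions is a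
  reparametrization of this one.\<close>

lemma smooth_mfd_family_evaluation: "smooth_mfd_family P (lctop A) (\<lambda>f. f)"
  unfolding smooth_mfd_family_def
proof clarify
  fix U \<phi> assume c: "(U, \<phi>) \<in> atlas P"
  let ?Y = "subtopology (Euclidean_space n) (\<phi> ` U)"
  have sub: "\<phi> ` U \<subseteq> topspace (Euclidean_space n)" by (rule openin_subset[OF chart_image_open[OF c]])
  have H: "Hausdorff_space (Euclidean_space n)"
    unfolding Euclidean_space_def
    by (intro Hausdorff_space_subtopology) (simp add: Hausdorff_space_product_topology)
  have base: "neighbourhood_base_of (compactin ?Y) ?Y"
    using locally_compact_space_neighbourhood_base[of ?Y] Hausdorff_space_subtopology[OF H]
      locally_compact_space_open_subset[OF _ locally_compact_Euclidean_space chart_image_open[OF c]] H by blast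
  have smooth: "smooth_fun n (\<phi> ` U) (\<lambda>y. f (inv_into U \<phi> y))" if "f \<in> smooth_functions P" for f
    using that c by (auto simp: smooth_functions_def)
  show "smooth_family (lctop A) n (\<phi> ` U) (\<lambda>f y. f (inv_into U \<phi> y))"
    unfolding smooth_family_iff
  proof (intro ballI conjI allI impI)
    fix "is" assume "is": "is \<in> lists {..<n}"
    show "continuous_map (prod_topology (lctop A) ?Y) euclidean (\<lambda>(f, y). iter_partial is (\<lambda>y. f (inv_into U \<phi> y)) y)"
    proof (rule continuous_map_evaluation[OF _ base])
      fix f assume "f \<in> topspace (lctop A)"
      then show "continuous_map ?Y euclidean (iter_partial is (\<lambda>y. f (inv_into U \<phi> y)))"
        using smooth "is" unfolding smooth_fun_def topspace_A by blast
    next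
      fix K and V :: "complex set" assume KV: "compactin ?Y K" "openin euclidean V"
      have "{f \<in> topspace (lctop A). iter_partial is (\<lambda>y. f (inv_into U \<phi> y)) ` K \<subseteq> V} =
          {f \<in> smooth_functions P. iter_partial is (\<lambda>y. f (inv_into U \<phi> y)) ` K \<subseteq> V}"
        by (simp add: topspace_A)
      also have "openin (lctop A) \<dots>"
        unfolding smooth_function_algebra_def using KV c "is" sub
        by (auto intro!: topology_generated_by_Basis exI[of _ U] exI[of _ \<phi>] exI[of _ "is"] exI[of _ K] exI[of _ V]
            simp: compactin_subtopology)
      finally show "openin (lctop A) {f \<in> topspace (lctop A). iter_partial is (\<lambda>y. f (inv_into U \<phi> y)) ` K \<subseteq> V}" .
    qed
    fix i f y assume "i < n" "f \<in> topspace (lctop A)" "y \<in> \<phi> ` U"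
    then show "(\<lambda>s. iter_partial is (\<lambda>y. f (inv_into U \<phi> y)) (y(i := s))) differentiable at (y i)"
      using smooth "is" unfolding smooth_fun_def topspace_A by blast
  qed
qed

text \<open>The tube lemma for each subbasic set. Sums, products and scalar multiples are continuous
  on the algebra because they preserve smooth families.\<close>

lemma continuous_map_into_A:
  assumes F: "smooth_mfd_family P X F"
  shows "continuous_map X (lctop A) (\<lambda>x. restrict (F x) (points P))"
proof -
  let ?F = "\<lambda>x. restrict (F x) (points P)"
  let ?S = "{{f \<in> smooth_functions P. iter_partial is (\<lambda>x. f (inv_into U \<phi> x)) ` K \<subseteq> V} | U \<phi> is K V.
           (U, \<phi>) \<in> atlas P \<and> is \<in> lists {..<mdim P} \<and>
           compactin (Euclidean_space (mdim P)) K \<and> K \<subseteq> \<phi> ` U \<and> open V}"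
  have F': "smooth_mfd_family P X ?F" using F by (simp add: restrict_smooth_mfd_family)
  have smooth: "?F x \<in> smooth_functions P" if "x \<in> topspace X" for x
    using smooth_mfd_family_imp_on_mfd[OF F that] by (simp add: restrict_smooth)
  have "openin X (?F -` S \<inter> topspace X)" if "S \<in> insert (smooth_functions P) ?S" for S
    using that
  proof
    assume "S = smooth_functions P"
    then have "?F -` S \<inter> topspace X = topspace X" using smooth by auto
    then show ?thesis by (metis openin_topspace)
  next
    assume "S \<in> ?S"
    then obtain U \<phi> "is" K V where S: "S = {f \<in> smooth_functions P. iter_partial is (\<lambda>x. f (inv_into U \<phi> x)) ` K \<subseteq> V}"
      "(U, \<phi>) \<in> atlas P" "is \<in> lists {..<n}" "compactin (Euclidean_space n) K" "K \<subseteq> \<phi> ` U" "open V"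
      by blast
    have "openin X {x \<in> topspace X. \<forall>y\<in>K. iter_partial is (\<lambda>y. ?F x (inv_into U \<phi> y)) y \<in> V}"
      by (rule openin_compact_tube[where Y = "subtopology (Euclidean_space n) (\<phi> ` U)" and Z = euclidean])
        (use smooth_mfd_familyD[OF F' S(2)] S(3-) in \<open>auto simp: smooth_family_iff compactin_subtopology\<close>)
    moreover have "{x \<in> topspace X. \<forall>y\<in>K. iter_partial is (\<lambda>y. ?F x (inv_into U \<phi> y)) y \<in> V} = ?F -` S \<inter> topspace X"
      using smooth by (auto simp: S(1))
    ultimately show ?thesis by simp
  qed
  moreover have "?F ` topspace X \<subseteq> \<Union> (insert (smooth_functions P) ?S)"
    using smooth by auto
  ultimately have "continuous_map X (topology_generated_by (insert (smooth_functions P) ?S)) ?F"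
    unfolding continuous_on_generated_topo_iff by blast
  then show ?thesis by (simp add: smooth_function_algebra_def)
qed

lemma evaluation_continuous:
  assumes "p \<in> points P"
  shows "continuous_map (lctop A) euclidean (\<lambda>f. f p)"
proof -
  obtain U \<phi> where c: "(U, \<phi>) \<in> atlas P" "p \<in> U" using chart_at[OF assms] .
  have "Ck_family 0 (lctop A) n (\<phi> ` U) (\<lambda>f y. f (inv_into U \<phi> y))"
    using smooth_mfd_familyD[OF smooth_mfd_family_evaluation c(1)] unfolding smooth_family_def by blast
  then have ev: "continuous_map (prod_topology (lctop A) (subtopology (Euclidean_space n) (\<phi> ` U))) euclidean (\<lambda>(f, y). f (inv_into U \<phi> y))"
    by simp
  have "continuous_map (lctop A) (prod_topology (lctop A) (subtopology (Euclidean_space n) (\<phi> ` U))) (\<lambda>f. (f, \<phi> p))"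
    using c openin_subset[OF chart_image_open[OF c(1)]] by (intro continuous_map_pairedI) auto
  from continuous_map_compose[OF this ev] show ?thesis
    using c by (simp add: o_def)
qed

lemma smooth_functions_on: "f \<in> smooth_functions P \<Longrightarrow> smooth_on_mfd P f"
  by (simp add: smooth_functions_iff)

lemma smooth_functions_extensional: "f \<in> smooth_functions P \<Longrightarrow> f \<in> extensional (points P)"
  by (simp add: smooth_functions_iff)

lemma smooth_functions_ext: "f \<in> smooth_functions P \<Longrightarrow> g \<in> smooth_functions P \<Longrightarrow> (\<And>p. p \<in> points P \<Longrightarrow> f p = g p) \<Longrightarrow> f = g"
  by (auto simp: smooth_functions_iff intro: extensionalityI)

lemma smooth_functions_restrict [simp]: "f \<in> smooth_functions P \<Longrightarrow> restrict f (points P) = f"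
  by (simp add: smooth_functions_iff extensional_restrict)

lemma A_closed:
  "f \<in> smooth_functions P \<Longrightarrow> g \<in> smooth_functions P \<Longrightarrow> (\<lambda>p\<in>points P. f p + g p) \<in> smooth_functions P"
  "f \<in> smooth_functions P \<Longrightarrow> g \<in> smooth_functions P \<Longrightarrow> (\<lambda>p\<in>points P. f p * g p) \<in> smooth_functions P"
  "f \<in> smooth_functions P \<Longrightarrow> (\<lambda>p\<in>points P. c * f p) \<in> smooth_functions P"
  "(\<lambda>p\<in>points P. c) \<in> smooth_functions P"
  unfolding restrict_smooth
  by (auto intro!: smooth_mfd_family_add smooth_mfd_family_mult smooth_mfd_family_parameter dest!: smooth_functions_on)

lemma ring_A: "ring A"
proof (intro ringI abelian_groupI monoidI)
  show "\<exists>g\<in>carrier A. g \<oplus>\<^bsub>A\<^esub> f = \<zero>\<^bsub>A\<^esub>" if "f \<in> carrier A" for f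
    by (rule bexI[of _ "\<lambda>p\<in>points P. -1 * f p"]) (use that A_closed(3)[of f "-1"] in \<open>auto simp: A_simps intro!: restrict_ext\<close>)
qed (auto simp: A_simps A_closed smooth_functions_extensional algebra_simps intro!: extensionalityI[where A = "points P"])

lemma module_A: "Module.module complex_ring A"
  by (rule moduleI[OF cring_complex_ring ring.is_abelian_group[OF ring_A]])
    (auto simp: A_simps A_closed complex_ring_def smooth_functions_extensional algebra_simps intro!: extensionalityI[where A = "points P"])

lemma lc_A: "locally_convex_algebra A"
  unfolding locally_convex_algebra_def
proof (intro conjI allI impI)
  show "unital_algebra A"
    unfolding unital_algebra_def using ring_A module_A by (auto simp: A_simps A_closed smooth_functions_extensional algebra_simps intro!: extensionalityI[where A = "points P"])
  show "topspace (lctop A) = carrier A"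
    by (simp add: topspace_A A_simps)
  show "Hausdorff_space (lctop A)"
    unfolding Hausdorff_space_def
  proof (intro allI impI)
    fix f g assume fg: "f \<in> topspace (lctop A) \<and> g \<in> topspace (lctop A) \<and> f \<noteq> g"
    then obtain p where p: "p \<in> points P" "f p \<noteq> g p"
      using smooth_functions_ext unfolding topspace_A by blast
    obtain U V where UV: "open U" "open V" "f p \<in> U" "g p \<in> V" "U \<inter> V = {}"
      using hausdorff[OF p(2)] by auto
    show "\<exists>U V. openin (lctop A) U \<and> openin (lctop A) V \<and> f \<in> U \<and> g \<in> V \<and> disjnt U V"
      by (intro exI[of _ "{f \<in> topspace (lctop A). f p \<in> U}"] exI[of _ "{f \<in> topspace (lctop A). f p \<in> V}"])
        (use UV fg in \<open>auto simp: disjnt_iff intro!: openin_continuous_map_preimage[OF evaluation_continuous[OF p(1)]]\<close>)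
  qed
  note ev = smooth_mfd_family_reparam[OF smooth_mfd_family_evaluation]
  show "continuous_map (prod_topology (lctop A) (lctop A)) (lctop A) (\<lambda>(a, b). a \<oplus>\<^bsub>A\<^esub> b)"
    using continuous_map_into_A[OF smooth_mfd_family_add[OF ev[OF continuous_map_fst] ev[OF continuous_map_snd]]]
    by (simp add: A_simps case_prod_unfold)
  show "continuous_map (prod_topology (lctop A) (lctop A)) (lctop A) (\<lambda>(a, b). a \<otimes>\<^bsub>A\<^esub> b)"
    using continuous_map_into_A[OF smooth_mfd_family_mult[OF ev[OF continuous_map_fst] ev[OF continuous_map_snd]]]
    by (simp add: A_simps case_prod_unfold)
  show "continuous_map (prod_topology euclidean (lctop A)) (lctop A) (\<lambda>(c, a). c \<odot>\<^bsub>A\<^esub> a)"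
    using continuous_map_into_A[OF smooth_mfd_family_mult[OF smooth_mfd_family_parameter[OF continuous_map_fst] ev[OF continuous_map_snd]]]
    by (simp add: A_simps case_prod_unfold)
  let ?S = "insert (smooth_functions P) {{f \<in> smooth_functions P. iter_partial is (\<lambda>x. f (inv_into U \<phi> x)) ` K \<subseteq> V} | U \<phi> is K V.
           (U, \<phi>) \<in> atlas P \<and> is \<in> lists {..<mdim P} \<and>
           compactin (Euclidean_space (mdim P)) K \<and> K \<subseteq> \<phi> ` U \<and> open V}"
  have T: "lctop A = topology_generated_by ?S"
    by (simp add: smooth_function_algebra_def)
  fix U assume U: "openin (lctop A) U \<and> \<zero>\<^bsub>A\<^esub> \<in> U"
  show "\<exists>V. openin (lctop A) V \<and> \<zero>\<^bsub>A\<^esub> \<in> V \<and> V \<subseteq> U \<and> convex_in A V"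
    unfolding T
  proof (rule locally_convex_generated)
    fix s assume s: "s \<in> ?S" "\<zero>\<^bsub>A\<^esub> \<in> s"
    from s(1) show "\<exists>V. openin (topology_generated_by ?S) V \<and> \<zero>\<^bsub>A\<^esub> \<in> V \<and> V \<subseteq> s \<and> convex_in A V"
    proof
      assume "s = smooth_functions P"
      moreover have "openin (topology_generated_by ?S) (smooth_functions P)"
        by (rule topology_generated_by_Basis) simp
      moreover have "convex_in A (smooth_functions P)"
        unfolding convex_in_def by (auto simp: A_simps A_closed simp del: restrict_apply)
      ultimately show ?thesis using s(2) by blast
    next
      assume "s \<in> {{f \<in> smooth_functions P. iter_partial is (\<lambda>x. f (inv_into U \<phi> x)) ` K \<subseteq> V} | U \<phi> is K V.
           (U, \<phi>) \<in> atlas P \<and> is \<in> lists {..<mdim P} \<and>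
           compactin (Euclidean_space (mdim P)) K \<and> K \<subseteq> \<phi> ` U \<and> open V}"
      then obtain U \<phi> "is" K V where S: "s = {f \<in> smooth_functions P. iter_partial is (\<lambda>x. f (inv_into U \<phi> x)) ` K \<subseteq> V}"
        "(U, \<phi>) \<in> atlas P" "is \<in> lists {..<n}" "compactin (Euclidean_space n) K" "K \<subseteq> \<phi> ` U" "open V"
        by blast
      have smooth: "smooth_fun n (\<phi> ` U) (\<lambda>y. f (inv_into U \<phi> y))" if "f \<in> smooth_functions P" for f
        using that S(2) by (auto simp: smooth_functions_def)
      have lin: "iter_partial is (\<lambda>y. (\<lambda>p\<in>points P. a * f p + b * g p) (inv_into U \<phi> y)) y =
          a * iter_partial is (\<lambda>y. f (inv_into U \<phi> y)) y + b * iter_partial is (\<lambda>y. g (inv_into U \<phi> y)) y"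
        if "f \<in> smooth_functions P" "g \<in> smooth_functions P" "y \<in> K" for f g a b y
      proof -
        have yV: "y \<in> \<phi> ` U" using S(5) that by auto
        have "iter_partial is (\<lambda>y. (\<lambda>p\<in>points P. a * f p + b * g p) (inv_into U \<phi> y)) y =
            iter_partial is (\<lambda>y. a * f (inv_into U \<phi> y) + b * g (inv_into U \<phi> y)) y"
          by (rule iter_partial_cong[OF chart_image_open[OF S(2)] S(3) yV])
            (use chart_inv_points[OF S(2)] in auto)
        also have "\<dots> = a * iter_partial is (\<lambda>y. f (inv_into U \<phi> y)) y + b * iter_partial is (\<lambda>y. g (inv_into U \<phi> y)) y"
          by (rule iter_partial_linear[OF chart_image_open[OF S(2)] smooth smooth S(3) yV]) (rule that)+
        finally show ?thesis .
      qed
      have z: "\<zero>\<^bsub>A\<^esub> \<in> smooth_functions P" using A_closed(4)[of 0] by (simp add: A_simps)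
      \<comment> \<open>Zero is the combination \<open>0 * 0 + 0 * 0\<close>, so linearity computes
        its derivatives.\<close>
      have zero: "iter_partial is (\<lambda>y. \<zero>\<^bsub>A\<^esub> (inv_into U \<phi> y)) y = 0" if "y \<in> K" for y
        using lin[OF z z that, of 0 0] by (simp add: A_simps)
      obtain B where B: "open B" "K \<noteq> {} \<longrightarrow> 0 \<in> B" "B \<subseteq> V" "convex B"
      proof (cases "K = {}")
        case True
        show thesis by (rule that[of "{}"]) (auto simp: True)
      next
        case False
        then have "0 \<in> V" using s(2) zero unfolding S(1) by force
        then obtain e where "e > 0" "ball 0 e \<subseteq> V" using S(6) open_contains_ball by blast
        then show thesis by (intro that[of "ball 0 e"]) auto
      qed
      let ?V = "{f \<in> smooth_functions P. iter_partial is (\<lambda>x. f (inv_into U \<phi> x)) ` K \<subseteq> B}"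
      have "openin (topology_generated_by ?S) ?V"
        using S B by (intro topology_generated_by_Basis) blast
      moreover have "\<zero>\<^bsub>A\<^esub> \<in> ?V" using z zero B(2) by auto
      moreover have "?V \<subseteq> s" using S(1) B(3) by auto
      moreover have "convex_in A ?V"
        unfolding convex_in_def
      proof (intro ballI)
        fix f g and t :: real assume fg: "f \<in> ?V" "g \<in> ?V" and t: "t \<in> {0..1}"
        have eq: "complex_of_real t \<odot>\<^bsub>A\<^esub> f \<oplus>\<^bsub>A\<^esub> complex_of_real (1 - t) \<odot>\<^bsub>A\<^esub> g =
            (\<lambda>p\<in>points P. complex_of_real t * f p + complex_of_real (1 - t) * g p)"
          by (auto simp: A_simps intro!: restrict_ext)
        have "t *\<^sub>R u + (1 - t) *\<^sub>R v \<in> B" if "u \<in> B" "v \<in> B" for u v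
          using B(4) t that unfolding convex_def by (metis add.commute atLeastAtMost_iff diff_add_cancel diff_ge_0_iff_ge)
        then have "iter_partial is (\<lambda>y. (\<lambda>p\<in>points P. complex_of_real t * f p + complex_of_real (1 - t) * g p) (inv_into U \<phi> y)) y \<in> B" if "y \<in> K" for y
          using fg that by (subst lin) (auto simp: scaleR_conv_of_real image_subset_iff)
        moreover have "complex_of_real t \<odot>\<^bsub>A\<^esub> f \<oplus>\<^bsub>A\<^esub> complex_of_real (1 - t) \<odot>\<^bsub>A\<^esub> g \<in> smooth_functions P"
          using fg by (simp add: A_simps A_closed del: restrict_apply)
        ultimately show "complex_of_real t \<odot>\<^bsub>A\<^esub> f \<oplus>\<^bsub>A\<^esub> complex_of_real (1 - t) \<odot>\<^bsub>A\<^esub> g \<in> ?V"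
          unfolding eq by auto
      qed
      ultimately show ?thesis by blast
    qed
  qed (use U T in auto)
qed

lemma lc_alg_A: "lc_alg A"
  by (intro lc_alg.intro ring_A lc_alg_axioms.intro lc_A)

end

section \<open>Bump functions\<close>

text \<open>The standard smooth transition from 0 for \<open>x \<le> 0\<close> to 1 for
  \<open>x \<ge> 1\<close>. The denominator is positive because \<open>x\<close> and
  \<open>1 - x\<close> are never both nonpositive.\<close>

definition smooth_step :: "real \<Rightarrow> real" where
  "smooth_step x = flat_exp x * inverse (flat_exp x + flat_exp (1 - x))"

text \<open>For \<open>\<bar>u\<bar> \<le> 1 / 2\<close> both arguments are at least 1; for
  \<open>\<bar>u\<bar> \<ge> 1\<close> one of them is at most 0. This fixes the constants 2.\<close>

definition plateau :: "real \<Rightarrow> real" where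
  "plateau u = smooth_step (2 - 2 * u) * smooth_step (2 + 2 * u)"

lemma smooth_step_denominator: "flat_exp x + flat_exp (1 - x) > 0"
proof (cases "x > 0")
  case True
  then show ?thesis by (intro add_pos_nonneg) auto
next
  case False
  then show ?thesis by (intro add_nonneg_pos) auto
qed

lemma smooth_step_eq_0: "x \<le> 0 \<Longrightarrow> smooth_step x = 0"
  by (simp add: smooth_step_def)

lemma smooth_step_eq_1: "x \<ge> 1 \<Longrightarrow> smooth_step x = 1"
proof -
  assume "x \<ge> 1"
  then have "flat_exp (1 - x) = 0" "flat_exp x \<noteq> 0" by simp_all
  then show ?thesis unfolding smooth_step_def by (metis add.right_neutral right_inverse)
qed

lemma plateau_eq_1: "\<bar>u\<bar> \<le> 1 / 2 \<Longrightarrow> plateau u = 1"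
  by (simp add: plateau_def smooth_step_eq_1 abs_le_iff)

lemma plateau_eq_0: "\<bar>u\<bar> \<ge> 1 \<Longrightarrow> plateau u = 0"
  by (cases "u \<ge> 0") (auto simp: plateau_def smooth_step_eq_0)

lemma smooth_family_affine:
  assumes "openin (Euclidean_space n) V" "smooth_family X n V F"
  shows "smooth_family X n V (\<lambda>x y. c + d * F x y :: real)"
  by (rule smooth_family_add[OF assms(1) smooth_family_parameter[OF assms(1)]
        smooth_family_mult[OF assms(1) smooth_family_parameter[OF assms(1)] assms(2)]]) auto

lemma smooth_family_step:
  assumes V: "openin (Euclidean_space n) V" and F: "smooth_family X n V F"
  shows "smooth_family X n V (\<lambda>x y. smooth_step (F x y))"
proof -
  have "smooth_family X n V (\<lambda>x y. 1 + -1 * F x y)"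
    by (rule smooth_family_affine[OF V F])
  from smooth_family_flat_exp[OF V this]
  have 1: "smooth_family X n V (\<lambda>x y. flat_exp (1 - F x y))"
    by simp
  have "smooth_family X n V (\<lambda>x y. inverse (flat_exp (F x y) + flat_exp (1 - F x y)))"
  proof (rule smooth_family_inverse[OF V smooth_family_add[OF V smooth_family_flat_exp[OF V F] 1]])
    show "flat_exp (F x y) + flat_exp (1 - F x y) \<noteq> 0" for x y
      using smooth_step_denominator[of "F x y"] by linarith
  qed
  from smooth_family_mult[OF V smooth_family_flat_exp[OF V F] this] show ?thesis
    by (simp add: smooth_step_def)
qed

lemma smooth_family_plateau:
  assumes V: "openin (Euclidean_space n) V" and F: "smooth_family X n V F"
  shows "smooth_family X n V (\<lambda>x y. plateau (F x y))"
  using smooth_family_mult[OF V smooth_family_step[OF V smooth_family_affine[OF V F, of 2 "-2"]]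
      smooth_family_step[OF V smooth_family_affine[OF V F, of 2 2]]]
  by (simp add: plateau_def)

text \<open>A product over coordinates matches smoothness by partial derivatives. For
  \<open>r > 0\<close> it is 1 on the cube of half-width \<open>r / 2\<close> and 0 off the open
  cube of half-width \<open>r\<close>; in dimension 0 it is the empty product 1.\<close>

definition cube_bump :: "nat \<Rightarrow> (nat \<Rightarrow> real) \<Rightarrow> real \<Rightarrow> (nat \<Rightarrow> real) \<Rightarrow> real" where
  "cube_bump n a r y = (\<Prod>j<n. plateau ((y j - a j) / r))"

lemma smooth_family_cube_bump:
  assumes V: "openin (Euclidean_space n) V"
  shows "smooth_family X n V (\<lambda>x y. cube_bump n a r y)"
proof -
  have p: "smooth_family X n V (\<lambda>x y. plateau ((y j - a j) / r))" for j
  proof -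
    have "smooth_family X n V (\<lambda>x y. plateau (- a j / r + inverse r * y j))"
      by (rule smooth_family_plateau[OF V smooth_family_affine[OF V smooth_family_coordinate[OF V]]])
    then show ?thesis by (simp add: divide_inverse algebra_simps)
  qed
  have "smooth_family X n V (\<lambda>x y. \<Prod>j\<in>J. plateau ((y j - a j) / r))" if "finite J" for J
    using that
    by (induction J rule: finite_induct) (auto intro: smooth_family_mult[OF V] p smooth_family_parameter[OF V])
  then show ?thesis by (simp add: cube_bump_def)
qed

lemma smooth_family_scaleR:
  "openin (Euclidean_space n) V \<Longrightarrow> smooth_family X n V F \<Longrightarrow> smooth_family X n V G \<Longrightarrow>
     smooth_family X n V (\<lambda>x y. F x y *\<^sub>R G x y)"
  by (simp add: smooth_family_def Ck_family_bounded_bilinear bounded_bilinear_scaleR)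

text \<open>The cube is a full product of compact factors, intervals below \<open>n\<close> and the
  point 0 from \<open>n\<close> on, so Tychonoff's theorem applies.\<close>

lemma compactin_Euclidean_cube:
  assumes a: "a \<in> topspace (Euclidean_space n)"
  shows "compactin (Euclidean_space n) {y \<in> topspace (Euclidean_space n). \<forall>j<n. \<bar>y j - a j\<bar> \<le> r}"
proof -
  let ?I = "\<lambda>j. if j < n then {a j - r..a j + r} else {0}"
  have "{y \<in> topspace (Euclidean_space n). \<forall>j<n. \<bar>y j - a j\<bar> \<le> r} = (\<Pi>\<^sub>E j\<in>UNIV. ?I j)"
  proof (rule Set.set_eqI)
    fix x :: "nat \<Rightarrow> real"
    have "x j \<in> ?I j \<longleftrightarrow> (j < n \<longrightarrow> \<bar>x j - a j\<bar> \<le> r) \<and> (n \<le> j \<longrightarrow> x j = 0)" for j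
      by (cases "j < n") (simp_all add: abs_le_iff, linarith)
    then show "x \<in> {y \<in> topspace (Euclidean_space n). \<forall>j<n. \<bar>y j - a j\<bar> \<le> r} \<longleftrightarrow> x \<in> (\<Pi>\<^sub>E j\<in>UNIV. ?I j)"
      unfolding topspace_Euclidean_space PiE_UNIV_domain Pi_iff by blast
  qed
  moreover have "compactin (powertop_real UNIV) (\<Pi>\<^sub>E j\<in>UNIV. ?I j)"
    by (simp add: compactin_PiE)
  moreover have "(\<Pi>\<^sub>E j\<in>UNIV. ?I j) \<subseteq> {x. \<forall>i\<ge>n. x i = 0}"
    by (auto simp: PiE_UNIV_domain Pi_iff) (metis not_less singletonD)
  ultimately show ?thesis
    by (simp add: Euclidean_space_def compactin_subtopology)
qed

lemma openin_Euclidean_cube: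
  "openin (Euclidean_space n) {y \<in> topspace (Euclidean_space n). \<forall>j<n. \<bar>y j - a j\<bar> < r}"
proof -
  have "openin (Euclidean_space n) {y \<in> topspace (Euclidean_space n). y j \<in> ball (a j) r}" for j
    by (rule openin_continuous_map_preimage[where Y = euclideanreal])
      (use continuous_map_Euclidean_coordinate[of n "topspace (Euclidean_space n)" j] in auto)
  then have "openin (Euclidean_space n) (topspace (Euclidean_space n) \<inter>
      \<Inter>((\<lambda>j. {y \<in> topspace (Euclidean_space n). y j \<in> ball (a j) r}) ` {..<n}))"
    by (cases "n = 0") (auto intro!: openin_Int openin_Inter)
  moreover have "topspace (Euclidean_space n) \<inter>
      \<Inter>((\<lambda>j. {y \<in> topspace (Euclidean_space n). y j \<in> ball (a j) r}) ` {..<n}) =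
      {y \<in> topspace (Euclidean_space n). \<forall>j<n. \<bar>y j - a j\<bar> < r}"
    by (auto simp: dist_real_def abs_minus_commute)
  ultimately show ?thesis by simp
qed

text \<open>\<open>h\<close> is multiplied by a cube bump in the chart and extended by 0. The
  support lies in the image of a compact cube, which is closed because the manifold is Hausdorff;
  this makes the extension smooth at points outside the chart. For \<open>h = 1\<close> the result
  is a bump function, for a coordinate it is a global function with that coordinate as local
  value.\<close>

lemma (in smooth_manifold) chart_function_extension:
  fixes h :: "(nat \<Rightarrow> real) \<Rightarrow> 'b::real_normed_vector"
  assumes c: "(U, \<phi>) \<in> atlas P" "p \<in> U" and W: "openin (mtop P) W" "p \<in> W"
    and h: "smooth_fun n (\<phi> ` U) h"
  obtains f N C where "smooth_on_mfd P f" "openin (mtop P) N" "p \<in> N" "N \<subseteq> U \<inter> W"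
    "\<And>q. q \<in> N \<Longrightarrow> f q = h (\<phi> q)" "closedin (mtop P) C" "C \<subseteq> W" "\<And>q. q \<in> points P - C \<Longrightarrow> f q = 0"
proof -
  have sub: "\<phi> ` U \<subseteq> topspace (Euclidean_space n)" by (rule openin_subset[OF chart_image_open[OF c(1)]])
  define a where "a = \<phi> p"
  have a: "a \<in> \<phi> ` (U \<inter> W)" "a \<in> topspace (Euclidean_space n)" using c W sub by (auto simp: a_def)
  obtain d where d: "d > 0"
    "\<And>w. w \<in> topspace (Euclidean_space n) \<Longrightarrow> (\<And>j. j < n \<Longrightarrow> \<bar>w j - a j\<bar> < d) \<Longrightarrow> w \<in> \<phi> ` (U \<inter> W)"
    using Euclidean_open_contains_cube[OF chart_image_openin[OF c(1) W(1)] a(1)] by blast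
  \<comment> \<open>Half of \<open>d\<close>, so that even the closed cube of half-width
    \<open>r\<close> lies in the image of \<open>U \<inter> W\<close>.\<close>
  define r where "r = d / 2"
  have r: "r > 0" "r < d" using d by (auto simp: r_def)
  define K where "K = {y \<in> topspace (Euclidean_space n). \<forall>j<n. \<bar>y j - a j\<bar> \<le> r}"
  have KV: "K \<subseteq> \<phi> ` (U \<inter> W)" using d(2) r by (force simp: K_def)
  define C where "C = inv_into U \<phi> ` K"
  have CUW: "C \<subseteq> U \<inter> W" using KV c(1) by (auto simp: C_def)
  have "compactin (subtopology (Euclidean_space n) (\<phi> ` U)) K"
    using compactin_Euclidean_cube[OF a(2)] KV unfolding K_def compactin_subtopology by blast
  then have "compactin (mtop P) C"
    unfolding C_def by (rule image_compactin[OF _ chart_inv_continuous[OF c(1)]])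
  then have C: "closedin (mtop P) C"
    using mfd by (intro compactin_imp_closedin) (auto simp: manifold_def)
  define b where "b = cube_bump n a r"
  have b0: "b y = 0" if y: "y \<in> topspace (Euclidean_space n)" "y \<notin> K" for y
  proof -
    obtain j where j: "j < n" "\<bar>y j - a j\<bar> > r" using y by (auto simp: K_def not_le)
    then have "plateau ((y j - a j) / r) = 0"
      using r by (intro plateau_eq_0) (simp add: abs_divide divide_simps)
    then show ?thesis using j(1) by (auto simp: b_def cube_bump_def)
  qed
  have b1: "b y = 1" if "\<And>j. j < n \<Longrightarrow> \<bar>y j - a j\<bar> < r / 2" for y
    unfolding b_def cube_bump_def
  proof (rule prod.neutral, rule ballI)
    fix j assume "j \<in> {..<n}"
    then have "\<bar>y j - a j\<bar> < r / 2" using that by simp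
    then show "plateau ((y j - a j) / r) = 1"
      using r by (intro plateau_eq_1) (simp add: abs_divide divide_simps)
  qed
  define f where "f q = (if q \<in> U then b (\<phi> q) *\<^sub>R h (\<phi> q) else 0)" for q
  have f0: "f q = 0" if "q \<in> points P - C" for q
  proof (cases "q \<in> U")
    case True
    have "\<phi> q \<notin> K"
    proof
      assume "\<phi> q \<in> K"
      then have "inv_into U \<phi> (\<phi> q) \<in> C" by (auto simp: C_def)
      then show False using True c(1) that by simp
    qed
    then show ?thesis using b0[of "\<phi> q"] sub True by (auto simp: f_def)
  qed (simp add: f_def)
  define N where "N = {q \<in> topspace (subtopology (mtop P) U). \<phi> q \<in> {y \<in> topspace (Euclidean_space n). \<forall>j<n. \<bar>y j - a j\<bar> < r / 2}}"
  have "continuous_map (subtopology (mtop P) U) (Euclidean_space n) \<phi>"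
    using homeomorphic_imp_continuous_map[OF chart_homeo[OF c(1)]] by (simp add: continuous_map_in_subtopology)
  then have "openin (subtopology (mtop P) U) N"
    unfolding N_def by (rule openin_continuous_map_preimage) (rule openin_Euclidean_cube)
  then have Nopen: "openin (mtop P) N"
    using chart_open[OF c(1)] openin_trans_full by blast
  have pN: "p \<in> N" using c r sub chart_subset[OF c(1)] by (auto simp: N_def a_def)
  have NUW: "N \<subseteq> U \<inter> W"
  proof
    fix q assume q: "q \<in> N"
    then have qU: "q \<in> U" by (auto simp: N_def)
    have "\<phi> q \<in> \<phi> ` (U \<inter> W)"
      using q r by (intro d(2)) (auto simp: N_def dest!: spec)
    then obtain q' where "q' \<in> U \<inter> W" "\<phi> q' = \<phi> q" by auto
    then show "q \<in> U \<inter> W" using qU inj_onD[OF chart_inj[OF c(1)]] by auto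
  qed
  have fN: "f q = h (\<phi> q)" if "q \<in> N" for q
    using that NUW b1[of "\<phi> q"] by (auto simp: f_def N_def)
  have "smooth_on_mfd P f"
    unfolding smooth_mfd_family_def
  proof clarify
    fix U' \<psi> assume c': "(U', \<psi>) \<in> atlas P"
    let ?X = "discrete_topology {()}"
    show "smooth_family ?X n (\<psi> ` U') (\<lambda>x y. f (inv_into U' \<psi> y))"
    proof (rule smooth_family_local)
      fix y assume y: "y \<in> \<psi> ` U'"
      let ?q = "inv_into U' \<psi> y"
      show "\<exists>V0. openin (Euclidean_space n) V0 \<and> y \<in> V0 \<and> smooth_family ?X n V0 (\<lambda>x y. f (inv_into U' \<psi> y))"
      proof (cases "?q \<in> U")
        case True
        have V0: "openin (Euclidean_space n) (\<psi> ` (U' \<inter> U))"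
          by (rule chart_image_openin[OF c' chart_open[OF c(1)]])
        have "smooth_family ?X n (\<phi> ` U) (\<lambda>x w. b w *\<^sub>R h w)"
          unfolding b_def
          by (rule smooth_family_scaleR[OF chart_image_open[OF c(1)] smooth_family_cube_bump[OF chart_image_open[OF c(1)]]
                smooth_fun_imp_family[OF h]])
        then have "smooth_family ?X n (\<psi> ` (U' \<inter> U)) (\<lambda>x y. b (\<phi> (inv_into U' \<psi> y)) *\<^sub>R h (\<phi> (inv_into U' \<psi> y)))"
          by (rule smooth_family_compose[OF V0 chart_image_open[OF c(1)], where F = "\<lambda>x w. b w *\<^sub>R h w" and G = "\<lambda>x y. \<phi> (inv_into U' \<psi> y)"])
            (use smooth_fun_imp_family[OF chart_transition[OF c' c(1)]] c' in auto)
        then have "smooth_family ?X n (\<psi> ` (U' \<inter> U)) (\<lambda>x y. f (inv_into U' \<psi> y))"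
          by (rule smooth_family_cong[OF V0, rotated]) (use c' in \<open>auto simp: f_def\<close>)
        moreover have "y \<in> \<psi> ` (U' \<inter> U)" using y True c' by auto
        ultimately show ?thesis using V0 by blast
      next
        case False
        \<comment> \<open>A point outside \<open>U\<close> has the complement of \<open>C\<close> as
          a neighbourhood, and \<open>f\<close> vanishes there.\<close>
        have "openin (mtop P) (points P - C)" using C by blast
        then have V0: "openin (Euclidean_space n) (\<psi> ` (U' \<inter> (points P - C)))"
          by (rule chart_image_openin[OF c'])
        have "smooth_family ?X n (\<psi> ` (U' \<inter> (points P - C))) (\<lambda>x y. 0)"
          by (rule smooth_family_parameter[OF V0]) simp
        then have "smooth_family ?X n (\<psi> ` (U' \<inter> (points P - C))) (\<lambda>x y. f (inv_into U' \<psi> y))"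
          by (rule smooth_family_cong[OF V0, rotated]) (use c' f0 in auto)
        moreover have "y \<in> \<psi> ` (U' \<inter> (points P - C))"
        proof -
          have "?q \<in> U' \<inter> (points P - C)"
            using inv_into_into[OF y] False CUW chart_subset[OF c'] by auto
          then have "\<psi> ?q \<in> \<psi> ` (U' \<inter> (points P - C))" by (rule imageI)
          then show ?thesis using f_inv_into_f[OF y] by simp
        qed
        ultimately show ?thesis using V0 by blast
      qed
    qed
  qed
  with that[of f N C] Nopen pN NUW fN C CUW f0 show thesis by blast
qed

lemma (in smooth_manifold) bump_function:
  assumes W: "openin (mtop P) W" "p \<in> W"
  obtains f :: "'p \<Rightarrow> real" and C where "smooth_on_mfd P f" "f p = 1" "closedin (mtop P) C" "C \<subseteq> W"
    "\<And>q. q \<in> points P - C \<Longrightarrow> f q = 0"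
proof -
  have "p \<in> points P" using W openin_subset by blast
  then obtain U \<phi> where c: "(U, \<phi>) \<in> atlas P" "p \<in> U" by (rule chart_at)
  have "smooth_fun n (\<phi> ` U) (\<lambda>_. 1 :: real)"
    unfolding smooth_fun_iff_family by (rule smooth_family_parameter[OF chart_image_open[OF c(1)]]) simp
  from chart_function_extension[OF c W this] that show thesis by metis
qed

section \<open>Characters of the algebra of smooth functions\<close>

text \<open>
  Let \<open>\<xi>\<close> be a character which is no point evaluation. Its kernel then contains nonnegative functions
  \<open>B 0, B 1, \<dots>\<close> without common zero. From them we build a locally finite family \<open>\<rho> k\<close>, with \<open>\<rho> k\<close>
  supported where \<open>B k > 0\<close>, and the mean \<open>h\<close> of the indices \<open>k\<close> with weights \<open>\<rho> k\<close>. Where \<open>h\<close> takes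
  the value \<open>\<xi> h\<close>, one of finitely many of the \<open>B k\<close> is positive, so \<open>\<bar>h - \<xi> h\<bar>\<^sup>2\<close> plus the sum of these
  is an invertible element of the kernel.
\<close>

theorem (in smooth_manifold) character_is_evaluation:
  assumes xi: "\<xi> \<in> algebra_characters A"
  obtains p where "p \<in> points P" "\<And>f. f \<in> smooth_functions P \<Longrightarrow> \<xi> f = f p"
proof (rule ccontr)
  assume "\<not> thesis"
  then have neg: "\<exists>f\<in>smooth_functions P. \<xi> f \<noteq> f p" if "p \<in> points P" for p
    using that \<open>\<And>p. p \<in> points P \<Longrightarrow> (\<And>f. f \<in> smooth_functions P \<Longrightarrow> \<xi> f = f p) \<Longrightarrow> thesis\<close> by blast
  \<comment> \<open>Elements of the algebra are extensional on \<open>points P\<close>.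
    \<open>E\<close> accepts arbitrary functions, so pointwise formulas can be used without writing
    restrictions.\<close>
  define E where "E F = \<xi> (restrict F (points P))" for F
  have xadd: "\<xi> (\<lambda>p\<in>points P. f p + g p) = \<xi> f + \<xi> g" and xmult: "\<xi> (\<lambda>p\<in>points P. f p * g p) = \<xi> f * \<xi> g"
    and xsm: "\<xi> (\<lambda>p\<in>points P. c * f p) = c * \<xi> f"
    if "f \<in> smooth_functions P" "g \<in> smooth_functions P" for f g c
    using xi that by (auto simp: algebra_characters_def A_simps)
  have E_add: "E (\<lambda>p. F p + G p) = E F + E G" and E_mult: "E (\<lambda>p. F p * G p) = E F * E G"
    if "smooth_on_mfd P F" "smooth_on_mfd P G" for F G
  proof -
    have "restrict F (points P) \<in> smooth_functions P" "restrict G (points P) \<in> smooth_functions P"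
      using that by (simp_all add: restrict_smooth)
    from xadd[OF this] xmult[OF this]
    show "E (\<lambda>p. F p + G p) = E F + E G" "E (\<lambda>p. F p * G p) = E F * E G"
      by (simp_all add: E_def cong: restrict_cong)
  qed
  have E_cong: "E F = E G" if "\<And>p. p \<in> points P \<Longrightarrow> F p = G p" for F G
    unfolding E_def using that by (metis restrict_ext)
  have const: "smooth_on_mfd P (\<lambda>p. c)" for c :: "'z::real_normed_vector"
    by (rule smooth_mfd_family_parameter) simp
  obtain u where u: "u \<in> smooth_functions P" "\<xi> u \<noteq> 0"
    using xi by (auto simp: algebra_characters_def A_simps)
  have "E (\<lambda>p. u p * 1) = E u * E (\<lambda>p. 1)"
    by (rule E_mult[OF smooth_functions_on[OF u(1)] const])
  then have E1: "E (\<lambda>p. 1) = 1"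
    using u by (simp add: E_def)
  have E_const: "E (\<lambda>p. c) = c" for c
  proof -
    have "\<xi> (\<lambda>p\<in>points P. c * (\<lambda>p\<in>points P. 1) p) = c * \<xi> (\<lambda>p\<in>points P. 1)"
      using xsm[OF A_closed(4) A_closed(4)] .
    then show ?thesis using E1 by (simp add: E_def cong: restrict_cong)
  qed
  have E0: "E (\<lambda>p. 0) = 0" by (rule E_const)
  have E_nonzero: "E F \<noteq> 0" if F: "smooth_on_mfd P F" and nz: "\<And>p. p \<in> points P \<Longrightarrow> F p \<noteq> 0" for F
  proof
    assume "E F = 0"
    have "smooth_on_mfd P (\<lambda>p. inverse (F p))"
      by (rule smooth_mfd_family_inverse[OF F]) (use nz in auto)
    from E_mult[OF F this] have "E (\<lambda>p. F p * inverse (F p)) = 0" using \<open>E F = 0\<close> by simp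
    moreover have "E (\<lambda>p. F p * inverse (F p)) = E (\<lambda>p. 1)"
      by (rule E_cong) (use nz in auto)
    ultimately show False using E1 by simp
  qed
  have sub: "smooth_on_mfd P (\<lambda>p. F p - c)" if "smooth_on_mfd P F" for F and c :: complex
    by (rule smooth_mfd_family_diff[OF that const])
  have cnj: "smooth_on_mfd P (\<lambda>p. cnj (F p))" if "smooth_on_mfd P F" for F
    by (rule smooth_mfd_family_bounded_linear[OF bounded_linear_cnj that])
  have cor: "smooth_on_mfd P (\<lambda>p. complex_of_real (F p))" if "smooth_on_mfd P F" for F
    by (rule smooth_mfd_family_bounded_linear[OF bounded_linear_of_real that])
  \<comment> \<open>Whether the character commutes with conjugation is not known at this stage.
    Writing the squared norm as a multiple of \<open>F - c\<close> makes it a kernel element for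
    \<open>c = E F\<close> all the same.\<close>
  have sq: "smooth_on_mfd P (\<lambda>p. (norm (F p - c))\<^sup>2) \<and> E (\<lambda>p. complex_of_real ((norm (F p - c))\<^sup>2)) = (E F - c) * E (\<lambda>p. cnj (F p - c))"
    if F: "smooth_on_mfd P F" for F and c :: complex
  proof
    have s: "smooth_on_mfd P (\<lambda>p. (F p - c) * cnj (F p - c))"
      by (rule smooth_mfd_family_mult[OF sub[OF F] cnj[OF sub[OF F]]])
    have eq: "(F p - c) * cnj (F p - c) = complex_of_real ((norm (F p - c))\<^sup>2)" for p
      by (rule complex_norm_square[symmetric])
    have "smooth_on_mfd P (\<lambda>p. Re ((F p - c) * cnj (F p - c)))"
      by (rule smooth_mfd_family_bounded_linear[OF bounded_linear_Re s])
    then show "smooth_on_mfd P (\<lambda>p. (norm (F p - c))\<^sup>2)"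
      unfolding eq by simp
    have "E (\<lambda>p. F p + - c) = E F + E (\<lambda>p. - c)"
      by (rule E_add[OF F const])
    then have "E (\<lambda>p. F p - c) = E F - c" by (simp add: E_const)
    then show "E (\<lambda>p. complex_of_real ((norm (F p - c))\<^sup>2)) = (E F - c) * E (\<lambda>p. cnj (F p - c))"
      using E_mult[OF sub[OF F] cnj[OF sub[OF F]], of c c] unfolding eq by simp
  qed
  have ex: "\<exists>b. smooth_on_mfd P b \<and> (\<forall>q. b q \<ge> (0::real)) \<and> b p > 0 \<and> E (\<lambda>q. complex_of_real (b q)) = 0" if p: "p \<in> points P" for p
  proof -
    obtain f where f: "f \<in> smooth_functions P" "\<xi> f \<noteq> f p" using neg[OF p] by blast
    have "E f = \<xi> f" using f by (simp add: E_def)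
    then show ?thesis
      using sq[OF smooth_functions_on[OF f(1)], of "\<xi> f"] f(2)
      by (intro exI[of _ "\<lambda>q. (norm (f q - \<xi> f))\<^sup>2"]) auto
  qed
  then obtain b where b: "\<And>p. p \<in> points P \<Longrightarrow> smooth_on_mfd P (b p)" "\<And>p q. p \<in> points P \<Longrightarrow> b p q \<ge> (0::real)"
      "\<And>p. p \<in> points P \<Longrightarrow> b p p > 0" "\<And>p. p \<in> points P \<Longrightarrow> E (\<lambda>q. complex_of_real (b p q)) = 0"
    by metis
  have pos_open: "openin (mtop P) {q \<in> points P. f q > c}" if "smooth_on_mfd P f" for f and c :: real
    using openin_continuous_map_preimage[OF smooth_on_mfd_continuous[OF that], of "{c<..}"] by simp
  \<comment> \<open>Second countability reduces the cover by positivity sets to a countable one, so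
    the functions can be numbered; the number \<open>k\<close> is what the weighted mean
    averages.\<close>
  have L: "Lindelof_space (mtop P)"
    using mfd by (intro second_countable_imp_Lindelof_space) (simp add: manifold_def)
  have op: "\<forall>V\<in>(\<lambda>p. {q \<in> points P. b p q > 0}) ` points P. openin (mtop P) V"
    using pos_open[OF b(1)] by blast
  have cov: "\<Union>((\<lambda>p. {q \<in> points P. b p q > 0}) ` points P) = points P"
    using b(3) by auto
  from L[unfolded Lindelof_space_def, THEN spec, THEN mp, OF conjI[OF op cov]]
  obtain \<V> where "countable \<V> \<and> \<V> \<subseteq> (\<lambda>p. {q \<in> points P. b p q > 0}) ` points P \<and> \<Union>\<V> = points P"
    by (elim exE)
  note V = this[THEN conjunct1] this[THEN conjunct2, THEN conjunct1] this[THEN conjunct2, THEN conjunct2]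
  obtain T where T: "countable T" "T \<subseteq> points P" "\<V> = (\<lambda>p. {q \<in> points P. b p q > 0}) ` T"
    using countable_subset_image[of \<V> "\<lambda>p. {q \<in> points P. b p q > 0}" "points P"] V(1,2) by auto
  have Tne: "T \<noteq> {}"
  proof
    assume "T = {}"
    then have "points P = {}" using V(3) unfolding T(3) by (simp only: image_empty Union_empty)
    then have "E (\<lambda>p. 1) = E (\<lambda>p. 0)" by (intro E_cong) auto
    then show False using E1 E0 by simp
  qed
  define B where "B k = b (from_nat_into T k)" for k
  have Tk: "from_nat_into T k \<in> points P" for k using from_nat_into[OF Tne] T(2) by blast
  have B: "smooth_on_mfd P (B k)" "B k q \<ge> 0" "E (\<lambda>q. complex_of_real (B k q)) = 0" for k q
    using b(1,2,4)[OF Tk] by (simp_all add: B_def)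
  have Bcover: "\<exists>k. B k q > 0" if q: "q \<in> points P" for q
  proof -
    obtain p where "p \<in> T" "b p q > 0" using q V(3) T(3) by auto
    moreover obtain k where "from_nat_into T k = p" using from_nat_into_surj[OF T(1) \<open>p \<in> T\<close>] by blast
    ultimately show ?thesis by (intro exI[of _ k]) (simp add: B_def)
  qed
  \<comment> \<open>The factor for \<open>i\<close> vanishes where
    \<open>B i q \<ge> 1 / (k + 1)\<close>. Around a point with \<open>B m > c > 0\<close> this
    kills all large \<open>k\<close>, which is local finiteness. At the first \<open>k\<close> with
    \<open>B k q > 0\<close> all earlier \<open>B i q\<close> are 0, so \<open>\<rho> k q\<close> is
    positive.\<close>
  define \<rho> where "\<rho> k q = B k q * (\<Prod>i<k. flat_exp (1 / (real k + 1) - B i q))" for k q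
  have rho_smooth: "smooth_on_mfd P (\<rho> k)" for k
    unfolding \<rho>_def
    by (rule smooth_mfd_family_mult[OF B(1) smooth_mfd_family_prod[OF finite_lessThan smooth_mfd_family_flat_exp[OF smooth_mfd_family_diff[OF const B(1)]]]])
  have rho_nonneg: "\<rho> k q \<ge> 0" for k q
    unfolding \<rho>_def by (intro mult_nonneg_nonneg prod_nonneg B) simp
  have rho_B: "B k q > 0" if "\<rho> k q > 0" for k q
    using that B(2)[of k q] by (auto simp: \<rho>_def order_less_le)
  have rho_cover: "\<exists>k. \<rho> k q > 0" if q: "q \<in> points P" for q
  proof -
    define k where "k = (LEAST k. B k q > 0)"
    have "B k q > 0" unfolding k_def by (rule LeastI_ex[OF Bcover[OF q]])
    moreover have "B i q = 0" if "i < k" for i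
      using not_less_Least[of i "\<lambda>k. B k q > 0"] that B(2)[of i q] unfolding k_def by fastforce
    ultimately have "\<rho> k q > 0"
      unfolding \<rho>_def by (intro mult_pos_pos prod_pos) auto
    then show ?thesis by blast
  qed
  have locfin: "\<exists>N M. openin (mtop P) N \<and> q0 \<in> N \<and> (\<forall>k\<ge>M. \<forall>q\<in>N. \<rho> k q = 0)" if q0: "q0 \<in> points P" for q0
  proof -
    obtain m where m: "B m q0 > 0" using Bcover[OF q0] by blast
    define c where "c = B m q0 / 2"
    have c: "c > 0" "B m q0 > c" using m by (auto simp: c_def)
    obtain M0 where M0: "inverse (real (Suc M0)) < c" using reals_Archimedean[OF c(1)] by blast
    have "\<rho> k q = 0" if "k \<ge> max (Suc m) M0" "B m q > c" for k q
    proof -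
      have "1 / (real k + 1) \<le> inverse (real (Suc M0))"
        using that(1) by (simp add: divide_simps)
      then have "flat_exp (1 / (real k + 1) - B m q) = 0" using M0 that(2) by simp
      moreover have "m < k" using that(1) by simp
      ultimately have "(\<Prod>i<k. flat_exp (1 / (real k + 1) - B i q)) = 0" by auto
      then show ?thesis by (simp add: \<rho>_def)
    qed
    then show ?thesis
      using pos_open[OF B(1), of c m] q0 c(2)
      by (intro exI[of _ "{q \<in> points P. B m q > c}"] exI[of _ "max (Suc m) M0"]) auto
  qed
  have sum_smooth: "smooth_on_mfd P (\<lambda>q. \<Sum>k. a k * \<rho> k q)" for a :: "nat \<Rightarrow> real"
  proof (rule smooth_mfd_family_local)
    fix q0 assume q0: "q0 \<in> points P"
    obtain N M where N: "openin (mtop P) N" "q0 \<in> N" "\<forall>k\<ge>M. \<forall>q\<in>N. \<rho> k q = 0" using locfin[OF q0] by auto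
    have "(\<Sum>k. a k * \<rho> k q) = (\<Sum>k<M. a k * \<rho> k q)" if "q \<in> N" for q
      using N(3) that by (intro suminf_finite) auto
    moreover have "smooth_on_mfd P (\<lambda>q. \<Sum>k<M. a k * \<rho> k q)"
      by (rule smooth_mfd_family_sum[OF finite_lessThan smooth_mfd_family_mult[OF const rho_smooth]])
    ultimately show "\<exists>W G. openin (mtop P) W \<and> q0 \<in> W \<and> smooth_mfd_family P (discrete_topology {()}) G \<and>
        (\<forall>x\<in>topspace (discrete_topology {()}). \<forall>q\<in>W. (\<Sum>k. a k * \<rho> k q) = G x q)"
      using N by (intro exI[of _ N] exI[of _ "\<lambda>_ q. \<Sum>k<M. a k * \<rho> k q"]) auto
  qed
  \<comment> \<open>One bound \<open>M\<close> serves all coefficient sequences, so that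
    \<open>s\<close> and \<open>\<tau>\<close> become finite sums over the same range.\<close>
  have finite_at: "\<exists>M. \<forall>a. (\<Sum>k. a k * \<rho> k q) = (\<Sum>k<M. a k * \<rho> k q) \<and> (\<exists>k<M. \<rho> k q > 0)" if q: "q \<in> points P" for q
  proof -
    obtain N M where N: "q \<in> N" "\<forall>k\<ge>M. \<forall>q\<in>N. \<rho> k q = 0" using locfin[OF q] by auto
    obtain k where "\<rho> k q > 0" using rho_cover[OF q] by blast
    then have "k < M" using N by (metis less_irrefl not_le)
    moreover have "(\<Sum>k. a k * \<rho> k q) = (\<Sum>k<M. a k * \<rho> k q)" for a
      using N by (intro suminf_finite) auto
    ultimately show ?thesis using \<open>\<rho> k q > 0\<close> by blast
  qed
  define s where "s q = (\<Sum>k. 1 * \<rho> k q)" for q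
  define \<tau> where "\<tau> q = (\<Sum>k. real k * \<rho> k q)" for q
  have s_pos: "s q > 0" if q: "q \<in> points P" for q
  proof -
    obtain M where M: "\<forall>a. (\<Sum>k. a k * \<rho> k q) = (\<Sum>k<M. a k * \<rho> k q) \<and> (\<exists>k<M. \<rho> k q > 0)" using finite_at[OF q] by blast
    then obtain k where k: "k < M" "\<rho> k q > 0" by blast
    have "s q = (\<Sum>k<M. 1 * \<rho> k q)" unfolding s_def by (rule M[THEN spec, of "\<lambda>_. 1", THEN conjunct1])
    moreover have "(\<Sum>k<M. 1 * \<rho> k q) > 0"
      by (rule sum_pos2[of _ k]) (use k rho_nonneg in auto)
    ultimately show ?thesis by simp
  qed
  define h where "h q = \<tau> q * inverse (s q)" for q
  have s_smooth: "smooth_on_mfd P s"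
    unfolding s_def by (rule sum_smooth)
  have "smooth_on_mfd P (\<lambda>q. inverse (s q))"
    by (rule smooth_mfd_family_inverse[OF s_smooth]) (use s_pos in \<open>auto simp: less_imp_neq[symmetric]\<close>)
  then have h_smooth: "smooth_on_mfd P h"
    unfolding h_def \<tau>_def by (rule smooth_mfd_family_mult[OF sum_smooth])
  define c where "c = E (\<lambda>q. complex_of_real (h q))"
  have hit: "\<exists>k\<le>nat \<lfloor>Re c\<rfloor>. B k q > 0" if q: "q \<in> points P" and hq: "complex_of_real (h q) = c" for q
  proof (rule ccontr)
    assume no: "\<not> ?thesis"
    have Re: "Re c = h q" using hq by (metis Re_complex_of_real)
    obtain M where M: "\<forall>a. (\<Sum>k. a k * \<rho> k q) = (\<Sum>k<M. a k * \<rho> k q) \<and> (\<exists>k<M. \<rho> k q > 0)" using finite_at[OF q] by blast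
    then obtain k where k: "k < M" "\<rho> k q > 0" by blast
    \<comment> \<open>If no index up to the floor of \<open>h q\<close> has positive
      \<open>B\<close>, every index with positive weight exceeds \<open>h q\<close>; but a weighted
      mean cannot lie below all indices that contribute.\<close>
    have gt: "real k > h q" if "\<rho> k q > 0" for k
    proof -
      have "\<not> k \<le> nat \<lfloor>Re c\<rfloor>" using no rho_B[OF that] by blast
      then show ?thesis unfolding Re by linarith
    qed
    have "(\<Sum>k<M. (real k - h q) * \<rho> k q) > 0"
    proof (rule sum_pos2[of _ k])
      show "0 < (real k - h q) * \<rho> k q" using gt[OF k(2)] k(2) by simp
      show "0 \<le> (real i - h q) * \<rho> i q" for i
        using gt[of i] rho_nonneg[of i q] by (cases "\<rho> i q = 0") (auto simp: order_less_le)
    qed (use k in auto)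
    moreover have "(\<Sum>k<M. (real k - h q) * \<rho> k q) = \<tau> q - h q * s q"
      using M[rule_format, of real] M[rule_format, of "\<lambda>_. 1"]
      by (simp add: \<tau>_def s_def left_diff_distrib sum_subtractf sum_distrib_left)
    moreover have "\<tau> q = h q * s q" using s_pos[OF q] by (simp add: h_def)
    ultimately show False by simp
  qed
  let ?h = "\<lambda>q. complex_of_real (h q)"
  let ?n = "\<lambda>q. (norm (?h q - c))\<^sup>2"
  have n: "smooth_on_mfd P ?n" "E (\<lambda>q. complex_of_real (?n q)) = 0"
    using sq[OF cor[OF h_smooth], of c] by (auto simp: c_def)
  have Bsum: "smooth_on_mfd P (\<lambda>q. \<Sum>k\<le>K. B k q) \<and> E (\<lambda>q. complex_of_real (\<Sum>k\<le>K. B k q)) = 0" for K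
  proof (induction K)
    case (Suc K)
    then show ?case
      using smooth_mfd_family_add[OF conjunct1[OF Suc] B(1)[of "Suc K"]]
        E_add[OF cor[OF conjunct1[OF Suc]] cor[OF B(1)[of "Suc K"]]] B(3)[of "Suc K"] by simp
  qed (use B in simp)
  define g where "g q = ?n q + (\<Sum>k\<le>nat \<lfloor>Re c\<rfloor>. B k q)" for q
  have "E (\<lambda>q. complex_of_real (g q)) = 0"
    unfolding g_def of_real_add
    using E_add[OF cor[OF n(1)] cor[OF conjunct1[OF Bsum]]] n(2) conjunct2[OF Bsum] by simp
  moreover have "smooth_on_mfd P (\<lambda>q. complex_of_real (g q))"
    unfolding g_def by (rule cor[OF smooth_mfd_family_add[OF n(1) conjunct1[OF Bsum]]])
  moreover have "complex_of_real (g q) \<noteq> 0" if q: "q \<in> points P" for q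
  proof -
    have "g q > 0"
    proof (cases "?h q = c")
      case True
      then obtain k where "k \<le> nat \<lfloor>Re c\<rfloor>" "B k q > 0" using hit[OF q] by blast
      then have "(\<Sum>k\<le>nat \<lfloor>Re c\<rfloor>. B k q) > 0" using B(2) by (intro sum_pos2[of _ k]) auto
      then show ?thesis unfolding g_def by (intro add_nonneg_pos) auto
    next
      case False
      then show ?thesis unfolding g_def using B(2) by (intro add_pos_nonneg sum_nonneg) auto
    qed
    then show ?thesis by simp
  qed
  ultimately show False using E_nonzero by blast
qed

section \<open>The dynamical system of a principal bundle\<close>

lemma smooth_fun_cong:
  assumes "openin (Euclidean_space n) V" "smooth_fun n V f" "\<And>y. y \<in> V \<Longrightarrow> f y = g y"
  shows "smooth_fun n V g"
  using assms unfolding smooth_fun_iff_family by (auto elim!: smooth_family_cong[rotated 2])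

lemma inv_into_times_singleton:
  assumes "inj_on \<phi> U" "y \<in> \<phi> ` U"
  shows "inv_into (U \<times> {g}) (\<phi> \<circ> fst) y = (inv_into U \<phi> y, g)"
proof (rule inv_into_f_eq)
  show "inj_on (\<phi> \<circ> fst) (U \<times> {g})"
    using assms(1) by (auto simp: inj_on_def)
qed (use assms in \<open>auto simp: inv_into_into f_inv_into_f\<close>)

lemma smooth_map_slice:
  assumes P: "manifold P" and N: "manifold N" and s: "smooth_map (times_discrete P D) N s" and g: "g \<in> D"
  shows "smooth_map P N (\<lambda>p. s (p, g))"
proof -
  interpret P: smooth_manifold P by standard (rule P)
  interpret N: smooth_manifold N by standard (rule N)
  have "continuous_map (mtop P) (prod_topology (mtop P) (discrete_topology D)) (\<lambda>p. (p, g))"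
    using g by (intro continuous_map_pairedI) auto
  moreover have "continuous_map (prod_topology (mtop P) (discrete_topology D)) (mtop N) s"
    using s by (simp add: smooth_map_def times_discrete_def)
  ultimately have "continuous_map (mtop P) (mtop N) (s \<circ> (\<lambda>p. (p, g)))"
    by (rule continuous_map_compose)
  then have cont: "continuous_map (mtop P) (mtop N) (\<lambda>p. s (p, g))"
    by (simp add: o_def)
  have "smooth_fun (mdim P) (\<phi> ` (U \<inter> (\<lambda>p. s (p, g)) -` V)) (\<lambda>x. \<psi> (s (inv_into U \<phi> x, g)) j)"
    if c: "(U, \<phi>) \<in> atlas P" and d: "(V, \<psi>) \<in> atlas N" and j: "j < mdim N" for U \<phi> V \<psi> j
  proof -
    have "(U \<times> {g}, \<phi> \<circ> fst) \<in> atlas (times_discrete P D)"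
      using c g by (auto simp: times_discrete_def)
    moreover have "\<forall>(U, \<phi>)\<in>atlas (times_discrete P D). \<forall>(V, \<psi>)\<in>atlas N. \<forall>j<mdim N.
        smooth_fun (mdim (times_discrete P D)) (\<phi> ` (U \<inter> s -` V)) (\<lambda>x. \<psi> (s (inv_into U \<phi> x)) j)"
      using s by (simp add: smooth_map_def)
    ultimately have "smooth_fun (mdim (times_discrete P D)) ((\<phi> \<circ> fst) ` ((U \<times> {g}) \<inter> s -` V))
        (\<lambda>x. \<psi> (s (inv_into (U \<times> {g}) (\<phi> \<circ> fst) x)) j)"
      using d j by blast
    moreover have "(\<phi> \<circ> fst) ` ((U \<times> {g}) \<inter> s -` V) = \<phi> ` (U \<inter> (\<lambda>p. s (p, g)) -` V)"
      by force
    ultimately have sm: "smooth_fun (mdim P) (\<phi> ` (U \<inter> (\<lambda>p. s (p, g)) -` V)) (\<lambda>x. \<psi> (s (inv_into (U \<times> {g}) (\<phi> \<circ> fst) x)) j)"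
      by (simp add: times_discrete_def)
    have "U \<inter> (\<lambda>p. s (p, g)) -` V = U \<inter> {p \<in> points P. s (p, g) \<in> V}"
      using P.chart_subset[OF c] by auto
    then have "openin (Euclidean_space (mdim P)) (\<phi> ` (U \<inter> (\<lambda>p. s (p, g)) -` V))"
      using P.chart_image_openin[OF c openin_continuous_map_preimage[OF cont N.chart_open[OF d]]] by simp
    then show ?thesis
    proof (rule smooth_fun_cong[OF _ sm])
      fix y assume "y \<in> \<phi> ` (U \<inter> (\<lambda>p. s (p, g)) -` V)"
      then have "y \<in> \<phi> ` U" by blast
      then show "\<psi> (s (inv_into (U \<times> {g}) (\<phi> \<circ> fst) y)) j = \<psi> (s (inv_into U \<phi> y, g)) j"
        by (simp only: inv_into_times_singleton[OF P.chart_inj[OF c]])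
    qed
  qed
  then show ?thesis
    using cont by (auto simp: smooth_map_def)
qed

context smooth_manifold
begin

lemma A_pow: "p \<in> points P \<Longrightarrow> (f [^]\<^bsub>A\<^esub> (k::nat)) p = f p ^ k"
proof (induction k)
  case (Suc k)
  interpret R: ring A by (rule ring_A)
  show ?case using Suc by (simp add: R.nat_pow_Suc) (simp add: A_simps)
qed (simp add: A_simps)

lemma mult_A_commute: "f \<otimes>\<^bsub>A\<^esub> g = g \<otimes>\<^bsub>A\<^esub> f"
  by (simp add: A_simps mult.commute)

lemma dynamical_system_pullback:
  assumes G: "group G" and act: "right_action (points P) G \<sigma>"
    and s: "smooth_map (times_discrete P (carrier G)) P \<sigma>"
  shows "dynamical_system A G (pullback_action P \<sigma>)"
proof -
  interpret G: group G by fact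
  let ?\<alpha> = "pullback_action P \<sigma>"
  have s_in: "\<sigma> (p, g) \<in> points P" if "p \<in> points P" "g \<in> carrier G" for p g
    using act that by (auto simp: right_action_def)
  have s_one: "\<sigma> (p, \<one>\<^bsub>G\<^esub>) = p" if "p \<in> points P" for p
    using act that by (auto simp: right_action_def)
  have s_comp: "\<sigma> (\<sigma> (p, g), h) = \<sigma> (p, g \<otimes>\<^bsub>G\<^esub> h)" if "p \<in> points P" "g \<in> carrier G" "h \<in> carrier G" for p g h
    using act that by (auto simp: right_action_def)
  have pull: "smooth_mfd_family P X (\<lambda>x p. F x (\<sigma> (p, g)))" if "g \<in> carrier G" "smooth_mfd_family P X F"
    for g and X :: "'x topology" and F :: "'x \<Rightarrow> 'p \<Rightarrow> complex"
    by (rule smooth_mfd_family_pullback[OF mfd mfd smooth_map_slice[OF mfd mfd s that(1)] that(2)])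
  have closed: "?\<alpha> g f \<in> smooth_functions P" if "g \<in> carrier G" "f \<in> smooth_functions P" for g f
    using pull[OF that(1) smooth_functions_on[OF that(2)]] that(2) by (simp add: pullback_action_def restrict_smooth)
  have ap: "?\<alpha> g f p = f (\<sigma> (p, g))" if "f \<in> smooth_functions P" "p \<in> points P" for g f p
    using that by (simp add: pullback_action_def)
  have comp: "?\<alpha> (g \<otimes>\<^bsub>G\<^esub> h) f = ?\<alpha> g (?\<alpha> h f)" if "g \<in> carrier G" "h \<in> carrier G" "f \<in> smooth_functions P" for g h f
    using that by (intro smooth_functions_ext) (auto simp: closed ap s_in s_comp)
  have one: "?\<alpha> \<one>\<^bsub>G\<^esub> f = f" if "f \<in> smooth_functions P" for f
    using that by (intro smooth_functions_ext) (auto simp: closed ap s_one)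
  have ext: "?\<alpha> g \<in> extensional (smooth_functions P)" for g
    by (simp add: pullback_action_def)
  have bij: "?\<alpha> g \<in> Bij (smooth_functions P)" if g: "g \<in> carrier G" for g
  proof -
    have "bij_betw (?\<alpha> g) (smooth_functions P) (smooth_functions P)"
      by (rule bij_betwI[where g = "?\<alpha> (inv\<^bsub>G\<^esub> g)"]) (use g closed comp[symmetric] one in auto)
    then show ?thesis using ext by (simp add: Bij_def)
  qed
  show ?thesis
    unfolding dynamical_system_def
  proof (intro conjI)
    show "locally_convex_algebra A" by (rule lc_A)
    show "group G" by fact
    show "?\<alpha> \<in> hom G (algebra_auto_group A)"
    proof (rule homI)
      fix g assume g: "g \<in> carrier G"
      have "?\<alpha> g \<in> ring_hom A A"
        by (rule ring_hom_memI)
          (use g in \<open>auto simp: A_simps closed A_closed s_in ap intro!: smooth_functions_ext simp del: restrict_apply simp: restrict_apply'\<close>)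
      moreover have "?\<alpha> g (c \<odot>\<^bsub>A\<^esub> f) = c \<odot>\<^bsub>A\<^esub> ?\<alpha> g f" if "f \<in> carrier A" for c f
        using that g by (intro smooth_functions_ext) (auto simp: A_simps closed A_closed s_in ap)
      ultimately show "?\<alpha> g \<in> carrier (algebra_auto_group A)"
        using bij[OF g] by (simp add: algebra_auto_group_def A_simps(1))
      fix h assume h: "h \<in> carrier G"
      have "?\<alpha> (g \<otimes>\<^bsub>G\<^esub> h) = compose (smooth_functions P) (?\<alpha> g) (?\<alpha> h)"
        by (rule extensionalityI[OF ext]) (use comp g h in \<open>auto simp: compose_def\<close>)
      then show "?\<alpha> (g \<otimes>\<^bsub>G\<^esub> h) = ?\<alpha> g \<otimes>\<^bsub>algebra_auto_group A\<^esub> ?\<alpha> h"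
        using bij g h by (simp add: algebra_auto_group_def BijGroup_def A_simps(1))
    qed
    show "continuous_map (prod_topology (discrete_topology (carrier G)) (lctop A)) (lctop A) (\<lambda>(g, a). ?\<alpha> g a)"
    proof (rule continuous_map_discrete_times)
      fix g assume g: "g \<in> carrier G"
      have "continuous_map (lctop A) (lctop A) (\<lambda>f. restrict (\<lambda>p. f (\<sigma> (p, g))) (points P))"
        by (rule continuous_map_into_A[OF pull[OF g smooth_mfd_family_evaluation]])
      then show "continuous_map (lctop A) (lctop A) (\<lambda>f. case (g, f) of (g, f) \<Rightarrow> ?\<alpha> g f)"
        by (rule continuous_map_eq) (auto simp: pullback_action_def topspace_A)
    qed
  qed
qed

end

text \<open>The given character of the fixed algebra is located at a point \<open>m\<close> of the
  base. A trivialization around \<open>m\<close> provides the fibre coordinate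
  \<open>\<theta>\<close>, and a bump function around \<open>m\<close> lets functions of
  \<open>\<theta>\<close> be extended by 0 to all of \<open>P\<close>.\<close>

theorem principal_bundle_imp_nc_principal_bundle:
  fixes \<Lambda> :: "('g, 'c) monoid_scheme" and P :: "'p mfd" and M :: "'m mfd"
  assumes comm: "comm_group \<Lambda>" and fin: "finite (carrier \<Lambda>)" and pb: "principal_bundle P M \<Lambda> q \<sigma>"
  shows "nc_principal_bundle (smooth_function_algebra P) \<Lambda> (pullback_action P \<sigma>)"
proof -
  interpret Lam: comm_group \<Lambda> by (rule comm)
  have mP: "manifold P" and mM: "manifold M" and q_smooth: "smooth_map P M q"
    and act: "right_action (points P) \<Lambda> \<sigma>" and s_smooth: "smooth_map (times_discrete P (carrier \<Lambda>)) P \<sigma>"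
    using pb by (auto simp: principal_bundle_def)
  interpret P: smooth_manifold P by standard (rule mP)
  interpret M: smooth_manifold M by standard (rule mM)
  let ?\<alpha> = "pullback_action P \<sigma>"
  have q_cont: "continuous_map (mtop P) (mtop M) q" using q_smooth by (simp add: smooth_map_def)
  have q_in: "q p \<in> points M" if "p \<in> points P" for p
    using continuous_map_image_subset_topspace[OF q_cont] that by auto
  have s_in: "\<sigma> (p, g) \<in> points P" if "p \<in> points P" "g \<in> carrier \<Lambda>" for p g
    using act that by (auto simp: right_action_def)
  have triv: "\<exists>U \<Phi>. openin (mtop M) U \<and> m \<in> U \<and>
        diffeomorphism (times_discrete (open_submanifold M U) (carrier \<Lambda>))
          (open_submanifold P {p \<in> points P. q p \<in> U}) \<Phi> \<and>
        (\<forall>u\<in>U. \<forall>g\<in>carrier \<Lambda>. q (\<Phi> (u, g)) = u) \<and>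
        (\<forall>u\<in>U. \<forall>g\<in>carrier \<Lambda>. \<forall>h\<in>carrier \<Lambda>. \<Phi> (u, g \<otimes>\<^bsub>\<Lambda>\<^esub> h) = \<sigma> (\<Phi> (u, g), h))" if "m \<in> points M" for m
    using pb that unfolding principal_bundle_def by blast
  have bij: "bij_betw \<Phi> (U \<times> carrier \<Lambda>) {p \<in> points P. q p \<in> U}"
    if "openin (mtop M) U" "diffeomorphism (times_discrete (open_submanifold M U) (carrier \<Lambda>))
          (open_submanifold P {p \<in> points P. q p \<in> U}) \<Phi>" for U \<Phi>
  proof -
    have "topspace (subtopology (mtop M) U) = U" using openin_subset[OF that(1)] by auto
    moreover have "topspace (subtopology (mtop P) {p \<in> points P. q p \<in> U}) = {p \<in> points P. q p \<in> U}" by auto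
    ultimately show ?thesis
      using that(2) by (simp add: diffeomorphism_def times_discrete_def open_submanifold_def)
  qed
  \<comment> \<open>Read off from a trivialization: \<open>\<Phi> (u, g)\<close> and its translate
    \<open>\<Phi> (u, g \<otimes> h)\<close> lie over the same \<open>u\<close>.\<close>
  have q_inv: "q (\<sigma> (p, h)) = q p" if p: "p \<in> points P" and h: "h \<in> carrier \<Lambda>" for p h
  proof -
    obtain U \<Phi> where U: "openin (mtop M) U" "q p \<in> U"
        "diffeomorphism (times_discrete (open_submanifold M U) (carrier \<Lambda>)) (open_submanifold P {p \<in> points P. q p \<in> U}) \<Phi>"
      and q\<Phi>: "\<forall>u\<in>U. \<forall>g\<in>carrier \<Lambda>. q (\<Phi> (u, g)) = u"
      and \<Phi>\<sigma>: "\<forall>u\<in>U. \<forall>g\<in>carrier \<Lambda>. \<forall>h\<in>carrier \<Lambda>. \<Phi> (u, g \<otimes>\<^bsub>\<Lambda>\<^esub> h) = \<sigma> (\<Phi> (u, g), h)"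
      using triv[OF q_in[OF p]] by auto
    have "p \<in> \<Phi> ` (U \<times> carrier \<Lambda>)"
      using bij[OF U(1,3)] p U(2) unfolding bij_betw_def by blast
    then obtain u g where "u \<in> U" "g \<in> carrier \<Lambda>" "p = \<Phi> (u, g)" by auto
    then show ?thesis
      using q\<Phi> \<Phi>\<sigma> h by (metis Lam.m_closed)
  qed
  have dyn: "dynamical_system P.A \<Lambda> ?\<alpha>"
    by (rule P.dynamical_system_pullback[OF Lam.group_axioms act s_smooth])
  have ap: "?\<alpha> g f p = f (\<sigma> (p, g))" if "f \<in> smooth_functions P" "p \<in> points P" for g f p
    using that by (simp add: pullback_action_def)
  interpret D: lc_dynamics P.A \<Lambda> ?\<alpha>
    by (intro lc_dynamics.intro P.lc_alg_A Lam.group_axioms lc_dynamics_axioms.intro dyn)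
  define pull where "pull f = (\<lambda>p\<in>points P. f (q p))" for f :: "'m \<Rightarrow> complex"
  have pull_smooth: "pull f \<in> smooth_functions P" if "smooth_on_mfd M f" for f
    using smooth_mfd_family_pullback[OF mP mM q_smooth that] by (simp add: pull_def P.restrict_smooth)
  have pull_fixed: "pull f \<in> fixed_center P.A \<Lambda> ?\<alpha>" if f: "smooth_on_mfd M f" for f
  proof -
    have "?\<alpha> g (pull f) = pull f" if "g \<in> carrier \<Lambda>" for g
      using pull_smooth[OF f] that D.auto_closed[of g "pull f"]
      by (intro P.smooth_functions_ext) (auto simp: ap P.A_simps, simp_all add: pull_def s_in q_inv)
    then show ?thesis
      using pull_smooth[OF f] P.mult_A_commute by (auto simp: fixed_center_def P.A_simps(1))
  qed
  show ?thesis
    unfolding nc_principal_bundle_def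
  proof (intro conjI ballI dyn)
    fix \<xi> assume xi: "\<xi> \<in> algebra_characters (subalgebra_on P.A (fixed_center P.A \<Lambda> ?\<alpha>))"
    let ?B = "fixed_center P.A \<Lambda> ?\<alpha>"
    have xi_add: "\<xi> (a \<oplus>\<^bsub>P.A\<^esub> b) = \<xi> a + \<xi> b" and xi_mult: "\<xi> (a \<otimes>\<^bsub>P.A\<^esub> b) = \<xi> a * \<xi> b"
      and xi_smult: "\<xi> (c \<odot>\<^bsub>P.A\<^esub> a) = c * \<xi> a" if "a \<in> ?B" "b \<in> ?B" for a b c
      using xi that by (auto simp: algebra_characters_def subalgebra_on_def)
    obtain v where v: "v \<in> ?B" "\<xi> v \<noteq> 0"
      using xi by (auto simp: algebra_characters_def subalgebra_on_def)
    \<comment> \<open>Pullbacks along \<open>q\<close> are fixed by the action, so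
      \<open>\<xi>\<close> can be evaluated on them. The result is a character of the smooth
      functions on \<open>M\<close> and therefore a point of \<open>M\<close>.\<close>
    define \<eta> where "\<eta> = (\<lambda>f\<in>smooth_functions M. \<xi> (pull f))"
    have one: "pull (\<lambda>m\<in>points M. 1) = \<one>\<^bsub>P.A\<^esub>"
      by (auto simp: pull_def P.A_simps q_in intro!: restrict_ext)
    have eta: "\<eta> \<in> algebra_characters M.A"
      unfolding algebra_characters_def
    proof (intro CollectI conjI ballI allI)
      show "\<eta> \<in> extensional (carrier M.A)" by (simp add: \<eta>_def M.A_simps)
      fix f g assume fg: "f \<in> carrier M.A" "g \<in> carrier M.A"
      then have fgM: "f \<in> smooth_functions M" "g \<in> smooth_functions M" by (simp_all add: M.A_simps)
      note fgB = fgM[THEN M.smooth_functions_on, THEN pull_fixed]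
      have "pull (f \<oplus>\<^bsub>M.A\<^esub> g) = pull f \<oplus>\<^bsub>P.A\<^esub> pull g" "pull (f \<otimes>\<^bsub>M.A\<^esub> g) = pull f \<otimes>\<^bsub>P.A\<^esub> pull g"
        by (auto simp: pull_def P.A_simps M.A_simps q_in intro!: restrict_ext)
      moreover have "f \<oplus>\<^bsub>M.A\<^esub> g \<in> smooth_functions M" "f \<otimes>\<^bsub>M.A\<^esub> g \<in> smooth_functions M"
        using M.A_closed(1,2)[OF fgM] by (simp_all add: M.A_simps)
      ultimately show "\<eta> (f \<oplus>\<^bsub>M.A\<^esub> g) = \<eta> f + \<eta> g" "\<eta> (f \<otimes>\<^bsub>M.A\<^esub> g) = \<eta> f * \<eta> g"
        using fgM xi_add[OF fgB] xi_mult[OF fgB] by (simp_all add: \<eta>_def)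
    next
      fix c f assume "f \<in> carrier M.A"
      then have fM: "f \<in> smooth_functions M" by (simp add: M.A_simps)
      note fB = fM[THEN M.smooth_functions_on, THEN pull_fixed]
      have "pull (c \<odot>\<^bsub>M.A\<^esub> f) = c \<odot>\<^bsub>P.A\<^esub> pull f"
        by (auto simp: pull_def P.A_simps M.A_simps q_in intro!: restrict_ext)
      moreover have "c \<odot>\<^bsub>M.A\<^esub> f \<in> smooth_functions M"
        using M.A_closed(3)[OF fM] by (simp add: M.A_simps)
      ultimately show "\<eta> (c \<odot>\<^bsub>M.A\<^esub> f) = c * \<eta> f"
        using fM xi_smult[OF fB fB] by (simp add: \<eta>_def)
    next
      have 1: "(\<lambda>m\<in>points M. 1) \<in> smooth_functions M" by (rule M.A_closed(4))
      have "\<one>\<^bsub>P.A\<^esub> \<in> ?B" using pull_fixed[OF M.smooth_functions_on[OF 1]] one by simp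
      \<comment> \<open>\<open>\<xi> v = \<xi> v * \<xi> 1\<close> with
        \<open>\<xi> v \<noteq> 0\<close>, so \<open>\<xi>\<close> does not vanish on the unit,
        which is a pullback.\<close>
      moreover have "v \<otimes>\<^bsub>P.A\<^esub> \<one>\<^bsub>P.A\<^esub> = v" using v by (simp add: fixed_center_def)
      ultimately have "\<xi> \<one>\<^bsub>P.A\<^esub> \<noteq> 0" using xi_mult[OF v(1), of "\<one>\<^bsub>P.A\<^esub>"] v(2) by auto
      then have "\<eta> (\<lambda>m\<in>points M. 1) \<noteq> 0" using 1 one by (simp add: \<eta>_def)
      then show "\<exists>a\<in>carrier M.A. \<eta> a \<noteq> 0" using 1 M.A_simps(1) by blast
    qed
    obtain m where m: "m \<in> points M" "\<And>f. f \<in> smooth_functions M \<Longrightarrow> \<eta> f = f m"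
      using M.character_is_evaluation[OF eta] by blast
    obtain U \<Phi> where U: "openin (mtop M) U" "m \<in> U"
        "diffeomorphism (times_discrete (open_submanifold M U) (carrier \<Lambda>)) (open_submanifold P {p \<in> points P. q p \<in> U}) \<Phi>"
      and q\<Phi>: "\<forall>u\<in>U. \<forall>g\<in>carrier \<Lambda>. q (\<Phi> (u, g)) = u"
      and \<Phi>\<sigma>: "\<forall>u\<in>U. \<forall>g\<in>carrier \<Lambda>. \<forall>h\<in>carrier \<Lambda>. \<Phi> (u, g \<otimes>\<^bsub>\<Lambda>\<^esub> h) = \<sigma> (\<Phi> (u, g), h)"
      using triv[OF m(1)] by auto
    obtain z0 :: "'m \<Rightarrow> real" and C where z0: "smooth_on_mfd M z0" "z0 m = 1" "closedin (mtop M) C" "C \<subseteq> U"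
        "\<And>u. u \<in> points M - C \<Longrightarrow> z0 u = 0"
      using M.bump_function[OF U(1,2)] by blast
    have z0c: "smooth_on_mfd M (\<lambda>u. complex_of_real (z0 u))"
      by (rule M.smooth_mfd_family_bounded_linear[OF bounded_linear_of_real z0(1)])
    define z where "z = pull (\<lambda>u. complex_of_real (z0 u))"
    have zB: "z \<in> ?B" unfolding z_def by (rule pull_fixed[OF z0c])
    have zp: "z p = complex_of_real (z0 (q p))" if "p \<in> points P" for p
      using that by (simp add: z_def pull_def)
    have "pull (\<lambda>u\<in>points M. complex_of_real (z0 u)) = z"
      by (auto simp: z_def pull_def q_in intro!: restrict_ext)
    moreover have "(\<lambda>u\<in>points M. complex_of_real (z0 u)) \<in> smooth_functions M"
      using z0c by (simp add: M.restrict_smooth)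
    ultimately have "\<xi> z = 1"
      using m(2)[of "\<lambda>u\<in>points M. complex_of_real (z0 u)"] m(1) z0(2) by (simp add: \<eta>_def)
    interpret L: lc_localization P.A \<Lambda> ?\<alpha> z
      by (intro lc_localization.intro D.lc_dynamics_axioms lc_localization_axioms.intro zB)
    define Q where "Q = {p \<in> points P. q p \<in> U}"
    have Qopen: "openin (mtop P) Q"
      unfolding Q_def by (rule openin_continuous_map_preimage[OF q_cont U(1)])
    have bij\<Phi>: "bij_betw \<Phi> (U \<times> carrier \<Lambda>) Q"
      unfolding Q_def by (rule bij[OF U(1,3)])
    let ?\<Psi> = "inv_into (U \<times> carrier \<Lambda>) \<Phi>"
    have "points (times_discrete (open_submanifold M U) (carrier \<Lambda>)) = U \<times> carrier \<Lambda>"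
      using openin_subset[OF U(1)] by (auto simp: times_discrete_def open_submanifold_def)
    then have "smooth_map (open_submanifold P Q) (times_discrete (open_submanifold M U) (carrier \<Lambda>)) ?\<Psi>"
      using U(3) by (simp add: diffeomorphism_def Q_def)
    then have "continuous_map (subtopology (mtop P) Q) (prod_topology (subtopology (mtop M) U) (discrete_topology (carrier \<Lambda>))) ?\<Psi>"
      by (simp add: smooth_map_def times_discrete_def open_submanifold_def)
    from continuous_map_compose[OF this continuous_map_snd]
    have \<theta>_cont: "continuous_map (subtopology (mtop P) Q) (discrete_topology (carrier \<Lambda>)) (\<lambda>p. snd (?\<Psi> p))"
      by (simp add: o_def)
    \<comment> \<open>The group component of the inverse trivialization: it is locally constant, as
      the group is discrete, and translation by \<open>h\<close> multiplies it by \<open>h\<close>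
      on the right.\<close>
    define \<theta> where "\<theta> p = snd (?\<Psi> p)" for p
    have \<Psi>: "p \<in> Q \<Longrightarrow> \<exists>u\<in>U. \<exists>g\<in>carrier \<Lambda>. p = \<Phi> (u, g)" for p
      using bij\<Phi> unfolding bij_betw_def by (metis (no_types, lifting) SigmaE imageE)
    have \<theta>\<Phi>: "\<theta> (\<Phi> (u, g)) = g" if "u \<in> U" "g \<in> carrier \<Lambda>" for u g
      using that bij_betw_inv_into_left[OF bij\<Phi>, of "(u, g)"] by (simp add: \<theta>_def)
    have \<theta>_in: "\<theta> p \<in> carrier \<Lambda>" if "p \<in> Q" for p
      using \<Psi>[OF that] \<theta>\<Phi> by auto
    have \<theta>\<sigma>: "\<theta> (\<sigma> (p, h)) = \<theta> p \<otimes>\<^bsub>\<Lambda>\<^esub> h" if p: "p \<in> Q" and h: "h \<in> carrier \<Lambda>" for p h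
    proof -
      obtain u g where ug: "u \<in> U" "g \<in> carrier \<Lambda>" "p = \<Phi> (u, g)" using \<Psi>[OF p] by auto
      then have "\<sigma> (p, h) = \<Phi> (u, g \<otimes>\<^bsub>\<Lambda>\<^esub> h)" using \<Phi>\<sigma> h by simp
      then show ?thesis using ug h \<theta>\<Phi> by simp
    qed
    obtain S where S: "minimal_cyclic_basis \<Lambda> S"
      using Lam.minimal_cyclic_basis_exists[OF fin] by blast
    have "\<exists>a \<in> isotypic_component (smooth_localization P.A z) \<Lambda> (localized_action P.A z ?\<alpha>) (dual_generator \<Lambda> S s).
           a \<in> Units (smooth_localization P.A z) \<and>
           a [^]\<^bsub>smooth_localization P.A z\<^esub> group.ord \<Lambda> s = \<one>\<^bsub>smooth_localization P.A z\<^esub>" if s: "s \<in> S" for s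
    proof -
      let ?s = "dual_generator \<Lambda> S s"
      have sdual: "?s \<in> dual_group_set \<Lambda>" by (rule Lam.dual_generator_eq(1)[OF fin S s])
      have s_mult: "?s (g \<otimes>\<^bsub>\<Lambda>\<^esub> h) = ?s g * ?s h" if "g \<in> carrier \<Lambda>" "h \<in> carrier \<Lambda>" for g h
        using sdual that by (auto simp: dual_group_set_def hom_def circle_group_def)
      \<comment> \<open>On the trivialized part, the bump times the dual generator of the fibre
        coordinate. Equivariance of \<open>\<theta>\<close> makes this isotypic.\<close>
      define w0 where "w0 p = (if p \<in> Q then complex_of_real (z0 (q p)) * ?s (\<theta> p) else 0)" for p
      have zq: "smooth_on_mfd P (\<lambda>p. complex_of_real (z0 (q p)))"
        by (rule smooth_mfd_family_pullback[OF mP mM q_smooth z0c])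
      have w0_smooth: "smooth_on_mfd P w0"
      proof (rule P.smooth_mfd_family_local)
        fix p assume p: "p \<in> points P"
        show "\<exists>W G. openin (mtop P) W \<and> p \<in> W \<and> smooth_mfd_family P (discrete_topology {()}) G \<and>
            (\<forall>x\<in>topspace (discrete_topology {()}). \<forall>r\<in>W. w0 r = G x r)"
        proof (cases "p \<in> Q")
          case True
          \<comment> \<open>On the neighbourhood where \<open>\<theta>\<close> keeps its value at
            \<open>p\<close>, the function is a constant multiple of the pulled back bump.\<close>
          let ?W = "{r \<in> topspace (subtopology (mtop P) Q). snd (?\<Psi> r) \<in> {\<theta> p}}"
          have "openin (subtopology (mtop P) Q) ?W"
            by (rule openin_continuous_map_preimage[OF \<theta>_cont]) (use \<theta>_in[OF True] in simp)
          then have "openin (mtop P) ?W" using Qopen openin_trans_full by blast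
          moreover have "p \<in> ?W" using True p by (simp add: \<theta>_def)
          moreover have "smooth_on_mfd P (\<lambda>r. complex_of_real (z0 (q r)) * ?s (\<theta> p))"
            by (rule P.smooth_mfd_family_mult[OF zq P.smooth_mfd_family_parameter]) simp
          moreover have "w0 r = complex_of_real (z0 (q r)) * ?s (\<theta> p)" if "r \<in> ?W" for r
            using that by (simp add: w0_def \<theta>_def)
          ultimately show ?thesis by blast
        next
          case False
          \<comment> \<open>Points outside \<open>Q\<close>, including its boundary, lie over the
            complement of the closed set \<open>C\<close>, where the bump vanishes.\<close>
          let ?W = "{r \<in> points P. q r \<in> points M - C}"
          have "openin (mtop P) ?W"
            by (rule openin_continuous_map_preimage[OF q_cont]) (use z0(3) in blast)
          moreover have "p \<in> ?W" using False p z0(4) q_in[OF p] by (auto simp: Q_def)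
          moreover have "smooth_on_mfd P (\<lambda>r. 0 :: complex)"
            by (rule P.smooth_mfd_family_parameter) simp
          moreover have "w0 r = 0" if "r \<in> ?W" for r
            using that z0(5) by (simp add: w0_def)
          ultimately show ?thesis by blast
        qed
      qed
      define w where "w = restrict w0 (points P)"
      have w_smooth: "w \<in> smooth_functions P"
        using w0_smooth by (simp add: w_def P.restrict_smooth)
      have "?\<alpha> g w = ?s g \<odot>\<^bsub>P.A\<^esub> w" if g: "g \<in> carrier \<Lambda>" for g
      proof (rule P.smooth_functions_ext)
        show "?\<alpha> g w \<in> smooth_functions P"
          using D.auto_closed[OF g, of w] w_smooth by (simp add: P.A_simps(1))
        show "?s g \<odot>\<^bsub>P.A\<^esub> w \<in> smooth_functions P"
          using P.A_closed(3)[OF w_smooth] by (simp add: P.A_simps)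
        fix p assume p: "p \<in> points P"
        have "w0 (\<sigma> (p, g)) = ?s g * w0 p"
        proof (cases "p \<in> Q")
          case True
          then have "\<sigma> (p, g) \<in> Q" using p g by (simp add: Q_def s_in q_inv)
          then show ?thesis
            using True p g by (simp add: w0_def q_inv \<theta>\<sigma> s_mult \<theta>_in)
        next
          case False
          then have "\<sigma> (p, g) \<notin> Q" using p g by (simp add: Q_def q_inv)
          then show ?thesis using False by (simp add: w0_def)
        qed
        then show "?\<alpha> g w p = (?s g \<odot>\<^bsub>P.A\<^esub> w) p"
          using p g by (simp add: ap[OF w_smooth] P.A_simps) (simp add: w_def s_in)
      qed
      then have w_iso: "w \<in> isotypic_component P.A \<Lambda> ?\<alpha> ?s"
        using w_smooth by (simp add: isotypic_component_def P.A_simps(1))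
      \<comment> \<open>On \<open>Q\<close> the factor \<open>?s (\<theta> p)\<close> has power 1
        for the exponent \<open>ord s\<close>; off \<open>Q\<close> both functions are 0.\<close>
      have "w [^]\<^bsub>P.A\<^esub> Lam.ord s = z [^]\<^bsub>P.A\<^esub> Lam.ord s"
      proof (rule P.smooth_functions_ext)
        show "w [^]\<^bsub>P.A\<^esub> Lam.ord s \<in> smooth_functions P" "z [^]\<^bsub>P.A\<^esub> Lam.ord s \<in> smooth_functions P"
          using D.nat_pow_closed[of w] D.nat_pow_closed[of z] w_smooth L.z_carrier by (simp_all add: P.A_simps(1))
        fix p assume p: "p \<in> points P"
        show "(w [^]\<^bsub>P.A\<^esub> Lam.ord s) p = (z [^]\<^bsub>P.A\<^esub> Lam.ord s) p"
        proof (cases "p \<in> Q")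
          case True
          then show ?thesis
            using p Lam.dual_generator_power[OF fin S s \<theta>_in[OF True]]
            by (simp add: P.A_pow zp w_def w0_def power_mult_distrib)
        next
          case False
          then have "q p \<in> points M - C" using p q_in z0(4) by (auto simp: Q_def)
          then show ?thesis
            using p False z0(5) by (simp add: P.A_pow zp w_def w0_def)
        qed
      qed
      moreover have "Lam.ord s > 0"
        using Lam.minimal_cyclic_basis_independent(2)[OF S] s Lam.ord_pos[OF fin] by blast
      ultimately show ?thesis
        using L.localization_root_of_unity[OF w_iso] by blast
    qed
    then have "trivial_nc_principal_bundle (smooth_localization P.A z) \<Lambda> (localized_action P.A z ?\<alpha>)"
      unfolding trivial_nc_principal_bundle_def using L.dynamical_system_localization S by blast
    then show "\<exists>z\<in>?B. \<xi> z \<noteq> 0 \<and> \<xi> z \<in> \<real> \<and>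
        trivial_nc_principal_bundle (smooth_localization P.A z) \<Lambda> (localized_action P.A z ?\<alpha>)"
      using zB \<open>\<xi> z = 1\<close> by (intro bexI[of _ z]) auto
  qed
qed

section \<open>The action determined by a dynamical system\<close>

lemma smooth_fun_subset: "smooth_fun n V f \<Longrightarrow> V' \<subseteq> V \<Longrightarrow> smooth_fun n V' f"
  unfolding smooth_fun_iff_family by (rule smooth_family_subset)

lemma smooth_fun_local:
  assumes "\<And>y. y \<in> V \<Longrightarrow> \<exists>V0. openin (Euclidean_space n) V0 \<and> y \<in> V0 \<and> smooth_fun n V0 f"
  shows "smooth_fun n V f"
  unfolding smooth_fun_iff_family by (rule smooth_family_local) (use assms in \<open>auto simp: smooth_fun_iff_family\<close>)

context smooth_manifold
begin

lemma complex_bump_function: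
  assumes W: "openin (mtop P) W" "p \<in> W"
  obtains f where "f \<in> smooth_functions P" "f p = 1" "\<And>q. q \<in> points P - W \<Longrightarrow> f q = 0"
proof -
  obtain f :: "'p \<Rightarrow> real" and C where f: "smooth_on_mfd P f" "f p = 1" "C \<subseteq> W" "\<And>q. q \<in> points P - C \<Longrightarrow> f q = 0"
    using bump_function[OF W] by metis
  have "smooth_on_mfd P (\<lambda>q. complex_of_real (f q))"
    by (rule smooth_mfd_family_bounded_linear[OF bounded_linear_of_real f(1)])
  then have "(\<lambda>q\<in>points P. complex_of_real (f q)) \<in> smooth_functions P"
    by (simp add: restrict_smooth)
  moreover have "p \<in> points P" using W openin_subset by blast
  ultimately show thesis
    using that[of "\<lambda>q\<in>points P. complex_of_real (f q)"] f by auto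
qed

lemma smooth_functions_separate:
  assumes "p \<in> points P" "p' \<in> points P" "\<And>f. f \<in> smooth_functions P \<Longrightarrow> f p = f p'"
  shows "p = p'"
proof (rule ccontr)
  assume ne: "p \<noteq> p'"
  have "Hausdorff_space (mtop P)" using mfd by (simp add: manifold_def)
  then obtain W W' where W: "openin (mtop P) W" "p \<in> W" "p' \<in> W'" "disjnt W W'"
    unfolding Hausdorff_space_def using assms(1,2) ne by metis
  obtain f where f: "f \<in> smooth_functions P" "f p = 1" "\<And>q. q \<in> points P - W \<Longrightarrow> f q = 0"
    using complex_bump_function[OF W(1,2)] by blast
  have "p' \<in> points P - W" using W assms(2) by (auto simp: disjnt_iff)
  from f(3)[OF this] show False using assms(3)[OF f(1)] f(2) by simp
qed

text \<open>For continuity, a bump function at \<open>s p\<close> that vanishes outside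
  \<open>W\<close> pulls back to a continuous function whose nonvanishing set is mapped into
  \<open>W\<close>. For smoothness, chart coordinates agree near a point with global smooth
  functions, whose pullbacks are smooth by hypothesis.\<close>

lemma smooth_map_if_pullback:
  assumes s: "\<And>p. p \<in> points P \<Longrightarrow> s p \<in> points P"
    and pull: "\<And>f. f \<in> smooth_functions P \<Longrightarrow> \<exists>f'\<in>smooth_functions P. \<forall>p\<in>points P. f' p = f (s p)"
  shows "smooth_map P P s"
proof -
  have cont: "continuous_map (mtop P) (mtop P) s"
    unfolding continuous_map_def
  proof (intro conjI allI impI)
    fix W assume W: "openin (mtop P) W"
    show "openin (mtop P) {p \<in> points P. s p \<in> W}"
    proof (subst openin_subopen, intro ballI)
      fix p0 assume p0: "p0 \<in> {p \<in> points P. s p \<in> W}"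
      then obtain f where f: "f \<in> smooth_functions P" "f (s p0) = 1" "\<And>q. q \<in> points P - W \<Longrightarrow> f q = 0"
        using complex_bump_function[OF W, of "s p0"] by blast
      obtain f' where f': "f' \<in> smooth_functions P" "\<forall>p\<in>points P. f' p = f (s p)"
        using pull[OF f(1)] by blast
      have "openin (mtop P) {p \<in> points P. f' p \<in> - {0}}"
        by (rule openin_continuous_map_preimage[OF smooth_on_mfd_continuous[OF smooth_functions_on[OF f'(1)]]]) auto
      moreover have "p0 \<in> {p \<in> points P. f' p \<in> - {0}}"
        using p0 f(2) f'(2) by auto
      moreover have "{p \<in> points P. f' p \<in> - {0}} \<subseteq> {p \<in> points P. s p \<in> W}"
      proof
        fix p assume "p \<in> {p \<in> points P. f' p \<in> - {0}}"
        then have p: "p \<in> points P" "f' p \<noteq> 0" by auto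
        then have "f (s p) \<noteq> 0" using f'(2) by auto
        then have "s p \<in> W" using f(3)[of "s p"] s[OF p(1)] by blast
        with p show "p \<in> {p \<in> points P. s p \<in> W}" by simp
      qed
      ultimately show "\<exists>T. openin (mtop P) T \<and> p0 \<in> T \<and> T \<subseteq> {p \<in> points P. s p \<in> W}"
        by blast
    qed
  qed (use s in auto)
  have "smooth_fun n (\<phi> ` (U \<inter> s -` V)) (\<lambda>x. \<psi> (s (inv_into U \<phi> x)) j)"
    if c: "(U, \<phi>) \<in> atlas P" and d: "(V, \<psi>) \<in> atlas P" and j: "j < n" for U \<phi> V \<psi> j
  proof (rule smooth_fun_local)
    fix y assume "y \<in> \<phi> ` (U \<inter> s -` V)"
    then obtain p0 where p0: "p0 \<in> U" "s p0 \<in> V" "y = \<phi> p0" by auto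
    have coord: "smooth_fun n (\<psi> ` V) (\<lambda>w. w j)"
      unfolding smooth_fun_iff_family by (rule smooth_family_coordinate[OF chart_image_open[OF d]])
    obtain f :: "'p \<Rightarrow> real" and N where f: "smooth_on_mfd P f" "openin (mtop P) N" "s p0 \<in> N" "N \<subseteq> V \<inter> V"
        "\<And>q. q \<in> N \<Longrightarrow> f q = \<psi> q j"
      using chart_function_extension[OF d p0(2) chart_open[OF d] p0(2) coord] by metis
    have "smooth_on_mfd P (\<lambda>q. complex_of_real (f q))"
      by (rule smooth_mfd_family_bounded_linear[OF bounded_linear_of_real f(1)])
    then have "(\<lambda>q\<in>points P. complex_of_real (f q)) \<in> smooth_functions P"
      by (simp add: restrict_smooth)
    from pull[OF this] obtain f' where f': "f' \<in> smooth_functions P"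
      "\<forall>p\<in>points P. f' p = (\<lambda>q\<in>points P. complex_of_real (f q)) (s p)" by blast
    let ?W = "{p \<in> points P. s p \<in> N}"
    have V0: "openin (Euclidean_space n) (\<phi> ` (U \<inter> ?W))"
      by (rule chart_image_openin[OF c openin_continuous_map_preimage[OF cont f(2)]])
    have "smooth_on_mfd P (\<lambda>q. Re (f' q))"
      by (rule smooth_mfd_family_bounded_linear[OF bounded_linear_Re smooth_functions_on[OF f'(1)]])
    then have "smooth_fun n (\<phi> ` U) (\<lambda>y. Re (f' (inv_into U \<phi> y)))"
      unfolding smooth_fun_iff_family by (rule smooth_mfd_familyD[OF _ c])
    then have "smooth_fun n (\<phi> ` (U \<inter> ?W)) (\<lambda>y. Re (f' (inv_into U \<phi> y)))"
      by (rule smooth_fun_subset) auto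
    then have "smooth_fun n (\<phi> ` (U \<inter> ?W)) (\<lambda>x. \<psi> (s (inv_into U \<phi> x)) j)"
      by (rule smooth_fun_cong[OF V0]) (use c f(5) f'(2) s in auto)
    moreover have "y \<in> \<phi> ` (U \<inter> ?W)"
      using p0 f(3) chart_subset[OF c] by auto
    ultimately show "\<exists>V0. openin (Euclidean_space n) V0 \<and> y \<in> V0 \<and> smooth_fun n V0 (\<lambda>x. \<psi> (s (inv_into U \<phi> x)) j)"
      using V0 by blast
  qed
  then show ?thesis using cont by (auto simp: smooth_map_def)
qed

lemma determined_action_iff:
  assumes "dynamical_system A G \<alpha>"
  shows "determined_action P G \<alpha> \<sigma> \<longleftrightarrow> \<sigma> \<in> points P \<times> carrier G \<rightarrow>\<^sub>E points P \<and>
    (\<forall>p\<in>points P. \<forall>g\<in>carrier G. \<forall>f\<in>smooth_functions P. f (\<sigma> (p, g)) = \<alpha> g f p)"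
proof -
  interpret D: lc_dynamics A G \<alpha>
    using assms by (intro lc_dynamics.intro lc_alg_A lc_dynamics_axioms.intro) (auto simp: dynamical_system_def)
  have closed: "\<alpha> g f \<in> smooth_functions P" if "g \<in> carrier G" "f \<in> smooth_functions P" for g f
    using D.auto_closed that by (simp add: A_simps)
  have "point_evaluation P r = compose (smooth_functions P) (point_evaluation P p) (\<alpha> g) \<longleftrightarrow>
      (\<forall>f\<in>smooth_functions P. f r = \<alpha> g f p)" if "g \<in> carrier G" for p r g
  proof
    assume eq: "point_evaluation P r = compose (smooth_functions P) (point_evaluation P p) (\<alpha> g)"
    show "\<forall>f\<in>smooth_functions P. f r = \<alpha> g f p"
    proof
      fix f assume "f \<in> smooth_functions P"
      then show "f r = \<alpha> g f p"
        using fun_cong[OF eq, of f] that by (simp add: point_evaluation_def compose_def closed)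
    qed
  next
    assume "\<forall>f\<in>smooth_functions P. f r = \<alpha> g f p"
    then show "point_evaluation P r = compose (smooth_functions P) (point_evaluation P p) (\<alpha> g)"
      using that by (auto simp: point_evaluation_def compose_def closed fun_eq_iff)
  qed
  then show ?thesis
    unfolding determined_action_def by blast
qed

text \<open>Evaluation at \<open>p\<close> after \<open>\<alpha> g\<close> is again a nonzero
  character, so it is evaluation at some point. Smooth functions separate points, and extensionality
  fixes the values off the domain; together they give uniqueness.\<close>

lemma determined_action_exists_unique:
  assumes dyn: "dynamical_system A G \<alpha>"
  shows "\<exists>!\<sigma>. determined_action P G \<alpha> \<sigma>"
proof -
  interpret D: lc_dynamics A G \<alpha>
    using dyn by (intro lc_dynamics.intro lc_alg_A lc_dynamics_axioms.intro) (auto simp: dynamical_system_def)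
  have ex: "\<exists>r\<in>points P. \<forall>f\<in>smooth_functions P. f r = \<alpha> g f p" if p: "p \<in> points P" and g: "g \<in> carrier G" for p g
  proof -
    let ?\<xi> = "\<lambda>f\<in>smooth_functions P. \<alpha> g f p"
    have "?\<xi> \<in> algebra_characters A"
      unfolding algebra_characters_def
    proof (intro CollectI conjI ballI allI)
      show "?\<xi> \<in> extensional (carrier A)" by (simp add: A_simps)
      fix a b c assume a: "a \<in> carrier A"
      have "c \<odot>\<^bsub>A\<^esub> a \<in> smooth_functions P"
        using D.smult_in[OF a] by (simp add: A_simps(1))
      then show "?\<xi> (c \<odot>\<^bsub>A\<^esub> a) = c * ?\<xi> a"
        using D.auto_smult[OF g a] a p by (simp add: A_simps(1)) (simp add: A_simps)
      assume b: "b \<in> carrier A"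
      have "a \<oplus>\<^bsub>A\<^esub> b \<in> smooth_functions P" "a \<otimes>\<^bsub>A\<^esub> b \<in> smooth_functions P"
        using D.a_closed[OF a b] D.m_closed[OF a b] by (simp_all add: A_simps(1))
      then show "?\<xi> (a \<oplus>\<^bsub>A\<^esub> b) = ?\<xi> a + ?\<xi> b" "?\<xi> (a \<otimes>\<^bsub>A\<^esub> b) = ?\<xi> a * ?\<xi> b"
        using D.auto_add[OF g a b] D.auto_mult[OF g a b] a b p by (simp_all add: A_simps(1)) (simp_all add: A_simps)
    next
      have "\<one>\<^bsub>A\<^esub> \<in> smooth_functions P" using D.one_closed by (simp add: A_simps(1))
      then have "?\<xi> \<one>\<^bsub>A\<^esub> = 1" using D.auto_one[OF g] p by simp (simp add: A_simps)
      then show "\<exists>a\<in>carrier A. ?\<xi> a \<noteq> 0" using D.one_closed by (metis zero_neq_one)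
    qed
    from character_is_evaluation[OF this] obtain r where "r \<in> points P" "\<And>f. f \<in> smooth_functions P \<Longrightarrow> ?\<xi> f = f r"
      by blast
    then show ?thesis by (metis restrict_apply')
  qed
  define r where "r p g = (SOME r. r \<in> points P \<and> (\<forall>f\<in>smooth_functions P. f r = \<alpha> g f p))" for p g
  define \<sigma> where "\<sigma> = (\<lambda>(p, g)\<in>points P \<times> carrier G. r p g)"
  have sig: "\<sigma> (p, g) \<in> points P \<and> (\<forall>f\<in>smooth_functions P. f (\<sigma> (p, g)) = \<alpha> g f p)"
    if "p \<in> points P" "g \<in> carrier G" for p g
    using someI_ex[OF ex[OF that, unfolded Bex_def], folded r_def] that by (simp add: \<sigma>_def)
  show ?thesis
  proof (rule ex1I[of _ \<sigma>])
    show "determined_action P G \<alpha> \<sigma>"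
      unfolding determined_action_iff[OF dyn] using sig by (auto simp: PiE_iff) (simp add: \<sigma>_def)
    fix \<tau> assume "determined_action P G \<alpha> \<tau>"
    then have tau: "\<tau> \<in> points P \<times> carrier G \<rightarrow>\<^sub>E points P"
        "\<And>p g f. p \<in> points P \<Longrightarrow> g \<in> carrier G \<Longrightarrow> f \<in> smooth_functions P \<Longrightarrow> f (\<tau> (p, g)) = \<alpha> g f p"
      unfolding determined_action_iff[OF dyn] by auto
    show "\<tau> = \<sigma>"
    proof (rule PiE_ext[OF tau(1)])
      show "\<sigma> \<in> points P \<times> carrier G \<rightarrow>\<^sub>E points P"
        using sig by (auto simp: PiE_iff) (simp add: \<sigma>_def)
      fix x assume "x \<in> points P \<times> carrier G"
      then obtain p g where x: "x = (p, g)" "p \<in> points P" "g \<in> carrier G" by auto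
      show "\<tau> x = \<sigma> x"
        unfolding x(1) by (rule smooth_functions_separate) (use tau sig x in auto)
    qed
  qed
qed

text \<open>\<open>f (\<sigma> (\<sigma> (p, g), h)) = \<alpha> h f (\<sigma> (p, g)) = \<alpha> g
  (\<alpha> h f) p\<close>, so a homomorphism \<open>\<alpha>\<close> yields a right action. Each
  translation is smooth because it pulls \<open>f\<close> back to the smooth function
  \<open>\<alpha> g f\<close>.\<close>

lemma determined_action_right_action:
  assumes dyn: "dynamical_system A G \<alpha>" and det: "determined_action P G \<alpha> \<sigma>"
  shows "right_action (points P) G \<sigma>" and "g \<in> carrier G \<Longrightarrow> smooth_map P P (\<lambda>p. \<sigma> (p, g))"
proof -
  interpret D: lc_dynamics A G \<alpha>
    using dyn by (intro lc_dynamics.intro lc_alg_A lc_dynamics_axioms.intro) (auto simp: dynamical_system_def)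
  have closed: "\<alpha> g f \<in> smooth_functions P" if "g \<in> carrier G" "f \<in> smooth_functions P" for g f
    using D.auto_closed that by (simp add: A_simps)
  have s_in: "\<sigma> (p, g) \<in> points P" and s_eq: "f \<in> smooth_functions P \<Longrightarrow> f (\<sigma> (p, g)) = \<alpha> g f p"
    if "p \<in> points P" "g \<in> carrier G" for p g f
    using det that unfolding determined_action_iff[OF dyn] by auto
  show "right_action (points P) G \<sigma>"
    unfolding right_action_def
  proof (intro conjI ballI)
    show "\<sigma> \<in> points P \<times> carrier G \<rightarrow> points P" using s_in by auto
    show "\<sigma> (p, \<one>\<^bsub>G\<^esub>) = p" if "p \<in> points P" for p
      by (rule smooth_functions_separate) (use that D.auto_id in \<open>auto simp: s_in s_eq A_simps(1)\<close>)
    show "\<sigma> (\<sigma> (p, g), h) = \<sigma> (p, g \<otimes>\<^bsub>G\<^esub> h)" if "p \<in> points P" "g \<in> carrier G" "h \<in> carrier G" for p g h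
      by (rule smooth_functions_separate) (use that D.auto_comp in \<open>auto simp: s_in s_eq closed A_simps(1)\<close>)
  qed
  show "smooth_map P P (\<lambda>p. \<sigma> (p, g))" if g: "g \<in> carrier G"
  proof (rule smooth_map_if_pullback)
    show "\<exists>f'\<in>smooth_functions P. \<forall>p\<in>points P. f' p = f (\<sigma> (p, g))" if "f \<in> smooth_functions P" for f
      using that g s_eq closed by (intro bexI[of _ "\<alpha> g f"]) auto
  qed (use g s_in in auto)
qed

lemma determined_action_free:
  assumes comm: "comm_group G" and fin: "finite (carrier G)"
    and nc: "nc_principal_bundle A G \<alpha>" and det: "determined_action P G \<alpha> \<sigma>"
    and p: "p \<in> points P" and g: "g \<in> carrier G" and fixed: "\<sigma> (p, g) = p"
  shows "g = \<one>\<^bsub>G\<^esub>"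
proof -
  interpret G: comm_group G by fact
  have dyn: "dynamical_system A G \<alpha>" using nc by (simp add: nc_principal_bundle_def)
  interpret D: lc_dynamics A G \<alpha>
    using dyn by (intro lc_dynamics.intro lc_alg_A lc_dynamics_axioms.intro G.group_axioms)
  let ?B = "fixed_center A G \<alpha>"
  let ?\<xi> = "\<lambda>z\<in>?B. z p"
  have B_iff: "z \<in> ?B \<longleftrightarrow> z \<in> carrier A \<and> (\<forall>g\<in>carrier G. \<alpha> g z = z)" for z
    using mult_A_commute by (auto simp: fixed_center_def)
  have oneB: "\<one>\<^bsub>A\<^esub> \<in> ?B" by (auto simp: B_iff)
  have "?\<xi> \<in> algebra_characters (subalgebra_on A ?B)"
    unfolding algebra_characters_def
  proof (intro CollectI conjI ballI allI)
    show "?\<xi> \<in> extensional (carrier (subalgebra_on A ?B))"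
      by (simp add: subalgebra_on_def)
    fix a b c assume "a \<in> carrier (subalgebra_on A ?B)"
    then have a: "a \<in> ?B" by (simp add: subalgebra_on_def)
    then have "c \<odot>\<^bsub>A\<^esub> a \<in> ?B" by (auto simp: B_iff D.auto_smult)
    then show "?\<xi> (c \<odot>\<^bsub>subalgebra_on A ?B\<^esub> a) = c * ?\<xi> a"
      using a p by (simp add: subalgebra_on_def) (simp add: A_simps)
    assume "b \<in> carrier (subalgebra_on A ?B)"
    then have b: "b \<in> ?B" by (simp add: subalgebra_on_def)
    then have "a \<oplus>\<^bsub>A\<^esub> b \<in> ?B" "a \<otimes>\<^bsub>A\<^esub> b \<in> ?B" using a by (auto simp: B_iff D.auto_add D.auto_mult)
    then show "?\<xi> (a \<oplus>\<^bsub>subalgebra_on A ?B\<^esub> b) = ?\<xi> a + ?\<xi> b" "?\<xi> (a \<otimes>\<^bsub>subalgebra_on A ?B\<^esub> b) = ?\<xi> a * ?\<xi> b"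
      using a b p by (simp_all add: subalgebra_on_def) (simp_all add: A_simps)
  next
    have "?\<xi> \<one>\<^bsub>A\<^esub> = 1" using oneB p by simp (simp add: A_simps)
    then show "\<exists>a\<in>carrier (subalgebra_on A ?B). ?\<xi> a \<noteq> 0"
      using oneB by (intro bexI[of _ "\<one>\<^bsub>A\<^esub>"]) (auto simp: subalgebra_on_def)
  qed
  with nc obtain z where z: "z \<in> ?B" "?\<xi> z \<noteq> 0" "?\<xi> z \<in> \<real>"
      "trivial_nc_principal_bundle (smooth_localization A z) G (localized_action A z \<alpha>)"
    unfolding nc_principal_bundle_def by blast
  interpret L: lc_localization A G \<alpha> z
    by (intro lc_localization.intro D.lc_dynamics_axioms lc_localization_axioms.intro z(1))
  obtain S where S: "minimal_cyclic_basis G S"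
    and roots: "\<forall>s\<in>S. \<exists>a \<in> isotypic_component (smooth_localization A z) G (localized_action A z \<alpha>) (dual_generator G S s).
           a \<in> Units (smooth_localization A z) \<and> a [^]\<^bsub>smooth_localization A z\<^esub> group.ord G s = \<one>\<^bsub>smooth_localization A z\<^esub>"
    using z(4) unfolding trivial_nc_principal_bundle_def by blast
  have zp: "z p \<noteq> 0" "z p \<in> \<real>" using z by auto
  \<comment> \<open>Time is a real parameter, so \<open>1 - t z(p)\<close> has a zero only because
    \<open>z p\<close> is real and nonzero.\<close>
  define t where "t = inverse (Re (z p))"
  have t: "complex_of_real t * z p = 1"
    using zp by (auto simp: t_def Reals_def)
  show ?thesis
  proof (rule G.dual_generators_separate[OF fin S g])
    fix s assume s: "s \<in> S"
    then obtain x where x: "x \<in> isotypic_component (smooth_localization A z) G (localized_action A z \<alpha>) (dual_generator G S s)"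
        "x \<in> Units (smooth_localization A z)"
      using roots by blast
    have "\<exists>a\<in>carrier A. a p \<noteq> 0 \<and> (\<forall>g\<in>carrier G. \<alpha> g a p = dual_generator G S s g * a p)"
      by (rule L.localization_character[OF evaluation_continuous[OF p] _ _ _ _ t x]) (use p in \<open>auto simp: A_simps\<close>)
    then obtain a where a: "a \<in> carrier A" "a p \<noteq> 0" "\<alpha> g a p = dual_generator G S s g * a p"
      using g by blast
    \<comment> \<open>As \<open>g\<close> fixes \<open>p\<close>, the left side is
      \<open>a p\<close>; the isotypic equation makes the right side a multiple of
      \<open>a p\<close>, and \<open>a p \<noteq> 0\<close> can be cancelled.\<close>
    have "a (\<sigma> (p, g)) = \<alpha> g a p"
      using det p g a(1) unfolding determined_action_iff[OF dyn] A_simps(1) by blast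
    then show "dual_generator G S s g = 1" using a fixed by simp
  qed
qed

end

section \<open>The quotient of a compact manifold by a free action of a finite group\<close>

lemma continuous_map_times_discrete:
  assumes "\<And>g. g \<in> D \<Longrightarrow> continuous_map Y Z (\<lambda>y. f (y, g))"
  shows "continuous_map (prod_topology Y (discrete_topology D)) Z f"
proof -
  have "continuous_map (prod_topology (discrete_topology D) Y) Z (\<lambda>z. f (snd z, fst z))"
    by (rule continuous_map_discrete_times) (use assms in simp)
  moreover have "continuous_map (prod_topology Y (discrete_topology D)) (prod_topology (discrete_topology D) Y) (\<lambda>z. (snd z, fst z))"
    by (intro continuous_map_pairedI continuous_map_fst continuous_map_snd)
  ultimately have "continuous_map (prod_topology Y (discrete_topology D)) Z ((\<lambda>z. f (snd z, fst z)) \<circ> (\<lambda>z. (snd z, fst z)))"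
    by (rule continuous_map_compose[rotated])
  then show ?thesis by (simp add: o_def)
qed

lemma compact_imp_paracompact_space: "compact_space X \<Longrightarrow> paracompact_space X"
  unfolding paracompact_space_def
proof (intro allI impI)
  fix C assume "compact_space X" and C: "(\<forall>U\<in>C. openin X U) \<and> \<Union> C = topspace X"
  then obtain D where D: "finite D" "D \<subseteq> C" "topspace X \<subseteq> \<Union>D"
    unfolding compact_space_alt by (metis order_refl)
  have "locally_finite_in X D"
    using D C openin_subset by (intro finite_imp_locally_finite_in) blast+
  moreover have "\<Union>D = topspace X"
    using D C by blast
  ultimately show "\<exists>D. (\<forall>V\<in>D. openin X V) \<and> \<Union> D = topspace X \<and> (\<forall>V\<in>D. \<exists>U\<in>C. V \<subseteq> U) \<and> locally_finite_in X D"
    using C D(2) by (intro exI[of _ D] conjI ballI) (auto intro: order_refl)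
qed

locale free_finite_action = smooth_manifold P + G: group G for P :: "'p mfd" and G :: "('g, 'c) monoid_scheme" +
  fixes \<sigma> :: "'p \<times> 'g \<Rightarrow> 'p"
  assumes fin: "finite (carrier G)" and act: "right_action (points P) G \<sigma>"
    and smooth: "\<And>g. g \<in> carrier G \<Longrightarrow> smooth_map P P (\<lambda>p. \<sigma> (p, g))"
    and free: "\<And>p g. p \<in> points P \<Longrightarrow> g \<in> carrier G \<Longrightarrow> \<sigma> (p, g) = p \<Longrightarrow> g = \<one>\<^bsub>G\<^esub>"
    and compact: "compact_space (mtop P)"
begin

section \<open>The orbit space and its topology\<close>

abbreviation "pr \<equiv> orbit_map G \<sigma>"

lemma act_in [simp]: "p \<in> points P \<Longrightarrow> g \<in> carrier G \<Longrightarrow> \<sigma> (p, g) \<in> points P"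
  and act_one [simp]: "p \<in> points P \<Longrightarrow> \<sigma> (p, \<one>\<^bsub>G\<^esub>) = p"
  and act_act: "p \<in> points P \<Longrightarrow> g \<in> carrier G \<Longrightarrow> h \<in> carrier G \<Longrightarrow> \<sigma> (\<sigma> (p, g), h) = \<sigma> (p, g \<otimes>\<^bsub>G\<^esub> h)"
  using act by (auto simp: right_action_def)

lemma act_cancel: "p \<in> points P \<Longrightarrow> g \<in> carrier G \<Longrightarrow> h \<in> carrier G \<Longrightarrow> \<sigma> (p, g) = \<sigma> (p, h) \<Longrightarrow> g = h"
proof -
  assume p: "p \<in> points P" and g: "g \<in> carrier G" and h: "h \<in> carrier G" and eq: "\<sigma> (p, g) = \<sigma> (p, h)"
  have "\<sigma> (p, g \<otimes>\<^bsub>G\<^esub> inv\<^bsub>G\<^esub> h) = \<sigma> (\<sigma> (p, h), inv\<^bsub>G\<^esub> h)"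
    using p g h eq by (simp add: act_act[symmetric])
  also have "\<dots> = p" using p h by (simp add: act_act)
  finally have "g \<otimes>\<^bsub>G\<^esub> inv\<^bsub>G\<^esub> h = \<one>\<^bsub>G\<^esub>" using free[OF p] g h by simp
  then show "g = h" using g h by (metis G.inv_closed G.inv_equality G.inv_inv)
qed

lemma act_cont: "g \<in> carrier G \<Longrightarrow> continuous_map (mtop P) (mtop P) (\<lambda>p. \<sigma> (p, g))"
  using smooth by (simp add: smooth_map_def)

lemma act_preimage_open: "g \<in> carrier G \<Longrightarrow> openin (mtop P) W \<Longrightarrow> openin (mtop P) {p \<in> points P. \<sigma> (p, g) \<in> W}"
  using openin_continuous_map_preimage[OF act_cont] .

lemma pr_eq_iff:
  assumes p: "p \<in> points P" and p': "p' \<in> points P"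
  shows "pr p = pr p' \<longleftrightarrow> (\<exists>g\<in>carrier G. p' = \<sigma> (p, g))"
proof
  assume "pr p = pr p'"
  moreover have "p' \<in> pr p'"
    using act_one[OF p'] by (auto simp: orbit_map_def intro!: exI[of _ "\<one>\<^bsub>G\<^esub>"])
  ultimately have "p' \<in> pr p" by simp
  then show "\<exists>g\<in>carrier G. p' = \<sigma> (p, g)" by (auto simp: orbit_map_def)
next
  assume "\<exists>g\<in>carrier G. p' = \<sigma> (p, g)"
  then obtain g where g: "g \<in> carrier G" "p' = \<sigma> (p, g)" by blast
  have "\<sigma> (p, h) = \<sigma> (p', inv\<^bsub>G\<^esub> g \<otimes>\<^bsub>G\<^esub> h)" if "h \<in> carrier G" for h
    using that g p by (simp add: act_act G.m_assoc[symmetric])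
  moreover have "\<sigma> (p', h) = \<sigma> (p, g \<otimes>\<^bsub>G\<^esub> h)" if "h \<in> carrier G" for h
    using that g p by (simp add: act_act)
  ultimately show "pr p = pr p'"
    using g(1) unfolding orbit_map_def by (auto intro: exI[of _ "inv\<^bsub>G\<^esub> g \<otimes>\<^bsub>G\<^esub> _"] exI[of _ "g \<otimes>\<^bsub>G\<^esub> _"]) (metis G.inv_closed G.m_closed)+
qed

lemma pr_act [simp]: "p \<in> points P \<Longrightarrow> g \<in> carrier G \<Longrightarrow> pr (\<sigma> (p, g)) = pr p"
  using pr_eq_iff[of p "\<sigma> (p, g)"] by auto

definition quot_top :: "'p set topology" where
  "quot_top = topology (\<lambda>W. W \<subseteq> pr ` points P \<and> openin (mtop P) {p \<in> points P. pr p \<in> W})"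

lemma openin_quot_top: "openin quot_top W \<longleftrightarrow> W \<subseteq> pr ` points P \<and> openin (mtop P) {p \<in> points P. pr p \<in> W}"
proof -
  let ?P = "\<lambda>W. W \<subseteq> pr ` points P \<and> openin (mtop P) {p \<in> points P. pr p \<in> W}"
  have "istopology ?P"
    unfolding istopology_def
  proof (intro conjI allI impI)
    fix S T assume "?P S" "?P T"
    moreover have "{p \<in> points P. pr p \<in> S \<inter> T} = {p \<in> points P. pr p \<in> S} \<inter> {p \<in> points P. pr p \<in> T}"
      by auto
    ultimately show "openin (mtop P) {p \<in> points P. pr p \<in> S \<inter> T}" by auto
    show "S \<inter> T \<subseteq> pr ` points P" using \<open>?P S\<close> by auto
  next
    fix K assume K: "\<forall>S\<in>K. ?P S"
    moreover have "{p \<in> points P. pr p \<in> \<Union>K} = (\<Union>S\<in>K. {p \<in> points P. pr p \<in> S})"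
      by auto
    ultimately show "openin (mtop P) {p \<in> points P. pr p \<in> \<Union>K}" by auto
    show "\<Union>K \<subseteq> pr ` points P" using K by auto
  qed
  then show ?thesis
    by (simp add: quot_top_def)
qed

lemma topspace_quot_top [simp]: "topspace quot_top = pr ` points P"
proof (rule antisym)
  have "{p \<in> points P. pr p \<in> pr ` points P} = points P" by auto
  then have "openin quot_top (pr ` points P)"
    unfolding openin_quot_top by (metis openin_topspace order_refl)
  then show "pr ` points P \<subseteq> topspace quot_top"
    by (rule openin_subset)
qed (use openin_quot_top openin_topspace in blast)

lemma pr_cont: "continuous_map (mtop P) quot_top pr"
  unfolding continuous_map_def by (auto simp: openin_quot_top)

text \<open>The saturation of \<open>U\<close> is a union of preimages of \<open>U\<close> under
  translations. This makes the projection open.\<close>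

lemma pr_preimage_image:
  assumes "U \<subseteq> points P"
  shows "{p \<in> points P. pr p \<in> pr ` U} = (\<Union>g\<in>carrier G. {p \<in> points P. \<sigma> (p, g) \<in> U})"
proof (intro equalityI subsetI)
  fix p assume "p \<in> {p \<in> points P. pr p \<in> pr ` U}"
  then obtain u where "p \<in> points P" "u \<in> U" "pr p = pr u" by auto
  then show "p \<in> (\<Union>g\<in>carrier G. {p \<in> points P. \<sigma> (p, g) \<in> U})"
    using assms pr_eq_iff[of p u] by auto
next
  fix p assume "p \<in> (\<Union>g\<in>carrier G. {p \<in> points P. \<sigma> (p, g) \<in> U})"
  then obtain g where "g \<in> carrier G" "p \<in> points P" "\<sigma> (p, g) \<in> U" by auto
  then show "p \<in> {p \<in> points P. pr p \<in> pr ` U}"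
    using pr_act[of p g] by (metis (mono_tags, lifting) image_eqI mem_Collect_eq)
qed

lemma pr_image_open: "openin (mtop P) U \<Longrightarrow> openin quot_top (pr ` U)"
proof -
  assume U: "openin (mtop P) U"
  then have "U \<subseteq> points P" by (rule openin_subset)
  then show ?thesis
    unfolding openin_quot_top using pr_preimage_image act_preimage_open U by (auto intro!: openin_Union)
qed

lemma pr_open: "open_map (mtop P) quot_top pr"
  by (simp add: open_map_def pr_image_open)

lemma pr_quotient: "quotient_map (mtop P) quot_top pr"
  by (rule continuous_open_imp_quotient_map[OF pr_cont pr_open]) simp

lemma separate_points:
  assumes "p \<in> points P" "p' \<in> points P" "p \<noteq> p'"
  shows "\<exists>N N'. openin (mtop P) N \<and> openin (mtop P) N' \<and> p \<in> N \<and> p' \<in> N' \<and> N \<inter> N' = {}"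
  using mfd assms unfolding manifold_def Hausdorff_space_def disjnt_def by blast

text \<open>For distinct orbits, \<open>p\<close> is separated from each of the finitely many points
  \<open>\<sigma> (p', g)\<close>. Intersecting over \<open>g\<close>, after pulling the second
  neighbourhoods back along the translations, gives open sets with disjoint images.\<close>

lemma Hausdorff_quot_top: "Hausdorff_space quot_top"
  unfolding Hausdorff_space_def
proof (intro allI impI)
  fix x y assume xy: "x \<in> topspace quot_top \<and> y \<in> topspace quot_top \<and> x \<noteq> y"
  then obtain p p' where p: "p \<in> points P" "x = pr p" and p': "p' \<in> points P" "y = pr p'" by auto
  have "\<exists>N N'. openin (mtop P) N \<and> openin (mtop P) N' \<and> p \<in> N \<and> \<sigma> (p', g) \<in> N' \<and> N \<inter> N' = {}" if "g \<in> carrier G" for g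
    by (rule separate_points) (use p p' that xy pr_act in auto)
  then obtain N N' where N: "\<And>g. g \<in> carrier G \<Longrightarrow> openin (mtop P) (N g) \<and> openin (mtop P) (N' g) \<and> p \<in> N g \<and> \<sigma> (p', g) \<in> N' g \<and> N g \<inter> N' g = {}"
    by metis
  define A where "A = \<Inter>(N ` carrier G)"
  define B where "B = \<Inter>((\<lambda>g. {q \<in> points P. \<sigma> (q, g) \<in> N' g}) ` carrier G)"
  have ne: "carrier G \<noteq> {}" using G.one_closed by blast
  have A: "openin (mtop P) A" "p \<in> A"
    unfolding A_def using N fin ne by (auto intro!: openin_Inter)
  have B: "openin (mtop P) B" "p' \<in> B"
    unfolding B_def using N fin ne p' act_preimage_open by (auto intro!: openin_Inter)
  have "disjnt (pr ` A) (pr ` B)"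
    unfolding disjnt_iff
  proof (intro allI notI)
    fix w assume "w \<in> pr ` A \<and> w \<in> pr ` B"
    then obtain a b where ab: "a \<in> A" "b \<in> B" "pr a = pr b" by auto
    have pts: "a \<in> points P" "b \<in> points P"
      using ab A(1) B(1) openin_subset by blast+
    then obtain g where g: "g \<in> carrier G" "a = \<sigma> (b, g)" using pr_eq_iff[of b a] ab by auto
    have "a \<in> N g" "\<sigma> (b, g) \<in> N' g" using ab g(1) by (auto simp: A_def B_def)
    then show False using N[OF g(1)] g(2) by auto
  qed
  then show "\<exists>U V. openin quot_top U \<and> openin quot_top V \<and> x \<in> U \<and> y \<in> V \<and> disjnt U V"
    using pr_image_open[OF A(1)] pr_image_open[OF B(1)] A(2) B(2) p p' by blast
qed

section \<open>Open sets disjoint from their translates, and local sections\<close>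

definition small :: "'p set \<Rightarrow> bool" where
  "small U \<longleftrightarrow> openin (mtop P) U \<and> (\<forall>p\<in>U. \<forall>g\<in>carrier G. \<sigma> (p, g) \<in> U \<longrightarrow> g = \<one>\<^bsub>G\<^esub>)"

lemma small_open: "small U \<Longrightarrow> openin (mtop P) U"
  by (simp add: small_def)

lemma small_points: "small U \<Longrightarrow> p \<in> U \<Longrightarrow> p \<in> points P"
  using small_open openin_subset by blast

text \<open>By freeness \<open>p\<close> differs from its translates under nontrivial elements. It
  is separated from each of these finitely many points, and the neighbourhoods are
  intersected.\<close>

lemma small_exists:
  assumes W: "openin (mtop P) W" "p \<in> W"
  obtains U where "small U" "p \<in> U" "U \<subseteq> W"
proof -
  have p: "p \<in> points P" using W openin_subset by blast
  let ?H = "carrier G - {\<one>\<^bsub>G\<^esub>}"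
  have "\<exists>N N'. openin (mtop P) N \<and> openin (mtop P) N' \<and> p \<in> N \<and> \<sigma> (p, g) \<in> N' \<and> N \<inter> N' = {}" if "g \<in> ?H" for g
    by (rule separate_points) (use p that free[OF p, of g] in auto)
  then obtain N N' where N: "\<And>g. g \<in> ?H \<Longrightarrow> openin (mtop P) (N g) \<and> openin (mtop P) (N' g) \<and> p \<in> N g \<and> \<sigma> (p, g) \<in> N' g \<and> N g \<inter> N' g = {}"
    by metis
  \<comment> \<open>Inserting \<open>W\<close> keeps the family nonempty when the group is
    trivial.\<close>
  define U where "U = \<Inter>(insert W ((\<lambda>g. N g \<inter> {q \<in> points P. \<sigma> (q, g) \<in> N' g}) ` ?H))"
  have "openin (mtop P) U"
    unfolding U_def using N W(1) fin act_preimage_open by (intro openin_Inter) auto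
  moreover have "g = \<one>\<^bsub>G\<^esub>" if "q \<in> U" "g \<in> carrier G" "\<sigma> (q, g) \<in> U" for q g
  proof (rule ccontr)
    assume "g \<noteq> \<one>\<^bsub>G\<^esub>"
    then have g: "g \<in> ?H" using that by simp
    then have "\<sigma> (q, g) \<in> N' g" "\<sigma> (q, g) \<in> N g" using that by (auto simp: U_def)
    then show False using N[OF g] by auto
  qed
  ultimately have "small U" by (auto simp: small_def)
  moreover have "p \<in> U" using W(2) N p by (auto simp: U_def)
  moreover have "U \<subseteq> W" by (auto simp: U_def)
  ultimately show thesis using that by blast
qed

definition sec :: "'p set \<Rightarrow> 'p set \<Rightarrow> 'p" where
  "sec U = inv_into U pr"

lemma small_inj: "small U \<Longrightarrow> inj_on pr U"
proof (rule inj_onI)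
  fix p p' assume U: "small U" and p: "p \<in> U" "p' \<in> U" "pr p = pr p'"
  then obtain g where g: "g \<in> carrier G" "p' = \<sigma> (p, g)"
    using pr_eq_iff[of p p'] small_points[OF U] by auto
  then have "g = \<one>\<^bsub>G\<^esub>" using U p by (auto simp: small_def)
  then show "p = p'" using g p small_points[OF U] by simp
qed

lemma sec_pr [simp]: "small U \<Longrightarrow> p \<in> U \<Longrightarrow> sec U (pr p) = p"
  by (simp add: sec_def small_inj)

lemma sec_in: "w \<in> pr ` U \<Longrightarrow> sec U w \<in> U"
  by (simp add: sec_def inv_into_into)

lemma pr_sec [simp]: "w \<in> pr ` U \<Longrightarrow> pr (sec U w) = w"
  by (simp add: sec_def f_inv_into_f)

lemma sec_pr_act: "small U \<Longrightarrow> p \<in> points P \<Longrightarrow> h \<in> carrier G \<Longrightarrow> \<sigma> (p, h) \<in> U \<Longrightarrow> sec U (pr p) = \<sigma> (p, h)"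
  using sec_pr[of U "\<sigma> (p, h)"] by simp

lemma sec_cont:
  assumes U: "small U"
  shows "continuous_map (subtopology quot_top (pr ` U)) (mtop P) (sec U)"
  unfolding continuous_map_def
proof (intro conjI allI impI)
  show "sec U \<in> topspace (subtopology quot_top (pr ` U)) \<rightarrow> points P"
    using sec_in small_points[OF U] by fastforce
  fix W assume W: "openin (mtop P) W"
  have "{w \<in> topspace (subtopology quot_top (pr ` U)). sec U w \<in> W} = pr ` (U \<inter> W)"
    using U small_points[OF U] by auto
  moreover have "openin (subtopology quot_top (pr ` U)) (pr ` (U \<inter> W))"
    using pr_image_open[OF openin_Int[OF small_open[OF U] W]] pr_image_open[OF small_open[OF U]]
    by (simp add: openin_open_subtopology image_mono)
  ultimately show "openin (subtopology quot_top (pr ` U)) {w \<in> topspace (subtopology quot_top (pr ` U)). sec U w \<in> W}"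
    by simp
qed

text \<open>The set of points of \<open>P\<close> at which the section after the projection, moved
  by \<open>g\<close>, lands in \<open>V\<close>. Working on \<open>P\<close> instead of the
  quotient allows smoothness to be tested in charts of \<open>P\<close>.\<close>

definition sec_domain :: "'p set \<Rightarrow> 'g \<Rightarrow> 'p set \<Rightarrow> 'p set" where
  "sec_domain U g V = {p \<in> points P. pr p \<in> pr ` U \<and> \<sigma> (sec U (pr p), g) \<in> V}"

lemma sec_domainE:
  assumes U: "small U" and g: "g \<in> carrier G" and p: "p \<in> sec_domain U g V"
  obtains h where "h \<in> carrier G" "\<sigma> (p, h) \<in> U" "\<sigma> (p, h \<otimes>\<^bsub>G\<^esub> g) \<in> V"
proof -
  have pp: "p \<in> points P" "pr p \<in> pr ` U" using p by (auto simp: sec_domain_def)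
  then obtain h where h: "h \<in> carrier G" "\<sigma> (p, h) \<in> U"
    using pr_preimage_image[of U] small_points[OF U] by blast
  then have "\<sigma> (sec U (pr p), g) = \<sigma> (p, h \<otimes>\<^bsub>G\<^esub> g)"
    using U g pp(1) by (simp add: sec_pr_act act_act)
  then show thesis using that[OF h] p by (simp add: sec_domain_def)
qed

lemma sec_domain_local:
  assumes U: "small U" and g: "g \<in> carrier G" and h: "h \<in> carrier G"
    and p: "p \<in> points P" "\<sigma> (p, h) \<in> U"
  shows "\<sigma> (sec U (pr p), g) = \<sigma> (p, h \<otimes>\<^bsub>G\<^esub> g)" "pr p \<in> pr ` U"
proof -
  show "\<sigma> (sec U (pr p), g) = \<sigma> (p, h \<otimes>\<^bsub>G\<^esub> g)"
    using U g h p by (simp add: sec_pr_act act_act)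
  show "pr p \<in> pr ` U" using imageI[OF p(2), of pr] p(1) h by simp
qed

lemma sec_domain_open:
  assumes U: "small U" and g: "g \<in> carrier G" and V: "openin (mtop P) V"
  shows "openin (mtop P) (sec_domain U g V)"
proof -
  have "sec_domain U g V = (\<Union>h\<in>carrier G. {p \<in> points P. \<sigma> (p, h) \<in> U} \<inter> {p \<in> points P. \<sigma> (p, h \<otimes>\<^bsub>G\<^esub> g) \<in> V})"
  proof (intro equalityI subsetI)
    fix p assume p: "p \<in> sec_domain U g V"
    then have "p \<in> points P" by (simp add: sec_domain_def)
    with sec_domainE[OF U g p] show "p \<in> (\<Union>h\<in>carrier G. {p \<in> points P. \<sigma> (p, h) \<in> U} \<inter> {p \<in> points P. \<sigma> (p, h \<otimes>\<^bsub>G\<^esub> g) \<in> V})"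
      by blast
  next
    fix p assume "p \<in> (\<Union>h\<in>carrier G. {p \<in> points P. \<sigma> (p, h) \<in> U} \<inter> {p \<in> points P. \<sigma> (p, h \<otimes>\<^bsub>G\<^esub> g) \<in> V})"
    then obtain h where "h \<in> carrier G" "p \<in> points P" "\<sigma> (p, h) \<in> U" "\<sigma> (p, h \<otimes>\<^bsub>G\<^esub> g) \<in> V" by auto
    then show "p \<in> sec_domain U g V"
      using sec_domain_local[OF U g] by (simp add: sec_domain_def)
  qed
  moreover have "openin (mtop P) ({p \<in> points P. \<sigma> (p, h) \<in> U} \<inter> {p \<in> points P. \<sigma> (p, h \<otimes>\<^bsub>G\<^esub> g) \<in> V})" if "h \<in> carrier G" for h
    using that g V small_open[OF U] by (intro openin_Int act_preimage_open) auto
  ultimately show ?thesis by auto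
qed

text \<open>Where \<open>\<sigma> (p, h)\<close> lies in \<open>U\<close>, the section sends the
  orbit of \<open>p\<close> to \<open>\<sigma> (p, h)\<close>. So the map is locally the translation
  by \<open>h \<otimes> g\<close>, which is smooth. Quotient charts, the projection and the
  trivializations all take their smoothness from here.\<close>

lemma sec_smooth:
  assumes c: "(V1, \<phi>1) \<in> atlas P" and d: "(V2, \<phi>2) \<in> atlas P" and U: "small U" and g: "g \<in> carrier G" and j: "j < n"
    and W: "W \<subseteq> sec_domain U g V2"
  shows "smooth_fun n (\<phi>1 ` (V1 \<inter> W)) (\<lambda>y. \<phi>2 (\<sigma> (sec U (pr (inv_into V1 \<phi>1 y)), g)) j)"
proof (rule smooth_fun_local)
  fix y assume "y \<in> \<phi>1 ` (V1 \<inter> W)"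
  then obtain p0 where p0: "p0 \<in> V1" "p0 \<in> W" "y = \<phi>1 p0" by auto
  then have p0d: "p0 \<in> sec_domain U g V2" using W by blast
  obtain h where h: "h \<in> carrier G" "\<sigma> (p0, h) \<in> U" "\<sigma> (p0, h \<otimes>\<^bsub>G\<^esub> g) \<in> V2"
    using sec_domainE[OF U g p0d] .
  let ?N = "{p \<in> points P. \<sigma> (p, h) \<in> U} \<inter> {p \<in> points P. \<sigma> (p, h \<otimes>\<^bsub>G\<^esub> g) \<in> V2}"
  have hg: "h \<otimes>\<^bsub>G\<^esub> g \<in> carrier G" using h g by simp
  have "openin (mtop P) ?N"
    by (rule openin_Int[OF act_preimage_open[OF h(1) small_open[OF U]] act_preimage_open[OF hg chart_open[OF d]]])
  then have V0: "openin (Euclidean_space n) (\<phi>1 ` (V1 \<inter> ?N))"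
    by (rule chart_image_openin[OF c])
  have "smooth_fun n (\<phi>1 ` (V1 \<inter> (\<lambda>p. \<sigma> (p, h \<otimes>\<^bsub>G\<^esub> g)) -` V2)) (\<lambda>y. \<phi>2 (\<sigma> (inv_into V1 \<phi>1 y, h \<otimes>\<^bsub>G\<^esub> g)) j)"
    using smooth[OF hg] c d j unfolding smooth_map_def by blast
  then have "smooth_fun n (\<phi>1 ` (V1 \<inter> ?N)) (\<lambda>y. \<phi>2 (\<sigma> (inv_into V1 \<phi>1 y, h \<otimes>\<^bsub>G\<^esub> g)) j)"
    by (rule smooth_fun_subset) auto
  then have "smooth_fun n (\<phi>1 ` (V1 \<inter> ?N)) (\<lambda>y. \<phi>2 (\<sigma> (sec U (pr (inv_into V1 \<phi>1 y)), g)) j)"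
  proof (rule smooth_fun_cong[OF V0])
    fix y assume "y \<in> \<phi>1 ` (V1 \<inter> ?N)"
    then obtain p where p: "p \<in> V1" "p \<in> points P" "\<sigma> (p, h) \<in> U" "y = \<phi>1 p" by auto
    then show "\<phi>2 (\<sigma> (inv_into V1 \<phi>1 y, h \<otimes>\<^bsub>G\<^esub> g)) j = \<phi>2 (\<sigma> (sec U (pr (inv_into V1 \<phi>1 y)), g)) j"
      using c sec_domain_local(1)[OF U g h(1) p(2,3)] by simp
  qed
  moreover have "y \<in> \<phi>1 ` (V1 \<inter> ?N)"
    using p0 h chart_subset[OF c] by auto
  ultimately show "\<exists>V0. openin (Euclidean_space n) V0 \<and> y \<in> V0 \<and>
      smooth_fun n V0 (\<lambda>y. \<phi>2 (\<sigma> (sec U (pr (inv_into V1 \<phi>1 y)), g)) j)"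
    using V0 by blast
qed

section \<open>The manifold structure on the orbit space\<close>

definition quot_mfd :: "'p set mfd" where
  "quot_mfd = \<lparr>mtop = quot_top, mdim = n,
     atlas = {(pr ` U, \<phi> \<circ> sec U) | U V \<phi>. (V, \<phi>) \<in> atlas P \<and> small U \<and> U \<subseteq> V}\<rparr>"

lemma quot_mfd_simps [simp]: "mtop quot_mfd = quot_top" "mdim quot_mfd = n"
  by (simp_all add: quot_mfd_def)

lemma quot_chartE:
  assumes "(W, \<xi>) \<in> atlas quot_mfd"
  obtains U V \<phi> where "W = pr ` U" "\<xi> = \<phi> \<circ> sec U" "(V, \<phi>) \<in> atlas P" "small U" "U \<subseteq> V"
  using assms by (auto simp: quot_mfd_def)

text \<open>Translates domains in the quotient into domains inside \<open>U\<close>, where the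
  charts of \<open>P\<close> live.\<close>

lemma quot_chart_image:
  assumes "small U"
  shows "(\<phi> \<circ> sec U) ` (pr ` U \<inter> T) = \<phi> ` (U \<inter> {p. pr p \<in> T})"
proof -
  have "sec U ` (pr ` U \<inter> T) = U \<inter> {p. pr p \<in> T}"
  proof (intro equalityI subsetI)
    fix p assume "p \<in> U \<inter> {p. pr p \<in> T}"
    then show "p \<in> sec U ` (pr ` U \<inter> T)"
      using assms by (intro image_eqI[of _ _ "pr p"]) auto
  qed (use assms in auto)
  then show ?thesis unfolding image_comp[symmetric] by simp
qed

lemma quot_chart_inj:
  assumes c: "(V, \<phi>) \<in> atlas P" and U: "small U" "U \<subseteq> V"
  shows "inj_on (\<phi> \<circ> sec U) (pr ` U)"
proof (rule comp_inj_on)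
  show "inj_on (sec U) (pr ` U)" using U by (auto simp: inj_on_def)
  have "sec U ` pr ` U \<subseteq> V" using U by auto
  then show "inj_on \<phi> (sec U ` pr ` U)" using chart_inj[OF c] inj_on_subset by blast
qed

lemma quot_chart_inv:
  assumes c: "(V, \<phi>) \<in> atlas P" and U: "small U" "U \<subseteq> V" and T: "T \<subseteq> pr ` U" and y: "y \<in> (\<phi> \<circ> sec U) ` T"
  shows "inv_into T (\<phi> \<circ> sec U) y = pr (inv_into V \<phi> y)"
proof -
  obtain w where w: "w \<in> T" "y = \<phi> (sec U w)" using y by auto
  have "w \<in> pr ` U" using w T by auto
  then have s: "sec U w \<in> V" "pr (sec U w) = w" using sec_in U by auto
  have "inv_into T (\<phi> \<circ> sec U) y = w"
    by (rule inv_into_f_eq) (use w quot_chart_inj[OF c U] T inj_on_subset in auto)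
  then show ?thesis using w s c by simp
qed

text \<open>A change of charts lifts to the second section after the projection, restricted to the
  first small set. This is \<open>sec_smooth\<close> with \<open>g\<close> the identity.\<close>

lemma manifold_quot: "manifold quot_mfd"
  unfolding manifold_def
proof (intro conjI)
  show "Hausdorff_space (mtop quot_mfd)" using Hausdorff_quot_top by simp
  show "second_countable (mtop quot_mfd)"
    using mfd second_countable_open_map_image[OF pr_cont pr_open] by (simp add: manifold_def)
  \<comment> \<open>Paracompactness of the quotient comes from compactness: a finite subcover is a
    locally finite refinement.\<close>
  have "compact_space quot_top"
    using image_compactin[OF _ pr_cont, of "points P"] compact by (simp add: compact_space_def)
  then show "paracompact_space (mtop quot_mfd)"
    by (simp add: compact_imp_paracompact_space)
  show "(\<Union>(U, \<phi>)\<in>atlas quot_mfd. U) = points quot_mfd"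
  proof (intro equalityI subsetI)
    fix w assume "w \<in> (\<Union>(U, \<phi>)\<in>atlas quot_mfd. U)"
    then obtain W \<xi> where "(W, \<xi>) \<in> atlas quot_mfd" "w \<in> W" by auto
    then show "w \<in> points quot_mfd"
      using small_points by (auto elim!: quot_chartE)
  next
    fix w assume "w \<in> points quot_mfd"
    then obtain p where p: "p \<in> points P" "w = pr p" by auto
    obtain V \<phi> where c: "(V, \<phi>) \<in> atlas P" "p \<in> V" using chart_at[OF p(1)] .
    obtain U where U: "small U" "p \<in> U" "U \<subseteq> V" using small_exists[OF chart_open[OF c(1)] c(2)] .
    then have "(pr ` U, \<phi> \<circ> sec U) \<in> atlas quot_mfd" using c by (auto simp: quot_mfd_def)
    moreover have "w \<in> pr ` U" using p U by blast
    ultimately show "w \<in> (\<Union>(U, \<phi>)\<in>atlas quot_mfd. U)" by (intro UN_I[where a = "(pr ` U, \<phi> \<circ> sec U)"]) simp_all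
  qed
  show "\<forall>(W, \<xi>)\<in>atlas quot_mfd. openin (mtop quot_mfd) W \<and> openin (Euclidean_space (mdim quot_mfd)) (\<xi> ` W) \<and>
      homeomorphic_map (subtopology (mtop quot_mfd) W) (subtopology (Euclidean_space (mdim quot_mfd)) (\<xi> ` W)) \<xi>"
  proof (intro ballI, clarify, intro conjI)
    fix W \<xi> assume "(W, \<xi>) \<in> atlas quot_mfd"
    then obtain U V \<phi> where W: "W = pr ` U" "\<xi> = \<phi> \<circ> sec U" and c: "(V, \<phi>) \<in> atlas P" and U: "small U" "U \<subseteq> V"
      by (rule quot_chartE)
    have Upts: "U \<subseteq> points P" using small_points[OF U(1)] by blast
    show "openin (mtop quot_mfd) W" using pr_image_open[OF small_open[OF U(1)]] W by simp
    have img: "\<xi> ` W = \<phi> ` U"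
      using quot_chart_image[OF U(1), of \<phi> UNIV] by (simp add: W)
    have "openin (Euclidean_space n) (\<phi> ` (V \<inter> U))"
      by (rule chart_image_openin[OF c small_open[OF U(1)]])
    then show op: "openin (Euclidean_space (mdim quot_mfd)) (\<xi> ` W)"
      using img U(2) by (simp add: Int_absorb1)
    have "homeomorphic_maps (subtopology quot_top (pr ` U)) (subtopology (Euclidean_space n) (\<phi> ` U)) (\<phi> \<circ> sec U) (pr \<circ> inv_into V \<phi>)"
      unfolding homeomorphic_maps_def
    proof (intro conjI ballI)
      have "continuous_map (subtopology quot_top (pr ` U)) (subtopology (mtop P) V) (sec U)"
        using sec_cont[OF U(1)] sec_in U(2) by (fastforce simp: continuous_map_in_subtopology)
      from continuous_map_compose[OF this homeomorphic_imp_continuous_map[OF chart_homeo[OF c]]]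
      show "continuous_map (subtopology quot_top (pr ` U)) (subtopology (Euclidean_space n) (\<phi> ` U)) (\<phi> \<circ> sec U)"
        using sec_in by (fastforce simp: continuous_map_in_subtopology)
      have "continuous_map (subtopology (Euclidean_space n) (\<phi> ` U)) (mtop P) (inv_into V \<phi>)"
        using continuous_map_from_subtopology_mono[OF chart_inv_continuous[OF c]] U(2) by blast
      from continuous_map_compose[OF this pr_cont]
      show "continuous_map (subtopology (Euclidean_space n) (\<phi> ` U)) (subtopology quot_top (pr ` U)) (pr \<circ> inv_into V \<phi>)"
        using U(2) c by (auto simp: continuous_map_in_subtopology subset_iff)
    next
      fix w assume "w \<in> topspace (subtopology quot_top (pr ` U))"
      then have "w \<in> pr ` U" by auto
      then show "(pr \<circ> inv_into V \<phi>) ((\<phi> \<circ> sec U) w) = w"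
        using c U sec_in[of w U] by (auto simp: subset_iff)
    next
      fix y assume "y \<in> topspace (subtopology (Euclidean_space n) (\<phi> ` U))"
      then show "(\<phi> \<circ> sec U) ((pr \<circ> inv_into V \<phi>) y) = y"
        using c U by (auto simp: subset_iff)
    qed
    then show "homeomorphic_map (subtopology (mtop quot_mfd) W) (subtopology (Euclidean_space (mdim quot_mfd)) (\<xi> ` W)) \<xi>"
      using homeomorphic_maps_map unfolding img by (auto simp: W)
  qed
  show "\<forall>(W1, \<xi>1)\<in>atlas quot_mfd. \<forall>(W2, \<xi>2)\<in>atlas quot_mfd. \<forall>j<mdim quot_mfd.
      smooth_fun (mdim quot_mfd) (\<xi>1 ` (W1 \<inter> W2)) (\<lambda>x. \<xi>2 (inv_into W1 \<xi>1 x) j)"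
  proof (intro ballI, clarify)
    fix W1 \<xi>1 W2 \<xi>2 j assume a: "(W1, \<xi>1) \<in> atlas quot_mfd" "(W2, \<xi>2) \<in> atlas quot_mfd" and j: "j < mdim quot_mfd"
    obtain U1 V1 \<phi>1 where W1: "W1 = pr ` U1" "\<xi>1 = \<phi>1 \<circ> sec U1" and c1: "(V1, \<phi>1) \<in> atlas P" and U1: "small U1" "U1 \<subseteq> V1"
      using quot_chartE[OF a(1)] .
    obtain U2 V2 \<phi>2 where W2: "W2 = pr ` U2" "\<xi>2 = \<phi>2 \<circ> sec U2" and c2: "(V2, \<phi>2) \<in> atlas P" and U2: "small U2" "U2 \<subseteq> V2"
      using quot_chartE[OF a(2)] .
    let ?D = "U1 \<inter> sec_domain U2 \<one>\<^bsub>G\<^esub> V2"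
    have Deq: "\<xi>1 ` (W1 \<inter> W2) = \<phi>1 ` (V1 \<inter> ?D)"
    proof -
      have "U1 \<inter> {p. pr p \<in> pr ` U2} = V1 \<inter> ?D"
        using U1 U2 small_points[OF U1(1)] small_points[OF U2(1)] by (auto simp: sec_domain_def subset_iff)
      then show ?thesis unfolding W1 W2 quot_chart_image[OF U1(1)] by simp
    qed
    have op: "openin (Euclidean_space n) (\<phi>1 ` (V1 \<inter> ?D))"
      by (rule chart_image_openin[OF c1 openin_Int[OF small_open[OF U1(1)] sec_domain_open[OF U2(1) G.one_closed chart_open[OF c2]]]])
    have "smooth_fun n (\<phi>1 ` (V1 \<inter> ?D)) (\<lambda>y. \<phi>2 (\<sigma> (sec U2 (pr (inv_into V1 \<phi>1 y)), \<one>\<^bsub>G\<^esub>)) j)"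
      by (rule sec_smooth[OF c1 c2 U2(1) G.one_closed]) (use j in auto)
    then have "smooth_fun n (\<phi>1 ` (V1 \<inter> ?D)) (\<lambda>x. \<xi>2 (inv_into W1 \<xi>1 x) j)"
    proof (rule smooth_fun_cong[OF op])
      fix y assume y: "y \<in> \<phi>1 ` (V1 \<inter> ?D)"
      then obtain p where p: "p \<in> V1" "p \<in> U1" "p \<in> sec_domain U2 \<one>\<^bsub>G\<^esub> V2" "y = \<phi>1 p" by auto
      have "inv_into W1 \<xi>1 y = pr (inv_into V1 \<phi>1 y)"
        unfolding W1 by (rule quot_chart_inv[OF c1 U1 order_refl]) (use y Deq in \<open>auto simp: W1\<close>)
      moreover have "sec U2 (pr p) \<in> points P"
        using p(3) sec_in[of "pr p" U2] small_points[OF U2(1)] by (auto simp: sec_domain_def)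
      ultimately show "\<phi>2 (\<sigma> (sec U2 (pr (inv_into V1 \<phi>1 y)), \<one>\<^bsub>G\<^esub>)) j = \<xi>2 (inv_into W1 \<xi>1 y) j"
        using p c1 by (simp add: W2)
    qed
    then show "smooth_fun (mdim quot_mfd) (\<xi>1 ` (W1 \<inter> W2)) (\<lambda>x. \<xi>2 (inv_into W1 \<xi>1 x) j)"
      unfolding Deq by simp
  qed
qed

lemma pr_chart_smooth:
  assumes c: "(V1, \<phi>1) \<in> atlas P" and a: "(W, \<xi>) \<in> atlas quot_mfd" and j: "j < n"
    and T: "openin (mtop P) T" "T \<subseteq> {p \<in> points P. pr p \<in> W}"
  shows "smooth_fun n (\<phi>1 ` (V1 \<inter> T)) (\<lambda>x. \<xi> (pr (inv_into V1 \<phi>1 x)) j)"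
proof -
  obtain U V \<phi> where W: "W = pr ` U" "\<xi> = \<phi> \<circ> sec U" and d: "(V, \<phi>) \<in> atlas P" and U: "small U" "U \<subseteq> V"
    using quot_chartE[OF a] .
  have s: "sec U (pr p) \<in> U" "sec U (pr p) \<in> points P" if "p \<in> T" for p
    using that T(2) sec_in[of "pr p" U] small_points[OF U(1)] by (auto simp: W)
  have sub: "T \<subseteq> sec_domain U \<one>\<^bsub>G\<^esub> V"
    using T(2) s U(2) by (auto simp: sec_domain_def W)
  have "smooth_fun n (\<phi>1 ` (V1 \<inter> T)) (\<lambda>y. \<phi> (\<sigma> (sec U (pr (inv_into V1 \<phi>1 y)), \<one>\<^bsub>G\<^esub>)) j)"
    by (rule sec_smooth[OF c d U(1) G.one_closed j sub])
  then show ?thesis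
    by (rule smooth_fun_cong[OF chart_image_openin[OF c T(1)]]) (use c s in \<open>auto simp: W\<close>)
qed

lemma smooth_map_pr: "smooth_map P quot_mfd pr"
  unfolding smooth_map_def
proof (intro conjI)
  show "continuous_map (mtop P) (mtop quot_mfd) pr" using pr_cont by simp
  show "\<forall>(U, \<phi>)\<in>atlas P. \<forall>(W, \<xi>)\<in>atlas quot_mfd. \<forall>j<mdim quot_mfd.
      smooth_fun n (\<phi> ` (U \<inter> pr -` W)) (\<lambda>x. \<xi> (pr (inv_into U \<phi> x)) j)"
  proof (intro ballI, clarify)
    fix U \<phi> W \<xi> j assume c: "(U, \<phi>) \<in> atlas P" and a: "(W, \<xi>) \<in> atlas quot_mfd" and j: "j < mdim quot_mfd"
    interpret Q: smooth_manifold quot_mfd by standard (rule manifold_quot)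
    have "openin (mtop P) {p \<in> points P. pr p \<in> W}"
      using openin_continuous_map_preimage[OF pr_cont] Q.chart_open[OF a] by simp
    from pr_chart_smooth[OF c a _ this] j
    have "smooth_fun n (\<phi> ` (U \<inter> {p \<in> points P. pr p \<in> W})) (\<lambda>x. \<xi> (pr (inv_into U \<phi> x)) j)"
      by simp
    moreover have "U \<inter> {p \<in> points P. pr p \<in> W} = U \<inter> pr -` W" using chart_subset[OF c] by auto
    ultimately show "smooth_fun n (\<phi> ` (U \<inter> pr -` W)) (\<lambda>x. \<xi> (pr (inv_into U \<phi> x)) j)" by simp
  qed
qed

lemma smooth_map_action: "smooth_map (times_discrete P (carrier G)) P \<sigma>"
  unfolding smooth_map_def
proof (intro conjI)
  show "continuous_map (mtop (times_discrete P (carrier G))) (mtop P) \<sigma>"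
    unfolding times_discrete_def by (simp, rule continuous_map_times_discrete, rule act_cont)
  show "\<forall>(U, \<phi>)\<in>atlas (times_discrete P (carrier G)). \<forall>(V, \<psi>)\<in>atlas P. \<forall>j<n.
      smooth_fun (mdim (times_discrete P (carrier G))) (\<phi> ` (U \<inter> \<sigma> -` V)) (\<lambda>x. \<psi> (\<sigma> (inv_into U \<phi> x)) j)"
  proof (intro ballI, clarify)
    fix U' \<phi>' V \<psi> j assume a: "(U', \<phi>') \<in> atlas (times_discrete P (carrier G))" and d: "(V, \<psi>) \<in> atlas P" and j: "j < n"
    then obtain U \<phi> g where U': "U' = U \<times> {g}" "\<phi>' = \<phi> \<circ> fst" and c: "(U, \<phi>) \<in> atlas P" and g: "g \<in> carrier G"
      by (auto simp: times_discrete_def)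
    have img: "\<phi>' ` (U' \<inter> \<sigma> -` V) = \<phi> ` (U \<inter> (\<lambda>p. \<sigma> (p, g)) -` V)"
      unfolding U' by force
    have "U \<inter> (\<lambda>p. \<sigma> (p, g)) -` V = U \<inter> {p \<in> points P. \<sigma> (p, g) \<in> V}" using chart_subset[OF c] by auto
    then have op: "openin (Euclidean_space n) (\<phi> ` (U \<inter> (\<lambda>p. \<sigma> (p, g)) -` V))"
      using chart_image_openin[OF c act_preimage_open[OF g chart_open[OF d]]] by simp
    have "smooth_fun n (\<phi> ` (U \<inter> (\<lambda>p. \<sigma> (p, g)) -` V)) (\<lambda>x. \<psi> (\<sigma> (inv_into U \<phi> x, g)) j)"
      using smooth[OF g] c d j unfolding smooth_map_def by blast
    then have "smooth_fun n (\<phi> ` (U \<inter> (\<lambda>p. \<sigma> (p, g)) -` V)) (\<lambda>x. \<psi> (\<sigma> (inv_into U' \<phi>' x)) j)"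
    proof (rule smooth_fun_cong[OF op])
      fix y assume "y \<in> \<phi> ` (U \<inter> (\<lambda>p. \<sigma> (p, g)) -` V)"
      then have "y \<in> \<phi> ` U" by blast
      then show "\<psi> (\<sigma> (inv_into U \<phi> y, g)) j = \<psi> (\<sigma> (inv_into U' \<phi>' y)) j"
        unfolding U' by (simp only: inv_into_times_singleton[OF chart_inj[OF c]])
    qed
    then show "smooth_fun (mdim (times_discrete P (carrier G))) (\<phi>' ` (U' \<inter> \<sigma> -` V)) (\<lambda>x. \<psi> (\<sigma> (inv_into U' \<phi>' x)) j)"
      unfolding img by (simp add: times_discrete_def)
  qed
qed

section \<open>Local triviality of the projection\<close>

lemma local_trivialization:
  assumes U0: "small U0"
  defines "U \<equiv> pr ` U0" and "\<Phi> \<equiv> \<lambda>(u, g). \<sigma> (sec U0 u, g)"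
  shows "diffeomorphism (times_discrete (open_submanifold quot_mfd U) (carrier G))
      (open_submanifold P {p \<in> points P. pr p \<in> U}) \<Phi>"
proof -
  interpret Q: smooth_manifold quot_mfd by standard (rule manifold_quot)
  define R where "R = {p \<in> points P. pr p \<in> U}"
  define N where "N = times_discrete (open_submanifold quot_mfd U) (carrier G)"
  define X where "X = open_submanifold P R"
  have Uopen: "openin quot_top U" unfolding U_def by (rule pr_image_open[OF small_open[OF U0]])
  have Usub: "U \<subseteq> pr ` points P" using openin_subset[OF Uopen] by simp
  have Ropen: "openin (mtop P) R"
    unfolding R_def by (rule openin_continuous_map_preimage[OF pr_cont Uopen])
  have ptsN: "points N = U \<times> carrier G"
    using Usub by (auto simp: N_def times_discrete_def open_submanifold_def)
  have ptsX: "points X = R"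
    by (auto simp: X_def open_submanifold_def R_def)
  have sec_pts: "sec U0 u \<in> U0" "sec U0 u \<in> points P" "pr (sec U0 u) = u" if "u \<in> U" for u
    using that sec_in[of u U0] small_points[OF U0] by (auto simp: U_def)
  have \<Phi>_in: "\<Phi> (u, g) \<in> R" "pr (\<Phi> (u, g)) = u" if "u \<in> U" "g \<in> carrier G" for u g
    using that sec_pts by (auto simp: \<Phi>_def R_def)
  have bij: "bij_betw \<Phi> (U \<times> carrier G) R"
    unfolding bij_betw_def
  proof
    show "inj_on \<Phi> (U \<times> carrier G)"
    proof (rule inj_onI, clarify)
      fix u g u' g' assume u: "u \<in> U" "g \<in> carrier G" "u' \<in> U" "g' \<in> carrier G" and eq: "\<Phi> (u, g) = \<Phi> (u', g')"
      have "u = u'" using \<Phi>_in(2)[OF u(1,2)] \<Phi>_in(2)[OF u(3,4)] eq by simp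
      moreover have "g = g'"
        using eq u sec_pts(2)[OF u(1)] act_cancel unfolding \<open>u = u'\<close> by (auto simp: \<Phi>_def)
      ultimately show "u = u' \<and> g = g'" by simp
    qed
    show "\<Phi> ` (U \<times> carrier G) = R"
    proof (intro equalityI subsetI)
      fix p assume p: "p \<in> R"
      then have pp: "p \<in> points P" "pr p \<in> U" by (auto simp: R_def)
      then obtain g where "g \<in> carrier G" "p = \<sigma> (sec U0 (pr p), g)"
        using pr_eq_iff[of "sec U0 (pr p)" p] sec_pts[OF pp(2)] by auto
      then have "p = \<Phi> (pr p, g)" "(pr p, g) \<in> U \<times> carrier G" using pp by (auto simp: \<Phi>_def)
      then show "p \<in> \<Phi> ` (U \<times> carrier G)" by blast
    qed (use \<Phi>_in in auto)
  qed
  \<comment> \<open>The inverse sends \<open>p\<close> to its orbit and to the element that moves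
    the section point of the orbit to \<open>p\<close>.\<close>
  define \<Psi> where "\<Psi> = inv_into (U \<times> carrier G) \<Phi>"
  have \<Psi>_in: "\<Psi> p \<in> U \<times> carrier G" "\<Phi> (\<Psi> p) = p" if "p \<in> R" for p
    using that bij inv_into_into[of p \<Phi> "U \<times> carrier G"] f_inv_into_f[of p \<Phi> "U \<times> carrier G"]
    unfolding \<Psi>_def bij_betw_def by blast+
  have fst\<Psi>: "fst (\<Psi> p) = pr p" if "p \<in> R" for p
    using \<Psi>_in[OF that] \<Phi>_in(2)[of "fst (\<Psi> p)" "snd (\<Psi> p)"] by (auto simp: mem_Times_iff)
  \<comment> \<open>The group component is \<open>g\<close> exactly where moving back by the inverse
    of \<open>g\<close> reaches \<open>U0\<close>. This is an open condition, so the component is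
    locally constant and only the orbit component matters for smoothness.\<close>
  have snd\<Psi>: "snd (\<Psi> p) = g \<longleftrightarrow> \<sigma> (p, inv\<^bsub>G\<^esub> g) \<in> U0" if p: "p \<in> R" and g: "g \<in> carrier G" for p g
  proof -
    define u where "u = sec U0 (pr p)"
    have u: "u \<in> U0" "u \<in> points P" using sec_pts p by (auto simp: u_def R_def)
    define k where "k = snd (\<Psi> p)"
    have k: "k \<in> carrier G" using \<Psi>_in(1)[OF p] by (auto simp: k_def mem_Times_iff)
    have pk: "p = \<sigma> (u, k)"
      using \<Psi>_in(2)[OF p] fst\<Psi>[OF p] by (simp add: \<Phi>_def case_prod_unfold u_def k_def)
    have "\<sigma> (p, inv\<^bsub>G\<^esub> g) = \<sigma> (u, k \<otimes>\<^bsub>G\<^esub> inv\<^bsub>G\<^esub> g)" using pk u k g by (simp add: act_act)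
    moreover have "\<sigma> (u, k \<otimes>\<^bsub>G\<^esub> inv\<^bsub>G\<^esub> g) \<in> U0 \<longleftrightarrow> k \<otimes>\<^bsub>G\<^esub> inv\<^bsub>G\<^esub> g = \<one>\<^bsub>G\<^esub>"
    proof
      assume "\<sigma> (u, k \<otimes>\<^bsub>G\<^esub> inv\<^bsub>G\<^esub> g) \<in> U0"
      then show "k \<otimes>\<^bsub>G\<^esub> inv\<^bsub>G\<^esub> g = \<one>\<^bsub>G\<^esub>" using U0 u(1) k g unfolding small_def by simp
    next
      assume "k \<otimes>\<^bsub>G\<^esub> inv\<^bsub>G\<^esub> g = \<one>\<^bsub>G\<^esub>"
      then show "\<sigma> (u, k \<otimes>\<^bsub>G\<^esub> inv\<^bsub>G\<^esub> g) \<in> U0" using u by simp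
    qed
    moreover have "k \<otimes>\<^bsub>G\<^esub> inv\<^bsub>G\<^esub> g = \<one>\<^bsub>G\<^esub> \<longleftrightarrow> k = g"
      using k g by (metis G.inv_closed G.inv_equality G.inv_inv G.r_inv)
    ultimately show ?thesis by (simp add: k_def)
  qed
  have smooth\<Phi>: "smooth_map N X \<Phi>"
    unfolding smooth_map_def
  proof (intro conjI)
    have "continuous_map (prod_topology (subtopology quot_top U) (discrete_topology (carrier G))) (mtop P) \<Phi>"
    proof (rule continuous_map_times_discrete)
      fix g assume "g \<in> carrier G"
      from continuous_map_compose[OF sec_cont[OF U0] act_cont[OF this]]
      show "continuous_map (subtopology quot_top U) (mtop P) (\<lambda>u. \<Phi> (u, g))"
        by (simp add: o_def \<Phi>_def U_def)
    qed
    moreover have "\<Phi> ` (topspace (prod_topology (subtopology quot_top U) (discrete_topology (carrier G)))) \<subseteq> R"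
      using \<Phi>_in(1) by auto
    ultimately show "continuous_map (mtop N) (mtop X) \<Phi>"
      by (simp add: N_def X_def times_discrete_def open_submanifold_def continuous_map_in_subtopology image_subset_iff_funcset)
    show "\<forall>(U', \<phi>')\<in>atlas N. \<forall>(V', \<psi>)\<in>atlas X. \<forall>j<mdim X.
        smooth_fun (mdim N) (\<phi>' ` (U' \<inter> \<Phi> -` V')) (\<lambda>x. \<psi> (\<Phi> (inv_into U' \<phi>' x)) j)"
    proof (intro ballI, clarify)
      fix U' \<phi>' V' \<psi> j assume a: "(U', \<phi>') \<in> atlas N" and b: "(V', \<psi>) \<in> atlas X" and j: "j < mdim X"
      obtain W \<xi> g where U': "U' = (W \<inter> U) \<times> {g}" "\<phi>' = \<xi> \<circ> fst" and ch: "(W, \<xi>) \<in> atlas quot_mfd" and g: "g \<in> carrier G"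
        using a by (auto simp: N_def times_discrete_def open_submanifold_def)
      obtain U1 V1 \<phi>1 where W: "W = pr ` U1" "\<xi> = \<phi>1 \<circ> sec U1" and c: "(V1, \<phi>1) \<in> atlas P" and U1: "small U1" "U1 \<subseteq> V1"
        using quot_chartE[OF ch] .
      obtain V where V': "V' = V \<inter> R" and d: "(V, \<psi>) \<in> atlas P"
        using b by (auto simp: X_def open_submanifold_def)
      have jn: "j < n" using j by (simp add: X_def open_submanifold_def)
      let ?D = "U1 \<inter> sec_domain U0 g V"
      have op: "openin (Euclidean_space n) (\<phi>1 ` (V1 \<inter> ?D))"
        by (rule chart_image_openin[OF c openin_Int[OF small_open[OF U1(1)] sec_domain_open[OF U0 g chart_open[OF d]]]])
      \<comment> \<open>The domain of the chart expression is lifted to the small set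
        \<open>U1\<close>, which brings it into the form required by
        \<open>sec_smooth\<close>.\<close>
      have img: "\<phi>' ` (U' \<inter> \<Phi> -` V') = \<phi>1 ` (V1 \<inter> ?D)"
      proof -
        have "\<phi>' ` (U' \<inter> \<Phi> -` V') = \<xi> ` (W \<inter> {w \<in> U. \<Phi> (w, g) \<in> V'})"
          unfolding U' by force
        also have "\<dots> = \<phi>1 ` (U1 \<inter> {p. pr p \<in> {w \<in> U. \<Phi> (w, g) \<in> V'}})"
          unfolding W by (rule quot_chart_image[OF U1(1)])
        also have "U1 \<inter> {p. pr p \<in> {w \<in> U. \<Phi> (w, g) \<in> V'}} = V1 \<inter> ?D"
          using U1(2) small_points[OF U1(1)] \<Phi>_in(1) g by (auto simp: V' sec_domain_def U_def \<Phi>_def)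
        finally show ?thesis .
      qed
      have "smooth_fun n (\<phi>1 ` (V1 \<inter> ?D)) (\<lambda>y. \<psi> (\<sigma> (sec U0 (pr (inv_into V1 \<phi>1 y)), g)) j)"
        by (rule sec_smooth[OF c d U0 g jn]) auto
      then have "smooth_fun n (\<phi>1 ` (V1 \<inter> ?D)) (\<lambda>x. \<psi> (\<Phi> (inv_into U' \<phi>' x)) j)"
      proof (rule smooth_fun_cong[OF op])
        fix y assume "y \<in> \<phi>1 ` (V1 \<inter> ?D)"
        then have "y \<in> \<phi>' ` U'" unfolding img[symmetric] by blast
        then have y: "y \<in> \<xi> ` (W \<inter> U)" unfolding U' by force
        have inj: "inj_on \<xi> (W \<inter> U)"
          using quot_chart_inj[OF c U1] inj_on_subset unfolding W by blast
        have "inv_into (W \<inter> U) \<xi> y = pr (inv_into V1 \<phi>1 y)"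
          using quot_chart_inv[OF c U1, of "W \<inter> U" y] y by (simp add: W)
        then show "\<psi> (\<sigma> (sec U0 (pr (inv_into V1 \<phi>1 y)), g)) j = \<psi> (\<Phi> (inv_into U' \<phi>' y)) j"
          unfolding U' inv_into_times_singleton[OF inj y] by (simp add: \<Phi>_def)
      qed
      then show "smooth_fun (mdim N) (\<phi>' ` (U' \<inter> \<Phi> -` V')) (\<lambda>x. \<psi> (\<Phi> (inv_into U' \<phi>' x)) j)"
        unfolding img by (simp add: N_def times_discrete_def open_submanifold_def)
    qed
  qed
  have snd_open: "openin (mtop P) {p \<in> R. snd (\<Psi> p) = g}" if g: "g \<in> carrier G" for g
  proof -
    have "{p \<in> R. snd (\<Psi> p) = g} = R \<inter> {p \<in> points P. \<sigma> (p, inv\<^bsub>G\<^esub> g) \<in> U0}"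
      using snd\<Psi>[OF _ g] by (auto simp: R_def)
    then show ?thesis
      using openin_Int[OF Ropen act_preimage_open[OF _ small_open[OF U0], of "inv\<^bsub>G\<^esub> g"]] g by simp
  qed
  have smooth\<Psi>: "smooth_map X N \<Psi>"
    unfolding smooth_map_def
  proof (intro conjI)
    have "continuous_map (subtopology (mtop P) R) (subtopology quot_top U) (\<lambda>p. fst (\<Psi> p))"
    proof (rule continuous_map_eq)
      show "continuous_map (subtopology (mtop P) R) (subtopology quot_top U) pr"
        using pr_cont by (auto simp: continuous_map_in_subtopology R_def intro: continuous_map_from_subtopology)
    qed (use fst\<Psi> in auto)
    moreover have "continuous_map (subtopology (mtop P) R) (discrete_topology (carrier G)) (\<lambda>p. snd (\<Psi> p))"
      unfolding continuous_map_def
    proof (intro conjI allI impI)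
      show "(\<lambda>p. snd (\<Psi> p)) \<in> topspace (subtopology (mtop P) R) \<rightarrow> topspace (discrete_topology (carrier G))"
        using \<Psi>_in(1) by (auto simp: mem_Times_iff)
      fix H assume "openin (discrete_topology (carrier G)) H"
      then have H: "H \<subseteq> carrier G" by simp
      have "{p \<in> topspace (subtopology (mtop P) R). snd (\<Psi> p) \<in> H} = (\<Union>g\<in>H. {p \<in> R. snd (\<Psi> p) = g})"
        by (auto simp: R_def)
      moreover have "openin (mtop P) (\<Union>g\<in>H. {p \<in> R. snd (\<Psi> p) = g})"
        using snd_open H by (intro openin_Union) auto
      ultimately show "openin (subtopology (mtop P) R) {p \<in> topspace (subtopology (mtop P) R). snd (\<Psi> p) \<in> H}"
        by (simp add: openin_open_subtopology[OF Ropen]) blast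
    qed
    ultimately have "continuous_map (subtopology (mtop P) R) (prod_topology (subtopology quot_top U) (discrete_topology (carrier G)))
        (\<lambda>p. (fst (\<Psi> p), snd (\<Psi> p)))"
      by (rule continuous_map_pairedI)
    then show "continuous_map (mtop X) (mtop N) \<Psi>"
      by (simp add: N_def X_def times_discrete_def open_submanifold_def)
    show "\<forall>(V', \<psi>)\<in>atlas X. \<forall>(U', \<phi>')\<in>atlas N. \<forall>j<mdim N.
        smooth_fun (mdim X) (\<psi> ` (V' \<inter> \<Psi> -` U')) (\<lambda>x. \<phi>' (\<Psi> (inv_into V' \<psi> x)) j)"
    proof (intro ballI, clarify)
      fix V' \<psi> U' \<phi>' j assume b: "(V', \<psi>) \<in> atlas X" and a: "(U', \<phi>') \<in> atlas N" and j: "j < mdim N"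
      obtain W \<xi> g where U': "U' = (W \<inter> U) \<times> {g}" "\<phi>' = \<xi> \<circ> fst" and ch: "(W, \<xi>) \<in> atlas quot_mfd" and g: "g \<in> carrier G"
        using a by (auto simp: N_def times_discrete_def open_submanifold_def)
      obtain V where V': "V' = V \<inter> R" and d: "(V, \<psi>) \<in> atlas P"
        using b by (auto simp: X_def open_submanifold_def)
      have jn: "j < n" using j by (simp add: N_def times_discrete_def open_submanifold_def)
      let ?T = "{p \<in> R. snd (\<Psi> p) = g} \<inter> {p \<in> points P. pr p \<in> W}"
      have "openin (mtop P) {p \<in> points P. pr p \<in> W}"
        using openin_continuous_map_preimage[OF pr_cont] Q.chart_open[OF ch] by simp
      then have Topen: "openin (mtop P) ?T" using snd_open[OF g] by (intro openin_Int)
      have eq: "V' \<inter> \<Psi> -` U' = V \<inter> ?T"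
      proof -
        have "\<Psi> p \<in> U' \<longleftrightarrow> pr p \<in> W \<and> snd (\<Psi> p) = g" if "p \<in> R" for p
          using fst\<Psi>[OF that] that by (auto simp: U' mem_Times_iff R_def)
        then show ?thesis unfolding V' using openin_subset[OF Ropen] by blast
      qed
      have "smooth_fun n (\<psi> ` (V \<inter> ?T)) (\<lambda>x. \<xi> (pr (inv_into V \<psi> x)) j)"
        by (rule pr_chart_smooth[OF d ch jn Topen]) auto
      then have "smooth_fun n (\<psi> ` (V \<inter> ?T)) (\<lambda>x. \<phi>' (\<Psi> (inv_into V' \<psi> x)) j)"
      proof (rule smooth_fun_cong[OF chart_image_openin[OF d Topen]])
        fix y assume "y \<in> \<psi> ` (V \<inter> ?T)"
        then obtain p where p: "p \<in> V" "p \<in> R" "y = \<psi> p" by auto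
        have "inv_into V' \<psi> y = p"
          by (rule inv_into_f_eq[OF inj_on_subset[OF chart_inj[OF d]]]) (use p V' in auto)
        then show "\<xi> (pr (inv_into V \<psi> y)) j = \<phi>' (\<Psi> (inv_into V' \<psi> y)) j"
          using p d fst\<Psi>[OF p(2)] by (simp add: U')
      qed
      then show "smooth_fun (mdim X) (\<psi> ` (V' \<inter> \<Psi> -` U')) (\<lambda>x. \<phi>' (\<Psi> (inv_into V' \<psi> x)) j)"
        unfolding eq by (simp add: X_def open_submanifold_def)
    qed
  qed
  have "diffeomorphism N X \<Phi>"
    unfolding diffeomorphism_def ptsN ptsX using bij smooth\<Phi> smooth\<Psi> by (simp add: \<Psi>_def)
  then show ?thesis by (simp add: N_def X_def R_def)
qed

theorem principal_bundle_quotient: "principal_bundle P quot_mfd G pr \<sigma>"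
  unfolding principal_bundle_def
proof (intro conjI ballI)
  show "manifold P" by (rule mfd)
  show "manifold quot_mfd" by (rule manifold_quot)
  show "smooth_map P quot_mfd pr" by (rule smooth_map_pr)
  show "pr ` points P = points quot_mfd" by simp
  show "right_action (points P) G \<sigma>" by (rule act)
  show "smooth_map (times_discrete P (carrier G)) P \<sigma>" by (rule smooth_map_action)
  fix m assume "m \<in> points quot_mfd"
  then obtain p where p: "p \<in> points P" "m = pr p" by auto
  obtain U0 where U0: "small U0" "p \<in> U0" "U0 \<subseteq> points P" using small_exists[OF openin_topspace p(1)] .
  have sec_pts: "sec U0 u \<in> points P" "pr (sec U0 u) = u" if "u \<in> pr ` U0" for u
    using that sec_in[of u U0] small_points[OF U0(1)] by auto
  show "\<exists>U \<Phi>. openin (mtop quot_mfd) U \<and> m \<in> U \<and>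
      diffeomorphism (times_discrete (open_submanifold quot_mfd U) (carrier G)) (open_submanifold P {p \<in> points P. pr p \<in> U}) \<Phi> \<and>
      (\<forall>u\<in>U. \<forall>g\<in>carrier G. pr (\<Phi> (u, g)) = u) \<and>
      (\<forall>u\<in>U. \<forall>g\<in>carrier G. \<forall>h\<in>carrier G. \<Phi> (u, g \<otimes>\<^bsub>G\<^esub> h) = \<sigma> (\<Phi> (u, g), h))"
  proof (rule exI[of _ "pr ` U0"], rule exI[of _ "\<lambda>(u, g). \<sigma> (sec U0 u, g)"], intro conjI ballI)
    show "openin (mtop quot_mfd) (pr ` U0)" using pr_image_open[OF small_open[OF U0(1)]] by simp
    show "m \<in> pr ` U0" using p U0(2) by blast
  qed (use local_trivialization[OF U0(1)] sec_pts in \<open>simp_all add: act_act\<close>)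
qed

end

theorem theorem5p4:
  fixes \<Lambda> :: "('g, 'c) monoid_scheme" and P :: "'p mfd"
  assumes "comm_group \<Lambda>" and "finite (carrier \<Lambda>)" and "manifold P"
  shows "(\<forall>\<alpha>. compact_space (mtop P) \<and> nc_principal_bundle (smooth_function_algebra P) \<Lambda> \<alpha> \<longrightarrow>
            (\<exists>!\<sigma>. determined_action P \<Lambda> \<alpha> \<sigma>) \<and>
            (\<forall>\<sigma>. determined_action P \<Lambda> \<alpha> \<sigma> \<longrightarrow>
               (\<exists>M. points M = orbit_map \<Lambda> \<sigma> ` points P \<and>
                    quotient_map (mtop P) (mtop M) (orbit_map \<Lambda> \<sigma>) \<and>
                    principal_bundle P M \<Lambda> (orbit_map \<Lambda> \<sigma>) \<sigma>))) \<and>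
         (\<forall>(M :: 'm mfd) q \<sigma>. principal_bundle P M \<Lambda> q \<sigma> \<longrightarrow>
            nc_principal_bundle (smooth_function_algebra P) \<Lambda> (pullback_action P \<sigma>))"
proof (intro conjI allI impI)
  interpret smooth_manifold P by standard (rule assms(3))
  fix \<alpha> assume a: "compact_space (mtop P) \<and> nc_principal_bundle (smooth_function_algebra P) \<Lambda> \<alpha>"
  then have dyn: "dynamical_system A \<Lambda> \<alpha>" by (simp add: nc_principal_bundle_def)
  show "\<exists>!\<sigma>. determined_action P \<Lambda> \<alpha> \<sigma>"
    by (rule determined_action_exists_unique[OF dyn])
  fix \<sigma> assume det: "determined_action P \<Lambda> \<alpha> \<sigma>"
  interpret free_finite_action P \<Lambda> \<sigma>
  proof (intro free_finite_action.intro free_finite_action_axioms.intro smooth_manifold_axioms)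
    show "group \<Lambda>" using assms(1) by (simp add: comm_group_def)
    show "g = \<one>\<^bsub>\<Lambda>\<^esub>" if "p \<in> points P" "g \<in> carrier \<Lambda>" "\<sigma> (p, g) = p" for p g
      using determined_action_free[OF assms(1,2) conjunct2[OF a] det that] .
  qed (use a assms(2) determined_action_right_action[OF dyn det] in auto)
  show "\<exists>M. points M = orbit_map \<Lambda> \<sigma> ` points P \<and> quotient_map (mtop P) (mtop M) (orbit_map \<Lambda> \<sigma>) \<and>
      principal_bundle P M \<Lambda> (orbit_map \<Lambda> \<sigma>) \<sigma>"
    using pr_quotient principal_bundle_quotient by (intro exI[of _ quot_mfd]) simp
next
  fix M :: "'m mfd" and q \<sigma> assume "principal_bundle P M \<Lambda> q \<sigma>"
  then show "nc_principal_bundle (smooth_function_algebra P) \<Lambda> (pullback_action P \<sigma>)"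
    by (rule principal_bundle_imp_nc_principal_bundle[OF assms(1,2)])
qed

end
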